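(* Let $(U,V)\in H^1(B_R^+)\times H^1(B_R^+)$ be a weak solution to the system \[ \Delta U=V \text{ in }B_R^+,\qquad \Delta V=0\text{ in }B_R^+,\qquad \frac{\partial U}{\partial\nu}=0\text{ on }B_R',\qquad \frac{\partial V}{\partial\nu}=h\,U(\cdot,0)\text{ on }B_R'. \] If \[ U(z)=o(|z|^n)\quad\text{as }|z|\to0\text{ for all }n\in\mathbb{N}, \] then $U\equiv V\equiv0$ in $B_R^+$.
   Context: $N>3$ is an integer, $R>0$, $h\in C^1(B_R')$. Points of $\mathbb{R}^{N+1}$ are written $z=(x,t)$ with $x\in\mathbb{R}^N$, $t\in\mathbb{R}$, $dz=dx\,dt$. For $r>0$: $B_r=\{z\in\mathbb{R}^{N+1}:|z|<r\}$, $B_r^+=\{(x,t)\in B_r:t>0\}$, $B_r'=\{x\in\mathbb{R}^N:|x|<r\}$ (identified with $B_r'\times\{0\}$), $S_r^+=\{(x,t)\in\partial B_r:t>0\}$. $\nu$ is the outward unit normal to the half-ball, so $\partial/\partial\nu=-\partial/\partial t$ on $B_r'$. $U(\cdot,0)=\mathrm{Tr}\,U$ denotes the trace on $B_R'$. A weak solution of the system is a couple $(U,V)\in H^1(B_R^+)\times H^1(B_R^+)$ such that, for every $\varphi\in H^1(B_R^+)$ with zero trace on $S_R^+$, $\int_{B_R^+}\nabla U\cdot\nabla\varphi\,dz=-\int_{B_R^+}V\varphi\,dz$ and $\int_{B_R^+}\nabla V\cdot\nabla\varphi\,dz=\int_{B_R'}h(x)\,U(x,0)\,\mathrm{Tr}\,\varphi(x)\,dx$.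 *)

theory Defs
  imports "HOL-Analysis.Analysis" "HOL-Library.Landau_Symbols"
begin

section \<open>Smooth functions\<close>

text \<open>\<open>C_on k S f\<close> is meant for open \<open>S\<close>, where the derivative \<^term>\<open>at x\<close> is the derivative within \<open>S\<close>.\<close>

primrec C_on :: "nat \<Rightarrow> 'a::euclidean_space set \<Rightarrow> ('a \<Rightarrow> real) \<Rightarrow> bool" where
  "C_on 0 S f \<longleftrightarrow> continuous_on S f"
| "C_on (Suc k) S f \<longleftrightarrow>
     f differentiable_on S \<and> (\<forall>i\<in>Basis. C_on k S (\<lambda>x. frechet_derivative f (at x) i))"

definition smooth :: "('a::euclidean_space \<Rightarrow> real) \<Rightarrow> bool" where
  "smooth f \<longleftrightarrow> (\<forall>k. C_on k UNIV f)"

definition test_functions :: "'a::euclidean_space set \<Rightarrow> ('a \<Rightarrow> real) set" where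
  "test_functions \<Omega> =
     {\<phi>. smooth \<phi> \<and> compact (closure {z. \<phi> z \<noteq> 0}) \<and> closure {z. \<phi> z \<noteq> 0} \<subseteq> \<Omega>}"


section \<open>The space \<open>H\<^sup>1\<close>\<close>

text \<open>Elements of \<open>L\<^sup>2\<close> and \<open>H\<^sup>1\<close> are represented by functions on the whole type; all notions
  below depend only on their almost everywhere classes on the set in question.\<close>

definition L2 :: "'b measure \<Rightarrow> ('b \<Rightarrow> 'c::euclidean_space) set" where
  "L2 M = {f \<in> borel_measurable M. integrable M (\<lambda>x. (norm (f x))\<^sup>2)}"

definition is_weak_gradient ::
  "'a::euclidean_space set \<Rightarrow> ('a \<Rightarrow> real) \<Rightarrow> ('a \<Rightarrow> 'a) \<Rightarrow> bool" where
  "is_weak_gradient \<Omega> u g \<longleftrightarrow>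
     (\<forall>\<phi>\<in>test_functions \<Omega>. \<forall>i\<in>Basis.
        (LINT z|lebesgue_on \<Omega>. u z * frechet_derivative \<phi> (at z) i)
          = - (LINT z|lebesgue_on \<Omega>. (g z \<bullet> i) * \<phi> z))"

definition H1 :: "'a::euclidean_space set \<Rightarrow> ('a \<Rightarrow> real) set" where
  "H1 \<Omega> = {u \<in> L2 (lebesgue_on \<Omega>). \<exists>g\<in>L2 (lebesgue_on \<Omega>). is_weak_gradient \<Omega> u g}"

text \<open>For \<open>u \<in> H1 \<Omega>\<close> the weak gradient exists by definition and is unique almost everywhere
  in \<open>\<Omega>\<close>.\<close>

definition weak_gradient :: "'a::euclidean_space set \<Rightarrow> ('a \<Rightarrow> real) \<Rightarrow> 'a \<Rightarrow> 'a" where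
  "weak_gradient \<Omega> u = (SOME g. g \<in> L2 (lebesgue_on \<Omega>) \<and> is_weak_gradient \<Omega> u g)"

definition H1_norm :: "'a::euclidean_space set \<Rightarrow> ('a \<Rightarrow> real) \<Rightarrow> real" where
  "H1_norm \<Omega> u = sqrt ((LINT z|lebesgue_on \<Omega>. (u z)\<^sup>2)
                      + (LINT z|lebesgue_on \<Omega>. (norm (weak_gradient \<Omega> u z))\<^sup>2))"


section \<open>Traces\<close>

text \<open>\<open>g\<close> is the trace of \<open>u\<close> on the part of the boundary parametrised by \<open>\<iota>\<close> and carrying the
  (finite) measure \<open>M\<close>: the \<open>L\<^sup>2(M)\<close>-limit of the boundary values of functions smooth up to the
  boundary that converge to \<open>u\<close> in \<open>H\<^sup>1(\<Omega>)\<close>. On the bounded Lipschitz domains used here the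
  trace theorem gives existence and (almost everywhere) uniqueness for every \<open>u \<in> H1 \<Omega>\<close>.\<close>

definition has_trace ::
  "'a::euclidean_space set \<Rightarrow> 'b measure \<Rightarrow> ('b \<Rightarrow> 'a) \<Rightarrow> ('a \<Rightarrow> real) \<Rightarrow> ('b \<Rightarrow> real) \<Rightarrow> bool" where
  "has_trace \<Omega> M \<iota> u g \<longleftrightarrow>
     g \<in> L2 M \<and>
     (\<exists>\<phi>::nat \<Rightarrow> 'a \<Rightarrow> real.
        (\<forall>k. smooth (\<phi> k)) \<and>
        (\<lambda>k. H1_norm \<Omega> (\<lambda>z. \<phi> k z - u z)) \<longlonglongrightarrow> 0 \<and>
        (\<lambda>k. LINT y|M. (\<phi> k (\<iota> y) - g y)\<^sup>2) \<longlonglongrightarrow> 0)"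


section \<open>The half ball and its boundary\<close>

text \<open>The product type carries the Euclidean norm, so \<^typ>\<open>(real^'n) \<times> real\<close> is
  \<open>\<real>\<close> to the power \<open>N + 1\<close> with \<open>N = CARD('n)\<close>, and \<open>z = (x, t)\<close>.\<close>

definition half_ball :: "real \<Rightarrow> ((real^'n) \<times> real) set" where
  "half_ball r = {z. norm z < r \<and> snd z > 0}"

text \<open>Surface measure on the half sphere of radius \<open>r\<close>, as a measure on the ambient space: the
  area of a Borel subset \<open>A\<close> of the sphere is \<open>(N + 1) / r\<close> times the volume of the cone
  \<open>{s z | z \<in> A, 0 < s < 1}\<close>, i.e. of the preimage of \<open>A\<close> under radial projection.\<close>

definition half_sphere_measure :: "real \<Rightarrow> ((real^'n) \<times> real) measure" where
  "half_sphere_measure r =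
     scale_measure (ennreal (real DIM((real^'n) \<times> real) / r))
       (distr (lebesgue_on (half_ball r)) borel (\<lambda>z. (r / norm z) *\<^sub>R z))"

definition has_flat_trace ::
  "real \<Rightarrow> ((real^'n) \<times> real \<Rightarrow> real) \<Rightarrow> (real^'n \<Rightarrow> real) \<Rightarrow> bool" where
  "has_flat_trace R u g \<longleftrightarrow>
     has_trace (half_ball R) (lebesgue_on (ball 0 R)) (\<lambda>x. (x, 0)) u g"

definition zero_trace_on_half_sphere :: "real \<Rightarrow> ((real^'n) \<times> real \<Rightarrow> real) \<Rightarrow> bool" where
  "zero_trace_on_half_sphere R u \<longleftrightarrow>
     has_trace (half_ball R) (half_sphere_measure R) (\<lambda>z. z) u (\<lambda>z. 0)"


section \<open>Weak solutions\<close>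

text \<open>Since \<open>h\<close> need not be bounded near the boundary of the ball, the existence of the boundary
  integral is demanded explicitly (a nonexistent Bochner integral would be \<open>0\<close>).\<close>

definition weak_solution ::
  "real \<Rightarrow> (real^'n \<Rightarrow> real) \<Rightarrow> ((real^'n) \<times> real \<Rightarrow> real) \<Rightarrow> ((real^'n) \<times> real \<Rightarrow> real) \<Rightarrow> bool"
where
  "weak_solution R h U V \<longleftrightarrow>
     U \<in> H1 (half_ball R) \<and> V \<in> H1 (half_ball R) \<and>
     (\<exists>TrU. has_flat_trace R U TrU \<and>
       (\<forall>\<phi>\<in>H1 (half_ball R). zero_trace_on_half_sphere R \<phi> \<longrightarrow>
          (LINT z|lebesgue_on (half_ball R).
              weak_gradient (half_ball R) U z \<bullet> weak_gradient (half_ball R) \<phi> z)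
            = - (LINT z|lebesgue_on (half_ball R). V z * \<phi> z) \<and>
          (\<forall>Tr\<phi>. has_flat_trace R \<phi> Tr\<phi> \<longrightarrow>
             integrable (lebesgue_on (ball 0 R)) (\<lambda>x. h x * TrU x * Tr\<phi> x) \<and>
             (LINT z|lebesgue_on (half_ball R).
                 weak_gradient (half_ball R) V z \<bullet> weak_gradient (half_ball R) \<phi> z)
               = (LINT x|lebesgue_on (ball 0 R). h x * TrU x * Tr\<phi> x))))"

end

theory Submission
 imports Defs "HOL-Analysis.Analysis" "HOL-Real_Asymp.Real_Asymp"
begin

text \<open>Reflecting the solution evenly in t turns the half-ball problem into \<open>\<Delta>u = v\<close> and
\<open>\<Delta>v = - 2 f \<delta>(t = 0)\<close> on a full ball, with \<open>f = h u(\<cdot>, 0)\<close>. A primitive \<open>y\<close> of \<open>v\<close> in t, chosen so that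
\<open>\<Delta>y = - f sgn t\<close>, replaces the singular second equation by the system \<open>\<Delta>u = \<partial>y/\<partial>t\<close>, \<open>\<Delta>y = - f sgn t\<close>. A Carleman
inequality with weight \<open>|z| powr (- b)\<close>, applied to \<open>y\<close> and then to \<open>u\<close>, bounds the weighted norms of \<open>u\<close> and of
its trace by a weighted norm of \<open>f\<close>, which is absorbed on a small ball because it carries three more powers of
\<open>|z|\<close> than the trace term. Everything is done for mollifications at scale \<open>\<delta>^2\<close>, cut off at radius \<open>\<delta>\<close>; infinite
vanishing order kills the inner cutoff error as \<open>\<delta>\<close> tends to 0. Letting b tend to infinity gives
\<open>u = 0\<close> near 0, hence \<open>v = 0\<close> there, and unique continuation for harmonic functions (again by the Carleman
inequality) spreads this first to V and then to U.\<close>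

section \<open>A Carleman inequality\<close>

text \<open>Two obstacles shape the proof. The trace enters the second equation as a source on t =
  0, and a mollified delta has no bounded weighted L2 norm as the scale shrinks; its primitive in t
  stays bounded, which is why \<open>y\<close> takes the place of \<open>v\<close>. And infinite
  order of vanishing is known for U only: the mollified \<open>u\<close>, \<open>v\<close>,
  \<open>y\<close> inherit it because all derivatives can be moved onto the kernel, at a polynomial
  cost in the scale, and the trace inherits it in the limit. The Carleman inequality controls the
  radial derivative alone and gives up one power of |z|, so that every large real b is allowed,
  without keeping b away from a spectrum. The three powers arise as follows: \<Delta>y with weight 4
  - b controls \<nabla>y with weight 3 - b, hence \<Delta>u with weight 3 - b, and the inequality
  with b + 1 then controls the trace of u with weight 1 - b. The scale is \<delta>^2 because on |z|
  \<ge> \<delta> a shift by k \<delta>^2 changes |z| by a factor 1 + O(\<delta>), so each fixed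
  power of |z| survives mollification with a constant close to 1.\<close>

abbreviation nbint :: "('a::euclidean_space \<Rightarrow> ennreal) \<Rightarrow> ennreal" (binder "NBINT " 60) where
 "nbint f \<equiv> integral\<^sup>N lborel f"

abbreviation L1 :: "('a::euclidean_space \<Rightarrow> real) \<Rightarrow> bool" where "L1 \<equiv> integrable lborel"

abbreviation BM :: "('a::topological_space \<Rightarrow> 'b::topological_space) set" where "BM \<equiv> borel_measurable borel"

abbreviation upper :: "('b::euclidean_space \<times> real) set" where "upper \<equiv> {z. snd z > 0}"

section \<open>Integration by parts for functions of bounded support\<close>

lemma integrable_continuous_vanishing:
 fixes f :: "'a::euclidean_space \<Rightarrow> real"
 assumes "continuous_on UNIV f" and "\<And>x. norm x \<ge> r \<Longrightarrow> f x = 0"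
 shows "L1 f"
proof -
 have "L1 (\<lambda>x. indicator (cball 0 r) x *\<^sub>R f x)" by (rule borel_integrable_compact) (auto intro: continuous_on_subset[OF assms(1)])
 also have "(\<lambda>x. indicator (cball 0 r) x *\<^sub>R f x) = f" using assms(2) by (force simp: indicator_def)
 finally show ?thesis .
qed

lemma has_derivative_zero_of_locally_zero:
 fixes f :: "'a::real_normed_vector \<Rightarrow> 'b::real_normed_vector"
 assumes "(f has_derivative D) (at x)" and "open S" "x \<in> S" and "\<And>y. y \<in> S \<Longrightarrow> f y = 0"
 shows "D = (\<lambda>_. 0)"
proof -
 have "(f has_derivative (\<lambda>_. 0)) (at x)" by (rule has_derivative_transform_within_open[OF has_derivative_const[of 0]])
    (use assms in auto)
 thus ?thesis using assms(1) has_derivative_unique by blast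
qed

text \<open>Difference quotients of F have integral 0 by translation invariance, and they converge
  to the derivative along \<open>e\<close> under a common integrable bound.\<close>

lemma integral_directional_derivative_eq_0:
 fixes F :: "'a::euclidean_space \<Rightarrow> real"
 assumes der: "\<And>x. (F has_derivative F' x) (at x)"
  and cont: "continuous_on UNIV (\<lambda>x. F' x e)"
  and supp: "\<And>x. norm x \<ge> r \<Longrightarrow> F x = 0"
 shows "(LBINT x. F' x e) = 0"
proof -
 have contF: "continuous_on UNIV F" using der by (meson continuous_at_imp_continuous_on has_derivative_continuous)
 have intF: "L1 F" by (rule integrable_continuous_vanishing[OF contF supp])
 have supp': "F' x e = 0" if "norm x \<ge> r + 1" for x
 proof -
  have "F' x = (\<lambda>_. 0)" by (rule has_derivative_zero_of_locally_zero[OF der, of "- cball 0 r"])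
     (use that supp in auto)
  thus ?thesis by simp
 qed
 have "bounded ((\<lambda>x. F' x e) ` cball 0 (r + 1))" by (intro compact_imp_bounded compact_continuous_image continuous_on_subset[OF cont]) auto
 then obtain M where M: "\<And>x. x \<in> cball 0 (r + 1) \<Longrightarrow> \<bar>F' x e\<bar> \<le> M" unfolding bounded_iff by fastforce
 define M' where "M' = max M 0"
 have M': "\<bar>F' x e\<bar> \<le> M'" for x using M[of x] supp'[of x] unfolding M'_def by (cases "norm x \<ge> r + 1") (auto simp: dist_norm)
 define h where "h n = inverse (real (Suc n))" for n
 have h: "h n > 0" "h n \<le> 1" for n unfolding h_def by (auto simp: field_simps)
 have h0: "h \<longlonglongrightarrow> 0" unfolding h_def by (rule LIMSEQ_inverse_real_of_nat)
 define s where "s n x = (F (x + h n *\<^sub>R e) - F x) / h n" for n x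
 have lim: "(\<lambda>n. s n x) \<longlonglongrightarrow> F' x e" for x
 proof -
  have "((\<lambda>t. F (x + t *\<^sub>R e)) has_real_derivative F' x e) (at 0)"
  proof -
   have "((\<lambda>t. F (x + t *\<^sub>R e)) has_derivative (\<lambda>t. F' x (t *\<^sub>R e))) (at 0)"
    by (rule has_derivative_compose[where f="\<lambda>t. x + t *\<^sub>R e" and g=F])
      (auto intro!: derivative_eq_intros der)
   moreover have "F' x (t *\<^sub>R e) = F' x e * t" for t using linear_scale[OF has_derivative_linear[OF der[of x]]] by simp
   ultimately show ?thesis by (simp add: has_field_derivative_def)
  qed
  hence "((\<lambda>t. (F (x + t *\<^sub>R e) - F x) / t) \<longlongrightarrow> F' x e) (at 0)" by (simp add: DERIV_def)
  hence "((\<lambda>n. (F (x + h n *\<^sub>R e) - F x) / h n) \<longlongrightarrow> F' x e) sequentially" by (rule filterlim_compose)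
     (use h0 h in \<open>auto simp: filterlim_at less_imp_neq[THEN not_sym]\<close>)
  thus ?thesis by (simp add: s_def)
 qed
 \<comment> \<open>The mean value theorem bounds the quotient by a bound of the derivative; since
   the step is at most 1, the quotient vanishes beyond \<open>r + norm e\<close>.\<close>
 have bnd: "\<bar>s n x\<bar> \<le> M' * indicator (cball 0 (r + norm e)) x" for n x
 proof (cases "norm x \<le> r + norm e")
  case True
  have d: "((\<lambda>t. F (x + t *\<^sub>R e)) has_derivative (\<lambda>s. F' (x + t *\<^sub>R e) (s *\<^sub>R e))) (at t)" for t
   by (rule has_derivative_compose[where f="\<lambda>t. x + t *\<^sub>R e" and g=F, OF _ der])
     (auto intro!: derivative_eq_intros)
  have "\<exists>t\<in>{0<..<h n}. F (x + h n *\<^sub>R e) - F (x + 0 *\<^sub>R e) = (\<lambda>s. F' (x + t *\<^sub>R e) (s *\<^sub>R e)) (h n - 0)"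
   by (rule mvt_simple[OF h(1)]) (rule has_derivative_at_withinI[OF d])
  then obtain t where "F (x + h n *\<^sub>R e) - F x = h n * F' (x + t *\<^sub>R e) e" using linear_scale[OF has_derivative_linear[OF der]] by auto
  thus ?thesis using M'[of "x + t *\<^sub>R e"] True h[of n] by (simp add: s_def)
 next
  case False
  have "norm x \<le> norm (x + h n *\<^sub>R e) + norm (h n *\<^sub>R e)" by (metis add_diff_cancel_right' norm_triangle_ineq4)
  also have "norm (h n *\<^sub>R e) \<le> norm e" using h[of n] by (simp add: mult_left_le_one_le)
  finally have "F (x + h n *\<^sub>R e) = 0" using False by (intro supp) auto
  moreover have "F x = 0" using False norm_ge_zero[of e] by (intro supp) linarith
  ultimately show ?thesis by (simp add: s_def False)
 qed
 have "(\<lambda>n. LBINT x. s n x) \<longlonglongrightarrow> (LBINT x. F' x e)"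
 proof (rule integral_dominated_convergence[where w="\<lambda>x. M' * indicator (cball 0 (r + norm e)) x"])
  show "(\<lambda>x. F' x e) \<in> borel_measurable lborel" using cont by (simp add: borel_measurable_continuous_onI)
  have "F \<in> BM" using contF by (simp add: borel_measurable_continuous_onI)
  thus "s n \<in> borel_measurable lborel" for n unfolding s_def by measurable
  show "L1 (\<lambda>x. M' * indicator (cball 0 (r + norm e)) x)" by (intro integrable_mult_right integrable_real_indicator emeasure_bounded_finite) auto
 qed (use lim bnd in auto)
 moreover have "(LBINT x. s n x) = 0" for n
 proof -
  have i: "L1 (\<lambda>x. F (h n *\<^sub>R e + x))"
  proof (rule integrable_continuous_vanishing)
   show "continuous_on UNIV (\<lambda>x. F (h n *\<^sub>R e + x))" by (rule continuous_on_compose2[OF contF]) (auto intro!: continuous_intros)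
   show "F (h n *\<^sub>R e + x) = 0" if "norm x \<ge> r + norm (h n *\<^sub>R e)" for x
    using that norm_triangle_ineq4[of "h n *\<^sub>R e + x" "h n *\<^sub>R e"] by (intro supp) auto
  qed
  have "(LBINT x. F (x + h n *\<^sub>R e)) = (LBINT x. F x)" by (subst lborel_distr_plus[of "h n *\<^sub>R e", symmetric])
     (subst integral_distr, use contF in \<open>auto simp: borel_measurable_continuous_onI add.commute\<close>)
  thus ?thesis unfolding s_def using i intF by (simp add: add.commute)
 qed
 ultimately show ?thesis by (simp add: LIMSEQ_const_iff)
qed

lemma integral_divergence_eq_0:
 fixes Q :: "'a::euclidean_space \<Rightarrow> 'a"
 assumes der: "\<And>x. (Q has_derivative D x) (at x)"
  and cont: "\<And>i. continuous_on UNIV (\<lambda>x. D x i)"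
  and supp: "\<And>x. norm x \<ge> r \<Longrightarrow> Q x = 0"
 shows "(LBINT x. (\<Sum>i\<in>Basis. D x i \<bullet> i)) = 0"
proof -
 have supp': "D x i = 0" if "norm x \<ge> r + 1" for x i
 proof -
  have "D x = (\<lambda>_. 0)" by (rule has_derivative_zero_of_locally_zero[OF der, of "- cball 0 r"])
     (use that supp in auto)
  thus ?thesis by simp
 qed
 have "(LBINT x. D x i \<bullet> i) = 0" if "i \<in> Basis" for i
  by (rule integral_directional_derivative_eq_0[of "\<lambda>x. Q x \<bullet> i" "\<lambda>x h. D x h \<bullet> i" i r])
    (use supp in \<open>auto intro!: derivative_eq_intros der continuous_intros cont\<close>)
 moreover have "L1 (\<lambda>x. D x i \<bullet> i)" for i by (rule integrable_continuous_vanishing[of _ "r + 1"])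
    (use supp' in \<open>auto intro!: continuous_intros cont\<close>)
 ultimately show ?thesis by (subst Bochner_Integration.integral_sum) auto
qed

section \<open>Calculus with explicit gradients and symmetric Hessians\<close>

definition C2 :: "('a::euclidean_space \<Rightarrow> real) \<Rightarrow> ('a \<Rightarrow> 'a) \<Rightarrow> ('a \<Rightarrow> 'a \<Rightarrow> 'a) \<Rightarrow> bool" where
 "C2 f g H \<longleftrightarrow> (\<forall>x. (f has_derivative (\<lambda>h. g x \<bullet> h)) (at x)) \<and> (\<forall>x. (g has_derivative H x) (at x))
   \<and> (\<forall>x h k. H x h \<bullet> k = H x k \<bullet> h) \<and> (\<forall>h. continuous_on UNIV (\<lambda>x. H x h))"

definition tr :: "('a::euclidean_space \<Rightarrow> 'a \<Rightarrow> 'a) \<Rightarrow> 'a \<Rightarrow> real" where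
 "tr H x = (\<Sum>i\<in>Basis. H x i \<bullet> i)"

lemma C2D:
 assumes "C2 f g H"
 shows "(f has_derivative (\<lambda>h. g x \<bullet> h)) (at x)" "(g has_derivative H x) (at x)"
  "H x h \<bullet> k = H x k \<bullet> h" "continuous_on UNIV (\<lambda>x. H x h)"
  "continuous_on UNIV f" "continuous_on UNIV g" "continuous_on UNIV (tr H)" "linear (H x)"
proof -
 show 1: "(f has_derivative (\<lambda>h. g x \<bullet> h)) (at x)" and 2: "(g has_derivative H x) (at x)" for x using assms by (auto simp: C2_def)
 show "H x h \<bullet> k = H x k \<bullet> h" and 3: "\<And>h. continuous_on UNIV (\<lambda>x. H x h)" using assms unfolding C2_def by blast+
 show "continuous_on UNIV f" "continuous_on UNIV g" using 1 2 by (meson continuous_at_imp_continuous_on has_derivative_continuous)+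
 show "continuous_on UNIV (tr H)" unfolding tr_def by (intro continuous_intros 3)
 show "linear (H x)" using 2 by (rule has_derivative_linear)
qed

lemma C2_locally_zero:
 assumes C: "C2 f g H" and "open S" "x \<in> S" "\<And>y. y \<in> S \<Longrightarrow> f y = 0"
 shows "g x = 0" "H x h = 0"
proof -
 have g: "g y = 0" if "y \<in> S" for y
 proof -
  have "(\<lambda>h. g y \<bullet> h) = (\<lambda>_. 0)" by (rule has_derivative_zero_of_locally_zero[OF C2D(1)[OF C]]) (use assms that in auto)
  thus ?thesis by (metis inner_eq_zero_iff)
 qed
 show "g x = 0" using g assms by auto
 have "H x = (\<lambda>_. 0)" by (rule has_derivative_zero_of_locally_zero[OF C2D(2)[OF C]]) (use assms g in auto)
 thus "H x h = 0" by simp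
qed

lemma C2_mult:
 assumes "C2 f g H" "C2 f' g' H'"
 shows "C2 (\<lambda>x. f x * f' x) (\<lambda>x. f x *\<^sub>R g' x + f' x *\<^sub>R g x)
   (\<lambda>x h. f x *\<^sub>R H' x h + (g x \<bullet> h) *\<^sub>R g' x + f' x *\<^sub>R H x h + (g' x \<bullet> h) *\<^sub>R g x)"
 unfolding C2_def
proof (intro conjI allI)
 note A = C2D[OF assms(1)] and B = C2D[OF assms(2)]
 show "((\<lambda>x. f x * f' x) has_derivative (\<lambda>h. (f x *\<^sub>R g' x + f' x *\<^sub>R g x) \<bullet> h)) (at x)" for x
  by (rule derivative_eq_intros A B refl)+ (auto simp: algebra_simps)
 show "((\<lambda>x. f x *\<^sub>R g' x + f' x *\<^sub>R g x) has_derivative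
   (\<lambda>h. f x *\<^sub>R H' x h + (g x \<bullet> h) *\<^sub>R g' x + f' x *\<^sub>R H x h + (g' x \<bullet> h) *\<^sub>R g x)) (at x)" for x
  by (rule derivative_eq_intros A B refl)+ (auto simp: algebra_simps)
 show "(f x *\<^sub>R H' x h + (g x \<bullet> h) *\<^sub>R g' x + f' x *\<^sub>R H x h + (g' x \<bullet> h) *\<^sub>R g x) \<bullet> k =
    (f x *\<^sub>R H' x k + (g x \<bullet> k) *\<^sub>R g' x + f' x *\<^sub>R H x k + (g' x \<bullet> k) *\<^sub>R g x) \<bullet> h" for x h k
  using A(3)[of x h k] B(3)[of x h k] by (simp add: inner_add_left algebra_simps inner_commute)
 show "continuous_on UNIV (\<lambda>x. f x *\<^sub>R H' x h + (g x \<bullet> h) *\<^sub>R g' x + f' x *\<^sub>R H x h + (g' x \<bullet> h) *\<^sub>R g x)" for h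
  by (intro continuous_intros A B)
qed

lemma tr_mult:
 "tr (\<lambda>x h. f x *\<^sub>R H' x h + (g x \<bullet> h) *\<^sub>R g' x + f' x *\<^sub>R H x h + (g' x \<bullet> h) *\<^sub>R g x) x
  = f x * tr H' x + 2 * (g x \<bullet> g' x) + f' x * tr H x"
proof -
 have "(\<Sum>i\<in>Basis. (g x \<bullet> i) * (g' x \<bullet> i)) = g x \<bullet> g' x" by (simp add: euclidean_inner[symmetric])
 moreover have "(\<Sum>i\<in>Basis. (g' x \<bullet> i) * (g x \<bullet> i)) = g x \<bullet> g' x"
  by (subst inner_commute[of "g x"]) (simp add: euclidean_inner[symmetric])
 ultimately show ?thesis unfolding tr_def by (simp add: inner_add_left sum.distrib sum_distrib_left[symmetric])
qed

lemma C2_radial: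
 fixes p :: "real \<Rightarrow> real"
 assumes "\<And>s. (p has_real_derivative p' s) (at s)" "\<And>s. (p' has_real_derivative p'' s) (at s)"
  and "continuous_on UNIV p''"
 shows "C2 (\<lambda>x. p (x \<bullet> x)) (\<lambda>x. (2 * p' (x \<bullet> x)) *\<^sub>R x)
   (\<lambda>x h. (2 * p' (x \<bullet> x)) *\<^sub>R h + (4 * p'' (x \<bullet> x) * (x \<bullet> h)) *\<^sub>R (x::'a::euclidean_space))"
 unfolding C2_def
proof (intro conjI allI)
 have d: "((\<lambda>x. q (x \<bullet> x)) has_derivative (\<lambda>h. q' (x \<bullet> x) * (2 * (x \<bullet> h)))) (at x)"
  if "\<And>s. (q has_real_derivative q' s) (at s)" for q q' :: "real \<Rightarrow> real" and x :: 'a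
 proof -
  have "((\<lambda>x. x \<bullet> x) has_derivative (\<lambda>h. 2 * (x \<bullet> h))) (at x)" by (auto intro!: derivative_eq_intros simp: inner_commute)
  from has_derivative_compose[OF this that[of "x \<bullet> x", unfolded has_field_derivative_def]]
  show ?thesis by simp
 qed
 have c: "continuous_on UNIV p'" "continuous_on UNIV p" using assms(1,2) by (meson DERIV_continuous continuous_at_imp_continuous_on)+
 show "((\<lambda>x. p (x \<bullet> x)) has_derivative (\<lambda>h. ((2 * p' (x \<bullet> x)) *\<^sub>R x) \<bullet> h)) (at x)" for x :: 'a
  using d[OF assms(1), of x] by (simp add: mult.assoc mult.left_commute)
 show "((\<lambda>x. (2 * p' (x \<bullet> x)) *\<^sub>R x) has_derivative
   (\<lambda>h. (2 * p' (x \<bullet> x)) *\<^sub>R h + (4 * p'' (x \<bullet> x) * (x \<bullet> h)) *\<^sub>R x)) (at x)" for x :: 'a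
  by (rule derivative_eq_intros d[OF assms(2)] refl)+ (simp add: mult_ac)
 show "((2 * p' (x \<bullet> x)) *\<^sub>R h + (4 * p'' (x \<bullet> x) * (x \<bullet> h)) *\<^sub>R x) \<bullet> k =
  ((2 * p' (x \<bullet> x)) *\<^sub>R k + (4 * p'' (x \<bullet> x) * (x \<bullet> k)) *\<^sub>R x) \<bullet> h" for x h k :: 'a
  by (simp add: inner_add_left inner_commute[of k h] mult_ac)
 show "continuous_on UNIV (\<lambda>x. (2 * p' (x \<bullet> x)) *\<^sub>R h + (4 * p'' (x \<bullet> x) * (x \<bullet> h)) *\<^sub>R x)" for h :: 'a
  by (intro continuous_intros continuous_on_compose2[OF c(1)] continuous_on_compose2[OF assms(3)]) auto
qed

lemma tr_radial:
 "tr (\<lambda>x h. (2 * p' (x \<bullet> x)) *\<^sub>R h + (4 * p'' (x \<bullet> x) * (x \<bullet> h)) *\<^sub>R x) (x::'a::euclidean_space)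
  = 2 * real DIM('a) * p' (x \<bullet> x) + 4 * p'' (x \<bullet> x) * (x \<bullet> x)"
proof -
 have "(\<Sum>i\<in>Basis. (x \<bullet> i) * (x \<bullet> i)) = x \<bullet> x" by (simp add: euclidean_inner[symmetric])
 thus ?thesis unfolding tr_def by (simp add: inner_add_left sum.distrib sum_distrib_left[symmetric] mult.assoc)
qed

lemma has_derivative_norm_powr:
 fixes x :: "'a::real_inner"
 assumes "x \<noteq> 0"
 shows "((\<lambda>x. norm x powr p) has_derivative (\<lambda>h. p * norm x powr (p - 2) * (x \<bullet> h))) (at x)"
proof -
 have "((\<lambda>x. norm x powr p) has_derivative
   (\<lambda>h. norm x powr p * (0 * ln (norm x) + (x \<bullet> h / norm x) * p / norm x))) (at x)"
  using assms
  by (intro has_derivative_powr has_derivative_const has_derivative_norm[of x] ) (auto simp: sgn_div_norm inner_commute divide_inverse mult_ac intro!: has_derivative_eq_rhs[OF has_derivative_norm])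
 moreover have "norm x powr (p - 2) = norm x powr p / (norm x * norm x)" using assms by (simp add: powr_diff power2_eq_square)
 ultimately show ?thesis by (simp add: field_simps)
qed

text \<open>Powers of the norm are singular only at 0. A function that vanishes near 0 has
  derivative 0 there, so a derivative formula valid off 0 holds everywhere once it evaluates to 0 at
  0; below it does, since each of its terms carries a factor that vanishes near 0.\<close>

lemma has_derivative_glue:
 fixes Q :: "'a::real_normed_vector \<Rightarrow> 'b::real_normed_vector"
 assumes "\<And>x. x \<noteq> 0 \<Longrightarrow> (Q has_derivative D x) (at x)" and "dl > 0"
  and Q: "\<And>x. norm x < dl \<Longrightarrow> Q x = 0" and D: "D 0 = (\<lambda>_. 0)"
 shows "(Q has_derivative D x) (at x)"
proof (cases "x = 0")
 case True
 have "(Q has_derivative (\<lambda>_. 0)) (at x)" by (rule has_derivative_transform_within_open[OF has_derivative_const[of 0], of "ball 0 dl"])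
    (use assms True in \<open>auto simp: Q\<close>)
 thus ?thesis using True D by simp
qed (use assms in auto)

lemma continuous_on_glue:
 fixes Q :: "'a::real_normed_vector \<Rightarrow> 'b::real_normed_vector"
 assumes "continuous_on (- {0}) Q" and "dl > 0" and Q: "\<And>x. norm x < dl \<Longrightarrow> Q x = 0"
 shows "continuous_on UNIV Q"
proof -
 have "continuous_on (ball 0 dl) Q" by (rule continuous_on_eq[of _ "\<lambda>_. 0"]) (auto simp: Q)
 moreover have "- {0} \<union> ball (0::'a) dl = UNIV" using \<open>dl > 0\<close> by auto
 moreover have "open (- {0::'a})" by (simp add: open_Compl)
 ultimately show ?thesis using continuous_on_open_Un[of "- {0}" "ball 0 dl" Q] assms(1) by simp
qed

section \<open>Weighted integral identities and the Carleman inequality on an annulus\<close>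

locale annular =
 fixes v :: "'a::euclidean_space \<Rightarrow> real" and g H and dl :: real
 assumes C: "C2 v g H" and dl: "dl > 0"
  and v0: "\<And>x. norm x < dl \<Longrightarrow> v x = 0" and v1: "\<And>x. norm x \<ge> 1 \<Longrightarrow> v x = 0"
begin

lemma zero:
 assumes "norm x < dl \<or> norm x > 1"
 shows "g x = 0" "H x h = 0" "v x = 0"
proof -
 have *: "open (ball 0 dl \<union> - cball (0::'a) 1)" by auto
 have **: "v y = 0" if "y \<in> ball 0 dl \<union> - cball (0::'a) 1" for y using that v0 v1 by auto
 have "x \<in> ball 0 dl \<union> - cball 0 1" using assms by auto
 thus "g x = 0" "H x h = 0" "v x = 0" using C2_locally_zero[OF C * _ **] ** by auto
qed

lemma zero_hess_sum: "norm x < dl \<or> norm x > 1 \<Longrightarrow> tr H x = 0"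
 by (simp add: tr_def zero)

lemma int_weighted:
 assumes "continuous_on UNIV f" "\<And>x. norm x < dl \<or> norm x > 1 \<Longrightarrow> f x = 0"
 shows "L1 (\<lambda>x. norm x powr p * f x)"
 by (rule integrable_continuous_vanishing[of _ 2], rule continuous_on_glue[OF _ dl])
   (use assms(2) in \<open>auto intro!: continuous_intros continuous_on_subset[OF assms(1)]\<close>)

text \<open>The divergence theorem for |x|^p Q, with the derivative of the weight written out. The
  field vanishes near 0, so the singularity of the weight is not felt for any real p.\<close>

lemma integral_weighted_divergence:
 fixes Q :: "'a \<Rightarrow> 'a"
 assumes der: "\<And>x. (Q has_derivative D x) (at x)"
  and cont: "\<And>i. continuous_on UNIV (\<lambda>x. D x i)"
  and Q0: "\<And>x. norm x < dl \<or> norm x > 1 \<Longrightarrow> Q x = 0"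
 shows "(LBINT x. norm x powr p * tr D x + p * norm x powr (p - 2) * (x \<bullet> Q x)) = 0"
proof -
 have cQ: "continuous_on UNIV Q" using der by (meson continuous_at_imp_continuous_on has_derivative_continuous)
 have D0: "D x = (\<lambda>_. 0)" if "norm x < dl \<or> norm x > 1" for x by (rule has_derivative_zero_of_locally_zero[OF der, of "ball 0 dl \<union> - cball (0::'a) 1"])
    (use that Q0 in auto)
 define D' where "D' x h = norm x powr p *\<^sub>R D x h + (p * norm x powr (p - 2) * (x \<bullet> h)) *\<^sub>R Q x" for x h
 have "(LBINT x. (\<Sum>i\<in>Basis. D' x i \<bullet> i)) = 0"
 proof (rule integral_divergence_eq_0[where r = 2 and Q = "\<lambda>x. norm x powr p *\<^sub>R Q x"])
  show "((\<lambda>x. norm x powr p *\<^sub>R Q x) has_derivative D' x) (at x)" for x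
  proof (rule has_derivative_glue[OF _ dl])
   show "((\<lambda>x. norm x powr p *\<^sub>R Q x) has_derivative D' x) (at x)" if "x \<noteq> 0" for x
    unfolding D'_def by (rule derivative_eq_intros has_derivative_norm_powr der that refl)+
  qed (use Q0 D0 dl in \<open>auto simp: D'_def\<close>)
  show "continuous_on UNIV (\<lambda>x. D' x i)" for i by (rule continuous_on_glue[OF _ dl])
     (use Q0 D0 in \<open>auto simp: D'_def intro!: continuous_intros continuous_on_subset[OF cont]
      continuous_on_subset[OF cQ]\<close>)
 qed (use Q0 in auto)
 moreover have "(\<Sum>i\<in>Basis. D' x i \<bullet> i) = norm x powr p * tr D x + p * norm x powr (p - 2) * (x \<bullet> Q x)" for x
  by (simp add: D'_def tr_def inner_add_left sum.distrib sum_distrib_left[symmetric] mult.assoc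
     euclidean_inner[of x "Q x"])
 ultimately show ?thesis by simp
qed

lemma norm_sq_powr: "norm x powr (p - 2) * (norm x)^2 = (norm (x::'a)) powr p"
 by (cases "x = 0") (auto simp: powr_diff)

text \<open>Divergence theorem for |x|^p ((x \<bullet> g) g - (g \<bullet> g) x / 2), the
  Rellich-Pohozaev field. With p = 2 - n the terms in the full |g|^2 cancel, and what remains
  involves the radial derivative x \<bullet> g and the Laplacian.\<close>

lemma pohozaev:
 "(LBINT x. norm x powr (2 - real DIM('a)) * ((x \<bullet> g x) * tr H x)
   - (real DIM('a) - 2) * (norm x powr (- real DIM('a)) * (x \<bullet> g x)^2)) = 0"
proof -
 define D where "D x h = (x \<bullet> g x) *\<^sub>R H x h + (h \<bullet> g x + x \<bullet> H x h) *\<^sub>R g x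
   - ((g x \<bullet> g x) / 2) *\<^sub>R h - (g x \<bullet> H x h) *\<^sub>R x" for x h
 note A = C2D[OF C]
 have "(LBINT x. norm x powr (2 - real DIM('a)) * tr D x + (2 - real DIM('a)) * norm x powr (2 - real DIM('a) - 2)
   * (x \<bullet> ((x \<bullet> g x) *\<^sub>R g x - ((g x \<bullet> g x) / 2) *\<^sub>R x))) = 0"
 proof (rule integral_weighted_divergence)
  show "((\<lambda>x. (x \<bullet> g x) *\<^sub>R g x - ((g x \<bullet> g x) / 2) *\<^sub>R x) has_derivative D x) (at x)" for x
   unfolding D_def by (rule derivative_eq_intros A refl)+ (auto simp: inner_commute algebra_simps)
 qed (auto simp: D_def zero intro!: continuous_intros A)
 moreover have "tr D x = (x \<bullet> g x) * tr H x + (g x \<bullet> g x) * (1 - real DIM('a) / 2)" for x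
 proof -
  have 1: "(\<Sum>i\<in>Basis. (i \<bullet> g x) * (g x \<bullet> i)) = g x \<bullet> g x" by (subst euclidean_inner) (simp add: inner_commute)
  have 2: "(\<Sum>i\<in>Basis. (x \<bullet> H x i) * (g x \<bullet> i)) = H x x \<bullet> g x"
   using A(3)[of x _ x] by (subst euclidean_inner[of "H x x"]) (simp add: inner_commute)
  have 3: "(\<Sum>i\<in>Basis. (g x \<bullet> H x i) * (x \<bullet> i)) = H x (g x) \<bullet> x"
   using A(3)[of x _ "g x"] by (subst euclidean_inner[of "H x (g x)"]) (simp add: inner_commute)
  show ?thesis unfolding tr_def D_def using 1 2 3 A(3)[of x x "g x"] by (simp add: inner_diff_left inner_add_left sum.distrib sum_subtractf sum_distrib_left[symmetric]
    distrib_right algebra_simps)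
 qed
 ultimately have "(LBINT x. norm x powr (2 - real DIM('a)) * ((x \<bullet> g x) * tr H x + (g x \<bullet> g x) * (1 - real DIM('a) / 2))
   + (2 - real DIM('a)) * norm x powr (- real DIM('a))
   * ((x \<bullet> g x)^2 - ((g x \<bullet> g x) / 2) * (norm x)^2)) = 0"
  by (simp add: inner_diff_right power2_eq_square[of "_ \<bullet> _"] power2_norm_eq_inner mult.assoc)
 moreover have "norm x powr (2 - real DIM('a)) * ((x \<bullet> g x) * tr H x + (g x \<bullet> g x) * (1 - real DIM('a) / 2))
   + (2 - real DIM('a)) * norm x powr (- real DIM('a))
   * ((x \<bullet> g x)^2 - ((g x \<bullet> g x) / 2) * (norm x)^2) = norm x powr (2 - real DIM('a)) * ((x \<bullet> g x) * tr H x)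
   - (real DIM('a) - 2) * (norm x powr (- real DIM('a)) * (x \<bullet> g x)^2)" for x
  using norm_sq_powr[of x "2 - real DIM('a)", symmetric] by (simp add: field_simps)
 ultimately show ?thesis by simp
qed

text \<open>Divergence theorem for |x|^p v^2 x. For p = -n the term in v^2 drops out: in the
  variable ln |x| the other term is then an exact derivative.\<close>

lemma int_v_xg:
 "(LBINT x. norm x powr p * ((real DIM('a) + p) * (v x)^2 + 2 * (v x * (x \<bullet> g x)))) = 0"
proof -
 note A = C2D[OF C]
 define D where "D x h = (v x)^2 *\<^sub>R h + (2 * v x * (g x \<bullet> h)) *\<^sub>R x" for x h
 have "(LBINT x. norm x powr p * tr D x + p * norm x powr (p - 2) * (x \<bullet> ((v x)^2 *\<^sub>R x))) = 0"
 proof (rule integral_weighted_divergence)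
  show "((\<lambda>x. (v x)^2 *\<^sub>R x) has_derivative D x) (at x)" for x unfolding D_def by (rule derivative_eq_intros A refl)+ (auto simp: algebra_simps)
 qed (auto simp: D_def zero intro!: continuous_intros A)
 moreover have "tr D x = real DIM('a) * (v x)^2 + 2 * (v x * (x \<bullet> g x))" for x unfolding tr_def D_def
  by (simp add: inner_add_left sum.distrib mult.assoc sum_distrib_left[symmetric] euclidean_inner[of x "g x"] mult.commute[of "g x \<bullet> _"])
 moreover have "norm x powr p * (real DIM('a) * (v x)^2 + 2 * (v x * (x \<bullet> g x))) + p * norm x powr (p - 2) * (x \<bullet> ((v x)^2 *\<^sub>R x))
  = norm x powr p * ((real DIM('a) + p) * (v x)^2 + 2 * (v x * (x \<bullet> g x)))" for x
  using norm_sq_powr[of x p, symmetric] by (simp add: power2_norm_eq_inner algebra_simps)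
 ultimately show ?thesis by simp
qed

text \<open>Divergence theorem for |x|^p v g.\<close>

lemma int_green:
 "(LBINT x. norm x powr p * (g x \<bullet> g x + v x * tr H x) + p * (norm x powr (p - 2) * (v x * (x \<bullet> g x)))) = 0"
proof -
 note A = C2D[OF C]
 define D where "D x h = v x *\<^sub>R H x h + (g x \<bullet> h) *\<^sub>R g x" for x h
 have "(LBINT x. norm x powr p * tr D x + p * norm x powr (p - 2) * (x \<bullet> (v x *\<^sub>R g x))) = 0"
 proof (rule integral_weighted_divergence)
  show "((\<lambda>x. v x *\<^sub>R g x) has_derivative D x) (at x)" for x unfolding D_def by (rule derivative_eq_intros A refl)+
 qed (auto simp: D_def zero intro!: continuous_intros A)
 moreover have "tr D x = g x \<bullet> g x + v x * tr H x" for x unfolding tr_def D_def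
  by (simp add: inner_add_left sum.distrib sum_distrib_left[symmetric] euclidean_inner[of "g x" "g x"])
 ultimately show ?thesis by (simp add: mult.assoc)
qed

context
 fixes a :: real
 assumes a: "a \<ge> 0" "2 * a + real DIM('a) - 2 \<ge> 2"
begin

text \<open>This is |x|^2 \<Delta> conjugated by |x|^a: if W = |x|^a v, then L v = |x|^(2-a)
  \<Delta>W. The number \<open>m\<close> below is the coefficient of the first radial derivative
  when L is written in the variable ln |x|.\<close>

definition L where "L x = (norm x)^2 * tr H x + 2 * a * (x \<bullet> g x) + a * (a + real DIM('a) - 2) * v x"

definition m where "m = 2 * a + real DIM('a) - 2"

lemma contL: "continuous_on UNIV L"
 unfolding L_def by (intro continuous_intros C2D[OF C])

lemma L0: "norm x < dl \<or> norm x > 1 \<Longrightarrow> L x = 0"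
 by (simp add: L_def zero zero_hess_sum)

lemma int_simps [simp, intro]:
 "L1 (\<lambda>x. norm x powr p * (L x)^2)"
 "L1 (\<lambda>x. norm x powr p * (v x)^2)"
 "L1 (\<lambda>x. norm x powr p * (x \<bullet> g x)^2)"
 "L1 (\<lambda>x. norm x powr p * (v x * (x \<bullet> g x)))"
 "L1 (\<lambda>x. norm x powr p * ((x \<bullet> g x) * tr H x))"
 by (rule int_weighted; use zero zero_hess_sum L0 in \<open>force intro!: continuous_intros contL C2D[OF C]\<close>)+

text \<open>In the variable ln |x|, L splits into the symmetric part \<open>S\<close> and the
  antisymmetric part m times x \<bullet> \<nabla>, both with respect to |x|^(-n) dx. Their cross
  term has integral 0, by \<open>pohozaev\<close> for the terms with derivatives in \<open>S\<close>
  and by \<open>int_v_xg\<close> for its zeroth-order term, so the square of the antisymmetric part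
  alone is bounded by that of L.\<close>

lemma carleman_radial:
 "m^2 * (LBINT x. norm x powr (- real DIM('a)) * (x \<bullet> g x)^2)
  \<le> (LBINT x. norm x powr (- real DIM('a)) * (L x)^2)"
proof -
 let ?n = "real DIM('a)"
 define S where "S x = (norm x)^2 * tr H x - (?n - 2) * (x \<bullet> g x) + a * (a + ?n - 2) * v x" for x
 have p: "(LBINT x. norm x powr (2 - ?n) * ((x \<bullet> g x) * tr H x)
   - (?n - 2) * (norm x powr (- ?n) * (x \<bullet> g x)^2)) = 0"
  by (rule pohozaev)
 have q: "(LBINT x. norm x powr (- ?n) * (v x * (x \<bullet> g x))) = 0" using int_v_xg[of "- ?n"] by (simp add: mult.left_commute[of _ 2])
 have "m^2 * (LBINT x. norm x powr (- ?n) * (x \<bullet> g x)^2)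
   = (LBINT x. m^2 * (norm x powr (- ?n) * (x \<bullet> g x)^2)
    + 2 * m * (norm x powr (2 - ?n) * ((x \<bullet> g x) * tr H x)
      - (?n - 2) * (norm x powr (- ?n) * (x \<bullet> g x)^2))
    + (2 * m * (a * (a + ?n - 2))) * (norm x powr (- ?n) * (v x * (x \<bullet> g x))))"
  using p q by (simp del: Bochner_Integration.integral_diff)
 also have "\<dots> \<le> (LBINT x. norm x powr (- ?n) * (L x)^2)"
 proof (rule integral_mono)
  fix x :: 'a
  have L: "L x = S x + m * (x \<bullet> g x)" unfolding L_def S_def m_def by (simp add: algebra_simps)
  have e: "norm x powr (2 - ?n) = norm x powr (- ?n) * (norm x)^2" using norm_sq_powr[of x "2 - ?n"] by simp
  have "norm x powr (- ?n) * (L x)^2 = norm x powr (- ?n) * (S x)^2 + norm x powr (- ?n) * (m^2 * (x \<bullet> g x)^2 + 2 * m * (S x * (x \<bullet> g x)))"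
   unfolding L by (simp add: power2_eq_square algebra_simps)
  also have "\<dots> \<ge> norm x powr (- ?n) * (m^2 * (x \<bullet> g x)^2 + 2 * m * (S x * (x \<bullet> g x)))" by simp
  finally show "m^2 * (norm x powr (- ?n) * (x \<bullet> g x)^2)
    + 2 * m * (norm x powr (2 - ?n) * ((x \<bullet> g x) * tr H x)
      - (?n - 2) * (norm x powr (- ?n) * (x \<bullet> g x)^2))
    + (2 * m * (a * (a + ?n - 2))) * (norm x powr (- ?n) * (v x * (x \<bullet> g x)))
    \<le> norm x powr (- ?n) * (L x)^2"
   unfolding e by (simp add: S_def power2_eq_square algebra_simps)
 qed auto
 finally show ?thesis .
qed

text \<open>A Hardy inequality: for the weight |x|^(1-n) the factor n + p in \<open>int_v_xg\<close>
  equals 1, so v is controlled by its radial derivative with a constant independent of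
  \<open>dl\<close>. The price is one power of |x|: the bound |x| \<le> 1 on the support is used to
  pass to the weight |x|^(-n).\<close>

lemma carleman_hardy:
 "m^2 * (LBINT x. norm x powr (1 - real DIM('a)) * (v x)^2)
  \<le> 4 * (LBINT x. norm x powr (- real DIM('a)) * (L x)^2)"
proof -
 let ?n = "real DIM('a)"
 let ?V = "LBINT x. norm x powr (1 - ?n) * (v x)^2"
 have 1: "(LBINT x. norm x powr (1 - ?n) * (v x)^2 + 2 * (norm x powr (1 - ?n) * (v x * (x \<bullet> g x)))) = 0" using int_v_xg[of "1 - ?n"] by (simp add: algebra_simps)
 have "?V = (LBINT x. (- 2) * (norm x powr (1 - ?n) * (v x * (x \<bullet> g x))))" using 1 by (subst (asm) Bochner_Integration.integral_add) auto
 also have "\<dots> \<le> (LBINT x. norm x powr (1 - ?n) * (v x)^2 / 2 + 2 * (norm x powr (- ?n) * (x \<bullet> g x)^2))"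
 proof (rule integral_mono)
  fix x :: 'a
  have "(- 2) * (v x * (x \<bullet> g x)) \<le> (v x)^2 / 2 + 2 * (x \<bullet> g x)^2"
   using zero_le_power2[of "v x / 2 + (x \<bullet> g x)"] by (simp add: power2_eq_square algebra_simps)
  from mult_left_mono[OF this, of "norm x powr (1 - ?n)"]
  have "(- 2) * (norm x powr (1 - ?n) * (v x * (x \<bullet> g x))) \<le> norm x powr (1 - ?n) * (v x)^2 / 2 + 2 * (norm x powr (1 - ?n) * (x \<bullet> g x)^2)"
   by (simp add: algebra_simps)
  also have "norm x powr (1 - ?n) * (x \<bullet> g x)^2 \<le> norm x powr (- ?n) * (x \<bullet> g x)^2"
  proof (cases "norm x \<le> 1 \<and> x \<noteq> 0")
   case True
   have "norm x powr (1 - ?n) = norm x powr (- ?n) * norm x" using True by (simp add: powr_add[of _ "- ?n" 1, simplified])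
   also have "\<dots> \<le> norm x powr (- ?n)" using True by (simp add: mult_left_le)
   finally show ?thesis by (rule mult_right_mono) auto
  qed (auto simp: zero)
  finally show "(- 2) * (norm x powr (1 - ?n) * (v x * (x \<bullet> g x)))
    \<le> norm x powr (1 - ?n) * (v x)^2 / 2 + 2 * (norm x powr (- ?n) * (x \<bullet> g x)^2)" by simp
 qed auto
 also have "\<dots> = ?V / 2 + 2 * (LBINT x. norm x powr (- ?n) * (x \<bullet> g x)^2)" by simp
 finally have "?V \<le> 4 * (LBINT x. norm x powr (- ?n) * (x \<bullet> g x)^2)" by simp
 from mult_left_mono[OF this, of "m^2"] carleman_radial show ?thesis by simp
qed

end

end

text \<open>\<open>carleman_hardy\<close> for v = |x|^(-a) W gives the first inequality. The
  gradient bound follows from Green's identity; its coefficients grow at most like b^2 and are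
  absorbed by the factor (b - 2)^2 of the first inequality. The constants 4 and 6 depend neither on
  b nor on \<open>dl\<close>.\<close>

lemma carleman:
 fixes W :: "'a::euclidean_space \<Rightarrow> real"
 assumes C: "C2 W g H" and dl: "dl > 0" and W0: "\<And>x. norm x < dl \<Longrightarrow> W x = 0"
  and W1: "\<And>x. norm x \<ge> 1 \<Longrightarrow> W x = 0"
  and n: "DIM('a) \<ge> 2" and b: "b \<ge> real DIM('a)" "b \<ge> 4"
 shows "(b - 2)^2 * (LBINT x. norm x powr (1 - b) * (W x)^2) \<le> 4 * (LBINT x. norm x powr (4 - b) * (tr H x)^2)"
  and "(LBINT x. norm x powr (3 - b) * (g x \<bullet> g x)) \<le> 6 * (LBINT x. norm x powr (4 - b) * (tr H x)^2)"
proof -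
 interpret W: annular W g H dl by unfold_locales (use assms in auto)
 note A = C2D[OF C]
 define n where "n = real DIM('a)"
 \<comment> \<open>With this a, |x|^(-n) (L v)^2 = |x|^(4-b) (\<Delta>W)^2 and |x|^(1-n) v^2 =
   |x|^(1-b) W^2, and the constant m becomes b - 2.\<close>
 define a where "a = (b - n) / 2"
 have ba: "b = 2 * a + n" by (simp add: a_def field_simps)
 define v where "v x = norm x powr (- a) * W x" for x
 define gv where "gv x = norm x powr (- a) *\<^sub>R g x - (a * norm x powr (- a - 2) * W x) *\<^sub>R x" for x
 define Hv where "Hv x h = norm x powr (- a) *\<^sub>R H x h - (a * norm x powr (- a - 2) * (x \<bullet> h)) *\<^sub>R g x
   - (a * norm x powr (- a - 2) * (g x \<bullet> h)) *\<^sub>R x - (a * norm x powr (- a - 2) * W x) *\<^sub>R h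
   + (a * (a + 2) * norm x powr (- a - 4) * (x \<bullet> h) * W x) *\<^sub>R x" for x h
 have Cv: "C2 v gv Hv" unfolding C2_def
 proof (intro conjI allI)
  show "(v has_derivative (\<lambda>h. gv x \<bullet> h)) (at x)" for x
  proof (rule has_derivative_glue[OF _ dl])
   show "(v has_derivative (\<lambda>h. gv x \<bullet> h)) (at x)" if "x \<noteq> 0" for x unfolding v_def gv_def
    by (rule has_derivative_norm_powr[OF that] A derivative_eq_intros refl)+
      (simp add: inner_diff_left algebra_simps)
  qed (use dl W.zero in \<open>auto simp: v_def gv_def\<close>)
  show "(gv has_derivative Hv x) (at x)" for x
  proof (rule has_derivative_glue[OF _ dl])
   show "(gv has_derivative Hv x) (at x)" if "x \<noteq> 0" for x unfolding gv_def Hv_def by (rule has_derivative_norm_powr[OF that] A derivative_eq_intros refl)+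
      (simp add: algebra_simps)
  qed (use dl W.zero in \<open>auto simp: gv_def Hv_def\<close>)
  show "Hv x h \<bullet> k = Hv x k \<bullet> h" for x h k using A(3)[of x h k] by (simp add: Hv_def inner_diff_left inner_add_left inner_commute[of k h] mult_ac)
  show "continuous_on UNIV (\<lambda>x. Hv x h)" for h by (rule continuous_on_glue[OF _ dl])
     (auto simp: Hv_def W.zero intro!: continuous_intros continuous_on_subset[OF A(4)]
       continuous_on_subset[OF A(5)] continuous_on_subset[OF A(6)])
 qed
 interpret v: annular v gv Hv dl
  by unfold_locales (use Cv dl W0 W1 in \<open>auto simp: v_def\<close>)
 have a: "a \<ge> 0" "2 * a + real DIM('a) - 2 \<ge> 2" using b by (auto simp: a_def n_def field_simps)
 have xgv: "x \<bullet> gv x = norm x powr (- a) * (x \<bullet> g x) - a * norm x powr (- a) * W x" for x using W.norm_sq_powr[of x "- a", symmetric]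
  by (simp add: gv_def inner_diff_right power2_norm_eq_inner mult_ac)
 have "(norm x)^2 * tr Hv x = norm x powr (2 - a) * tr H x - 2 * a * (norm x powr (- a) * (x \<bullet> g x))
   - a * n * (norm x powr (- a) * W x) + a * (a + 2) * (norm x powr (- a) * W x)" for x
 proof -
  have e1: "norm x powr (2 - a) = norm x powr (- a) * (norm x)^2" using W.norm_sq_powr[of x "2 - a"] by simp
  have e2: "norm x powr (- a) = norm x powr (- a - 2) * (norm x)^2" using W.norm_sq_powr[of x "- a"] by simp
  have e3: "norm x powr (- a - 2) = norm x powr (- a - 4) * (norm x)^2" using W.norm_sq_powr[of x "- a - 2"] by (simp add: algebra_simps)
  have s1: "(\<Sum>i\<in>Basis. (x \<bullet> i) * (x \<bullet> i)) = (norm x)^2" by (simp add: euclidean_inner[symmetric] power2_norm_eq_inner)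
  have s2: "(\<Sum>i\<in>Basis. (x \<bullet> i) * (g x \<bullet> i)) = x \<bullet> g x" by (simp add: euclidean_inner[symmetric])
  have s3: "(\<Sum>i\<in>Basis. (g x \<bullet> i) * (x \<bullet> i)) = x \<bullet> g x" by (subst inner_commute[of x]) (simp add: euclidean_inner[symmetric])
  have t: "tr Hv x = norm x powr (- a) * tr H x - 2 * a * norm x powr (- a - 2) * (x \<bullet> g x)
   - a * norm x powr (- a - 2) * W x * n + a * (a + 2) * norm x powr (- a - 4) * W x * (norm x)^2"
   unfolding tr_def Hv_def n_def by (simp add: inner_add_left inner_diff_left sum.distrib sum_subtractf sum_distrib_left[symmetric]
     s1[symmetric] s2[symmetric] s3 mult.assoc)
     (simp add: s1[symmetric] s2[symmetric] s3 sum_distrib_left mult_ac)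
  show ?thesis by (simp only: t e1 e2 e3) (simp add: algebra_simps power2_eq_square)
 qed
 hence Lv: "v.L a x = norm x powr (2 - a) * tr H x" for x unfolding v.L_def[OF a] xgv by (simp add: v_def n_def algebra_simps)
 have pp: "norm x powr p * (norm x powr q * y)^2 = norm x powr (p + 2 * q) * y^2" for x :: 'a and p q y
 proof -
  have "(norm x powr q)^2 = norm x powr (2 * q)" by (simp add: power2_eq_square flip: powr_add)
  thus ?thesis by (simp add: power_mult_distrib powr_add)
 qed
 let ?I = "LBINT x. norm x powr (4 - b) * (tr H x)^2"
 have I: "(LBINT x. norm x powr (- real DIM('a)) * (v.L a x)^2) = ?I" unfolding Lv pp by (simp add: ba n_def algebra_simps)
 have V: "(LBINT x. norm x powr (1 - real DIM('a)) * (v x)^2) = (LBINT x. norm x powr (1 - b) * (W x)^2)" unfolding v_def pp by (simp add: ba n_def algebra_simps)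
 let ?V = "LBINT x. norm x powr (1 - b) * (W x)^2"
 have V0: "?V \<ge> 0" by (rule Bochner_Integration.integral_nonneg) auto
 have H: "(v.m a)^2 * ?V \<le> 4 * ?I" using v.carleman_hardy[OF a] unfolding I V .
 thus H: "(b - 2)^2 * ?V \<le> 4 * ?I" by (simp add: v.m_def[OF a] ba n_def)
 let ?G = "LBINT x. norm x powr (3 - b) * (g x \<bullet> g x)"
 let ?T = "LBINT x. norm x powr (3 - b) * (W x * tr H x)"
 let ?X = "LBINT x. norm x powr (1 - b) * (W x * (x \<bullet> g x))"
 have i: "L1 (\<lambda>x. norm x powr p * (W x)^2)" "L1 (\<lambda>x. norm x powr p * (W x * (x \<bullet> g x)))"
  "L1 (\<lambda>x. norm x powr p * (g x \<bullet> g x))" "L1 (\<lambda>x. norm x powr p * (W x * tr H x))"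
  "L1 (\<lambda>x. norm x powr p * (tr H x)^2)" for p
  by (rule W.int_weighted; use W.zero W.zero_hess_sum in \<open>force intro!: continuous_intros A\<close>)+
 have 1: "?G + ?T + (3 - b) * ?X = 0" using W.int_green[of "3 - b"] i by (simp add: distrib_left)
 have 2: "(n + 1 - b) * ?V + 2 * ?X = 0" using W.int_v_xg[of "1 - b"] i by (simp add: distrib_left mult.left_commute[of "norm _ powr _"] n_def add_diff_eq)
 have "- ?T = (LBINT x. - (norm x powr (3 - b) * (W x * tr H x)))" by simp
 also have "\<dots> \<le> (LBINT x. norm x powr (1 - b) * (W x)^2 / 2 + norm x powr (4 - b) * (tr H x)^2 / 2)"
 proof (rule integral_mono)
  fix x :: 'a
  have e1: "norm x powr (3 - b) = norm x powr (1 - b) * (norm x)^2" using W.norm_sq_powr[of x "3 - b"] by simp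
  have e2: "norm x powr (5 - b) = norm x powr (3 - b) * (norm x)^2" using W.norm_sq_powr[of x "5 - b"] by simp
  have "- ((norm x)^2 * (W x * tr H x)) \<le> ((W x)^2 + (norm x)^2 * (norm x)^2 * (tr H x)^2) / 2"
   using zero_le_power2[of "W x + (norm x)^2 * tr H x"] by (simp add: power2_eq_square algebra_simps)
  from mult_left_mono[OF this, of "norm x powr (1 - b)"]
  have "- (norm x powr (3 - b) * (W x * tr H x)) \<le> norm x powr (1 - b) * (W x)^2 / 2 + norm x powr (5 - b) * (tr H x)^2 / 2"
   unfolding e2 e1 by (simp add: algebra_simps add_divide_distrib)
  also have "norm x powr (5 - b) * (tr H x)^2 \<le> norm x powr (4 - b) * (tr H x)^2"
  proof (cases "norm x \<le> 1")
   case True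
   thus ?thesis by (cases "x = 0") (auto intro!: mult_right_mono powr_mono')
  qed (simp add: W.zero_hess_sum)
  finally show "- (norm x powr (3 - b) * (W x * tr H x)) \<le> norm x powr (1 - b) * (W x)^2 / 2 + norm x powr (4 - b) * (tr H x)^2 / 2" by simp
 qed (use i in auto)
 also have "\<dots> = ?V / 2 + ?I / 2" using i by simp
 finally have T: "- ?T \<le> ?V / 2 + ?I / 2" .
 have "(b - 3) * (b - 1 - n) \<le> (b - 3) * (b - 2)" using b by (intro mult_left_mono) (auto simp: n_def)
 also have "\<dots> \<le> (b - 2) * (b - 2)" using b by (intro mult_right_mono) auto
 finally have "(b - 3) * (b - 1 - n) \<le> (b - 2) * (b - 2)" .
 from mult_right_mono[OF this V0] have C: "(b - 3) * (b - 1 - n) * ?V \<le> 4 * ?I" using H by (simp add: power2_eq_square)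
 have "2 * 2 \<le> (b - 2) * (b - 2)" using b by (intro mult_mono) auto
 from mult_right_mono[OF this V0] have V: "?V \<le> ?I" using H by (simp add: power2_eq_square)
 \<comment> \<open>Green's identity expresses G by T and X, and the divergence identity for
   |x|^(1-b) W^2 x turns X into a multiple of V; the resulting factor (b - 3) (b - 1 - n) has just
   been bounded by (b - 2)^2.\<close>
 have "2 * G = - 2 * T + (b - 3) * (b - 1 - n) * V" if "G + T + (3 - b) * X = 0" "(n + 1 - b) * V + 2 * X = 0" for G T X V
 proof -
  have "2 * X = (b - 1 - n) * V" "2 * G = - 2 * T + (b - 3) * (2 * X)" using that by (simp_all add: algebra_simps)
  thus ?thesis by simp
 qed
 from this[OF 1 2] show "?G \<le> 6 * ?I" using T C V V0 by linarith
qed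

section \<open>The trace term\<close>

text \<open>Fundamental theorem of calculus along the half-lines t > 0, then Fubini; the boundary
  term sits at t = 0.\<close>

lemma half_space_divergence:
 fixes F :: "'b::euclidean_space \<times> real \<Rightarrow> real"
 assumes der: "\<And>z. (F has_derivative F' z) (at z)"
  and cont: "continuous_on UNIV (\<lambda>z. F' z (0, 1))"
  and supp: "\<And>z. norm z \<ge> r \<Longrightarrow> F z = 0"
 shows "(LBINT z. indicator upper z * F' z (0, 1)) = - (LBINT x. F (x, 0))"
proof -
 have supp': "F' z (0, 1) = 0" if "norm z \<ge> r + 1" for z
 proof -
  have "F' z = (\<lambda>_. 0)" by (rule has_derivative_zero_of_locally_zero[OF der, of "- cball 0 r"])
     (use that supp in auto)
  thus ?thesis by simp
 qed
 have I: "L1 (\<lambda>z. F' z (0, 1))" by (rule integrable_continuous_vanishing[OF cont supp'])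
 have m: "upper \<in> sets borel" by (intro borel_open open_Collect_less continuous_intros)
 have J: "L1 (\<lambda>z. indicator upper z * F' z (0, 1))" using integrable_mult_indicator[OF _ I, of "upper"] m by simp
 have inner: "(LINT t|lborel. indicator upper (x, t) * F' (x, t) (0, 1)) = - F (x, 0)" for x :: 'b
 proof -
  define T where "T = \<bar>r\<bar> + 1"
  have T: "T > 0" "T \<ge> r + 1" by (auto simp: T_def)
  have big: "norm (x, t) \<ge> \<bar>t\<bar>" for t :: real by (simp add: norm_Pair real_le_rsqrt)
  have "(LINT t|lborel. indicator upper (x, t) * F' (x, t) (0, 1))
    = (LINT t|lborel. indicator {0..T} t *\<^sub>R F' (x, t) (0, 1))"
  proof (rule integral_cong_AE)
   have c: "continuous_on UNIV (\<lambda>t. F' (x, t) (0, 1))" by (rule continuous_on_compose2[OF cont]) (auto intro!: continuous_intros)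
   hence [measurable]: "(\<lambda>t. F' (x, t) (0, 1)) \<in> BM" by (simp add: borel_measurable_continuous_onI)
   show "(\<lambda>t. indicator upper (x, t) * F' (x, t) (0, 1)) \<in> borel_measurable lborel" by (simp add: indicator_def)
   show "(\<lambda>t. indicator {0..T} t *\<^sub>R F' (x, t) (0, 1)) \<in> borel_measurable lborel" by simp
   have "AE t in lborel. t \<noteq> (0::real)" by (rule AE_lborel_singleton)
   thus "AE t in lborel. indicator upper (x, t) * F' (x, t) (0, 1) = indicator {0..T} t *\<^sub>R F' (x, t) (0, 1)"
   proof (rule AE_mp, intro AE_I2 impI)
    fix t :: real assume "t \<noteq> 0"
    have "F' (x, t) (0, 1) = 0" if "t > T" using that T big[of t] by (intro supp') linarith
    thus "indicator upper (x, t) * F' (x, t) (0, 1) = indicator {0..T} t *\<^sub>R F' (x, t) (0, 1)" using \<open>t \<noteq> 0\<close> by (auto simp: indicator_def)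
   qed
  qed
  also have "\<dots> = F (x, T) - F (x, 0)"
  proof (rule integral_FTC_Icc)
   show "0 \<le> T" using T by simp
   show "((\<lambda>t. F (x, t)) has_vector_derivative F' (x, t) (0, 1)) (at t within {0..T})" for t
   proof -
    have "((\<lambda>t. F (x, t)) has_derivative (\<lambda>s. F' (x, t) (0, s))) (at t)" by (rule has_derivative_compose[where f="\<lambda>t. (x, t)" and g=F, OF _ der])
       (auto intro!: derivative_eq_intros)
    moreover have "(\<lambda>s. F' (x, t) (0, s)) = (\<lambda>s. s *\<^sub>R F' (x, t) (0, 1))"
    proof
     fix s :: real
     show "F' (x, t) (0, s) = s *\<^sub>R F' (x, t) (0, 1)" using linear_scale[OF has_derivative_linear[OF der[of "(x, t)"]], of s "(0, 1)"] by simp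
    qed
    ultimately show ?thesis unfolding has_vector_derivative_def by (metis has_derivative_at_withinI)
   qed
   show "continuous_on {0..T} (\<lambda>t. F' (x, t) (0, 1))" by (rule continuous_on_compose2[OF cont]) (auto intro!: continuous_intros)
  qed
  also have "F (x, T) = 0" using T big[of T] by (intro supp) linarith
  finally show ?thesis by simp
 qed
 have "(LBINT z. indicator upper z * F' z (0, 1))
   = (LBINT x. (LINT t|lborel. indicator upper (x, t) * F' (x, t) (0, 1)))"
  using J unfolding lborel_prod[symmetric] by (subst lborel_pair.integral_fst'[symmetric]) auto
 thus ?thesis unfolding inner by simp
qed

text \<open>Integrating the t derivative of |z|^(2-b) W^2 over t > 0 produces the trace.
  Differentiating the weight costs a factor b - 2, which the factor (b - 2)^2 in
  \<open>carleman\<close> pays for; the total is I + 2 I + 6 I.\<close>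

lemma carleman_trace:
 fixes W :: "'b::euclidean_space \<times> real \<Rightarrow> real"
 assumes C: "C2 W g H" and dl: "dl > 0" and W0: "\<And>x. norm x < dl \<Longrightarrow> W x = 0"
  and W1: "\<And>x. norm x \<ge> 1 \<Longrightarrow> W x = 0"
  and n: "DIM('b \<times> real) \<ge> 2" and b: "b \<ge> real DIM('b \<times> real)" "b \<ge> 4"
 shows "(LBINT x. norm x powr (2 - b) * (W (x, 0))^2)
   \<le> 9 * (LBINT z. norm z powr (4 - b) * (tr H z)^2)"
proof -
 interpret W: annular W g H dl by unfold_locales (use assms in auto)
 note A = C2D[OF C]
 define F' where "F' z h = norm z powr (2 - b) * (2 * W z * (g z \<bullet> h)) + (2 - b) * norm z powr (- b) * (z \<bullet> h) * (W z)^2" for z h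
 define F where "F z = norm z powr (2 - b) * (W z)^2" for z
 let ?I = "LBINT z. norm z powr (4 - b) * (tr H z)^2"
 let ?V = "LBINT z. norm z powr (1 - b) * (W z)^2"
 let ?G = "LBINT z. norm z powr (3 - b) * (g z \<bullet> g z)"
 have a: "(b - 2) / 2 \<ge> 0" "0 \<le> b" using b by auto
 have i1: "L1 (\<lambda>z. norm z powr (1 - b) * (W z)^2)" by (rule W.int_weighted) (auto simp: W.zero intro!: continuous_intros A)
 have i2: "L1 (\<lambda>z. norm z powr (3 - b) * (g z \<bullet> g z))" by (rule W.int_weighted) (auto simp: W.zero intro!: continuous_intros A)
 have cF': "continuous_on UNIV (\<lambda>z. F' z (0, 1))" by (rule continuous_on_glue[OF _ dl])
    (auto simp: F'_def W.zero intro!: continuous_intros continuous_on_subset[OF A(5)] continuous_on_subset[OF A(6)])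
 have i3: "L1 (\<lambda>z. F' z (0, 1))" by (rule integrable_continuous_vanishing[OF cF', of 2]) (auto simp: F'_def W.zero)
 have m: "upper \<in> sets borel" by (intro borel_open open_Collect_less continuous_intros)
 have "(LBINT z. indicator upper z * F' z (0, 1)) = - (LBINT x. F (x, 0))"
 proof (rule half_space_divergence[where r = 2])
  show "(F has_derivative F' z) (at z)" for z
  proof (rule has_derivative_glue[OF _ dl])
   show "(F has_derivative F' z) (at z)" if "z \<noteq> 0" for z unfolding F_def F'_def
    by (rule has_derivative_norm_powr[OF that] A derivative_eq_intros refl)+ (simp add: algebra_simps)
  qed (use dl W.zero in \<open>auto simp: F_def F'_def\<close>)
  show "F z = 0" if "norm z \<ge> 2" for z using that by (simp add: F_def W.zero)
 qed (rule cF')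
 hence "(LBINT x. F (x, 0)) = (LBINT z. - (indicator upper z * F' z (0, 1)))" by simp
 also have "\<dots> \<le> (LBINT z. (b - 1) * (norm z powr (1 - b) * (W z)^2) + norm z powr (3 - b) * (g z \<bullet> g z))"
 proof (rule integral_mono)
  show "L1 (\<lambda>z. - (indicator upper z * F' z (0, 1)))" using integrable_mult_indicator[OF _ i3, of "upper"] m by simp
  show "L1 (\<lambda>z. (b - 1) * (norm z powr (1 - b) * (W z)^2) + norm z powr (3 - b) * (g z \<bullet> g z))" using i1 i2 by auto
  fix z :: "'b \<times> real"
  show "- (indicator upper z * F' z (0, 1)) \<le> (b - 1) * (norm z powr (1 - b) * (W z)^2) + norm z powr (3 - b) * (g z \<bullet> g z)"
  proof (cases "snd z > 0")
   case False
   thus ?thesis using b by simp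
  next
   case True
   hence z: "z \<noteq> 0" by auto
   obtain x t where xt: "z = (x, t)" by (cases z)
   have t: "z \<bullet> (0, 1) = t" "0 < t" "t \<le> norm z" using True by (auto simp: xt norm_Pair real_le_rsqrt)
   have e0: "norm z powr (1 - b) = norm z powr (- b) * norm z" using z by (simp add: powr_add[of _ "- b" 1, simplified])
   have e1: "norm z powr (2 - b) = norm z powr (1 - b) * norm z" using z by (simp add: powr_add[of _ "1 - b" 1, simplified])
   have e2: "norm z powr (3 - b) = norm z powr (1 - b) * (norm z)^2" using W.norm_sq_powr[of z "3 - b"] by simp
   have gz: "\<bar>g z \<bullet> (0, 1)\<bar> \<le> norm (g z)" using Cauchy_Schwarz_ineq2[of "g z" "(0, 1)"] by (simp add: norm_Pair)
   have "- (norm z powr (2 - b) * (2 * W z * (g z \<bullet> (0, 1)))) \<le> norm z powr (1 - b) * ((W z)^2 + (norm z * norm (g z))^2)"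
   proof -
    have "- (norm z * (2 * W z * (g z \<bullet> (0, 1)))) \<le> \<bar>norm z * (2 * W z * (g z \<bullet> (0, 1)))\<bar>" by (rule abs_ge_minus_self)
    also have "\<dots> = 2 * \<bar>W z\<bar> * (norm z * \<bar>g z \<bullet> (0, 1)\<bar>)" by (simp add: abs_mult)
    also have "\<dots> \<le> 2 * \<bar>W z\<bar> * (norm z * norm (g z))" by (intro mult_left_mono gz) auto
    also have "\<dots> \<le> \<bar>W z\<bar>^2 + (norm z * norm (g z))^2" by (rule sum_squares_bound)
    also have "\<bar>W z\<bar>^2 = (W z)^2" by simp
    finally have *: "- (norm z * (2 * W z * (g z \<bullet> (0, 1)))) \<le> (W z)^2 + (norm z * norm (g z))^2" .
    from mult_left_mono[OF *, of "norm z powr (1 - b)"] show ?thesis unfolding e1 by (simp add: mult.assoc)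
   qed
   moreover have "- ((2 - b) * norm z powr (- b) * t * (W z)^2) \<le> (b - 2) * (norm z powr (1 - b) * (W z)^2)"
   proof -
    have "(b - 2) * norm z powr (- b) * (W z)^2 * t \<le> (b - 2) * norm z powr (- b) * (W z)^2 * norm z" using b t by (intro mult_left_mono) auto
    thus ?thesis unfolding e0 by (simp add: algebra_simps)
   qed
   ultimately show ?thesis using True t by (simp add: F'_def e2 power_mult_distrib power2_norm_eq_inner algebra_simps)
  qed
 qed
 also have "\<dots> = ?V + (b - 2) * ?V + ?G" using i1 i2 by (simp add: algebra_simps)
 finally have 1: "(LBINT x. F (x, 0)) \<le> ?V + (b - 2) * ?V + ?G" .
 note c = carleman[OF assms]
 have V0: "?V \<ge> 0" by (rule Bochner_Integration.integral_nonneg) auto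
 have "2 * (b - 2) \<le> (b - 2) * (b - 2)" using b by (intro mult_right_mono) auto
 from mult_right_mono[OF this V0] have "2 * ((b - 2) * ?V) \<le> (b - 2)^2 * ?V" by (simp only: power2_eq_square mult.assoc)
 hence 2: "(b - 2) * ?V \<le> 2 * ?I" using c(1) by linarith
 have "2 * ?V \<le> (b - 2) * ?V" by (rule mult_right_mono[OF _ V0]) (use b in simp)
 with 2 have 3: "?V \<le> ?I" by linarith
 have "(LBINT x. F (x, 0)) = (LBINT x. norm x powr (2 - b) * (W (x, 0))^2)" by (simp add: F_def norm_Pair)
 thus ?thesis using 1 2 3 c(2) by linarith
qed

section \<open>Bounded smooth functions\<close>

definition pd :: "'a::euclidean_space \<Rightarrow> ('a \<Rightarrow> real) \<Rightarrow> 'a \<Rightarrow> real" where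
 "pd i f = (\<lambda>x. frechet_derivative f (at x) i)"

primrec Cb :: "nat \<Rightarrow> ('a::euclidean_space \<Rightarrow> real) \<Rightarrow> bool" where
 "Cb 0 f \<longleftrightarrow> continuous_on UNIV f \<and> bounded (range f)"
| "Cb (Suc k) f \<longleftrightarrow> f differentiable_on UNIV \<and> bounded (range f) \<and> (\<forall>i\<in>Basis. Cb k (pd i f))"

text \<open>Boundedness of all derivatives, without compact support, is preserved by products,
  affine substitutions and convolution with integrable functions, and it yields Taylor remainders
  that are uniform in the base point.\<close>

definition bsm :: "('a::euclidean_space \<Rightarrow> real) \<Rightarrow> bool" where
 "bsm f \<longleftrightarrow> (\<forall>k. Cb k f)"

lemma pd_eq: "(f has_derivative D) (at x) \<Longrightarrow> pd i f x = D i"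
 by (simp add: pd_def frechet_derivative_at[symmetric])

lemma Cb_Suc_imp: "Cb (Suc k) f \<Longrightarrow> Cb k f"
proof (induction k arbitrary: f)
 case 0
 thus ?case by (auto intro: differentiable_imp_continuous_on)
next
 case (Suc k)
 thus ?case using Cb.simps(2)[of "Suc k" f] Cb.simps(2)[of k f] by blast
qed

lemma Cb_bounded: "Cb k f \<Longrightarrow> bounded (range f)" by (cases k) auto

lemma Cb_cong_pd:
 assumes "\<And>x. (f has_derivative D x) (at x)" "bounded (range f)" "\<And>i. i \<in> Basis \<Longrightarrow> Cb k (\<lambda>x. D x i)"
 shows "Cb (Suc k) f"
proof -
 have "pd i f = (\<lambda>x. D x i)" for i using pd_eq[OF assms(1)] by auto
 moreover have "f differentiable_on UNIV" using assms(1) by (auto simp: differentiable_on_def differentiable_def)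
 ultimately show ?thesis using assms by simp
qed

lemma Cb_has_derivative:
 assumes "Cb (Suc k) f"
 shows "(f has_derivative frechet_derivative f (at x)) (at x)"
 using assms by (auto simp: differentiable_on_def frechet_derivative_works)

lemma Cb_const: "Cb k (\<lambda>_. c)"
proof (induction k arbitrary: c)
 case (Suc k)
 show ?case by (rule Cb_cong_pd[where D = "\<lambda>_ _. 0"]) (auto intro: Suc)
qed auto

lemma Cb_add: "Cb k f \<Longrightarrow> Cb k g \<Longrightarrow> Cb k (\<lambda>x. f x + g x)"
proof (induction k arbitrary: f g)
 case 0
 thus ?case by (auto intro!: continuous_intros bounded_plus_comp)
next
 case (Suc k)
 have "bounded (range (\<lambda>x. f x + g x))" using Suc.prems by (auto intro!: bounded_plus_comp dest: Cb_bounded simp del: Cb.simps)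
 moreover have "((\<lambda>x. f x + g x) has_derivative
   (\<lambda>h. frechet_derivative f (at x) h + frechet_derivative g (at x) h)) (at x)" for x
  by (rule has_derivative_add[OF Cb_has_derivative[OF Suc.prems(1)] Cb_has_derivative[OF Suc.prems(2)]])
 moreover have "Cb k (\<lambda>x. frechet_derivative f (at x) i + frechet_derivative g (at x) i)" if "i \<in> Basis" for i
  using Suc that by (intro Suc.IH) (auto simp: pd_def)
 ultimately show ?case by (intro Cb_cong_pd)
qed

lemma Cb_mult: "Cb k f \<Longrightarrow> Cb k g \<Longrightarrow> Cb k (\<lambda>x. f x * g x)"
proof (induction k arbitrary: f g)
 case 0
 have "bounded (range (\<lambda>x. f x * g x))"
 proof -
  obtain A B where "\<And>x. \<bar>f x\<bar> \<le> A" "\<And>x. \<bar>g x\<bar> \<le> B" using 0 by (auto simp: bounded_iff)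
  hence "\<bar>f x * g x\<bar> \<le> A * B" for x unfolding abs_mult by (intro mult_mono) (auto intro: order_trans[OF abs_ge_zero])
  thus ?thesis by (auto simp: bounded_iff)
 qed
 thus ?case using 0 by (auto intro!: continuous_intros)
next
 case (Suc k)
 have "bounded (range (\<lambda>x. f x * g x))"
 proof -
  obtain A B where "\<And>x. \<bar>f x\<bar> \<le> A" "\<And>x. \<bar>g x\<bar> \<le> B" using Suc by (auto simp: bounded_iff)
  hence "\<bar>f x * g x\<bar> \<le> A * B" for x unfolding abs_mult by (intro mult_mono) (auto intro: order_trans[OF abs_ge_zero])
  thus ?thesis by (auto simp: bounded_iff)
 qed
 moreover have "Cb k (\<lambda>x. f x * frechet_derivative g (at x) i + frechet_derivative f (at x) i * g x)" if "i \<in> Basis" for i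
  using Suc that Cb_Suc_imp[of k f] Cb_Suc_imp[of k g] unfolding pd_def by (intro Cb_add Suc.IH) (auto simp: pd_def)
 moreover have "((\<lambda>x. f x * g x) has_derivative
   (\<lambda>h. f x * frechet_derivative g (at x) h + frechet_derivative f (at x) h * g x)) (at x)" for x
  by (rule has_derivative_mult[OF Cb_has_derivative[OF Suc.prems(1)] Cb_has_derivative[OF Suc.prems(2)]])
 ultimately show ?case by (intro Cb_cong_pd)
qed

lemma Cb_sum: "finite A \<Longrightarrow> (\<And>i. i \<in> A \<Longrightarrow> Cb k (f i)) \<Longrightarrow> Cb k (\<lambda>x. \<Sum>i\<in>A. f i x)"
 by (induction A rule: finite_induct) (auto intro!: Cb_add Cb_const simp del: Cb.simps)

lemma Cb_prod: "finite A \<Longrightarrow> (\<And>i. i \<in> A \<Longrightarrow> Cb k (f i)) \<Longrightarrow> Cb k (\<lambda>x. \<Prod>i\<in>A. f i x)"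
 by (induction A rule: finite_induct) (auto intro!: Cb_mult Cb_const simp del: Cb.simps)

lemma linear_Basis_expansion:
 fixes D :: "'a::euclidean_space \<Rightarrow> real"
 assumes "linear D" shows "D h = (\<Sum>i\<in>Basis. (h \<bullet> i) * D i)"
proof -
 have "D h = D (\<Sum>i\<in>Basis. (h \<bullet> i) *\<^sub>R i)" by (simp add: euclidean_representation)
 also have "\<dots> = (\<Sum>i\<in>Basis. (h \<bullet> i) * D i)" by (simp add: linear_sum[OF assms] linear_cmul[OF assms])
 finally show ?thesis .
qed

lemma Cb_affine:
 fixes A :: "'a::euclidean_space \<Rightarrow> 'b::euclidean_space"
 assumes "linear A"
 shows "Cb k f \<Longrightarrow> Cb k (\<lambda>x. f (A x + c))"
proof (induction k arbitrary: f)
 case 0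
 have "range (\<lambda>x. f (A x + c)) \<subseteq> range f" by auto
 moreover have "continuous_on UNIV (\<lambda>x. f (A x + c))"
 proof (rule continuous_on_compose2[of UNIV f])
  show "continuous_on UNIV (\<lambda>x. A x + c)" using assms by (intro continuous_intros linear_continuous_on) (simp add: linear_conv_bounded_linear)
 qed (use 0 in auto)
 moreover have "bounded (range f)" using 0 by simp
 ultimately show ?case by (simp add: bounded_subset)
next
 case (Suc k)
 have b: "bounded (range (\<lambda>x. f (A x + c)))"
 proof (rule bounded_subset)
  show "bounded (range f)" using Suc.prems by simp
 qed auto
 have d: "((\<lambda>x. f (A x + c)) has_derivative (\<lambda>h. \<Sum>j\<in>Basis. (A h \<bullet> j) * pd j f (A x + c))) (at x)" for x
 proof -
  have "((\<lambda>x. f (A x + c)) has_derivative (\<lambda>h. frechet_derivative f (at (A x + c)) (A h))) (at x)"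
   by (rule has_derivative_compose[where f = "\<lambda>x. A x + c" and g = f])
     (auto intro!: derivative_eq_intros Cb_has_derivative[OF Suc.prems] linear_imp_has_derivative assms)
  moreover have "frechet_derivative f (at (A x + c)) (A h) = (\<Sum>j\<in>Basis. (A h \<bullet> j) * pd j f (A x + c))" for h
   unfolding pd_def by (rule linear_Basis_expansion) (rule has_derivative_linear[OF Cb_has_derivative[OF Suc.prems]])
  ultimately show ?thesis by simp
 qed
 have "Cb k (pd j f)" if "j \<in> Basis" for j using Suc.prems that by simp
 hence "Cb k (\<lambda>x. \<Sum>j\<in>Basis. (A i \<bullet> j) * pd j f (A x + c))" for i by (intro Cb_sum finite_Basis Cb_mult Cb_const Suc.IH)
 thus ?case by (rule Cb_cong_pd[OF d b])
qed

lemma bsm_const: "bsm (\<lambda>_. c)" by (simp add: bsm_def Cb_const)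
lemma bsm_add: "bsm f \<Longrightarrow> bsm g \<Longrightarrow> bsm (\<lambda>x. f x + g x)" by (simp add: bsm_def Cb_add)
lemma bsm_mult: "bsm f \<Longrightarrow> bsm g \<Longrightarrow> bsm (\<lambda>x. f x * g x)" by (simp add: bsm_def Cb_mult)
lemma bsm_cmult: "bsm f \<Longrightarrow> bsm (\<lambda>x. c * f x)" by (simp add: bsm_mult bsm_const)
lemma bsm_diff: "bsm f \<Longrightarrow> bsm g \<Longrightarrow> bsm (\<lambda>x. f x - g x)"
 using bsm_add[of f "\<lambda>x. (-1) * g x"] bsm_cmult[of g "-1"] by simp
lemma bsm_sum: "finite A \<Longrightarrow> (\<And>i. i \<in> A \<Longrightarrow> bsm (f i)) \<Longrightarrow> bsm (\<lambda>x. \<Sum>i\<in>A. f i x)"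
 by (simp add: bsm_def Cb_sum)
lemma bsm_prod: "finite A \<Longrightarrow> (\<And>i. i \<in> A \<Longrightarrow> bsm (f i)) \<Longrightarrow> bsm (\<lambda>x. \<Prod>i\<in>A. f i x)"
 by (simp add: bsm_def Cb_prod)
lemma bsm_affine: "linear A \<Longrightarrow> bsm f \<Longrightarrow> bsm (\<lambda>x. f (A x + c))"
 by (simp add: bsm_def Cb_affine)

lemma bsm_pd: "bsm f \<Longrightarrow> i \<in> Basis \<Longrightarrow> bsm (pd i f)"
 unfolding bsm_def using Cb.simps(2) by blast

lemma bsm_bounded: assumes "bsm f" obtains M where "M \<ge> 0" "\<And>x. \<bar>f x\<bar> \<le> M"
proof -
 have "bounded (range f)" using assms Cb_bounded by (auto simp: bsm_def)
 then obtain M where "\<And>x. \<bar>f x\<bar> \<le> M" by (auto simp: bounded_iff)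
 thus ?thesis using that[of "max M 0"] by (metis max.coboundedI1 max.cobounded2)
qed

lemma bsm_has_derivative:
 assumes "bsm f"
 shows "(f has_derivative (\<lambda>h. \<Sum>i\<in>Basis. (h \<bullet> i) * pd i f x)) (at x)"
proof -
 have d: "(f has_derivative frechet_derivative f (at x)) (at x)" using assms Cb_has_derivative unfolding bsm_def by blast
 have "frechet_derivative f (at x) = (\<lambda>h. \<Sum>i\<in>Basis. (h \<bullet> i) * pd i f x)"
  unfolding pd_def using linear_Basis_expansion[OF has_derivative_linear[OF d]] by blast
 with d show ?thesis by simp
qed

lemma bsm_continuous: "bsm f \<Longrightarrow> continuous_on S f"
 by (meson bsm_has_derivative continuous_at_imp_continuous_on has_derivative_continuous)

lemma bsm_imp_smooth: "bsm f \<Longrightarrow> smooth f"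
proof -
 have "C_on k UNIV f" if "bsm f" for k using that
 proof (induction k arbitrary: f)
  case 0
  thus ?case by (simp add: bsm_continuous)
 next
  case (Suc k)
  have "f differentiable_on UNIV" using bsm_has_derivative[OF Suc.prems] by (auto simp: differentiable_on_def differentiable_def)
  thus ?case using Suc.IH[OF bsm_pd[OF Suc.prems]] by (simp add: pd_def)
 qed
 thus "bsm f \<Longrightarrow> smooth f" by (simp add: smooth_def)
qed

section \<open>A smooth step function\<close>

lemma power_exp_bounded:
 fixes y :: real assumes "y \<ge> 0" shows "y ^ k * exp (- y) \<le> real k ^ k"
proof (cases "k = 0")
 case True
 thus ?thesis using assms by simp
next
 case False
 have "y / real k \<le> exp (y / real k)" using exp_ge_add_one_self[of "y / real k"] by linarith
 hence "(y / real k) ^ k \<le> exp (y / real k) ^ k" using assms by (intro power_mono) auto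
 also have "\<dots> = exp y" using False by (simp flip: exp_of_nat_mult)
 finally have "y ^ k \<le> exp y * real k ^ k" using False by (simp add: power_divide field_simps)
 thus ?thesis by (simp add: exp_minus field_simps)
qed

text \<open>The functions x^(-k) e^(-1/x), extended by 0. Derivatives stay in the span of this
  family, so bounds on all derivatives follow by induction on their order, for all k
  simultaneously.\<close>

definition flat :: "nat \<Rightarrow> real \<Rightarrow> real" where
 "flat k x = (if x > 0 then (1 / x) ^ k * exp (- (1 / x)) else 0)"

lemma flat_bounds: "0 \<le> flat k x" "flat k x \<le> real k ^ k"
 using power_exp_bounded[of "1 / x" k] by (auto simp: flat_def)

lemma flat_has_derivative:
 "(flat k has_real_derivative flat (k + 2) x - real k * flat (k + 1) x) (at x)"
proof -
 consider "x < 0" | "x = 0" | "x > 0" by linarith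
 thus ?thesis
 proof cases
  case 1
  have "(flat k has_real_derivative 0) (at x)" by (rule has_field_derivative_transform_within_open[of "\<lambda>_. 0" _ _ "{..<0}"])
     (use 1 in \<open>auto simp: flat_def\<close>)
  thus ?thesis using 1 by (simp add: flat_def)
 next
  case 2
  \<comment> \<open>For h > 0 the quotient is h times \<open>flat (k + 2) h\<close>, a bounded
    factor times h; for h < 0 it is 0.\<close>
  have "(\<lambda>h. (flat k (0 + h) - flat k 0) / h) \<midarrow>0\<rightarrow> 0"
  proof (rule Lim_null_comparison[where g = "\<lambda>h. real (k + 2) ^ (k + 2) * \<bar>h\<bar>"])
   show "\<forall>\<^sub>F h in at 0. norm ((flat k (0 + h) - flat k 0) / h) \<le> real (k + 2) ^ (k + 2) * \<bar>h\<bar>"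
   proof (rule always_eventually, rule allI)
    fix h :: real
    show "norm ((flat k (0 + h) - flat k 0) / h) \<le> real (k + 2) ^ (k + 2) * \<bar>h\<bar>"
    proof (cases "h > 0")
     case True
     hence "flat k h / h = h * flat (k + 2) h" by (simp add: flat_def power_add power2_eq_square)
     thus ?thesis using True flat_bounds[of "k + 2" h] flat_bounds[of k h] by (simp add: flat_def[of k 0] abs_mult mult.commute del: of_nat_add of_nat_Suc)
    next
     case False
     hence "flat k h = 0" by (simp add: flat_def)
     thus ?thesis by (simp add: flat_def[of k 0] del: of_nat_add of_nat_Suc)
    qed
   qed
   show "((\<lambda>h. real (k + 2) ^ (k + 2) * \<bar>h\<bar>) \<longlongrightarrow> 0) (at 0)" by (auto intro!: tendsto_eq_intros)
  qed
  thus ?thesis using 2 by (simp add: DERIV_def flat_def)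
 next
  case 3
  have "((\<lambda>x. (1 / x) ^ k * exp (- (1 / x))) has_real_derivative flat (k + 2) x - real k * flat (k + 1) x) (at x)"
  proof -
   have "((\<lambda>x. (1 / x) ^ k * exp (- (1 / x))) has_real_derivative
     (1 / x) ^ k * (exp (- (1 / x)) * (1 / x^2)) + real k * (1 / x) ^ (k - 1) * (- 1 / x^2) * exp (- (1 / x))) (at x)"
    using 3 by (auto intro!: derivative_eq_intros simp: power2_eq_square)
   moreover have "real k * (1 / x) ^ (k - 1) * (- 1 / x^2) = - real k * (1 / x) ^ (k + 1)" using 3 by (cases k) (auto simp: power2_eq_square field_simps)
   ultimately have "((\<lambda>x. (1 / x) ^ k * exp (- (1 / x))) has_real_derivative
     (1 / x) ^ k * (exp (- (1 / x)) * (1 / x^2)) + - real k * (1 / x) ^ (k + 1) * exp (- (1 / x))) (at x)"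
    by (simp only:)
   thus ?thesis by (rule DERIV_cong) (use 3 in \<open>simp add: flat_def power_add power2_eq_square\<close>)
  qed
  thus ?thesis by (rule has_field_derivative_transform_within_open[of _ _ _ "{0<..}"])
     (use 3 in \<open>auto simp: flat_def\<close>)
 qed
qed

lemma bsm_real_derivI:
 fixes f :: "real \<Rightarrow> real"
 assumes "\<And>x. (f has_real_derivative f' x) (at x)" "bounded (range f)" "Cb k f'"
 shows "Cb (Suc k) f"
 by (rule Cb_cong_pd[where D = "\<lambda>x h. f' x * h"])
   (use assms in \<open>auto simp: has_field_derivative_def\<close>)

lemma bsm_flat: "bsm (flat k)"
proof -
 have b: "bounded (range (flat k))" for k unfolding bounded_iff using flat_bounds by (metis abs_of_nonneg rangeE real_norm_def)
 have "Cb n (flat k)" for n k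
 proof (induction n arbitrary: k)
  case 0
  have "continuous_on UNIV (flat k)" using flat_has_derivative by (meson DERIV_continuous continuous_at_imp_continuous_on)
  with b show ?case by simp
 next
  case (Suc n)
  have "Cb n (\<lambda>x. flat (k + 2) x + (- real k) * flat (k + 1) x)" by (intro Cb_add Cb_mult Cb_const Suc)
  hence "Cb n (\<lambda>x. flat (k + 2) x - real k * flat (k + 1) x)" by simp
  thus ?case by (rule bsm_real_derivI[OF flat_has_derivative b])
 qed
 thus ?thesis by (simp add: bsm_def)
qed

text \<open>The normalised primitive of a bump on (0, 1) that is symmetric about 1/2. The symmetry
  of the bump makes S x + S (1 - x) a function with derivative 0, whence the reflection
  formula.\<close>

lemma smooth_step_exists:
 "\<exists>S::real \<Rightarrow> real. bsm S \<and> (\<forall>x\<le>0. S x = 0) \<and> (\<forall>x\<ge>1. S x = 1) \<and> (\<forall>x. 0 \<le> S x \<and> S x \<le> 1)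
   \<and> (\<forall>x. S (1 - x) = 1 - S x) \<and> mono S"
proof -
 define p where "p s = flat 0 s * flat 0 (1 - s)" for s
 have "bsm (\<lambda>s. flat 0 ((-1) *\<^sub>R s + 1))" by (rule bsm_affine) (auto intro: bsm_flat linearI simp del: scaleR_minus1_left)
 hence "bsm p" unfolding p_def by (intro bsm_mult bsm_flat) simp
 hence contp: "continuous_on A p" for A by (rule bsm_continuous)
 have p0: "p s \<ge> 0" for s by (simp add: p_def flat_bounds)
 have pz: "p s = 0" if "s \<le> 0 \<or> s \<ge> 1" for s using that by (auto simp: p_def flat_def)
 have ps: "p (1 - s) = p s" for s by (simp add: p_def)
 have pp: "p s > 0" if "0 < s" "s < 1" for s using that by (simp add: p_def flat_def)
 \<comment> \<open>The lower limit -1 makes 0 an interior point of the interval of integration, so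
   that G can be differentiated there; the extra piece contributes 0 because p vanishes on the
   negative axis.\<close>
 define G where "G x = integral {- 1..x} p" for x
 have int: "p integrable_on {a..b}" for a b by (rule integrable_continuous_real[OF contp])
 have G0: "G x = 0" if "x \<le> 0" for x
 proof -
  have "G x = integral {- 1..x} (\<lambda>_. 0)" unfolding G_def by (rule integral_cong) (use that pz in auto)
  thus ?thesis by simp
 qed
 have dG: "(G has_real_derivative p x) (at x)" for x
 proof (cases "x > - 1")
  case True
  have "(G has_real_derivative p x) (at x within {- 1..x + 1})" unfolding G_def by (rule integral_has_real_derivative[OF contp]) (use True in auto)
  moreover have "at x within {- 1..x + 1} = at x" using True by (intro at_within_interior) auto
  ultimately show ?thesis by simp
 next
  case False
  have "(G has_real_derivative 0) (at x)" by (rule has_field_derivative_transform_within_open[of "\<lambda>_. 0" _ _ "{..<0}"])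
     (use False G0 in auto)
  thus ?thesis using False pz[of x] by simp
 qed
 have mono: "G x \<le> G y" if "x \<le> y" for x y by (rule DERIV_nonneg_imp_nondecreasing[OF that]) (use dG p0 in blast)
 have G1: "G x = G 1" if "x \<ge> 1" for x
 proof (rule antisym)
  have "(\<lambda>x. - G x) 1 \<le> (\<lambda>x. - G x) x" by (rule DERIV_nonneg_imp_nondecreasing[OF that])
     (use pz in \<open>auto intro!: exI[of _ "0::real"] derivative_eq_intros dG\<close>)
  thus "G x \<le> G 1" by simp
 qed (use mono that in auto)
 define c where "c = G 1"
 have c: "c > 0"
 proof -
  have "G (1/4) < G (3/4)" by (rule DERIV_pos_imp_increasing) (use dG pp in \<open>auto intro!: exI\<close>)
  moreover have "G (1/4) \<ge> 0" using mono[of 0 "1/4"] G0[of 0] by simp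
  moreover have "G (3/4) \<le> G 1" using mono by simp
  ultimately show ?thesis by (simp add: c_def)
 qed
 define S where "S x = G x / c" for x
 have S: "0 \<le> S x \<and> S x \<le> 1" for x using mono[of x 1] G1[of x] mono[of 0 x] G0[of 0] G0[of x] c
  by (cases "x \<ge> 1"; cases "x \<le> 0") (auto simp: S_def c_def)
 have dS: "(S has_real_derivative p x / c) (at x)" for x unfolding S_def by (rule DERIV_cdivide[OF dG])
 have bS: "bounded (range S)" unfolding bounded_iff by (rule exI[of _ 1]) (use S in auto)
 have "Cb k S" for k
 proof (cases k)
  case 0
  have "continuous_on UNIV S" using dS by (meson DERIV_continuous continuous_at_imp_continuous_on)
  thus ?thesis using 0 bS by simp
 next
  case (Suc n)
  have "Cb n (\<lambda>x. (1 / c) * p x)" using \<open>bsm p\<close> by (intro Cb_mult Cb_const) (simp add: bsm_def)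
  thus ?thesis unfolding Suc by (intro bsm_real_derivI[OF dS bS]) simp
 qed
 moreover have "(\<lambda>x. S x + S (1 - x)) x = (\<lambda>x. S x + S (1 - x)) 0" for x
 proof (rule DERIV_isconst_all[of "\<lambda>x. S x + S (1 - x)"])
  have "((\<lambda>x. S (1 - x)) has_real_derivative (p (1 - x) / c) * (- 1)) (at x)" for x by (rule DERIV_chain2[OF dS]) (auto intro!: derivative_eq_intros)
  from DERIV_add[OF dS this] show "\<forall>x. ((\<lambda>x. S x + S (1 - x)) has_real_derivative 0) (at x)" by (simp add: ps)
 qed
 hence "S x + S (1 - x) = S 0 + S 1" for x by simp
 moreover have "S 0 = 0" using G0[of 0] by (simp add: S_def)
 moreover have "S 1 = 1" using c by (simp add: S_def c_def)
 ultimately have 1: "bsm S" "S (1 - x) = 1 - S x" for x unfolding bsm_def by (auto simp: algebra_simps)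
 have 2: "mono S" unfolding S_def using mono c by (intro monoI) (simp add: divide_right_mono)
 have 3: "S x = 0" if "x \<le> 0" for x using G0[OF that] by (simp add: S_def)
 have 4: "S x = 1" if "x \<ge> 1" for x using G1[OF that] c by (simp add: S_def c_def)
 show ?thesis using 1 2 3 4 S by blast
qed

text \<open>The symmetry \<open>S (1 - x) = 1 - S x\<close> makes the mollifier derived from this step even.\<close>

definition stp :: "real \<Rightarrow> real" where
 "stp = (SOME S::real \<Rightarrow> real. bsm S \<and> (\<forall>x\<le>0. S x = 0) \<and> (\<forall>x\<ge>1. S x = 1) \<and> (\<forall>x. 0 \<le> S x \<and> S x \<le> 1)
   \<and> (\<forall>x. S (1 - x) = 1 - S x) \<and> mono S)"

lemma stp: "bsm stp" "x \<le> 0 \<Longrightarrow> stp x = 0" "x \<ge> 1 \<Longrightarrow> stp x = 1" "0 \<le> stp x" "stp x \<le> 1"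
 "stp (1 - x) = 1 - stp x" "mono stp"
 using someI_ex[OF smooth_step_exists, folded stp_def] by auto

lemma bsm_stp_inner: "bsm (\<lambda>z::'a::euclidean_space. stp (a \<bullet> z + c))"
 using bsm_affine[of "\<lambda>z. a \<bullet> z" stp c] stp(1) by (simp add: linear_iff inner_add_right)

section \<open>Test functions and the fundamental lemma of the calculus of variations\<close>

definition tst :: "'a::euclidean_space set \<Rightarrow> ('a \<Rightarrow> real) \<Rightarrow> bool" where
 "tst Om ph \<longleftrightarrow> bsm ph \<and> (\<exists>K. compact K \<and> K \<subseteq> Om \<and> (\<forall>z. z \<notin> K \<longrightarrow> ph z = 0))"

lemma tst_imp_test_functions: "tst Om ph \<Longrightarrow> ph \<in> test_functions Om"
proof -
 assume "tst Om ph"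
 then obtain K where K: "bsm ph" "compact K" "K \<subseteq> Om" "\<And>z. z \<notin> K \<Longrightarrow> ph z = 0" by (auto simp: tst_def)
 have "closure {z. ph z \<noteq> 0} \<subseteq> K" by (rule closure_minimal) (use K compact_imp_closed in auto)
 moreover have "bounded {z. ph z \<noteq> 0}" by (rule bounded_subset[OF compact_imp_bounded[OF K(2)]]) (use K(4) in blast)
 moreover have "smooth ph" using K(1) by (rule bsm_imp_smooth)
 ultimately show ?thesis using K(3) unfolding test_functions_def compact_closure by blast
qed

text \<open>Products of steepening steps converge pointwise to the indicator of the open box, are
  bounded by 1 and are supported in the closed box, so dominated convergence applies with bound
  |g|.\<close>

lemma fundamental_box:
 fixes g :: "'a::euclidean_space \<Rightarrow> real"
 assumes g: "L1 g" and 0: "\<And>ph. tst Om ph \<Longrightarrow> (LBINT z. g z * ph z) = 0"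
  and sub: "cbox a b \<subseteq> Om"
 shows "(LBINT z. indicator (box a b) z * g z) = 0"
proof -
 define ph where "ph n z = (\<Prod>i\<in>Basis. stp (real n * (z \<bullet> i - a \<bullet> i)) * stp (real n * (b \<bullet> i - z \<bullet> i)))" for n and z :: 'a
 have supp: "ph n z = 0" if out: "z \<notin> box a b" for n z
 proof -
  obtain i where i: "i \<in> Basis" "z \<bullet> i \<le> a \<bullet> i \<or> b \<bullet> i \<le> z \<bullet> i" using out unfolding mem_box by (meson not_le)
  hence "stp (real n * (z \<bullet> i - a \<bullet> i)) = 0 \<or> stp (real n * (b \<bullet> i - z \<bullet> i)) = 0" by (auto intro!: stp(2) simp: mult_nonneg_nonpos)
  thus ?thesis unfolding ph_def using i by (intro prod_zero) auto
 qed
 have "bsm (ph n)" for n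
 proof -
  have "bsm (\<lambda>z::'a. stp (real n * (z \<bullet> i - a \<bullet> i)))" for i
   using bsm_stp_inner[of "real n *\<^sub>R i" "- real n * (a \<bullet> i)"] by (simp add: algebra_simps inner_commute)
  moreover have "bsm (\<lambda>z::'a. stp (real n * (b \<bullet> i - z \<bullet> i)))" for i
   using bsm_stp_inner[of "(- real n) *\<^sub>R i" "real n * (b \<bullet> i)"] by (simp add: algebra_simps inner_commute)
  ultimately show ?thesis unfolding ph_def by (intro bsm_prod bsm_mult) auto
 qed
 moreover have "ph n z = 0" if "z \<notin> cbox a b" for n z using supp that box_subset_cbox[of a b] by blast
 ultimately have "tst Om (ph n)" for n unfolding tst_def using sub by (intro conjI exI[of _ "cbox a b"]) auto
 hence "(LBINT z. g z * ph n z) = 0" for n by (rule 0)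
 moreover have "(\<lambda>n. LBINT z. g z * ph n z) \<longlonglongrightarrow> (LBINT z. indicator (box a b) z * g z)"
 proof (rule integral_dominated_convergence[where w = "\<lambda>z. \<bar>g z\<bar>"])
  have [measurable]: "ph n \<in> borel_measurable lborel" for n using bsm_continuous[OF \<open>bsm (ph n)\<close>] by (simp add: borel_measurable_continuous_onI)
  have [measurable]: "g \<in> borel_measurable lborel" using g by auto
  show "(\<lambda>z. indicat_real (box a b) z * g z) \<in> borel_measurable lborel" by measurable
  show "(\<lambda>z. g z * ph n z) \<in> borel_measurable lborel" for n by measurable
  show "L1 (\<lambda>z. \<bar>g z\<bar>)" using g by auto
  have "\<bar>ph n z\<bar> \<le> 1" for n z unfolding ph_def abs_prod by (rule prod_le_1) (auto simp: abs_mult stp intro!: mult_le_one)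
  thus "AE z in lborel. norm (g z * ph n z) \<le> \<bar>g z\<bar>" for n by (auto simp: abs_mult mult_left_le)
  have "(\<lambda>n. ph n z) \<longlonglongrightarrow> indicator (box a b) z" for z
  proof (cases "z \<in> box a b")
   case True
   have "eventually (\<lambda>n. stp (real n * (z \<bullet> i - a \<bullet> i)) * stp (real n * (b \<bullet> i - z \<bullet> i)) = 1) sequentially" if i: "i \<in> Basis" for i
   proof -
    have p: "z \<bullet> i - a \<bullet> i > 0" "b \<bullet> i - z \<bullet> i > 0" using True i by (auto simp: box_def)
    have "eventually (\<lambda>n. real n \<ge> max (1 / (z \<bullet> i - a \<bullet> i)) (1 / (b \<bullet> i - z \<bullet> i))) sequentially"
     using eventually_ge_at_top[of "nat \<lceil>max (1 / (z \<bullet> i - a \<bullet> i)) (1 / (b \<bullet> i - z \<bullet> i))\<rceil>"] by eventually_elim linarith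
    thus ?thesis
    proof eventually_elim
     case (elim n)
     hence "real n * (z \<bullet> i - a \<bullet> i) \<ge> 1" "real n * (b \<bullet> i - z \<bullet> i) \<ge> 1" using p by (simp_all add: field_simps)
     thus ?case by (simp add: stp)
    qed
   qed
   hence "eventually (\<lambda>n. \<forall>i\<in>Basis. stp (real n * (z \<bullet> i - a \<bullet> i)) * stp (real n * (b \<bullet> i - z \<bullet> i)) = 1) sequentially"
    by (simp add: eventually_ball_finite_distrib)
   hence "eventually (\<lambda>n. ph n z = 1) sequentially" by eventually_elim (simp add: ph_def)
   thus ?thesis using True by (simp add: tendsto_eventually)
  qed (simp add: supp)
  thus "AE z in lborel. (\<lambda>n. g z * ph n z) \<longlonglongrightarrow> indicator (box a b) z * g z"
   by (intro AE_I2) (subst mult.commute[of _ "g _"], intro tendsto_mult tendsto_const)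
 qed
 ultimately show ?thesis by (simp add: LIMSEQ_const_iff)
qed

text \<open>Open boxes are an intersection-stable generator of the Borel sets, so the vanishing of
  the integrals over boxes passes to all Borel sets; the sets where g is positive or negative then
  give g = 0.\<close>

lemma fundamental_local:
 fixes g :: "'a::euclidean_space \<Rightarrow> real"
 assumes g: "L1 g" and 0: "\<And>ph. tst Om ph \<Longrightarrow> (LBINT z. g z * ph z) = 0"
  and sub: "cbox c d \<subseteq> Om"
 shows "AE z in lborel. z \<in> box c d \<longrightarrow> g z = 0"
proof -
 define G where "G z = indicator (box c d) z * g z" for z
 have G: "L1 G" unfolding G_def using integrable_mult_indicator[OF _ g, of "box c d"] by simp
 have set: "set_integrable lborel A G" if "A \<in> sets borel" for A unfolding set_integrable_def using integrable_mult_indicator[OF _ G, of A] that by simp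
 have box: "(LINT z:box a b|lborel. G z) = 0" for a b
 proof -
  have *: "box a b \<inter> box c d = box (\<Sum>i\<in>Basis. max (a \<bullet> i) (c \<bullet> i) *\<^sub>R i) (\<Sum>i\<in>Basis. min (b \<bullet> i) (d \<bullet> i) *\<^sub>R i)" (is "_ = box ?p ?q")
   by (auto simp: mem_box)
  have "cbox ?p ?q \<subseteq> cbox c d" by (auto simp: mem_box)
  hence "(LBINT z. indicator (box ?p ?q) z * g z) = 0" by (intro fundamental_box[where Om = Om, OF g 0]) (use sub in auto)
  moreover have "indicator (box a b) z *\<^sub>R G z = indicator (box a b \<inter> box c d) z * g z" for z by (auto simp: G_def indicator_def)
  ultimately show ?thesis unfolding set_lebesgue_integral_def by (simp only: *)
 qed
 have all: "(LINT z:A|lborel. G z) = 0" if "A \<in> sets borel" for A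
 proof -
  have A: "A \<in> sigma_sets UNIV (range (\<lambda>(a, b). box a b))" using that unfolding borel_eq_box sets_measure_of_conv by (simp add: image_def)
  have "Int_stable (range (\<lambda>(a, b). box a b :: 'a set))"
  proof (rule Int_stableI, clarsimp)
   fix a b c d :: 'a
   have "box a b \<inter> box c d = box (\<Sum>i\<in>Basis. max (a \<bullet> i) (c \<bullet> i) *\<^sub>R i) (\<Sum>i\<in>Basis. min (b \<bullet> i) (d \<bullet> i) *\<^sub>R i)"
    by (auto simp: mem_box)
   thus "box a b \<inter> box c d \<in> range (\<lambda>(a, b). box a b)" by auto
  qed
  moreover have "range (\<lambda>(a, b). box a b :: 'a set) \<subseteq> Pow UNIV" by auto
  ultimately show ?thesis using A
  proof (induction rule: sigma_sets_induct_disjoint)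
   case (basic A)
   thus ?case using box by auto
  next
   case empty
   thus ?case by (simp add: set_lebesgue_integral_def)
  next
   case (compl A)
   have m: "A \<in> sets borel" using compl(1) unfolding borel_eq_box sets_measure_of_conv by (simp add: image_def)
   have "(LINT z:A|lborel. G z) + (LINT z:UNIV - A|lborel. G z) = (LINT z:A \<union> (UNIV - A)|lborel. G z)" by (rule set_integral_Un[symmetric]) (use m set in auto)
   also have "A \<union> (UNIV - A) = UNIV" by auto
   also have "(LINT z:UNIV|lborel. G z) = (LINT z:box c d|lborel. G z)" unfolding set_lebesgue_integral_def
    by (intro Bochner_Integration.integral_cong) (auto simp: G_def indicator_def)
   finally show ?case using compl box by simp
  next
   case (union A)
   have m: "A i \<in> sets borel" for i using union(2) unfolding borel_eq_box sets_measure_of_conv by (auto simp: image_def)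
   have "(LINT z:(\<Union>i. A i)|lborel. G z) = (\<Sum>i. LINT z:A i|lborel. G z)"
    by (rule lebesgue_integral_countable_add) (use m set union(1) in \<open>auto simp: disjoint_family_on_def\<close>)
   thus ?case using union by simp
  qed
 qed
 have [measurable]: "G \<in> BM" using G by auto
 have sg: "AE z in lborel. H z \<le> 0" if "L1 H" and H: "\<And>A. A \<in> sets borel \<Longrightarrow> (LINT z:A|lborel. H z) = 0" for H :: "'a \<Rightarrow> real"
 proof -
  have [measurable]: "H \<in> BM" using that by auto
  let ?A = "{z. H z > 0}"
  have i: "L1 (\<lambda>z. indicator ?A z * H z)" using integrable_mult_indicator[OF _ that(1), of ?A] by simp
  have "(LBINT z. indicator ?A z * H z) = 0" using H[of ?A] by (simp add: set_lebesgue_integral_def)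
  hence "AE z in lborel. indicator ?A z * H z = 0" by (subst (asm) integral_nonneg_eq_0_iff_AE[OF i]) (auto simp: indicator_def)
  thus ?thesis by eventually_elim (auto simp: indicator_def not_less split: if_splits)
 qed
 have "AE z in lborel. G z \<le> 0" by (rule sg[OF G all])
 moreover have "AE z in lborel. - G z \<le> 0" by (rule sg) (use G all in \<open>auto simp: set_lebesgue_integral_def\<close>)
 ultimately show ?thesis by eventually_elim (auto simp: G_def)
qed

text \<open>An open set is a countable union of closed boxes, and the faces of a box are a null
  set.\<close>

lemma fundamental_lemma:
 fixes g :: "'a::euclidean_space \<Rightarrow> real"
 assumes g: "L1 g" and 0: "\<And>ph. tst Om ph \<Longrightarrow> (LBINT z. g z * ph z) = 0"
  and "open Om"
 shows "AE z in lborel. z \<in> Om \<longrightarrow> g z = 0"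
proof -
 obtain D where D: "countable D" "D \<subseteq> Pow Om" "\<And>X. X \<in> D \<Longrightarrow> \<exists>a b. X = cbox a b" "\<Union>D = Om"
  by (rule open_countable_Union_open_cbox[OF \<open>open Om\<close>]) (rule that; assumption)
 have "AE z in lborel. z \<in> X \<longrightarrow> g z = 0" if XD: "X \<in> D" for X
 proof -
  obtain a b where X: "X = cbox a b" using D(3)[OF XD] by blast
  have "AE z in lborel. z \<in> box a b \<longrightarrow> g z = 0" by (rule fundamental_local[where Om = Om, OF g 0]) (use D(2) XD X in auto)
  moreover have "AE z in lborel. z \<notin> cbox a b - box a b"
  proof (rule AE_not_in)
   have "emeasure lborel (cbox a b - box a b) = emeasure lborel (cbox a b) - emeasure lborel (box a b)"
    by (rule emeasure_Diff) (auto simp: box_subset_cbox emeasure_lborel_box_eq)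
   also have "\<dots> = 0" by (simp add: emeasure_lborel_box_eq emeasure_lborel_cbox_eq)
   finally show "cbox a b - box a b \<in> null_sets lborel" by (auto intro: null_setsI)
  qed
  ultimately show ?thesis unfolding X by eventually_elim auto
 qed
 hence "AE z in lborel. \<forall>X\<in>D. z \<in> X \<longrightarrow> g z = 0" by (subst AE_ball_countable[OF D(1)]) auto
 thus ?thesis by eventually_elim (use D(4) in blast)
qed

section \<open>Gradient, Hessian and Laplacian of bounded smooth functions\<close>

definition grad :: "('a::euclidean_space \<Rightarrow> real) \<Rightarrow> 'a \<Rightarrow> 'a" where
 "grad f x = (\<Sum>i\<in>Basis. pd i f x *\<^sub>R i)"

definition hess :: "('a::euclidean_space \<Rightarrow> real) \<Rightarrow> 'a \<Rightarrow> 'a \<Rightarrow> 'a" where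
 "hess f x h = (\<Sum>i\<in>Basis. (\<Sum>j\<in>Basis. (h \<bullet> j) * pd j (pd i f) x) *\<^sub>R i)"

definition lap :: "('a::euclidean_space \<Rightarrow> real) \<Rightarrow> 'a \<Rightarrow> real" where
 "lap f x = (\<Sum>i\<in>Basis. pd i (pd i f) x)"

lemma grad_inner_Basis: "i \<in> Basis \<Longrightarrow> grad f x \<bullet> i = pd i f x"
 by (simp add: grad_def inner_sum_left inner_Basis sum.delta if_distrib cong: if_cong)

lemma grad_inner: "grad f x \<bullet> h = (\<Sum>i\<in>Basis. (h \<bullet> i) * pd i f x)"
 by (simp add: grad_def inner_sum_left inner_commute[of h] mult.commute)

lemma bsm_grad: "bsm f \<Longrightarrow> (f has_derivative (\<lambda>h. grad f x \<bullet> h)) (at x)"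
 unfolding grad_inner by (rule bsm_has_derivative)

lemma bsm_slice:
 assumes "bsm f" "i \<in> Basis"
 shows "((\<lambda>t. f (x + t *\<^sub>R i)) has_real_derivative pd i f (x + t *\<^sub>R i)) (at t)"
proof -
 have "((\<lambda>t. f (x + t *\<^sub>R i)) has_derivative (\<lambda>s. grad f (x + t *\<^sub>R i) \<bullet> (s *\<^sub>R i))) (at t)"
  by (rule has_derivative_compose[where f = "\<lambda>t. x + t *\<^sub>R i" and g = f])
    (auto intro!: derivative_eq_intros bsm_grad assms)
 moreover have "(\<lambda>s. grad f (x + t *\<^sub>R i) \<bullet> (s *\<^sub>R i)) = (*) (pd i f (x + t *\<^sub>R i))"
  using assms(2) by (auto simp: grad_inner_Basis mult.commute)
 ultimately show ?thesis by (simp only: has_field_derivative_def)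
qed

lemma bsm_mvt:
 assumes "bsm f"
 obtains t where "0 < t" "t < 1" "f (x + h) - f x = grad f (x + t *\<^sub>R h) \<bullet> h"
proof -
 have d: "((\<lambda>t. f (x + t *\<^sub>R h)) has_real_derivative grad f (x + t *\<^sub>R h) \<bullet> h) (at t)" for t
 proof -
  have "((\<lambda>t. f (x + t *\<^sub>R h)) has_derivative (\<lambda>s. grad f (x + t *\<^sub>R h) \<bullet> (s *\<^sub>R h))) (at t)"
   by (rule has_derivative_compose[where f = "\<lambda>t. x + t *\<^sub>R h" and g = f])
     (auto intro!: derivative_eq_intros bsm_grad assms)
  moreover have "(\<lambda>s. grad f (x + t *\<^sub>R h) \<bullet> (s *\<^sub>R h)) = (*) (grad f (x + t *\<^sub>R h) \<bullet> h)" by (auto simp: mult.commute)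
  ultimately show ?thesis by (simp only: has_field_derivative_def)
 qed
 obtain t where "0 < t" "t < 1" "f (x + 1 *\<^sub>R h) - f (x + 0 *\<^sub>R h) = (1 - 0) * (grad f (x + t *\<^sub>R h) \<bullet> h)"
  using MVT2[OF zero_less_one d] by blast
 thus thesis using that by simp
qed

lemma clairaut_aux:
 assumes f: "bsm f" and ij: "i \<in> Basis" "j \<in> Basis" and s: "s > 0"
 shows "\<exists>xi et. 0 < xi \<and> xi < s \<and> 0 < et \<and> et < s \<and>
  f (x + s *\<^sub>R i + s *\<^sub>R j) - f (x + s *\<^sub>R i) - f (x + s *\<^sub>R j) + f x
   = s^2 * pd j (pd i f) (x + xi *\<^sub>R i + et *\<^sub>R j)"
proof -
 define ph where "ph r = f (x + s *\<^sub>R j + r *\<^sub>R i) - f (x + r *\<^sub>R i)" for r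
 have d: "(ph has_real_derivative pd i f (x + s *\<^sub>R j + r *\<^sub>R i) - pd i f (x + r *\<^sub>R i)) (at r)" for r
  unfolding ph_def by (rule DERIV_diff[OF bsm_slice[OF f ij(1)] bsm_slice[OF f ij(1)]])
 obtain xi where xi: "0 < xi" "xi < s" "ph s - ph 0 = (s - 0) * (pd i f (x + s *\<^sub>R j + xi *\<^sub>R i) - pd i f (x + xi *\<^sub>R i))" using MVT2[OF s d] by blast
 obtain et where et: "0 < et" "et < s"
  "pd i f (x + xi *\<^sub>R i + s *\<^sub>R j) - pd i f (x + xi *\<^sub>R i + 0 *\<^sub>R j) = (s - 0) * pd j (pd i f) (x + xi *\<^sub>R i + et *\<^sub>R j)"
  using MVT2[OF s bsm_slice[OF bsm_pd[OF f ij(1)] ij(2), of "x + xi *\<^sub>R i"]] by blast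
 have "f (x + s *\<^sub>R i + s *\<^sub>R j) - f (x + s *\<^sub>R i) - f (x + s *\<^sub>R j) + f x = ph s - ph 0" by (simp add: ph_def algebra_simps)
 also have "\<dots> = s * (s * pd j (pd i f) (x + xi *\<^sub>R i + et *\<^sub>R j))" using xi(3) et(3) by (simp add: algebra_simps)
 finally show ?thesis using xi et by (intro exI[of _ xi] exI[of _ et]) (simp add: power2_eq_square)
qed

text \<open>The second difference quotient is symmetric in i and j, and two applications of the mean
  value theorem show that it converges to either mixed derivative.\<close>

lemma clairaut:
 assumes f: "bsm f" and ij: "i \<in> Basis" "j \<in> Basis"
 shows "pd j (pd i f) x = pd i (pd j f) x"
proof -
 define \<Delta> where "\<Delta> s = (f (x + s *\<^sub>R i + s *\<^sub>R j) - f (x + s *\<^sub>R i) - f (x + s *\<^sub>R j) + f x) / s^2" for s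
 have *: "(\<Delta> \<longlongrightarrow> pd j (pd i f) x) (at_right 0)" if ij: "i \<in> Basis" "j \<in> Basis"
  and \<Delta>: "\<And>s. \<Delta> s = (f (x + s *\<^sub>R i + s *\<^sub>R j) - f (x + s *\<^sub>R i) - f (x + s *\<^sub>R j) + f x) / s^2" for i j
 proof (rule tendstoI)
  fix e :: real assume e: "e > 0"
  have "isCont (pd j (pd i f)) x" using bsm_continuous[OF bsm_pd[OF bsm_pd[OF f ij(1)] ij(2)], of UNIV] by (simp add: continuous_on_eq_continuous_at)
  then obtain d where d: "d > 0" "\<And>y. dist y x < d \<Longrightarrow> dist (pd j (pd i f) y) (pd j (pd i f) x) < e" using e unfolding continuous_at_eps_delta by blast
  have "eventually (\<lambda>s. s \<in> {0<..<d / 2}) (at_right (0::real))" by (rule eventually_at_right_real) (use d in simp)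
  thus "eventually (\<lambda>s. dist (\<Delta> s) (pd j (pd i f) x) < e) (at_right 0)"
  proof eventually_elim
   case (elim s)
   then obtain xi et where *: "0 < xi" "xi < s" "0 < et" "et < s"
    "\<Delta> s = s^2 * pd j (pd i f) (x + xi *\<^sub>R i + et *\<^sub>R j) / s^2"
    using clairaut_aux[OF f ij, of s x] unfolding \<Delta> by auto
   have "norm (xi *\<^sub>R i + et *\<^sub>R j) \<le> xi + et" using norm_triangle_ineq[of "xi *\<^sub>R i" "et *\<^sub>R j"] * ij by simp
   also have "\<dots> < d" using * elim by simp
   finally have "dist (x + xi *\<^sub>R i + et *\<^sub>R j) x < d" by (simp add: dist_norm add.assoc)
   thus ?case using d(2) * elim by simp
  qed
 qed
 have "(\<Delta> \<longlongrightarrow> pd j (pd i f) x) (at_right 0)" by (rule *[OF ij \<Delta>_def])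
 moreover have "(\<Delta> \<longlongrightarrow> pd i (pd j f) x) (at_right 0)" by (rule *[OF ij(2,1)]) (simp add: \<Delta>_def algebra_simps)
 ultimately show ?thesis by (rule tendsto_unique[rotated]) simp
qed

lemma bsm_C2:
 assumes f: "bsm f" shows "C2 f (grad f) (hess f)"
 unfolding C2_def
proof (intro conjI allI)
 show "(f has_derivative (\<lambda>h. grad f x \<bullet> h)) (at x)" for x by (rule bsm_grad[OF f])
 show "(grad f has_derivative hess f x) (at x)" for x
 proof -
  have "((\<lambda>x. \<Sum>i\<in>Basis. pd i f x *\<^sub>R i) has_derivative (\<lambda>h. \<Sum>i\<in>Basis. (\<Sum>j\<in>Basis. (h \<bullet> j) * pd j (pd i f) x) *\<^sub>R i)) (at x)"
   by (intro has_derivative_sum has_derivative_scaleR_left bsm_has_derivative bsm_pd f)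
  thus ?thesis unfolding grad_def[abs_def] hess_def .
 qed
 show "hess f x h \<bullet> k = hess f x k \<bullet> h" for x h k
 proof -
  have "hess f x h \<bullet> k = (\<Sum>i\<in>Basis. \<Sum>j\<in>Basis. (h \<bullet> j) * (k \<bullet> i) * pd j (pd i f) x)" for h k
   unfolding hess_def by (simp add: inner_sum_left inner_commute[of k] sum_distrib_left sum_distrib_right mult_ac)
  note e = this
  have "hess f x h \<bullet> k = (\<Sum>j\<in>Basis. \<Sum>i\<in>Basis. (h \<bullet> j) * (k \<bullet> i) * pd j (pd i f) x)" unfolding e by (rule sum.swap)
  also have "\<dots> = (\<Sum>j\<in>Basis. \<Sum>i\<in>Basis. (k \<bullet> i) * (h \<bullet> j) * pd i (pd j f) x)" by (intro sum.cong refl) (simp add: clairaut[OF f])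
  finally show ?thesis unfolding e .
 qed
 show "continuous_on UNIV (\<lambda>x. hess f x h)" for h unfolding hess_def by (intro continuous_intros bsm_continuous bsm_pd f)
qed

lemma sum_inner_Basis:
 fixes g :: "'a::euclidean_space \<Rightarrow> real"
 assumes "i \<in> Basis" shows "(\<Sum>j\<in>Basis. (i \<bullet> j) * g j) = g i"
proof -
 have "(\<Sum>j\<in>Basis. (i \<bullet> j) * g j) = (\<Sum>j\<in>Basis. if j = i then g j else 0)" using assms by (intro sum.cong) (auto simp: inner_Basis)
 thus ?thesis using assms by simp
qed

lemma tr_hess: "tr (hess f) x = lap f x"
 unfolding tr_def hess_def lap_def
proof (intro sum.cong refl)
 fix i :: 'a assume i: "i \<in> Basis"
 have "(\<Sum>k\<in>Basis. (\<Sum>j\<in>Basis. (i \<bullet> j) * pd j (pd k f) x) *\<^sub>R k) \<bullet> i = (\<Sum>k\<in>Basis. pd i (pd k f) x *\<^sub>R k) \<bullet> i"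
  by (simp add: sum_inner_Basis[OF i])
 also have "\<dots> = (\<Sum>k\<in>Basis. (i \<bullet> k) * pd i (pd k f) x)" by (simp add: inner_sum_left inner_commute[of i] mult.commute)
 finally show "(\<Sum>k\<in>Basis. (\<Sum>j\<in>Basis. (i \<bullet> j) * pd j (pd k f) x) *\<^sub>R k) \<bullet> i = pd i (pd i f) x" by (simp add: sum_inner_Basis[OF i])
qed

lemma bsm_lap: "bsm f \<Longrightarrow> bsm (lap f)"
 unfolding lap_def[abs_def] by (intro bsm_sum bsm_pd) auto

lemma bsm_lipschitz:
 assumes "bsm f" obtains M where "M \<ge> 0" "\<And>x h. \<bar>f (x + h) - f x\<bar> \<le> M * norm h"
proof -
 have "\<exists>M\<ge>0. \<forall>x. \<bar>pd i f x\<bar> \<le> M" if "i \<in> Basis" for i using bsm_bounded[OF bsm_pd[OF assms that]] by metis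
 then obtain B where B: "\<And>i x. i \<in> Basis \<Longrightarrow> \<bar>pd i f x\<bar> \<le> B i" "\<And>i. i \<in> Basis \<Longrightarrow> B i \<ge> 0" by metis
 define M where "M = (\<Sum>i\<in>Basis. B i)"
 have gb: "norm (grad f x) \<le> M" for x
 proof -
  have "norm (grad f x) \<le> (\<Sum>i\<in>Basis. \<bar>grad f x \<bullet> i\<bar>)" by (rule norm_le_l1)
  also have "\<dots> \<le> M" unfolding M_def by (intro sum_mono) (simp add: grad_inner_Basis B)
  finally show ?thesis .
 qed
 show thesis
 proof (rule that[of M])
  show "M \<ge> 0" unfolding M_def by (intro sum_nonneg B)
  show "\<bar>f (x + h) - f x\<bar> \<le> M * norm h" for x h
  proof -
   obtain t where "f (x + h) - f x = grad f (x + t *\<^sub>R h) \<bullet> h" by (rule bsm_mvt[OF assms])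
   thus ?thesis using Cauchy_Schwarz_ineq2[of "grad f (x + t *\<^sub>R h)" h] mult_right_mono[OF gb[of "x + t *\<^sub>R h"], of "norm h"] by simp
  qed
 qed
qed

text \<open>The mean value theorem combined with a Lipschitz bound on the gradient. Uniformity in x
  is what differentiation under a convolution integral asks for.\<close>

lemma bsm_remainder:
 assumes "bsm f" obtains M where "M \<ge> 0" "\<And>x h. \<bar>f (x + h) - f x - grad f x \<bullet> h\<bar> \<le> M * (norm h)^2"
proof -
 have "\<exists>M\<ge>0. \<forall>x h. \<bar>pd i f (x + h) - pd i f x\<bar> \<le> M * norm h" if "i \<in> Basis" for i
  using bsm_lipschitz[OF bsm_pd[OF assms that]] by metis
 then obtain B where B: "\<And>i x h. i \<in> Basis \<Longrightarrow> \<bar>pd i f (x + h) - pd i f x\<bar> \<le> B i * norm h" "\<And>i. i \<in> Basis \<Longrightarrow> B i \<ge> 0" by metis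
 define M where "M = (\<Sum>i\<in>Basis. B i)"
 have gb: "norm (grad f (x + h) - grad f x) \<le> M * norm h" for x h
 proof -
  have "norm (grad f (x + h) - grad f x) \<le> (\<Sum>i\<in>Basis. \<bar>(grad f (x + h) - grad f x) \<bullet> i\<bar>)" by (rule norm_le_l1)
  also have "\<dots> \<le> M * norm h" unfolding M_def sum_distrib_right by (intro sum_mono) (simp add: grad_inner_Basis B inner_diff_left)
  finally show ?thesis .
 qed
 have M0: "M \<ge> 0" unfolding M_def by (intro sum_nonneg B)
 show thesis
 proof (rule that[OF M0])
  show "\<bar>f (x + h) - f x - grad f x \<bullet> h\<bar> \<le> M * (norm h)^2" for x h
  proof -
   obtain t where t: "0 < t" "t < 1" "f (x + h) - f x = grad f (x + t *\<^sub>R h) \<bullet> h" by (rule bsm_mvt[OF assms])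
   hence "f (x + h) - f x - grad f x \<bullet> h = (grad f (x + t *\<^sub>R h) - grad f x) \<bullet> h" by (simp add: inner_diff_left)
   also have "\<bar>\<dots>\<bar> \<le> norm (grad f (x + t *\<^sub>R h) - grad f x) * norm h" by (rule Cauchy_Schwarz_ineq2)
   also have "\<dots> \<le> (M * norm (t *\<^sub>R h)) * norm h" by (intro mult_right_mono gb) auto
   also have "\<dots> \<le> (M * norm h) * norm h" using t M0 by (intro mult_right_mono mult_left_mono) (auto simp: mult_left_le_one_le)
   finally show ?thesis by (simp add: power2_eq_square mult.assoc)
  qed
 qed
qed

lemma pd_affine:
 assumes "bsm f" "i \<in> Basis"
 shows "pd i (\<lambda>x. f (c *\<^sub>R x + a)) = (\<lambda>x. c * pd i f (c *\<^sub>R x + a))"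
proof
 fix x
 have "((\<lambda>x. f (c *\<^sub>R x + a)) has_derivative (\<lambda>h. grad f (c *\<^sub>R x + a) \<bullet> (c *\<^sub>R h))) (at x)"
  by (rule has_derivative_compose[where f = "\<lambda>x. c *\<^sub>R x + a" and g = f])
    (auto intro!: derivative_eq_intros bsm_grad assms)
 from pd_eq[OF this, of i] show "pd i (\<lambda>x. f (c *\<^sub>R x + a)) x = c * pd i f (c *\<^sub>R x + a)" using assms by (simp add: grad_inner_Basis)
qed

lemma bsm_scale: "bsm f \<Longrightarrow> bsm (\<lambda>x. f (c *\<^sub>R x + a))"
 by (rule bsm_affine) (auto intro!: linearI simp: algebra_simps)

lemma bsm_frechet: "bsm f \<Longrightarrow> (f has_derivative frechet_derivative f (at x)) (at x)"
 using Cb_has_derivative[of 0 f] unfolding bsm_def by blast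

lemma pd_cmult:
 assumes "bsm f" shows "pd i (\<lambda>x. c * f x) = (\<lambda>x. c * pd i f x)"
proof
 fix x
 have "((\<lambda>x. c * f x) has_derivative (\<lambda>h. c * frechet_derivative f (at x) h)) (at x)" by (rule has_derivative_mult_right[OF bsm_frechet[OF assms]])
 from pd_eq[OF this] show "pd i (\<lambda>x. c * f x) x = c * pd i f x" by (simp add: pd_def)
qed

lemma pd_add:
 assumes "bsm f" "bsm g" shows "pd i (\<lambda>x. f x + g x) = (\<lambda>x. pd i f x + pd i g x)"
proof
 fix x
 have "((\<lambda>x. f x + g x) has_derivative (\<lambda>h. frechet_derivative f (at x) h + frechet_derivative g (at x) h)) (at x)"
  by (intro has_derivative_add) (intro bsm_frechet assms)+
 from pd_eq[OF this] show "pd i (\<lambda>x. f x + g x) x = pd i f x + pd i g x" by (simp add: pd_def)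
qed

lemma lap_affine:
 assumes "bsm f"
 shows "lap (\<lambda>x. f (c *\<^sub>R x + a)) = (\<lambda>x. c^2 * lap f (c *\<^sub>R x + a))"
proof
 fix x
 have "pd i (pd i (\<lambda>x. f (c *\<^sub>R x + a))) x = c^2 * pd i (pd i f) (c *\<^sub>R x + a)" if "i \<in> Basis" for i
  using that assms by (simp add: pd_affine pd_cmult bsm_pd bsm_scale power2_eq_square)
 thus "lap (\<lambda>x. f (c *\<^sub>R x + a)) x = c^2 * lap f (c *\<^sub>R x + a)" by (simp add: lap_def sum_distrib_left)
qed

lemma lap_cmult: "bsm f \<Longrightarrow> lap (\<lambda>x. c * f x) = (\<lambda>x. c * lap f x)"
 by (auto simp: lap_def pd_cmult bsm_pd sum_distrib_left)

lemma lap_add: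
 assumes "bsm f" "bsm g" shows "lap (\<lambda>x. f x + g x) = (\<lambda>x. lap f x + lap g x)"
 using assms by (auto simp: lap_def pd_add bsm_pd sum.distrib intro!: ext sum.cong)

section \<open>Mollification\<close>

definition conv :: "('a::euclidean_space \<Rightarrow> real) \<Rightarrow> ('a \<Rightarrow> real) \<Rightarrow> 'a \<Rightarrow> real" where
 "conv g k z = (LINT w|lborel. g w * k (z - w))"

lemma bsm_measurable[measurable]: "bsm k \<Longrightarrow> k \<in> BM"
 by (simp add: borel_measurable_continuous_onI bsm_continuous)

lemma integrable_mult_bounded:
 fixes g k :: "'a \<Rightarrow> real"
 assumes "integrable M g" "k \<in> borel_measurable M" "\<And>x. \<bar>k x\<bar> \<le> B"
 shows "integrable M (\<lambda>x. g x * k x)"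
proof (rule Bochner_Integration.integrable_bound[of M "\<lambda>x. B * g x"])
 show "AE x in M. norm (g x * k x) \<le> norm (B * g x)"
 proof (rule AE_I2)
  fix x
  have "\<bar>k x\<bar> \<le> \<bar>B\<bar>" using assms(3)[of x] by simp
  from mult_right_mono[OF this, of "\<bar>g x\<bar>"] show "norm (g x * k x) \<le> norm (B * g x)" by (simp add: abs_mult mult.commute)
 qed
qed (use assms in auto)

lemma conv_integrable:
 assumes "L1 g" "bsm k"
 shows "L1 (\<lambda>w. g w * k (z - w))"
proof -
 obtain M where "\<And>x. \<bar>k x\<bar> \<le> M" by (rule bsm_bounded[OF assms(2)]) blast
 moreover have "k \<in> BM" by (rule bsm_measurable[OF assms(2)])
 hence "(\<lambda>w. k (z - w)) \<in> borel_measurable lborel" by measurable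
 ultimately show ?thesis using assms(1) by (intro integrable_mult_bounded) auto
qed

lemma conv_bounded:
 assumes g: "L1 g" and k: "bsm k" and M: "\<And>x. \<bar>k x\<bar> \<le> M"
 shows "\<bar>conv g k z\<bar> \<le> M * (LINT w|lborel. \<bar>g w\<bar>)"
proof -
 have "\<bar>conv g k z\<bar> \<le> (LINT w|lborel. \<bar>g w * k (z - w)\<bar>)" unfolding conv_def by (rule integral_abs_bound)
 also have "\<dots> \<le> (LINT w|lborel. M * \<bar>g w\<bar>)"
 proof (rule integral_mono)
  show "L1 (\<lambda>w. \<bar>g w * k (z - w)\<bar>)" by (rule integrable_abs[OF conv_integrable[OF g k]])
  show "L1 (\<lambda>w. M * \<bar>g w\<bar>)" using g by auto
  show "\<bar>g w * k (z - w)\<bar> \<le> M * \<bar>g w\<bar>" for w unfolding abs_mult by (subst mult.commute) (rule mult_right_mono[OF M abs_ge_zero])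
 qed
 finally show ?thesis by simp
qed

text \<open>The quadratic Taylor remainder of k is uniform, so it integrates against |g| to an error
  of order |h|^2.\<close>

lemma conv_has_derivative:
 assumes g: "L1 g" and k: "bsm k"
 shows "(conv g k has_derivative (\<lambda>h. \<Sum>i\<in>Basis. (h \<bullet> i) * conv g (pd i k) z)) (at z)"
proof -
 obtain M where M: "M \<ge> 0" "\<And>x h. \<bar>k (x + h) - k x - grad k x \<bullet> h\<bar> \<le> M * (norm h)^2" by (rule bsm_remainder[OF k]) blast
 define A where "A = (LINT w|lborel. \<bar>g w\<bar>)"
 have est: "\<bar>conv g k (z + h) - conv g k z - (\<Sum>i\<in>Basis. (h \<bullet> i) * conv g (pd i k) z)\<bar> \<le> M * A * (norm h)^2" for h
 proof -
  note I = conv_integrable[OF g k] conv_integrable[OF g bsm_pd[OF k]]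
  have s: "(\<Sum>i\<in>Basis. (h \<bullet> i) * conv g (pd i k) z) = (LINT w|lborel. g w * (grad k (z - w) \<bullet> h))" unfolding grad_inner conv_def sum_distrib_left
   by (subst Bochner_Integration.integral_sum) (auto simp: I mult.left_commute[of "g _"])
  have J: "L1 (\<lambda>w. g w * (grad k (z - w) \<bullet> h))" unfolding grad_inner sum_distrib_left by (auto simp: I mult.left_commute[of "g _"])
  have e: "g w * (k (z - w + h) - k (z - w) - grad k (z - w) \<bullet> h)
    = g w * k (z + h - w) - g w * k (z - w) - g w * (grad k (z - w) \<bullet> h)" for w
  proof -
   have "z - w + h = z + h - w" by simp
   thus ?thesis by (simp only: right_diff_distrib)
  qed
  have K: "L1 (\<lambda>w. g w * (k (z - w + h) - k (z - w) - grad k (z - w) \<bullet> h))"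
   unfolding e by (rule Bochner_Integration.integrable_diff[OF Bochner_Integration.integrable_diff[OF I(1) I(1)] J])
  have eq: "conv g k (z + h) - conv g k z - (\<Sum>i\<in>Basis. (h \<bullet> i) * conv g (pd i k) z)
    = (LINT w|lborel. g w * (k (z - w + h) - k (z - w) - grad k (z - w) \<bullet> h))"
   unfolding e Bochner_Integration.integral_diff[OF Bochner_Integration.integrable_diff[OF I(1) I(1)] J]
    Bochner_Integration.integral_diff[OF I(1) I(1)] s by (simp only: conv_def)
  have "\<bar>conv g k (z + h) - conv g k z - (\<Sum>i\<in>Basis. (h \<bullet> i) * conv g (pd i k) z)\<bar> \<le> (LINT w|lborel. \<bar>g w * (k (z - w + h) - k (z - w) - grad k (z - w) \<bullet> h)\<bar>)"
   unfolding eq by (rule integral_abs_bound)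
  also have "\<dots> \<le> (LINT w|lborel. (M * (norm h)^2) * \<bar>g w\<bar>)"
  proof (rule integral_mono)
   show "L1 (\<lambda>w. \<bar>g w * (k (z - w + h) - k (z - w) - grad k (z - w) \<bullet> h)\<bar>)" by (rule integrable_abs[OF K])
   show "L1 (\<lambda>w. M * (norm h)^2 * \<bar>g w\<bar>)" by (intro integrable_mult_right integrable_abs g)
   show "\<bar>g w * (k (z - w + h) - k (z - w) - grad k (z - w) \<bullet> h)\<bar> \<le> M * (norm h)^2 * \<bar>g w\<bar>" for w
    unfolding abs_mult by (subst mult.commute) (rule mult_right_mono[OF M(2) abs_ge_zero])
  qed
  also have "\<dots> = M * A * (norm h)^2" by (simp add: A_def)
  finally show ?thesis .
 qed
 show ?thesis unfolding has_derivative_at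
 proof (intro conjI)
  show "bounded_linear (\<lambda>h. \<Sum>i\<in>Basis. (h \<bullet> i) * conv g (pd i k) z)"
   by (intro bounded_linear_sum bounded_linear_mult_const bounded_linear_inner_left)
  show "(\<lambda>h. norm (conv g k (z + h) - conv g k z - (\<Sum>i\<in>Basis. (h \<bullet> i) * conv g (pd i k) z)) / norm h) \<midarrow>0\<rightarrow> 0"
  proof (rule Lim_null_comparison[where g = "\<lambda>h. M * A * norm h"])
   show "\<forall>\<^sub>F h in at 0. norm (norm (conv g k (z + h) - conv g k z - (\<Sum>i\<in>Basis. (h \<bullet> i) * conv g (pd i k) z)) / norm h) \<le> M * A * norm h"
   proof (rule eventually_at_filter[THEN iffD2], rule always_eventually, intro allI impI)
    fix h :: 'a assume "h \<noteq> 0"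
    thus "norm (norm (conv g k (z + h) - conv g k z - (\<Sum>i\<in>Basis. (h \<bullet> i) * conv g (pd i k) z)) / norm h) \<le> M * A * norm h"
     using est[of h] by (simp add: divide_le_eq power2_eq_square mult.assoc)
   qed
   show "(\<lambda>h. M * A * norm h) \<midarrow>0\<rightarrow> 0" by (auto intro!: tendsto_eq_intros)
  qed
 qed
qed

lemma pd_conv:
 assumes "L1 g" "bsm k" "i \<in> Basis"
 shows "pd i (conv g k) = conv g (pd i k)"
proof
 fix z
 have "pd i (conv g k) z = (\<Sum>j\<in>Basis. (i \<bullet> j) * conv g (pd j k) z)" by (rule pd_eq[OF conv_has_derivative[OF assms(1,2)]])
 also have "\<dots> = conv g (pd i k) z" by (rule sum_inner_Basis[OF assms(3)])
 finally show "pd i (conv g k) z = conv g (pd i k) z" .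
qed

lemma bsm_conv:
 assumes "L1 g" "bsm k" shows "bsm (conv g k)"
proof -
 have b: "bounded (range (conv g k))" if k: "bsm k" for k
 proof -
  obtain M where "\<And>x. \<bar>k x\<bar> \<le> M" by (rule bsm_bounded[OF k]) blast
  from conv_bounded[OF assms(1) k this] show ?thesis by (auto simp: bounded_iff)
 qed
 have "Cb n (conv g k)" if "bsm k" for n k using that
 proof (induction n arbitrary: k)
  case 0
  have "continuous_on UNIV (conv g k)" using conv_has_derivative[OF assms(1) 0] by (meson continuous_at_imp_continuous_on has_derivative_continuous)
  thus ?case using b[OF 0] by simp
 next
  case (Suc n)
  have "conv g k differentiable_on UNIV" using conv_has_derivative[OF assms(1) Suc.prems] by (auto simp: differentiable_on_def differentiable_def)
  thus ?case using b[OF Suc.prems] Suc.IH[OF bsm_pd[OF Suc.prems]] by (simp add: pd_conv[OF assms(1) Suc.prems])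
 qed
 thus ?thesis using assms(2) by (simp add: bsm_def)
qed

lemma lap_conv:
 assumes "L1 g" "bsm k"
 shows "lap (conv g k) = conv g (lap k)"
proof
 fix z
 have "lap (conv g k) z = (\<Sum>i\<in>Basis. conv g (pd i (pd i k)) z)" unfolding lap_def by (intro sum.cong refl) (simp add: pd_conv assms bsm_pd)
 also have "\<dots> = conv g (lap k) z" unfolding conv_def lap_def sum_distrib_left
  by (rule Bochner_Integration.integral_sum[symmetric]) (intro conv_integrable assms bsm_pd)
 finally show "lap (conv g k) z = conv g (lap k) z" .
qed

text \<open>The Schur test with weights: Cauchy-Schwarz against the square root of the kernel, then
  Tonelli. \<open>om\<close> weights the target variable, and \<open>B\<close> bounds this weight
  transported to the source variable. Values in \<open>ennreal\<close> let the estimate apply before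
  finiteness is known.\<close>

lemma schur:
 fixes ka :: "'x \<times> 'y \<Rightarrow> real" and g :: "'y \<Rightarrow> real"
 assumes "sigma_finite_measure M" "sigma_finite_measure N"
  and [measurable]: "ka \<in> borel_measurable (M \<Otimes>\<^sub>M N)" "g \<in> borel_measurable N" "om \<in> borel_measurable M"
   "B \<in> borel_measurable N"
  and pos: "\<And>p. 0 \<le> ka p"
  and A: "\<And>x. x \<in> space M \<Longrightarrow> (\<integral>\<^sup>+y. ennreal (ka (x, y)) \<partial>N) \<le> A"
  and B: "\<And>y. y \<in> space N \<Longrightarrow> (\<integral>\<^sup>+x. om x * ennreal (ka (x, y)) \<partial>M) \<le> B y"
 shows "(\<integral>\<^sup>+x. om x * (\<integral>\<^sup>+y. ennreal (\<bar>g y\<bar> * ka (x, y)) \<partial>N)^2 \<partial>M)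
  \<le> A * (\<integral>\<^sup>+y. B y * ennreal ((g y)^2) \<partial>N)"
proof -
 interpret M: sigma_finite_measure M by fact
 interpret N: sigma_finite_measure N by fact
 interpret P: pair_sigma_finite M N by unfold_locales
 have "(\<integral>\<^sup>+x. om x * (\<integral>\<^sup>+y. ennreal (\<bar>g y\<bar> * ka (x, y)) \<partial>N)^2 \<partial>M)
   \<le> (\<integral>\<^sup>+x. om x * (A * (\<integral>\<^sup>+y. ennreal ((g y)^2 * ka (x, y)) \<partial>N)) \<partial>M)"
 proof (rule nn_integral_mono, rule mult_left_mono)
  fix x assume x: "x \<in> space M"
  have [measurable]: "(\<lambda>y. ka (x, y)) \<in> borel_measurable N" using x by measurable
  have "(\<integral>\<^sup>+y. ennreal (\<bar>g y\<bar> * ka (x, y)) \<partial>N)^2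
    = (\<integral>\<^sup>+y. ennreal (sqrt (ka (x, y))) * ennreal (\<bar>g y\<bar> * sqrt (ka (x, y))) \<partial>N)^2"
   by (intro arg_cong[where f = "\<lambda>t. t^2"] nn_integral_cong)
     (simp add: pos flip: ennreal_mult)
  also have "\<dots> \<le> (\<integral>\<^sup>+y. (ennreal (sqrt (ka (x, y))))^2 \<partial>N) * (\<integral>\<^sup>+y. (ennreal (\<bar>g y\<bar> * sqrt (ka (x, y))))^2 \<partial>N)"
   by (rule Cauchy_Schwarz_nn_integral) measurable
  also have "(\<integral>\<^sup>+y. (ennreal (sqrt (ka (x, y))))^2 \<partial>N) = (\<integral>\<^sup>+y. ennreal (ka (x, y)) \<partial>N)"
   by (intro nn_integral_cong) (simp add: pos ennreal_power)
  also have "(\<integral>\<^sup>+y. (ennreal (\<bar>g y\<bar> * sqrt (ka (x, y))))^2 \<partial>N) = (\<integral>\<^sup>+y. ennreal ((g y)^2 * ka (x, y)) \<partial>N)"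
   by (intro nn_integral_cong) (simp add: pos ennreal_power power_mult_distrib)
  finally show "(\<integral>\<^sup>+y. ennreal (\<bar>g y\<bar> * ka (x, y)) \<partial>N)^2 \<le> A * (\<integral>\<^sup>+y. ennreal ((g y)^2 * ka (x, y)) \<partial>N)"
   using A[OF x] by (meson mult_right_mono order_trans zero_le)
 qed simp
 also have "\<dots> = A * (\<integral>\<^sup>+x. (\<integral>\<^sup>+y. om x * ennreal ((g y)^2 * ka (x, y)) \<partial>N) \<partial>M)"
  by (subst nn_integral_cmult[symmetric], measurable)
    (intro nn_integral_cong, subst nn_integral_cmult, measurable, simp add: mult_ac)
 also have "(\<integral>\<^sup>+x. (\<integral>\<^sup>+y. om x * ennreal ((g y)^2 * ka (x, y)) \<partial>N) \<partial>M)
   = (\<integral>\<^sup>+y. (\<integral>\<^sup>+x. om x * ennreal ((g y)^2 * ka (x, y)) \<partial>M) \<partial>N)"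
  by (rule P.Fubini'[symmetric]) measurable
 also have "\<dots> \<le> (\<integral>\<^sup>+y. B y * ennreal ((g y)^2) \<partial>N)"
 proof (rule nn_integral_mono)
  fix y assume y: "y \<in> space N"
  have [measurable]: "(\<lambda>x. ka (x, y)) \<in> borel_measurable M" using y by measurable
  have "(\<integral>\<^sup>+x. om x * ennreal ((g y)^2 * ka (x, y)) \<partial>M) = (\<integral>\<^sup>+x. ennreal ((g y)^2) * (om x * ennreal (ka (x, y))) \<partial>M)"
   by (intro nn_integral_cong) (simp add: ennreal_mult pos mult_ac)
  also have "\<dots> = ennreal ((g y)^2) * (\<integral>\<^sup>+x. om x * ennreal (ka (x, y)) \<partial>M)" by (rule nn_integral_cmult) measurable
  also have "\<dots> \<le> ennreal ((g y)^2) * B y" by (intro mult_left_mono B y) simp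
  finally show "(\<integral>\<^sup>+x. om x * ennreal ((g y)^2 * ka (x, y)) \<partial>M) \<le> B y * ennreal ((g y)^2)" by (simp add: mult.commute)
 qed
 finally show ?thesis by (simp add: mult_left_mono)
qed

section \<open>Mollifiers as tensor products of a one-dimensional bump\<close>

definition bb :: "real \<Rightarrow> real" where "bb s = pd 1 stp ((s + 1) / 2) / 2"

lemma stp_deriv: "(stp has_real_derivative pd 1 stp x) (at x)"
 using bsm_slice[OF stp(1), of 1 0 x] by simp

lemma bb_deriv: "((\<lambda>s. stp ((s + 1) / 2)) has_real_derivative bb s) (at s)"
proof -
 have "((\<lambda>s. stp ((s + 1) / 2)) has_real_derivative pd 1 stp ((s + 1) / 2) * (1 / 2)) (at s)"
  by (rule DERIV_chain2[OF stp_deriv]) (auto intro!: derivative_eq_intros)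
 thus ?thesis by (simp add: bb_def)
qed

lemma bsm_bb: "bsm bb"
proof -
 have "bsm (\<lambda>s. 1 / 2 * pd 1 stp ((1 / 2) *\<^sub>R s + 1 / 2))" by (intro bsm_cmult bsm_scale bsm_pd stp(1)) simp
 moreover have "(\<lambda>s. 1 / 2 * pd 1 stp ((1 / 2) *\<^sub>R s + 1 / 2)) = bb" by (auto simp: bb_def add_divide_distrib)
 ultimately show ?thesis by simp
qed

lemma bb_zero: "\<bar>s\<bar> \<ge> 1 \<Longrightarrow> bb s = 0"
proof -
 have *: "bb s = 0" if "\<bar>s\<bar> > 1" for s
 proof -
  have "((\<lambda>s. stp ((s + 1) / 2)) has_real_derivative 0) (at s)"
  proof (cases "s > 1")
   case True
   show ?thesis by (rule has_field_derivative_transform_within_open[of "\<lambda>_. 1" _ _ "{1<..}"])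
      (use True stp(3) in auto)
  next
   case False
   show ?thesis by (rule has_field_derivative_transform_within_open[of "\<lambda>_. 0" _ _ "{..<- 1}"])
      (use False \<open>\<bar>s\<bar> > 1\<close> stp(2) in auto)
  qed
  with bb_deriv[of s] show ?thesis by (rule DERIV_unique)
 qed
 assume s: "\<bar>s\<bar> \<ge> 1"
 show "bb s = 0"
 proof (cases "\<bar>s\<bar> > 1")
  \<comment> \<open>The endpoints |s| = 1 are limits of points with |s| > 1, where the bump
    vanishes.\<close>
  case False
  have "closed {s. bb s = 0}" using continuous_closed_vimage[of "{0}" bb] bsm_continuous[OF bsm_bb, of UNIV] by (simp add: continuous_on_eq_continuous_at vimage_def)
  moreover have "{s. \<bar>s\<bar> > 1} \<subseteq> {s. bb s = 0}" using * by auto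
  ultimately have "closure {s. \<bar>s\<bar> > 1} \<subseteq> {s. bb s = 0}" by (rule closure_minimal[rotated])
  moreover have "s \<in> closure {s. \<bar>s\<bar> > 1}" unfolding closure_approachable
  proof (intro allI impI)
   fix e :: real assume "e > 0"
   thus "\<exists>y\<in>{s. \<bar>s\<bar> > 1}. dist y s < e" using s by (intro bexI[of _ "s + sgn s * (e / 2)"]) (auto simp: dist_real_def sgn_if)
  qed
  ultimately show ?thesis by auto
 qed (rule *)
qed

lemma bb_nonneg: "bb s \<ge> 0"
proof -
 have "mono (\<lambda>s. stp ((s + 1) / 2))" using stp(7) by (auto simp: mono_def)
 thus ?thesis using bb_deriv[of s] by (rule mono_on_imp_deriv_nonneg[where A = UNIV, unfolded interior_UNIV]) simp
qed

text \<open>Evenness comes from the symmetry of \<open>stp\<close> by differentiating both sides of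
  \<open>stp (1 - x) = 1 - stp x\<close>.\<close>

lemma bb_even: "bb (- s) = bb s"
proof -
 have e: "stp ((- s + 1) / 2) = 1 - stp ((s + 1) / 2)" for s using stp(6)[of "(s + 1) / 2"] by (simp add: field_simps)
 have "((\<lambda>s. stp ((- s + 1) / 2)) has_real_derivative bb (- s) * (- 1)) (at s)" by (rule DERIV_chain2[OF bb_deriv]) (auto intro!: derivative_eq_intros)
 moreover have "((\<lambda>s. 1 - stp ((s + 1) / 2)) has_real_derivative 0 - bb s) (at s)" by (intro DERIV_diff DERIV_const bb_deriv)
 ultimately show ?thesis unfolding e using DERIV_unique by fastforce
qed

lemma nn_integral_bb: "(NBINT s. ennreal (bb s)) = 1"
proof -
 have "(NBINT s. ennreal (bb s) * indicator {- 1..1} s) = stp ((1 + 1) / 2) - stp ((- 1 + 1) / 2)"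
  by (rule nn_integral_FTC_Icc) (use bsm_bb bb_deriv bb_nonneg in \<open>auto intro: DERIV_subset\<close>)
 moreover have "(NBINT s. ennreal (bb s) * indicator {- 1..1} s) = (NBINT s. ennreal (bb s))"
  using bb_zero by (intro nn_integral_cong) (auto simp: indicator_def abs_le_iff not_le)
 ultimately show ?thesis by (simp add: stp)
qed

lemma nn_integral_bb_scaled:
 assumes "e > 0" shows "(NBINT s. ennreal (bb (s / e) / e)) = 1"
proof -
 have "(NBINT s. ennreal (bb s)) = ennreal (1 / e) * (NBINT s. ennreal (bb (0 + (1 / e) * s)))"
  using nn_integral_real_affine[of "\<lambda>s. ennreal (bb s)" "1 / e" 0] assms bsm_measurable[OF bsm_bb] by simp
 also have "\<dots> = (NBINT s. ennreal (1 / e) * ennreal (bb (s / e)))" using bsm_measurable[OF bsm_bb] by (subst nn_integral_cmult) auto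
 also have "\<dots> = (NBINT s. ennreal (bb (s / e) / e))" using assms bb_nonneg by (intro nn_integral_cong) (simp flip: ennreal_mult)
 finally show ?thesis by (simp add: nn_integral_bb)
qed

text \<open>The tensor product is supported in a cube of half-width e, hence in a ball of radius e
  times the dimension, and its integral factorises.\<close>

definition be :: "real \<Rightarrow> 'b::euclidean_space \<Rightarrow> real" where
 "be e x = (\<Prod>i\<in>Basis. bb (x \<bullet> i / e) / e)"

lemma bsm_bb_inner:
 "bsm (\<lambda>z::'a::euclidean_space. bb (a \<bullet> z / e) / e)"
proof -
 have "bsm (\<lambda>z::'a. bb ((a /\<^sub>R e) \<bullet> z + 0))" by (rule bsm_affine) (auto intro!: bsm_bb linearI simp: inner_add_right algebra_simps)
 from bsm_cmult[OF this, of "1 / e"] show ?thesis by (simp add: divide_inverse mult.commute)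
qed

lemma bsm_be: "bsm (be e :: 'b::euclidean_space \<Rightarrow> real)"
 unfolding be_def[abs_def] using bsm_bb_inner by (intro bsm_prod) (auto simp: inner_commute)

lemma be_nonneg: "e > 0 \<Longrightarrow> be e x \<ge> 0"
 unfolding be_def by (intro prod_nonneg) (simp add: bb_nonneg)

lemma be_even: "be e (- x) = be e x"
 by (simp add: be_def bb_even)

lemma be_zero:
 assumes "e > 0" "norm (x::'b::euclidean_space) > e * real DIM('b)" shows "be e x = 0"
proof -
 have "\<exists>i\<in>Basis. \<bar>x \<bullet> i\<bar> > e"
 proof (rule ccontr)
  assume "\<not> ?thesis"
  hence "norm x \<le> (\<Sum>i\<in>(Basis::'b set). e)" by (intro order_trans[OF norm_le_l1] sum_mono) auto
  thus False using assms by (simp add: mult.commute)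
 qed
 then obtain i where i: "i \<in> Basis" "\<bar>x \<bullet> i\<bar> > e" by auto
 hence "\<bar>x \<bullet> i / e\<bar> \<ge> 1" using assms by simp
 hence "bb (x \<bullet> i / e) / e = 0" by (simp add: bb_zero)
 thus ?thesis unfolding be_def using i by (intro prod_zero) auto
qed

lemma nn_integral_be:
 assumes "e > 0" shows "(NBINT (x::'b::euclidean_space). ennreal (be e x)) = 1"
proof -
 have "(NBINT (x::'b). ennreal (be e x)) = (NBINT (x::'b). (\<Prod>i\<in>Basis. ennreal (bb (x \<bullet> i / e) / e)))"
  using assms by (intro nn_integral_cong) (simp add: be_def prod_ennreal bb_nonneg)
 also have "\<dots> = (\<Prod>i\<in>(Basis::'b set). (NBINT s. ennreal (bb (s / e) / e)))"
  using bsm_measurable[OF bsm_bb] assms bb_nonneg by (intro nn_integral_lborel_prod) auto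
 finally show ?thesis using assms by (simp add: nn_integral_bb_scaled)
qed

lemma nn_integral_lborel_shift:
 fixes f :: "'b::euclidean_space \<Rightarrow> ennreal"
 assumes [measurable]: "f \<in> BM"
 shows "(NBINT x. f (x - a)) = (NBINT x. f x)"
  and "(NBINT x. f (a - x)) = (NBINT x. f x)"
proof -
 show 1: "(NBINT x. f (x - a)) = (NBINT x. f x)" for a by (subst (2) lborel_distr_plus[of "- a", symmetric]) (simp add: nn_integral_distr)
 have "(NBINT x. f x) = (NBINT x. f (a + (- 1) *\<^sub>R x))" by (subst lborel_affine[of "- 1" a]) (simp_all add: nn_integral_density nn_integral_distr)
 thus "(NBINT x. f (a - x)) = (NBINT x. f x)" by simp
qed

lemma nn_integral_be_shift:
 assumes "e > 0"
 shows "(NBINT (x::'b::euclidean_space). ennreal (be e (x - a))) = 1"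
  "(NBINT (x::'b). ennreal (be e (a - x))) = 1"
proof -
 have [measurable]: "(\<lambda>x::'b. ennreal (be e x)) \<in> BM" using bsm_measurable[OF bsm_be] by measurable
 show "(NBINT (x::'b). ennreal (be e (x - a))) = 1" "(NBINT (x::'b). ennreal (be e (a - x))) = 1" by (subst nn_integral_lborel_shift; simp add: nn_integral_be[OF assms])+
qed

section \<open>Reflection in t and the mollifying kernels\<close>

definition rfl :: "'b::euclidean_space \<times> real \<Rightarrow> 'b \<times> real" where
 "rfl z = (fst z, - snd z)"

lemma rfl_simps [simp]: "rfl (x, t) = (x, - t)" "rfl (rfl z) = z" "norm (rfl z) = norm z"
 by (auto simp: rfl_def norm_prod_def)

lemma linear_rfl: "linear rfl"
 by (rule linearI) (auto simp: rfl_def)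

lemma rfl_measurable [measurable]: "rfl \<in> BM"
 unfolding rfl_def[abs_def] by (intro borel_measurable_continuous_onI continuous_intros)

lemma lborel_distr_rfl: "distr lborel borel rfl = (lborel :: ('b::euclidean_space \<times> real) measure)"
proof -
 define c where "c i = (if i = (0::'b, 1::real) then - 1 else (1::real))" for i
 have "(\<Sum>i\<in>Basis. (c i * (z \<bullet> i)) *\<^sub>R i) = rfl z" for z
 proof (rule euclidean_eqI)
  fix j :: "'b \<times> real" assume j: "j \<in> Basis"
  have "(\<Sum>i\<in>Basis. (c i * (z \<bullet> i)) *\<^sub>R i) \<bullet> j = c j * (z \<bullet> j)" using j by (simp add: inner_sum_left_Basis)
  also have "\<dots> = rfl z \<bullet> j" using j by (auto simp: c_def Basis_prod_def rfl_def inner_prod_def)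
  finally show "(\<Sum>i\<in>Basis. (c i * (z \<bullet> i)) *\<^sub>R i) \<bullet> j = rfl z \<bullet> j" .
 qed
 hence T: "(\<lambda>z. 0 + (\<Sum>i\<in>Basis. (c i * (z \<bullet> i)) *\<^sub>R i)) = rfl" by auto
 have "(lborel :: ('b \<times> real) measure) = density (distr lborel borel rfl) (\<lambda>_. (\<Prod>i\<in>(Basis :: ('b \<times> real) set). \<bar>c i\<bar>))"
  using lborel_affine_euclidean[of c 0] unfolding T by (simp add: c_def)
 also have "(\<Prod>i\<in>(Basis :: ('b \<times> real) set). \<bar>c i\<bar>) = 1" by (intro prod.neutral) (auto simp: c_def)
 finally show ?thesis by (simp add: density_1)
qed

lemma integral_rfl:
 fixes f :: "'b::euclidean_space \<times> real \<Rightarrow> real"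
 assumes [measurable]: "f \<in> BM"
 shows "(LBINT z. f (rfl z)) = (LBINT z. f z)"
  "L1 f \<Longrightarrow> L1 (\<lambda>z. f (rfl z))"
proof -
 show "(LBINT z. f (rfl z)) = (LBINT z. f z)" by (subst (2) lborel_distr_rfl[symmetric]) (simp add: integral_distr)
 show "L1 (\<lambda>z. f (rfl z))" if "L1 f" using that integrable_distr_eq[of rfl lborel borel f] by (simp add: lborel_distr_rfl)
qed

definition rho :: "real \<Rightarrow> 'b::euclidean_space \<times> real \<Rightarrow> real" where
 "rho e z = be e (fst z) * (bb (snd z / e) / e)"

text \<open>The primitive of \<open>rho\<close> in t that is odd in t; oddness makes its even reflection \<open>Ker\<close> compactly supported.\<close>

definition Tht :: "real \<Rightarrow> 'b::euclidean_space \<times> real \<Rightarrow> real" where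
 "Tht e z = be e (fst z) * (stp ((snd z / e + 1) / 2) - 1 / 2)"

lemma bsm_comp_fst: "bsm k \<Longrightarrow> bsm (\<lambda>z::'b::euclidean_space \<times> real. k (fst z))"
 using bsm_affine[of fst k 0] by (simp add: linear_fst)

lemma bsm_comp_snd: "bsm k \<Longrightarrow> bsm (\<lambda>z::'b::euclidean_space \<times> real. k (snd z))"
 using bsm_affine[of snd k 0] by (simp add: linear_snd)

lemma bsm_rho: "bsm (rho e)"
proof -
 have "bsm (\<lambda>t. bb (t / e) / e)" using bsm_bb_inner[of "1::real" e] by simp
 thus ?thesis unfolding rho_def[abs_def] by (intro bsm_mult bsm_comp_fst[OF bsm_be] bsm_comp_snd)
qed

lemma bsm_Tht: "bsm (Tht e)"
proof -
 have "bsm (\<lambda>t. stp (((1 / (2 * e)) *\<^sub>R t + 1 / 2)) - 1 / 2)" by (intro bsm_diff bsm_const bsm_scale stp(1))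
 hence "bsm (\<lambda>t. stp ((t / e + 1) / 2) - 1 / 2)" by (simp add: add_divide_distrib mult.commute)
 from bsm_comp_snd[OF this] show ?thesis unfolding Tht_def[abs_def] by (intro bsm_mult bsm_comp_fst[OF bsm_be])
qed

lemma Basis_01: "(0::'b::euclidean_space, 1::real) \<in> Basis"
 by (simp add: Basis_prod_def)

lemma pd_Tht:
 assumes "e \<noteq> 0" shows "pd (0, 1) (Tht e :: 'b::euclidean_space \<times> real \<Rightarrow> real) = rho e"
proof
 fix z :: "'b \<times> real"
 have "((\<lambda>t. be e (fst z) * (stp (((snd z + t) / e + 1) / 2) - 1 / 2)) has_real_derivative be e (fst z) * (bb (snd z / e) * (1 / e))) (at 0)"
 proof -
  have "((\<lambda>t. stp (((snd z + t) / e + 1) / 2)) has_real_derivative bb ((snd z + 0) / e) * (1 / e)) (at 0)"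
   by (rule DERIV_chain2[OF bb_deriv]) (auto intro!: derivative_eq_intros simp: assms)
  from DERIV_cmult[OF DERIV_diff[OF this DERIV_const[of "1 / 2"]], of "be e (fst z)"] show ?thesis by simp
 qed
 moreover have "((\<lambda>t. Tht e (z + t *\<^sub>R (0, 1))) has_real_derivative pd (0, 1) (Tht e) z) (at 0)"
  using bsm_slice[OF bsm_Tht Basis_01, of e z 0] by (simp flip: zero_prod_def)
 ultimately have "pd (0, 1) (Tht e) z = be e (fst z) * (bb (snd z / e) * (1 / e))" by (intro DERIV_unique) (auto simp: Tht_def scaleR_prod_def)
 thus "pd (0, 1) (Tht e) z = rho e z" by (simp add: rho_def)
qed

lemma rho_nonneg: "e > 0 \<Longrightarrow> rho e z \<ge> 0"
 by (simp add: rho_def be_nonneg bb_nonneg)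

text \<open>\<open>rho e\<close> is supported in the ball of radius \<open>ka\<close> times e: the
  dimension for the tangential factor plus 1 for the factor in t, by adding the two norms.\<close>

definition ka :: "'b::euclidean_space itself \<Rightarrow> real" where "ka _ = real DIM('b) + 1"

lemma rho_zero:
 fixes z :: "'b::euclidean_space \<times> real"
 assumes "e > 0" "norm z > ka TYPE('b) * e" shows "rho e z = 0"
proof -
 have "norm z \<le> norm (fst z) + \<bar>snd z\<bar>" using norm_Pair_le[of "fst z" "snd z"] by simp
 hence "norm (fst z) > e * real DIM('b) \<or> \<bar>snd z\<bar> > e" using assms by (auto simp: ka_def algebra_simps)
 thus ?thesis using assms(1) be_zero[of e "fst z"] bb_zero[of "snd z / e"] by (auto simp: rho_def)
qed

lemma be_scale: "be e (x::'b::euclidean_space) = (1 / e) ^ DIM('b) * be 1 ((1 / e) *\<^sub>R x + 0)"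
proof -
 have "bb (x \<bullet> i / e) / e = (1 / e) * (bb (((1 / e) *\<^sub>R x + 0) \<bullet> i / 1) / 1)" for i by simp
 thus ?thesis unfolding be_def by (simp only: prod.distrib prod_constant)
qed

lemma rho_scale: "rho e = (\<lambda>z::'b::euclidean_space \<times> real. (1 / e) ^ (DIM('b) + 1) * rho 1 ((1 / e) *\<^sub>R z + 0))"
proof
 fix z :: "'b \<times> real"
 show "rho e z = (1 / e) ^ (DIM('b) + 1) * rho 1 ((1 / e) *\<^sub>R z + 0)" using be_scale[of e "fst z"] by (simp add: rho_def)
qed

lemma Tht_scale: "Tht e = (\<lambda>z::'b::euclidean_space \<times> real. (1 / e) ^ DIM('b) * Tht 1 ((1 / e) *\<^sub>R z + 0))"
proof
 fix z :: "'b \<times> real"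
 show "Tht e z = (1 / e) ^ DIM('b) * Tht 1 ((1 / e) *\<^sub>R z + 0)" using be_scale[of e "fst z"] by (simp add: Tht_def)
qed

text \<open>Scaling reduces the bounds to e = 1. With N the dimension of the tangential space, the
  natural powers are e^(-N-1), e^(-N-3) and e^(-N-2); for e \<le> 1 the worst of them serves for all
  three kernels.\<close>

lemma kernel_bounds:
 "\<exists>M\<ge>0. \<forall>e z. 0 < e \<longrightarrow> e \<le> 1 \<longrightarrow>
   \<bar>rho e (z::'b::euclidean_space \<times> real)\<bar> \<le> M * (1 / e) ^ (DIM('b) + 3) \<and>
   \<bar>lap (rho e) z\<bar> \<le> M * (1 / e) ^ (DIM('b) + 3) \<and> \<bar>lap (Tht e) z\<bar> \<le> M * (1 / e) ^ (DIM('b) + 3)"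
proof -
 obtain A where A: "A \<ge> 0" "\<And>z. \<bar>rho 1 (z::'b \<times> real)\<bar> \<le> A" by (rule bsm_bounded[OF bsm_rho]) blast
 obtain B where B: "B \<ge> 0" "\<And>z. \<bar>lap (rho 1) (z::'b \<times> real)\<bar> \<le> B" by (rule bsm_bounded[OF bsm_lap[OF bsm_rho]]) blast
 obtain C where C: "C \<ge> 0" "\<And>z. \<bar>lap (Tht 1) (z::'b \<times> real)\<bar> \<le> C" by (rule bsm_bounded[OF bsm_lap[OF bsm_Tht]]) blast
 define M where "M = max A (max B C)"
 have M: "M \<ge> 0" "A \<le> M" "B \<le> M" "C \<le> M" using A by (auto simp: M_def)
 have pw: "x * (1 / e) ^ m \<le> M * (1 / e) ^ (DIM('b) + 3)" if "0 < e" "e \<le> 1" "0 \<le> x" "x \<le> M" "m \<le> DIM('b) + 3" for e x :: real and m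
  using that by (intro mult_mono power_increasing) auto
 have k: "\<bar>(1 / e) ^ m * y\<bar> \<le> M * (1 / e) ^ (DIM('b) + 3)" if "0 < e" "e \<le> 1" "\<bar>y\<bar> \<le> x" "x \<le> M" "m \<le> DIM('b) + 3" for e x y :: real and m
  using pw[of e "\<bar>y\<bar>" m] that by (simp add: abs_mult mult.commute)
 show ?thesis
 proof (intro exI[of _ M] conjI allI impI M(1))
  fix e :: real and z :: "'b \<times> real" assume e: "0 < e" "e \<le> 1"
  show "\<bar>rho e z\<bar> \<le> M * (1 / e) ^ (DIM('b) + 3)" unfolding rho_scale[of e] by (rule k[OF e A(2) M(2)]) simp
  have e2: "lap (rho e) z = (1 / e) ^ (DIM('b) + 3) * lap (rho 1) ((1 / e) *\<^sub>R z + 0)"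
   unfolding rho_scale[of e] lap_cmult[OF bsm_scale[OF bsm_rho]] lap_affine[OF bsm_rho] by (simp add: power_add power2_eq_square power3_eq_cube)
  show "\<bar>lap (rho e) z\<bar> \<le> M * (1 / e) ^ (DIM('b) + 3)" unfolding e2 by (rule k[OF e B(2) M(3)]) simp
  have e3: "lap (Tht e) z = (1 / e) ^ (DIM('b) + 2) * lap (Tht 1) ((1 / e) *\<^sub>R z + 0)"
   unfolding Tht_scale[of e] lap_cmult[OF bsm_scale[OF bsm_Tht]] lap_affine[OF bsm_Tht] by (simp add: power_add power2_eq_square power3_eq_cube)
  show "\<bar>lap (Tht e) z\<bar> \<le> M * (1 / e) ^ (DIM('b) + 3)" unfolding e3 by (rule k[OF e C(2) M(4)]) simp
 qed
qed

definition Ker :: "real \<Rightarrow> 'b::euclidean_space \<times> real \<Rightarrow> 'b \<times> real \<Rightarrow> real" where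
 "Ker e z w = Tht e (z - w) + Tht e (z - rfl w)"

lemma pd_rfl:
 fixes k :: "'b::euclidean_space \<times> real \<Rightarrow> real"
 assumes "bsm k" "i \<in> Basis"
 shows "pd i (\<lambda>w. k (z - rfl w)) = (\<lambda>w. (if i = (0, 1) then 1 else - 1) * pd i k (z - rfl w))"
proof
 fix w :: "'b \<times> real"
 have "((\<lambda>w. z - rfl w) has_derivative (\<lambda>h. 0 - rfl h)) (at w)"
  by (rule has_derivative_diff[OF has_derivative_const linear_imp_has_derivative[OF linear_rfl]])
 hence "((\<lambda>w. k (z - rfl w)) has_derivative (\<lambda>h. grad k (z - rfl w) \<bullet> (0 - rfl h))) (at w)"
  by (rule has_derivative_compose[where f = "\<lambda>w. z - rfl w" and g = k, OF _ bsm_grad[OF assms(1)]])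
 hence "((\<lambda>w. k (z - rfl w)) has_derivative (\<lambda>h. grad k (z - rfl w) \<bullet> (- rfl h))) (at w)" by simp
 from pd_eq[OF this, of i] have "pd i (\<lambda>w. k (z - rfl w)) w = grad k (z - rfl w) \<bullet> (- rfl i)" .
 also have "- rfl i = (if i = (0, 1) then 1 else - 1) *\<^sub>R i" using assms(2) by (auto simp: Basis_prod_def rfl_def)
 finally show "pd i (\<lambda>w. k (z - rfl w)) w = (if i = (0, 1) then 1 else - 1) * pd i k (z - rfl w)" using assms(2) by (simp add: grad_inner_Basis)
qed

lemma bsm_rfl: "bsm k \<Longrightarrow> bsm (\<lambda>w. k (z - rfl w))"
 using bsm_affine[of "\<lambda>w. - rfl w" k z] by (simp add: linear_compose_neg linear_rfl)

lemma lap_rfl: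
 assumes "bsm k" shows "lap (\<lambda>w. k (z - rfl w)) = (\<lambda>w. lap k (z - rfl w))"
proof
 fix w
 have "pd i (pd i (\<lambda>w. k (z - rfl w))) w = pd i (pd i k) (z - rfl w)" if "i \<in> Basis" for i using that assms by (simp add: pd_rfl pd_cmult bsm_pd bsm_rfl)
 thus "lap (\<lambda>w. k (z - rfl w)) w = lap k (z - rfl w)" by (simp add: lap_def)
qed

lemma bsm_neg: "bsm k \<Longrightarrow> bsm (\<lambda>w. k (z - w))"
 using bsm_scale[of k "- 1" z] by simp

lemma lap_neg: "bsm k \<Longrightarrow> lap (\<lambda>w. k (z - w)) = (\<lambda>w. lap k (z - w))"
 using lap_affine[of k "- 1" z] by simp

lemma bsm_Ker: "bsm (Ker e z)"
 unfolding Ker_def[abs_def] by (intro bsm_add bsm_neg bsm_rfl bsm_Tht)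

lemma lap_Ker: "lap (Ker e z) w = lap (Tht e) (z - w) + lap (Tht e) (z - rfl w)"
 unfolding Ker_def[abs_def] by (simp add: lap_add bsm_neg bsm_rfl bsm_Tht lap_neg lap_rfl)

text \<open>The two step factors add up to 1 as soon as |t'| > |t| + e, which cancels the two
  constants 1/2; what remains has |x - x'| \<le> e N and |t'| \<le> |t| + e, with N the tangential
  dimension.\<close>

lemma Ker_zero:
 fixes z w :: "'b::euclidean_space \<times> real"
 assumes e: "e > 0" and n: "norm w > norm z + ka TYPE('b) * e" shows "Ker e z w = 0"
proof -
 obtain x t where z: "z = (x, t)" by (cases z)
 obtain x' t' where w: "w = (x', t')" by (cases w)
 show ?thesis
 proof (cases "norm (x - x') > e * real DIM('b)")
  case True
  thus ?thesis using be_zero[OF e True] by (simp add: Ker_def Tht_def z w)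
 next
  case False
  have "\<bar>t'\<bar> > \<bar>t\<bar> + e"
  proof (rule ccontr)
   assume c: "\<not> ?thesis"
   \<comment> \<open>The point of the interval [-|t|, |t|] nearest to t'. Then w is compared with
     (x, s), whose norm is at most that of z.\<close>
   define s where "s = (if t' > \<bar>t\<bar> then \<bar>t\<bar> else if t' < - \<bar>t\<bar> then - \<bar>t\<bar> else t')"
   have s: "\<bar>s\<bar> \<le> \<bar>t\<bar>" "\<bar>t' - s\<bar> \<le> e" using c e by (auto simp: s_def)
   have "(x', t') = (x, s) + (x' - x, t' - s)" by simp
   hence 1: "norm w \<le> norm (x, s) + norm (x' - x, t' - s)" unfolding w by (metis norm_triangle_ineq)
   have 2: "norm (x, s) \<le> norm z" using s(1) unfolding z norm_Pair by (intro real_sqrt_le_mono add_left_mono) (simp add: abs_le_square_iff)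
   have 3: "norm (x' - x, t' - s) \<le> norm (x' - x) + norm (t' - s)" by (rule norm_Pair_le)
   have 4: "norm (x' - x) + norm (t' - s) \<le> e * real DIM('b) + e" using False s(2) by (simp add: norm_minus_commute)
   have "ka TYPE('b) * e = e * real DIM('b) + e" by (simp add: ka_def algebra_simps)
   with 1 2 3 4 show False using n by linarith
  qed
  moreover have "stp (((t - t') / e + 1) / 2) + stp (((t + t') / e + 1) / 2) = 1" if "\<bar>t'\<bar> > \<bar>t\<bar> + e"
  proof (cases "t' > 0")
   case True
   hence "t - t' < - e" "t + t' > e" using that by auto
   hence "(t - t') / e \<le> - 1" "(t + t') / e \<ge> 1" using e by (auto simp: field_simps)
   thus ?thesis by (simp add: stp)
  next
   case False
   hence "t + t' < - e" "t - t' > e" using that by auto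
   hence "(t + t') / e \<le> - 1" "(t - t') / e \<ge> 1" using e by (auto simp: field_simps)
   thus ?thesis by (simp add: stp)
  qed
  ultimately have "stp (((t - t') / e + 1) / 2) + stp (((t + t') / e + 1) / 2) = 1" by blast
  thus ?thesis by (simp add: Ker_def Tht_def z w flip: distrib_left)
 qed
qed

lemma integrable_of_square:
 fixes g :: "'a::euclidean_space \<Rightarrow> real"
 assumes [measurable]: "g \<in> BM" and "L1 (\<lambda>z. (g z)^2)"
  and out: "\<And>z. norm z \<ge> R \<Longrightarrow> g z = 0"
 shows "L1 g"
proof (rule Bochner_Integration.integrable_bound)
 have "L1 (\<lambda>z. indicator (ball 0 R) z :: real)" by (intro integrable_real_indicator emeasure_bounded_finite) auto
 thus "L1 (\<lambda>z. indicator (ball 0 R) z + (g z)^2)" by (intro Bochner_Integration.integrable_add assms)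
 have "\<bar>g z\<bar> \<le> indicator (ball 0 R) z + (g z)^2" for z
 proof (cases "norm z < R")
  case True
  have "2 * 1 * \<bar>g z\<bar> \<le> 1^2 + \<bar>g z\<bar>^2" by (rule sum_squares_bound)
  thus ?thesis using True by simp
 qed (simp add: out)
 thus "AE z in lborel. norm (g z) \<le> norm (indicator (ball 0 R) z + (g z)^2)" by (intro AE_I2) (simp add: abs_of_nonneg)
qed simp

lemma lap_far_zero:
 fixes f :: "'a::euclidean_space \<Rightarrow> real"
 assumes "bsm f" "\<And>w. norm w > s \<Longrightarrow> f w = 0" "norm w > s" shows "lap f w = 0"
proof -
 have "hess f w i = 0" for i by (rule C2_locally_zero(2)[OF bsm_C2[OF assms(1)], of "- cball 0 s"]) (use assms in auto)
 thus ?thesis unfolding tr_hess[symmetric] tr_def by simp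
qed

section \<open>The reflected and mollified system\<close>

text \<open>The reflected problem in a ball of radius at most 1, where the Carleman inequality
  lives: \<open>u0\<close> and \<open>v0\<close> are even and cut off to the ball, \<open>T0\<close>
  is the trace, \<open>f\<close> stands for h times the trace, and \<open>G\<close> is the t
  derivative of the solution in the upper half. The factor -2 in \<open>eq2\<close> collects the
  flux of v through t = 0 from both sides. \<open>trace\<close> is Green's formula on the upper half
  and ties \<open>T0\<close> to \<open>u0\<close>.\<close>

locale core =
 fixes R Hb :: real and f T0 :: "'b::euclidean_space \<Rightarrow> real" and u0 v0 G :: "'b \<times> real \<Rightarrow> real"
 assumes R: "0 < R" "R \<le> 1" and Hb: "Hb \<ge> 0"
  and meas [measurable]: "f \<in> BM" "T0 \<in> BM"
   "u0 \<in> BM" "v0 \<in> BM" "G \<in> BM"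
  and out: "\<And>z. norm z \<ge> R \<Longrightarrow> u0 z = 0" "\<And>z. norm z \<ge> R \<Longrightarrow> v0 z = 0" "\<And>x. norm x \<ge> R \<Longrightarrow> T0 x = 0"
  and sq: "L1 (\<lambda>z. (u0 z)^2)" "L1 (\<lambda>z. (v0 z)^2)"
   "L1 (\<lambda>z. (G z)^2)" "L1 (\<lambda>x. (T0 x)^2)"
  and f_le: "\<And>x. \<bar>f x\<bar> \<le> Hb * \<bar>T0 x\<bar>"
  and even: "\<And>z. u0 (rfl z) = u0 z" "\<And>z. v0 (rfl z) = v0 z"
  and eq1: "\<And>ph. tst (ball 0 R) ph \<Longrightarrow> (LBINT z. u0 z * lap ph z) = (LBINT z. v0 z * ph z)"
  and eq2: "\<And>ph. tst (ball 0 R) ph \<Longrightarrow> (LBINT z. v0 z * lap ph z) = - 2 * (LBINT x. f x * ph (x, 0))"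
  and trace: "\<And>qs. tst (ball 0 R) qs \<Longrightarrow> (LBINT x. T0 x * qs (x, 0))
    = - (LBINT z. indicator upper z * (G z * qs z + u0 z * pd (0, 1) qs z))"
  and T0_approx: "\<And>e. e > 0 \<Longrightarrow> \<exists>q. continuous_on UNIV q \<and>
    (NBINT x. ennreal (indicator (ball 0 R) x * (T0 x - q x)^2)) \<le> ennreal e"
  and vanish: "\<And>n::nat. \<exists>rh>0. AE z in lborel. norm z < rh \<longrightarrow> \<bar>u0 z\<bar> \<le> norm z ^ n"
begin

lemma int: "L1 u0" "L1 v0" "L1 T0" "L1 f"
proof -
 show "L1 u0" by (rule integrable_of_square[OF _ sq(1) out(1)]) simp
 show "L1 v0" by (rule integrable_of_square[OF _ sq(2) out(2)]) simp
 show T: "L1 T0" by (rule integrable_of_square[OF _ sq(4) out(3)]) simp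
 show "L1 f" by (rule Bochner_Integration.integrable_bound[of _ "\<lambda>x. Hb * T0 x"])
    (use T f_le Hb in \<open>auto simp: abs_mult\<close>)
qed

definition k :: real where "k = ka TYPE('b)"

lemma k: "k \<ge> 1" by (simp add: k_def ka_def)

text \<open>Symmetrising over w and its reflection replaces the kernel by K (z - w) + K (z - rfl w),
  which for K = \<open>Tht e\<close> is the compactly supported \<open>Ker\<close>.\<close>

lemma conv_even:
 assumes g: "L1 g" and e: "\<And>z. g (rfl z) = g z" and K: "bsm K"
 shows "2 * conv g K z = (LINT w|lborel. g w * (K (z - w) + K (z - rfl w)))"
proof -
 have [measurable]: "g \<in> BM" "K \<in> BM" using g bsm_measurable[OF K] by auto
 have m: "(\<lambda>w. g w * K (z - w)) \<in> BM" by measurable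
 have i: "L1 (\<lambda>w. g w * K (z - w))" by (rule conv_integrable[OF g K])
 have 1: "(LINT w|lborel. g w * K (z - rfl w)) = conv g K z" using integral_rfl(1)[OF m] by (simp add: e conv_def)
 have 2: "L1 (\<lambda>w. g w * K (z - rfl w))" using integral_rfl(2)[OF m i] by (simp add: e)
 show ?thesis using Bochner_Integration.integral_add[OF i 2] 1 by (simp add: conv_def distrib_left)
qed

lemma tst_rho:
 fixes z :: "'b \<times> real"
 assumes "e > 0" "norm z + k * e < R" shows "tst (ball 0 R) (\<lambda>w. rho e (z - w))"
 unfolding tst_def
proof (intro conjI exI)
 show "bsm (\<lambda>w. rho e (z - w))" by (intro bsm_neg bsm_rho)
 show "compact (cball z (k * e))" by simp
 show "cball z (k * e) \<subseteq> ball 0 R"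
 proof
  fix w assume "w \<in> cball z (k * e)"
  hence "norm (w - z) \<le> k * e" by (simp add: dist_norm norm_minus_commute)
  thus "w \<in> ball 0 R" using norm_triangle_ineq[of z "w - z"] assms by simp
 qed
 show "\<forall>w. w \<notin> cball z (k * e) \<longrightarrow> rho e (z - w) = 0" by (intro allI impI rho_zero[OF assms(1)]) (simp add: k_def dist_norm)
qed

lemma tst_Ker:
 fixes z :: "'b \<times> real"
 assumes "e > 0" "norm z + k * e < R" shows "tst (ball 0 R) (Ker e z)"
 unfolding tst_def
proof (intro conjI exI)
 show "bsm (Ker e z)" by (rule bsm_Ker)
 show "compact (cball (0 :: 'b \<times> real) (norm z + k * e))" by simp
 show "cball 0 (norm z + k * e) \<subseteq> ball 0 R" using assms by auto
 show "\<forall>w. w \<notin> cball 0 (norm z + k * e) \<longrightarrow> Ker e z w = 0" by (intro allI impI Ker_zero[OF assms(1)]) (simp add: k_def)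
qed

definition u where "u e = conv u0 (rho e)"
definition v where "v e = conv v0 (rho e)"
definition y where "y e = conv v0 (Tht e)"
text \<open>The mollification of -f sgn t: twice \<open>Tht e\<close> is the tangential mollifier
  times a smoothed sign of t.\<close>

definition F where "F e z = - 2 * (LBINT x. f x * Tht e (fst z - x, snd z))"

lemma bsm_uvy: "bsm (u e)" "bsm (v e)" "bsm (y e)"
 unfolding u_def v_def y_def by (intro bsm_conv int bsm_rho bsm_Tht)+

lemma lap_u:
 assumes "e > 0" "norm z + k * e < R" shows "lap (u e) z = v e z"
proof -
 have "lap (u e) z = (LINT w|lborel. u0 w * lap (\<lambda>w. rho e (z - w)) w)" by (simp add: u_def lap_conv int bsm_rho conv_def lap_neg)
 also have "\<dots> = v e z" unfolding eq1[OF tst_rho[OF assms]] by (simp add: v_def conv_def)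
 finally show ?thesis .
qed

text \<open>\<open>Tht\<close> is not compactly supported, but on even functions it acts as half of
  \<open>Ker\<close>, which is an admissible test function; the first equation then moves the
  Laplacian onto the kernel. In this way y inherits the vanishing order of
  \<open>u0\<close>.\<close>

lemma conv_u0_lap_Tht:
 assumes "e > 0" "norm z + k * e < R" shows "y e z = conv u0 (lap (Tht e)) z"
proof -
 have "2 * y e z = (LINT w|lborel. v0 w * Ker e z w)" unfolding y_def Ker_def by (rule conv_even[OF int(2) even(2) bsm_Tht])
 also have "\<dots> = (LINT w|lborel. u0 w * lap (Ker e z) w)" by (rule eq1[OF tst_Ker[OF assms], symmetric])
 also have "\<dots> = 2 * conv u0 (lap (Tht e)) z" unfolding lap_Ker by (rule conv_even[OF int(1) even(1) bsm_lap[OF bsm_Tht], symmetric])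
 finally show ?thesis by simp
qed

lemma lap_y:
 assumes "e > 0" "norm z + k * e < R" shows "lap (y e) z = F e z"
proof -
 have "2 * lap (y e) z = (LINT w|lborel. v0 w * lap (Ker e z) w)" unfolding lap_Ker y_def lap_conv[OF int(2) bsm_Tht]
  by (rule conv_even[OF int(2) even(2) bsm_lap[OF bsm_Tht]])
 also have "\<dots> = - 2 * (LBINT x. f x * Ker e z (x, 0))" by (rule eq2[OF tst_Ker[OF assms]])
 \<comment> \<open>Points with t = 0 are fixed by the reflection, so there the two summands of
   \<open>Ker\<close> coincide.\<close>
 also have "\<dots> = - 2 * (LBINT x. 2 * (f x * Tht e (fst z - x, snd z)))" by (intro arg_cong[where f = "\<lambda>t. - 2 * t"] Bochner_Integration.integral_cong refl)
    (cases z, simp add: Ker_def)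
 also have "\<dots> = 2 * F e z" by (simp add: F_def)
 finally show ?thesis by simp
qed

lemma pd_y: "e > 0 \<Longrightarrow> pd (0, 1) (y e) = v e"
 unfolding y_def v_def by (simp add: pd_conv[OF int(2) bsm_Tht Basis_01] pd_Tht)

lemma local_bound:
 assumes K: "K \<in> BM" "\<And>w. \<bar>K w\<bar> \<le> M" "\<And>w. norm w > s \<Longrightarrow> K w = 0"
 shows "\<bar>LINT w|lborel. u0 w * K w\<bar> \<le> M * (LINT w|lborel. indicator (cball 0 s) w * \<bar>u0 w\<bar>)"
proof -
 have i: "L1 (\<lambda>w. indicator (cball 0 s) w * \<bar>u0 w\<bar>)"
  using integrable_mult_indicator[of "cball 0 s" lborel "\<lambda>w. \<bar>u0 w\<bar>"] int(1) by simp
 have "\<bar>LINT w|lborel. u0 w * K w\<bar> \<le> (LINT w|lborel. \<bar>u0 w * K w\<bar>)" by (rule integral_abs_bound)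
 also have "\<dots> \<le> (LINT w|lborel. M * (indicator (cball 0 s) w * \<bar>u0 w\<bar>))"
 proof (rule integral_mono)
  show "L1 (\<lambda>w. \<bar>u0 w * K w\<bar>)" using K by (intro integrable_abs integrable_mult_bounded[OF int(1)]) auto
  show "L1 (\<lambda>w. M * (indicator (cball 0 s) w * \<bar>u0 w\<bar>))" using i by simp
  show "\<bar>u0 w * K w\<bar> \<le> M * (indicator (cball 0 s) w * \<bar>u0 w\<bar>)" for w
  proof (cases "norm w > s")
   case False
   have "\<bar>u0 w * K w\<bar> \<le> M * \<bar>u0 w\<bar>" unfolding abs_mult by (subst mult.commute) (rule mult_right_mono[OF K(2) abs_ge_zero])
   thus ?thesis using False by simp
  qed (simp add: K)
 qed
 finally show ?thesis by simp
qed

definition La where "La s = (LINT w|lborel. indicator (cball 0 s) w * \<bar>u0 w\<bar>)"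

text \<open>\<open>v\<close> and \<open>y\<close> are rewritten as integrals of \<open>u0\<close>
  against Laplacians of kernels, so all three functions are bounded by the size of a kernel times
  the L1 mass of \<open>u0\<close> in a slightly larger ball. The loss in e is crude but polynomial,
  which infinite vanishing order can afford.\<close>

lemma inner_bounds:
 "\<exists>M\<ge>0. \<forall>e (z::'b \<times> real). 0 < e \<longrightarrow> e \<le> 1 \<longrightarrow> norm z + k * e < R \<longrightarrow>
   \<bar>u e z\<bar> \<le> M * (1 / e) ^ (DIM('b) + 3) * La (norm z + k * e) \<and>
   \<bar>v e z\<bar> \<le> M * (1 / e) ^ (DIM('b) + 3) * La (norm z + k * e) \<and>
   \<bar>y e z\<bar> \<le> M * (1 / e) ^ (DIM('b) + 3) * La (norm z + k * e)"
proof -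
 obtain M where M: "M \<ge> 0" "\<And>e z. 0 < e \<Longrightarrow> e \<le> 1 \<Longrightarrow>
   \<bar>rho e (z::'b \<times> real)\<bar> \<le> M * (1 / e) ^ (DIM('b) + 3) \<and>
   \<bar>lap (rho e) z\<bar> \<le> M * (1 / e) ^ (DIM('b) + 3) \<and> \<bar>lap (Tht e) z\<bar> \<le> M * (1 / e) ^ (DIM('b) + 3)"
  using kernel_bounds[where 'b = 'b] by blast
 show ?thesis
 proof (intro exI[of _ M] conjI allI impI M(1))
  fix e and z :: "'b \<times> real" assume e: "0 < e" "e \<le> 1" and z: "norm z + k * e < R"
  let ?P = "M * (1 / e) ^ (DIM('b) + 3)"
  have far: "norm (z - w) > k * e" if "norm w > norm z + k * e" for w using norm_triangle_ineq2[of w z] that by (simp add: norm_minus_commute)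
  have "\<bar>LINT w|lborel. u0 w * rho e (z - w)\<bar> \<le> ?P * La (norm z + k * e)" unfolding La_def
  proof (rule local_bound)
   show "rho e (z - w) = 0" if "norm w > norm z + k * e" for w using rho_zero[OF e(1)] far[OF that] by (simp add: k_def)
   show "\<bar>rho e (z - w)\<bar> \<le> ?P" for w using M(2)[OF e] by blast
  qed (rule bsm_measurable[OF bsm_neg[OF bsm_rho]])
  thus "\<bar>u e z\<bar> \<le> ?P * La (norm z + k * e)" by (simp add: u_def conv_def)
  have lr: "lap (rho e) w = 0" if "norm w > k * e" for w :: "'b \<times> real" by (rule lap_far_zero[OF bsm_rho _ that]) (simp add: rho_zero[OF e(1)] k_def)
  have "\<bar>LINT w|lborel. u0 w * lap (rho e) (z - w)\<bar> \<le> ?P * La (norm z + k * e)" unfolding La_def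
  proof (rule local_bound)
   show "lap (rho e) (z - w) = 0" if "norm w > norm z + k * e" for w using lr far[OF that] by simp
   show "\<bar>lap (rho e) (z - w)\<bar> \<le> ?P" for w using M(2)[OF e] by blast
  qed (rule bsm_measurable[OF bsm_neg[OF bsm_lap[OF bsm_rho]]])
  moreover have "v e z = (LINT w|lborel. u0 w * lap (rho e) (z - w))" unfolding lap_u[OF e(1) z, symmetric] by (simp add: u_def lap_conv int bsm_rho conv_def)
  ultimately show "\<bar>v e z\<bar> \<le> ?P * La (norm z + k * e)" by simp
  have "\<bar>LINT w|lborel. u0 w * lap (Ker e z) w\<bar> \<le> (2 * ?P) * La (norm z + k * e)" unfolding La_def
  proof (rule local_bound)
   show "lap (Ker e z) w = 0" if "norm w > norm z + k * e" for w by (rule lap_far_zero[OF bsm_Ker _ that]) (simp add: Ker_zero[OF e(1)] k_def)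
   show "\<bar>lap (Ker e z) w\<bar> \<le> 2 * ?P" for w unfolding lap_Ker using M(2)[OF e, of "z - w"] M(2)[OF e, of "z - rfl w"] by linarith
  qed (rule bsm_measurable[OF bsm_lap[OF bsm_Ker]])
  moreover have "2 * y e z = (LINT w|lborel. u0 w * lap (Ker e z) w)"
   unfolding conv_u0_lap_Tht[OF e(1) z] lap_Ker by (rule conv_even[OF int(1) even(1) bsm_lap[OF bsm_Tht]])
  ultimately show "\<bar>y e z\<bar> \<le> ?P * La (norm z + k * e)" by simp
 qed
qed

lemma La_bound:
 "\<exists>s0>0. \<exists>C\<ge>0. \<forall>s. 0 < s \<longrightarrow> s < s0 \<longrightarrow> 0 \<le> La s \<and> La s \<le> C * s ^ n"
proof -
 obtain s0 where s0: "s0 > 0" "AE z in lborel. norm z < s0 \<longrightarrow> \<bar>u0 z\<bar> \<le> norm z ^ n" using vanish[of n] by blast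
 define C where "C = measure lborel (cball (0 :: 'b \<times> real) s0)"
 have "0 \<le> La s \<and> La s \<le> C * s ^ n" if s: "0 < s" "s < s0" for s
 proof
  show "0 \<le> La s" unfolding La_def by (rule Bochner_Integration.integral_nonneg) simp
  have i: "L1 (\<lambda>w. indicator (cball (0 :: 'b \<times> real) s0) w * s ^ n)" by (intro integrable_mult_left integrable_real_indicator emeasure_bounded_finite) auto
  have "La s \<le> (LINT w|lborel. indicator (cball (0 :: 'b \<times> real) s0) w * s ^ n)" unfolding La_def
  proof (rule integral_mono_AE)
   show "L1 (\<lambda>w. indicator (cball 0 s) w * \<bar>u0 w\<bar>)" using integrable_mult_indicator[of "cball 0 s" lborel "\<lambda>w. \<bar>u0 w\<bar>"] int(1) by simp
   show "AE w in lborel. indicator (cball 0 s) w * \<bar>u0 w\<bar> \<le> indicator (cball 0 s0) w * s ^ n" using s0(2)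
   proof eventually_elim
    case (elim w)
    thus ?case using s power_mono[of "norm w" s n] by (auto simp: indicator_def)
   qed
  qed (rule i)
  also have "\<dots> = C * s ^ n" by (simp add: C_def)
  finally show "La s \<le> C * s ^ n" .
 qed
 moreover have "C \<ge> 0" by (simp add: C_def)
 ultimately show ?thesis using s0(1) by blast
qed

end

section \<open>L2 bounds uniform in the mollification scale\<close>

declare bsm_measurable [measurable del]

lemma nn_integral_prod_real:
 fixes a :: "'b::euclidean_space \<Rightarrow> ennreal" and c :: "real \<Rightarrow> ennreal"
 assumes [measurable]: "a \<in> BM" "c \<in> BM"
 shows "(NBINT z. a (fst z) * c (snd z)) = (NBINT x. a x) * (NBINT t. c t)"
proof -
 have "(NBINT z. a (fst z) * c (snd z)) = (NBINT x. (NBINT t. a x * c t))" unfolding lborel_prod[symmetric] by (subst lborel.nn_integral_fst[symmetric]) auto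
 also have "\<dots> = (NBINT x. a x) * (NBINT t. c t)" by (simp add: nn_integral_cmult nn_integral_multc)
 finally show ?thesis .
qed

lemma rho_measurable [measurable]: "rho e \<in> BM"
 by (rule bsm_measurable[OF bsm_rho])

lemma Tht_measurable [measurable]: "Tht e \<in> BM"
 by (rule bsm_measurable[OF bsm_Tht])

lemma be_measurable [measurable]: "be e \<in> BM"
 by (rule bsm_measurable[OF bsm_be])

lemma bb_measurable [measurable]: "bb \<in> BM"
 by (rule bsm_measurable[OF bsm_bb])

lemma nn_integral_rho:
 assumes "e > 0"
 shows "(NBINT z. ennreal (rho e (z::'b::euclidean_space \<times> real))) = 1"
proof -
 have "(NBINT z. ennreal (rho e (z::'b \<times> real)))
  = (NBINT (z::'b \<times> real). ennreal (be e (fst z)) * ennreal (bb (snd z / e) / e))"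
  using assms by (intro nn_integral_cong) (simp add: rho_def be_nonneg bb_nonneg flip: ennreal_mult)
 also have "\<dots> = (NBINT x. ennreal (be e (x::'b))) * (NBINT t. ennreal (bb (t / e) / e))" by (rule nn_integral_prod_real) measurable
 finally show ?thesis using assms by (simp add: nn_integral_be nn_integral_bb_scaled)
qed

lemma ennreal_integral_sq_le:
 fixes g h :: "'a \<Rightarrow> real"
 assumes "\<bar>c\<bar> \<le> \<bar>LINT w|M. g w\<bar>" "integrable M g" "\<And>w. w \<in> space M \<Longrightarrow> \<bar>g w\<bar> \<le> h w"
 shows "ennreal (c^2) \<le> (\<integral>\<^sup>+w. ennreal (h w) \<partial>M)^2"
proof -
 have "ennreal \<bar>c\<bar> \<le> ennreal (norm (LINT w|M. g w))" using assms(1) by (intro ennreal_leI) simp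
 also have "\<dots> \<le> (\<integral>\<^sup>+w. ennreal (norm (g w)) \<partial>M)" by (rule integral_norm_bound_ennreal[OF assms(2)])
 also have "\<dots> \<le> (\<integral>\<^sup>+w. ennreal (h w) \<partial>M)" by (intro nn_integral_mono ennreal_leI) (use assms(3) in auto)
 finally have "(ennreal \<bar>c\<bar>)^2 \<le> (\<integral>\<^sup>+w. ennreal (h w) \<partial>M)^2" by (rule power_mono) simp
 thus ?thesis by (simp add: ennreal_power)
qed

text \<open>Young's inequality as the Schur test with both marginals of the kernel equal to
  1.\<close>

lemma conv_L2:
 fixes g K :: "'a::euclidean_space \<Rightarrow> real"
 assumes g: "L1 g" and K: "bsm K" "\<And>z. K z \<ge> 0" "(NBINT z. ennreal (K z)) = 1"
 shows "(NBINT z. ennreal ((conv g K z)^2)) \<le> (NBINT z. ennreal ((g z)^2))"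
proof -
 have [measurable]: "g \<in> BM" "K \<in> BM" using g bsm_measurable[OF K(1)] by auto
 have "(NBINT z. ennreal ((conv g K z)^2))
   \<le> (NBINT z. 1 * (NBINT w. ennreal (\<bar>g w\<bar> * K (fst (z, w) - snd (z, w))))^2)"
 proof (rule nn_integral_mono)
  fix z :: 'a
  show "ennreal ((conv g K z)^2) \<le> 1 * (NBINT w. ennreal (\<bar>g w\<bar> * K (fst (z, w) - snd (z, w))))^2" unfolding mult_1 fst_conv snd_conv
   by (rule ennreal_integral_sq_le[OF _ conv_integrable[OF g K(1), of z]])
     (use K(2) in \<open>auto simp: conv_def abs_mult\<close>)
 qed
 also have "\<dots> \<le> 1 * (NBINT w. 1 * ennreal ((g w)^2))"
 proof (rule schur)
  show "(\<lambda>p. K (fst p - snd p)) \<in> borel_measurable (lborel \<Otimes>\<^sub>M lborel)" by measurable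
  show "(NBINT w. ennreal (K (fst (z, w) - snd (z, w)))) \<le> 1" for z :: 'a using nn_integral_lborel_shift(2)[of "\<lambda>z. ennreal (K z)" z] K(3) by simp
  show "(NBINT z. 1 * ennreal (K (fst (z, w) - snd (z, w)))) \<le> 1" for w :: 'a using nn_integral_lborel_shift(1)[of "\<lambda>z. ennreal (K z)" w] K(3) by simp
 qed (use K(2) in \<open>auto intro: lborel.sigma_finite_measure_axioms\<close>)
 finally show ?thesis by simp
qed

lemma Tht_bound: "e > 0 \<Longrightarrow> \<bar>Tht e z\<bar> \<le> be e (fst z) / 2"
proof -
 assume e: "e > 0"
 have "\<bar>stp ((snd z / e + 1) / 2) - 1 / 2\<bar> \<le> 1 / 2" using stp(4,5)[of "(snd z / e + 1) / 2"] unfolding abs_le_iff by linarith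
 from mult_left_mono[OF this be_nonneg[OF e, of "fst z"]] show ?thesis by (simp add: Tht_def abs_mult be_nonneg[OF e])
qed

context core begin

lemma u_L2: "e > 0 \<Longrightarrow> (NBINT z. ennreal ((u e z)^2)) \<le> (NBINT z. ennreal ((u0 z)^2))"
 unfolding u_def by (rule conv_L2[OF int(1) bsm_rho rho_nonneg nn_integral_rho])

lemma v_L2: "e > 0 \<Longrightarrow> (NBINT z. ennreal ((v e z)^2)) \<le> (NBINT z. ennreal ((v0 z)^2))"
 unfolding v_def by (rule conv_L2[OF int(2) bsm_rho rho_nonneg nn_integral_rho])

text \<open>\<open>Tht\<close> is not integrable in t. Since \<open>v0\<close> is supported in |t|
  \<le> 1 and the claim is restricted to |t| \<le> 1, \<open>Tht\<close> may be replaced by half of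
  \<open>be\<close> on an interval of length 2 in t, a kernel whose two marginals are at most
  1.\<close>

lemma y_L2:
 assumes e: "e > 0"
 shows "(NBINT z. indicator {z. \<bar>snd z\<bar> \<le> 1} z * ennreal ((y e z)^2)) \<le> (NBINT z. ennreal ((v0 z)^2))"
proof -
 define ka' where "ka' p = be e (fst (fst p) - fst (snd p)) * (indicator {- 1..1::real} (snd (snd p)) / 2)"
  for p :: "('b \<times> real) \<times> ('b \<times> real)"
 have out': "v0 w = 0" if "\<bar>snd w\<bar> > 1" for w using that R norm_snd_le[of "snd w" "fst w"] by (intro out(2)) simp
 have ind: "(NBINT t. ennreal (indicator {- 1..1::real} t / 2)) = 1"
 proof -
  have "(NBINT t. ennreal (indicator {- 1..1::real} t / 2)) = (NBINT t. ennreal (1 / 2) * indicator {- 1..1::real} t)"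
   by (intro nn_integral_cong) (auto simp: indicator_def)
  also have "\<dots> = ennreal (1 / 2) * ennreal 2" by (subst nn_integral_cmult_indicator) auto
  also have "\<dots> = 1" by (subst ennreal_mult[symmetric]) auto
  finally show ?thesis .
 qed
 have "(NBINT z. indicator {z. \<bar>snd z\<bar> \<le> 1} z * ennreal ((y e z)^2))
   \<le> (NBINT z. indicator {z. \<bar>snd z\<bar> \<le> 1} z * (NBINT w. ennreal (\<bar>v0 w\<bar> * ka' (z, w)))^2)"
 proof (intro nn_integral_mono mult_left_mono)
  fix z :: "'b \<times> real"
  show "ennreal ((y e z)^2) \<le> (NBINT w. ennreal (\<bar>v0 w\<bar> * ka' (z, w)))^2"
  proof (rule ennreal_integral_sq_le[OF _ conv_integrable[OF int(2) bsm_Tht[of e], of z]])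
   show "\<bar>v0 w * Tht e (z - w)\<bar> \<le> \<bar>v0 w\<bar> * ka' (z, w)" for w
   proof (cases "\<bar>snd w\<bar> > 1")
    case False
    thus ?thesis unfolding abs_mult using Tht_bound[OF e, of "z - w"] by (intro mult_left_mono) (auto simp: ka'_def indicator_def)
   qed (simp add: out')
  qed (simp add: y_def conv_def)
 qed simp
 also have "\<dots> \<le> 1 * (NBINT w. 1 * ennreal ((v0 w)^2))"
 proof (rule schur)
  have [measurable]: "(\<lambda>p :: ('b \<times> real) \<times> ('b \<times> real). be e (fst (fst p) - fst (snd p))) \<in> BM"
   by (intro borel_measurable_continuous_onI continuous_on_compose2[OF bsm_continuous[OF bsm_be]] continuous_intros) auto
  have "(\<lambda>p :: ('b \<times> real) \<times> ('b \<times> real). snd (snd p)) \<in> BM" by (intro borel_measurable_continuous_onI continuous_intros)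
  hence [measurable]: "(\<lambda>p :: ('b \<times> real) \<times> ('b \<times> real). indicator {- 1..1::real} (snd (snd p)) :: real) \<in> BM" by measurable
  show "ka' \<in> borel_measurable (lborel \<Otimes>\<^sub>M lborel)" unfolding ka'_def lborel_prod measurable_lborel2 by measurable
  show "0 \<le> ka' p" for p using e by (simp add: ka'_def be_nonneg)
  show "(NBINT w. ennreal (ka' (z, w))) \<le> 1" for z
  proof -
   have "(NBINT w. ennreal (ka' (z, w))) = (NBINT w. ennreal (be e (fst z - fst w)) * ennreal (indicator {- 1..1::real} (snd w) / 2))"
    using e by (intro nn_integral_cong) (simp add: ka'_def be_nonneg flip: ennreal_mult)
   also have "\<dots> = (NBINT x. ennreal (be e (fst z - x))) * (NBINT t. ennreal (indicator {- 1..1::real} t / 2))" by (rule nn_integral_prod_real) measurable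
   also have "\<dots> = 1" unfolding ind by (simp add: nn_integral_be_shift[OF e])
   finally show ?thesis by simp
  qed
  show "(NBINT z. indicator {z. \<bar>snd z\<bar> \<le> 1} z * ennreal (ka' (z, w))) \<le> 1" for w
  proof -
   have "(NBINT z. indicator {z. \<bar>snd z\<bar> \<le> 1} z * ennreal (ka' (z, w)))
     \<le> (NBINT z. ennreal (be e (fst z - fst w)) * ennreal (indicator {- 1..1::real} (snd z) / 2))"
   proof (rule nn_integral_mono)
    fix z :: "'b \<times> real"
    have "ka' (z, w) \<le> be e (fst z - fst w) * (1 / 2)" using e by (simp add: ka'_def be_nonneg indicator_def)
    thus "indicator {z. \<bar>snd z\<bar> \<le> 1} z * ennreal (ka' (z, w)) \<le> ennreal (be e (fst z - fst w)) * ennreal (indicator {- 1..1::real} (snd z) / 2)"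
     using e by (auto simp: indicator_def be_nonneg abs_le_iff simp flip: ennreal_mult intro!: ennreal_leI)
   qed
   also have "\<dots> = (NBINT x. ennreal (be e (x - fst w))) * (NBINT t. ennreal (indicator {- 1..1::real} t / 2))" by (rule nn_integral_prod_real) measurable
   also have "\<dots> = 1" unfolding ind by (simp add: nn_integral_be_shift[OF e])
   finally show ?thesis .
  qed
  have "{z::'b \<times> real. \<bar>snd z\<bar> \<le> 1} \<in> sets borel" by (intro borel_closed closed_Collect_le continuous_intros)
  thus "(\<lambda>z. indicator {z::'b \<times> real. \<bar>snd z\<bar> \<le> 1} z :: ennreal) \<in> borel_measurable lborel" by simp
 qed (auto intro: lborel.sigma_finite_measure_axioms)
 finally show ?thesis by simp
qed

text \<open>\<open>F\<close> averages f in the tangential variables, and twice |\<open>Tht\<close>|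
  is at most \<open>be\<close>, so the Schur test involves the weight averaged by \<open>be\<close>,
  which \<open>B\<close> dominates. Integration over |t| \<le> s contributes the factor 2 s.\<close>

lemma F_L2:
 fixes om :: "'b \<times> real \<Rightarrow> ennreal" and Om B :: "'b \<Rightarrow> ennreal"
 assumes e: "e > 0" and s: "s \<ge> 0"
  and [measurable]: "om \<in> BM" "Om \<in> BM" "B \<in> BM"
  and om: "\<And>z. om z \<le> indicator {- s..s} (snd z) * Om (fst z)"
  and B: "\<And>x'. (NBINT x. Om x * ennreal (be e (x - x'))) \<le> B x'"
 shows "(NBINT z. om z * ennreal ((F e z)^2)) \<le> (NBINT x. ennreal (2 * s) * B x * ennreal ((f x)^2))"
proof -
 have "(NBINT z. om z * ennreal ((F e z)^2))
   \<le> (NBINT z. om z * (NBINT x. ennreal (\<bar>f x\<bar> * be e (fst (fst (z, x)) - snd (z, x))))^2)"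
 proof (intro nn_integral_mono mult_left_mono)
  fix z :: "'b \<times> real"
  have "(\<lambda>x. Tht e (fst z - x, snd z)) \<in> borel_measurable lborel" by measurable
  moreover obtain M where "\<And>z. \<bar>Tht e (z::'b \<times> real)\<bar> \<le> M" by (rule bsm_bounded[OF bsm_Tht]) blast
  ultimately have i: "L1 (\<lambda>x. (-2) * (f x * Tht e (fst z - x, snd z)))" by (intro integrable_mult_right integrable_mult_bounded[OF int(4)])
  show "ennreal ((F e z)^2) \<le> (NBINT x. ennreal (\<bar>f x\<bar> * be e (fst (fst (z, x)) - snd (z, x))))^2"
  proof (rule ennreal_integral_sq_le[OF _ i])
   show "\<bar>F e z\<bar> \<le> \<bar>LBINT x. - 2 * (f x * Tht e (fst z - x, snd z))\<bar>" by (simp add: F_def)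
   show "\<bar>- 2 * (f x * Tht e (fst z - x, snd z))\<bar> \<le> \<bar>f x\<bar> * be e (fst (fst (z, x)) - snd (z, x))" for x
    using mult_left_mono[OF Tht_bound[OF e, of "(fst z - x, snd z)"] abs_ge_zero[of "f x"]] by (simp add: abs_mult)
  qed
 qed simp
 also have "\<dots> \<le> 1 * (NBINT x. (ennreal (2 * s) * B x) * ennreal ((f x)^2))"
 proof (rule schur)
  show "(\<lambda>p :: ('b \<times> real) \<times> 'b. be e (fst (fst p) - snd p)) \<in> borel_measurable (lborel \<Otimes>\<^sub>M lborel)"
   unfolding lborel_prod measurable_lborel2 by (intro borel_measurable_continuous_onI continuous_on_compose2[OF bsm_continuous[OF bsm_be]] continuous_intros) auto
  show "0 \<le> be e (fst (fst p) - snd p)" for p :: "('b \<times> real) \<times> 'b" using e by (simp add: be_nonneg)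
  show "(NBINT x. ennreal (be e (fst (fst (z, x)) - snd (z, x)))) \<le> 1" for z :: "'b \<times> real" by (simp add: nn_integral_be_shift[OF e])
  show "(NBINT z. om z * ennreal (be e (fst (fst (z, x)) - snd (z, x)))) \<le> ennreal (2 * s) * B x" for x
  proof -
   have "(NBINT z. om z * ennreal (be e (fst (fst (z, x)) - snd (z, x))))
    \<le> (NBINT z. (Om (fst z) * ennreal (be e (fst z - x))) * indicator {- s..s} (snd z))"
   proof (rule nn_integral_mono)
    fix z
    from mult_right_mono[OF om[of z], of "ennreal (be e (fst z - x))"]
    show "om z * ennreal (be e (fst (fst (z, x)) - snd (z, x))) \<le> (Om (fst z) * ennreal (be e (fst z - x))) * indicator {- s..s} (snd z)" by (simp add: mult_ac)
   qed
   also have "\<dots> = (NBINT x'. Om x' * ennreal (be e (x' - x))) * (NBINT t. indicator {- s..s} t)" by (rule nn_integral_prod_real) measurable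
   also have "\<dots> \<le> B x * ennreal (2 * s)" using s by (intro mult_mono B) auto
   finally show ?thesis by (simp add: mult.commute)
  qed
 qed (auto intro: lborel.sigma_finite_measure_axioms)
 finally show ?thesis by (simp add: mult_ac)
qed

end

section \<open>Convergence of the mollified trace\<close>

definition kap :: "real \<Rightarrow> real \<Rightarrow> real" where
 "kap e t = 2 * (1 - stp ((t / e + 1) / 2)) * stp (t / e + 2)"

lemma bsm_kap: "bsm (kap e)"
proof -
 have "bsm (\<lambda>t. stp ((1 / (2 * e)) *\<^sub>R t + 1 / 2))" by (intro bsm_scale stp(1))
 moreover have "bsm (\<lambda>t. stp ((1 / e) *\<^sub>R t + 2))" by (intro bsm_scale stp(1))
 ultimately have "bsm (\<lambda>t. 2 * (1 - stp ((1 / (2 * e)) *\<^sub>R t + 1 / 2)) * stp ((1 / e) *\<^sub>R t + 2))" by (intro bsm_mult bsm_diff bsm_const)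
 thus ?thesis by (simp add: kap_def[abs_def] add_divide_distrib mult.commute)
qed

lemma kap_0: "e > 0 \<Longrightarrow> kap e 0 = 1"
proof -
 have "stp (1 / 2) = 1 / 2" using stp(6)[of "1 / 2"] by simp
 thus ?thesis by (simp add: kap_def stp)
qed

lemma kap_bounds: "0 \<le> kap e t" "kap e t \<le> 2"
proof -
 have "(1 - stp ((t / e + 1) / 2)) * stp (t / e + 2) \<le> 1"
  using mult_mono[of "1 - stp ((t / e + 1) / 2)" 1 "stp (t / e + 2)" 1] stp(4,5)[of "(t / e + 1) / 2"] stp(4,5)[of "t / e + 2"] by simp
 thus "kap e t \<le> 2" unfolding kap_def mult.assoc by linarith
 show "0 \<le> kap e t" using stp(4,5) by (simp add: kap_def)
qed

lemma kap_zero: "e > 0 \<Longrightarrow> t \<ge> e \<or> t \<le> - 2 * e \<Longrightarrow> kap e t = 0"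
proof -
 assume e: "e > 0" and t: "t \<ge> e \<or> t \<le> - 2 * e"
 have "(t / e + 1) / 2 \<ge> 1 \<or> t / e + 2 \<le> 0" using e t by (auto simp: field_simps)
 thus ?thesis by (auto simp: kap_def stp)
qed

lemma kap_deriv:
 assumes "e > 0" "t > 0" shows "(kap e has_real_derivative - (2 * bb (t / e) / e)) (at t)"
proof -
 have "((\<lambda>t. stp ((t / e + 1) / 2)) has_real_derivative bb (t / e) * (1 / e)) (at t)"
  by (rule DERIV_chain2[OF bb_deriv]) (use assms in \<open>auto intro!: derivative_eq_intros\<close>)
 from DERIV_cmult[OF DERIV_diff[OF DERIV_const this], of 2 1]
 have "((\<lambda>t. 2 * (1 - stp ((t / e + 1) / 2))) has_real_derivative - (2 * bb (t / e) / e)) (at t)" by simp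
 thus ?thesis
 proof (rule has_field_derivative_transform_within_open[of _ _ _ "{0<..}"])
  show "2 * (1 - stp ((s / e + 1) / 2)) = kap e s" if "s \<in> {0<..}" for s using that assms by (simp add: kap_def stp)
 qed (use assms in auto)
qed

lemma integral_even_half:
 fixes g :: "'b::euclidean_space \<times> real \<Rightarrow> real"
 assumes g: "L1 g" and e: "\<And>z. g (rfl z) = g z"
 shows "2 * (LBINT z. indicator upper z * g z) = (LBINT z. g z)"
proof -
 have [measurable]: "g \<in> BM" using g by auto
 have op: "upper \<in> sets borel" "{z::'b \<times> real. snd z < 0} \<in> sets borel" by (intro borel_open open_Collect_less continuous_intros)+
 have i: "L1 (\<lambda>z. indicator upper z * g z)" "L1 (\<lambda>z. indicator {z. snd z < 0} z * g z)" using integrable_mult_indicator[OF _ g] op by auto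
 have "(LBINT z. indicator upper (rfl z) * g (rfl z)) = (LBINT z. indicator upper z * g z)"
  by (rule integral_rfl(1)[of "\<lambda>z. indicator upper z * g z"]) (use op in measurable)
 moreover have "indicator upper (rfl z) * g (rfl z) = indicator {z. snd z < 0} z * g z" for z by (simp add: e) (auto simp: rfl_def indicator_def)
 ultimately have "2 * (LBINT z. indicator upper z * g z)
   = (LBINT z. indicator upper z * g z + indicator {z. snd z < 0} z * g z)"
  using i by simp
 also have "\<dots> = (LBINT z. g z)"
 proof (rule integral_cong_AE)
  have "negligible {z. (0::'b, 1::real) \<bullet> z = 0}" by (rule negligible_hyperplane) (simp add: zero_prod_def)
  hence "AE z in lebesgue. z \<notin> {z. (0::'b, 1::real) \<bullet> z = 0}" by (intro AE_not_in) (simp add: negligible_iff_null_sets)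
  hence "AE z in lborel. (0::'b, 1::real) \<bullet> z \<noteq> 0" by (simp add: AE_completion_iff)
  thus "AE z in lborel. indicator upper z * g z + indicator {z. snd z < 0} z * g z = g z" by eventually_elim (auto simp: indicator_def inner_prod_def)
 qed (use i g in auto)
 finally show ?thesis .
qed

context core begin

text \<open>Green's formula tested with \<open>be e (x - fst w) * kap e (snd w)\<close>. The profile
  \<open>kap\<close> is 1 at t = 0, has derivative \<open>- 2 * bb (t / e) / e\<close> for t > 0 and
  is cut off for t \<le> -2 e to give compact support. The \<open>u0\<close> term is thus twice the
  mollification over the upper half, which is \<open>u e (x, 0)\<close> because \<open>u0\<close> is
  even; the term with \<open>G\<close> is the error.\<close>

lemma trace_identity:
 assumes e: "e > 0" and x: "norm x + (k + 1) * e < R"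
 shows "u e (x, 0) - conv T0 (be e) x
   = (LINT w|lborel. indicator upper w * (G w * (be e (x - fst w) * kap e (snd w))))"
proof -
 define qs where "qs w = be e (x - fst w) * kap e (snd w)" for w
 have b1: "bsm (\<lambda>w::'b \<times> real. be e (x - fst w))" by (intro bsm_comp_fst bsm_neg bsm_be)
 have b2: "bsm (\<lambda>w::'b \<times> real. kap e (snd w))" by (intro bsm_comp_snd bsm_kap)
 have b: "bsm qs" unfolding qs_def by (intro bsm_mult b1 b2)
 have z: "qs w = 0" if w: "norm w > norm x + (k + 1) * e" for w
 proof -
  have "norm w \<le> norm (fst w) + \<bar>snd w\<bar>" using norm_Pair_le[of "fst w" "snd w"] by simp
  moreover have "norm (fst w) \<le> norm x + norm (x - fst w)" using norm_triangle_ineq2[of "fst w" x] by (simp add: norm_minus_commute)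
  moreover have "(k + 1) * e = e * real DIM('b) + 2 * e" by (simp add: k_def ka_def algebra_simps)
  ultimately have "norm (x - fst w) > e * real DIM('b) \<or> \<bar>snd w\<bar> > 2 * e" using w by linarith
  moreover have "kap e (snd w) = 0" if "\<bar>snd w\<bar> > 2 * e" using that e by (intro kap_zero) auto
  ultimately show ?thesis using be_zero[OF e, of "x - fst w"] by (auto simp: qs_def)
 qed
 have t: "tst (ball 0 R) qs" unfolding tst_def using b z x by (intro conjI exI[of _ "cball 0 (norm x + (k + 1) * e)"]) auto
 have pd: "pd (0, 1) qs w = - 2 * rho e ((x, 0) - w)" if "snd w > 0" for w
 proof -
  have "((\<lambda>s. qs (w + s *\<^sub>R (0, 1))) has_real_derivative be e (x - fst w) * - (2 * bb (snd w / e) / e)) (at 0)"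
  proof -
   have "((\<lambda>s. kap e (snd w + s)) has_real_derivative - (2 * bb (snd w / e) / e) * 1) (at 0)"
    by (rule DERIV_chain2[where f = "kap e" and g = "\<lambda>s. snd w + s"])
      (use kap_deriv[OF e that] in \<open>auto intro!: derivative_eq_intros\<close>)
   from DERIV_cmult[OF this, of "be e (x - fst w)"] show ?thesis by (simp add: qs_def)
  qed
  moreover have "((\<lambda>s. qs (w + s *\<^sub>R (0, 1))) has_real_derivative pd (0, 1) qs w) (at 0)"
   using bsm_slice[OF b Basis_01, of w 0] by (simp flip: zero_prod_def)
  ultimately have "pd (0, 1) qs w = be e (x - fst w) * - (2 * bb (snd w / e) / e)" by (rule DERIV_unique[rotated])
  thus ?thesis by (simp add: rho_def bb_even)
 qed
 have op: "upper \<in> sets borel" by (intro borel_open open_Collect_less continuous_intros)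
 have iG: "L1 (\<lambda>w. indicator upper w * (G w * qs w))"
 proof -
  have "L1 (\<lambda>w. (G w)^2 + (qs w)^2)"
  proof (intro Bochner_Integration.integrable_add sq(3))
   show "L1 (\<lambda>w. (qs w)^2)"
   proof (rule integrable_continuous_vanishing[of _ "norm x + (k + 1) * e + 1"])
    show "continuous_on UNIV (\<lambda>w. (qs w)^2)" by (rule continuous_on_power[OF bsm_continuous[OF b]])
    show "(qs w)^2 = 0" if "norm w \<ge> norm x + (k + 1) * e + 1" for w using z[of w] that by simp
   qed
  qed
  hence "L1 (\<lambda>w. G w * qs w)"
  proof (rule Bochner_Integration.integrable_bound)
   show "(\<lambda>w. G w * qs w) \<in> borel_measurable lborel" using bsm_measurable[OF b] by simp
   show "AE w in lborel. norm (G w * qs w) \<le> norm ((G w)^2 + (qs w)^2)"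
   proof (rule AE_I2)
    fix w
    have "2 * \<bar>G w\<bar> * \<bar>qs w\<bar> \<le> \<bar>G w\<bar>^2 + \<bar>qs w\<bar>^2" by (rule sum_squares_bound)
    moreover have "0 \<le> \<bar>G w\<bar> * \<bar>qs w\<bar>" by simp
    ultimately have "\<bar>G w\<bar> * \<bar>qs w\<bar> \<le> (G w)^2 + (qs w)^2" unfolding power2_abs by linarith
    thus "norm (G w * qs w) \<le> norm ((G w)^2 + (qs w)^2)" by (simp add: abs_mult)
   qed
  qed
  thus ?thesis using integrable_mult_indicator[of "upper" lborel "\<lambda>w. G w * qs w"] op by simp
 qed
 have iu: "L1 (\<lambda>w. u0 w * rho e ((x, 0) - w))" by (rule conv_integrable[OF int(1) bsm_rho])
 have ih: "L1 (\<lambda>w. indicator upper w * (u0 w * rho e ((x, 0) - w)))" using integrable_mult_indicator[OF _ iu, of "upper"] op by simp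
 have h: "2 * (LINT w|lborel. indicator upper w * (u0 w * rho e ((x, 0) - w))) = u e (x, 0)" unfolding u_def conv_def
 proof (rule integral_even_half[OF iu])
  fix w :: "'b \<times> real"
  show "u0 (rfl w) * rho e ((x, 0) - rfl w) = u0 w * rho e ((x, 0) - w)" unfolding even(1) by (simp add: rho_def rfl_def bb_even)
 qed
 have "conv T0 (be e) x = (LINT x'|lborel. T0 x' * qs (x', 0))" by (simp add: conv_def qs_def kap_0 e)
 also have "\<dots> = - (LINT w|lborel. indicator upper w * (G w * qs w + u0 w * pd (0, 1) qs w))" by (rule trace[OF t])
 also have "(LINT w|lborel. indicator upper w * (G w * qs w + u0 w * pd (0, 1) qs w))
  = (LINT w|lborel. indicator upper w * (G w * qs w) + (- 2) * (indicator upper w * (u0 w * rho e ((x, 0) - w))))"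
  by (intro Bochner_Integration.integral_cong refl) (simp add: pd indicator_def algebra_simps)
 also have "\<dots> = (LINT w|lborel. indicator upper w * (G w * qs w)) + (- 2) * (LINT w|lborel. indicator upper w * (u0 w * rho e ((x, 0) - w)))"
  using iG ih by (subst Bochner_Integration.integral_add) simp_all
 finally show ?thesis using h by (simp add: qs_def)
qed

text \<open>The kernel lives in the strip 0 \<le> t \<le> e, whose width makes one marginal at most
  2 e, while the other is at most 2. In the L2 norm the error is therefore of the order of the
  square root of e.\<close>

lemma trace_error_L2:
 assumes e: "e > 0"
 shows "(NBINT x. ennreal ((LINT w|lborel. indicator upper w * (G w * (be e (x - fst w) * kap e (snd w))))^2))
   \<le> ennreal (4 * e) * (NBINT w. ennreal ((G w)^2))"
proof -
 define K where "K p = be e (fst p - fst (snd p)) * (2 * indicator {0..e} (snd (snd p)))" for p :: "'b \<times> ('b \<times> real)"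
 define E where "E x = (LINT w|lborel. indicator upper w * (G w * (be e (x - fst w) * kap e (snd w))))" for x
 have "(NBINT x. ennreal ((E x)^2)) \<le> (NBINT x. 1 * (NBINT w. ennreal (\<bar>G w\<bar> * K (x, w)))^2)"
 proof (rule nn_integral_mono)
  fix x :: 'b
  have le: "\<bar>indicator upper w * (G w * (be e (x - fst w) * kap e (snd w)))\<bar> \<le> \<bar>G w\<bar> * K (x, w)" for w
  proof (cases "0 < snd w \<and> snd w < e")
   case True
   thus ?thesis using kap_bounds[of e "snd w"] be_nonneg[OF e, of "x - fst w"] by (simp add: K_def abs_mult mult_left_mono)
  next
   case False
   hence "snd w \<le> 0 \<or> kap e (snd w) = 0" using kap_zero[OF e, of "snd w"] by auto
   hence zero: "indicator upper w * (G w * (be e (x - fst w) * kap e (snd w))) = 0" by auto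
   have "0 \<le> \<bar>G w\<bar> * K (x, w)" using be_nonneg[OF e, of "x - fst w"] by (auto simp: K_def indicator_def)
   thus ?thesis unfolding zero by simp
  qed
  show "ennreal ((E x)^2) \<le> 1 * (NBINT w. ennreal (\<bar>G w\<bar> * K (x, w)))^2"
  \<comment> \<open>Without integrability the Bochner integral has the default value 0, and the
    bound is trivial.\<close>
  proof (cases "L1 (\<lambda>w. indicator upper w * (G w * (be e (x - fst w) * kap e (snd w))))")
   case True
   show ?thesis unfolding mult_1 by (rule ennreal_integral_sq_le[OF _ True le]) (simp add: E_def)
  next
   case False
   hence "E x = 0" unfolding E_def by (rule not_integrable_integral_eq)
   thus ?thesis by simp
  qed
 qed
 also have "\<dots> \<le> ennreal (2 * e) * (NBINT w. ennreal 2 * ennreal ((G w)^2))"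
 proof (rule schur)
  have [measurable]: "(\<lambda>p :: 'b \<times> ('b \<times> real). be e (fst p - fst (snd p))) \<in> BM"
   by (intro borel_measurable_continuous_onI continuous_on_compose2[OF bsm_continuous[OF bsm_be]] continuous_intros) auto
  have "(\<lambda>p :: 'b \<times> ('b \<times> real). snd (snd p)) \<in> BM" by (intro borel_measurable_continuous_onI continuous_intros)
  hence [measurable]: "(\<lambda>p :: 'b \<times> ('b \<times> real). indicator {0..e} (snd (snd p)) :: real) \<in> BM" by measurable
  show "K \<in> borel_measurable (lborel \<Otimes>\<^sub>M lborel)" unfolding K_def lborel_prod measurable_lborel2 by measurable
  show "0 \<le> K p" for p using be_nonneg[OF e] by (auto simp: K_def indicator_def)
  have ind: "(NBINT t. ennreal (2 * indicator {0..e} t)) = ennreal (2 * e)"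
  proof -
   have "(NBINT t. ennreal (2 * indicator {0..e} t)) = (NBINT t. ennreal 2 * indicator {0..e} t)" by (intro nn_integral_cong) (auto simp: indicator_def)
   also have "\<dots> = ennreal 2 * ennreal e" using e by (subst nn_integral_cmult_indicator) auto
   also have "\<dots> = ennreal (2 * e)" using e by (simp add: ennreal_mult)
   finally show ?thesis .
  qed
  show "(NBINT w. ennreal (K (x, w))) \<le> ennreal (2 * e)" for x
  proof -
   have "(NBINT w. ennreal (K (x, w))) = (NBINT w. ennreal (be e (x - fst w)) * ennreal (2 * indicator {0..e} (snd w)))"
    using e by (intro nn_integral_cong) (simp add: K_def be_nonneg flip: ennreal_mult)
   also have "\<dots> = (NBINT x'. ennreal (be e (x - x'))) * (NBINT t. ennreal (2 * indicator {0..e} t))" by (rule nn_integral_prod_real) measurable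
   finally show ?thesis unfolding ind by (simp add: nn_integral_be_shift[OF e])
  qed
  show "(NBINT x. 1 * ennreal (K (x, w))) \<le> ennreal 2" for w
  proof -
   have "(NBINT x. 1 * ennreal (K (x, w))) \<le> (NBINT x. ennreal 2 * ennreal (be e (x - fst w)))"
   proof (rule nn_integral_mono)
    fix x
    have "K (x, w) \<le> 2 * be e (x - fst w)" using be_nonneg[OF e, of "x - fst w"] by (simp add: K_def indicator_def)
    thus "1 * ennreal (K (x, w)) \<le> ennreal 2 * ennreal (be e (x - fst w))" by (subst ennreal_mult[symmetric]) (auto simp: be_nonneg[OF e] intro: ennreal_leI)
   qed
   also have "\<dots> = ennreal 2 * (NBINT x. ennreal (be e (x - fst w)))" by (rule nn_integral_cmult) measurable
   finally show ?thesis by (simp add: nn_integral_be_shift[OF e])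
  qed
 qed (auto intro: lborel.sigma_finite_measure_axioms)
 also have "\<dots> = ennreal (2 * e) * (ennreal 2 * (NBINT w. ennreal ((G w)^2)))" by (subst nn_integral_cmult) auto
 also have "\<dots> = ennreal (4 * e) * (NBINT w. ennreal ((G w)^2))"
 proof -
  have "ennreal (2 * e) * ennreal 2 = ennreal (4 * e)" using e by (subst ennreal_mult[symmetric]) auto
  thus ?thesis by (simp only: mult.assoc[symmetric])
 qed
 finally show ?thesis by (simp only: E_def)
qed

text \<open>The difference is split into the strip error of \<open>trace_identity\<close>, the
  mollified and the plain approximation error r, and the mollification error of a continuous
  function, controlled by uniform continuity. The square of a sum of four terms costs a factor 4,
  whence the shares et / 16 and et / 32.\<close>

lemma trace_L2:
 assumes R': "R' < R" and et: "et > 0"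
 shows "\<exists>e0>0. \<forall>e. 0 < e \<longrightarrow> e < e0 \<longrightarrow>
   (NBINT x. indicator (ball 0 R') x * ennreal ((u e (x, 0) - T0 x)^2)) \<le> ennreal et"
proof -
 obtain q where q: "continuous_on UNIV q"
  "(NBINT x. ennreal (indicator (ball 0 R) x * (T0 x - q x)^2)) \<le> ennreal (et / 32)"
  using T0_approx[of "et / 32"] et by auto
 define q' where "q' x = indicator (ball 0 R) x * q x" for x
 have [measurable]: "q \<in> BM" using q(1) by (simp add: borel_measurable_continuous_onI)
 have iq: "L1 q'"
 proof -
  have "L1 (\<lambda>x. indicator (cball 0 R) x *\<^sub>R q x)" by (rule borel_integrable_compact) (auto intro: continuous_on_subset[OF q(1)])
  from integrable_mult_indicator[OF _ this, of "ball 0 R"] show ?thesis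
   unfolding q'_def by (rule Bochner_Integration.integrable_cong[THEN iffD1, rotated 2]) (auto simp: indicator_def)
 qed
 define r where "r x = T0 x - q' x" for x
 have r_eq: "(r x)^2 = indicator (ball 0 R) x * (T0 x - q x)^2" for x using out(3)[of x] by (auto simp: r_def q'_def indicator_def)
 have ir: "L1 r" unfolding r_def using int(3) iq by auto
 have r2: "(NBINT x. ennreal ((r x)^2)) \<le> ennreal (et / 32)" unfolding r_eq by (rule q(2))
 define vol where "vol = measure lborel (ball (0::'b) R')"
 have emv: "emeasure lborel (ball (0::'b) R') = ennreal vol"
  unfolding vol_def by (intro emeasure_eq_ennreal_measure) (use emeasure_bounded_finite[OF bounded_ball] in \<open>auto simp: less_top\<close>)
 define th where "th = sqrt (et / (16 * (vol + 1)))"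
 have vol: "vol \<ge> 0" by (simp add: vol_def)
 have th: "th > 0" "th^2 * vol \<le> et / 16" using vol et by (auto simp: th_def field_simps)
 have "uniformly_continuous_on (cball 0 R) q" by (intro compact_uniformly_continuous continuous_on_subset[OF q(1)]) auto
 then obtain d where d: "d > 0" "\<And>x x'. x \<in> cball 0 R \<Longrightarrow> x' \<in> cball 0 R \<Longrightarrow> dist x' x < d \<Longrightarrow> dist (q x') (q x) < th"
  using th(1) unfolding uniformly_continuous_on_def by metis
 define Gs where "Gs = (LINT w|lborel. (G w)^2)"
 have Gs: "(NBINT w. ennreal ((G w)^2)) = ennreal Gs" "Gs \<ge> 0" unfolding Gs_def by (auto intro!: nn_integral_eq_integral sq(3) Bochner_Integration.integral_nonneg)
 \<comment> \<open>The three bounds keep the mollification within the uniform continuity distance d,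
   within the margin R - R', and make the strip error 4 e Gs at most et / 16.\<close>
 define e0 where "e0 = min (min (d / (k + 1)) ((R - R') / (k + 1))) (et / (64 * (Gs + 1)))"
 have e0: "e0 > 0" using d(1) k R' et Gs(2) by (simp add: e0_def)
 show ?thesis
 proof (intro exI[of _ e0] conjI allI impI e0)
  fix e assume e: "0 < e" "e < e0"
  have ke: "(k + 1) * e < d" "(k + 1) * e < R - R'" and Ge: "4 * e * Gs \<le> et / 16"
  proof -
   have "e < d / (k + 1)" "e < (R - R') / (k + 1)" "e < et / (64 * (Gs + 1))" using e by (auto simp: e0_def)
   thus "(k + 1) * e < d" "(k + 1) * e < R - R'" using k by (auto simp: field_simps)
   have "e * (64 * (Gs + 1)) \<le> et" using \<open>e < et / (64 * (Gs + 1))\<close> Gs(2) by (simp add: field_simps)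
   thus "4 * e * Gs \<le> et / 16" using e(1) by (simp add: algebra_simps)
  qed
  define E where "E x = (LINT w|lborel. indicator upper w * (G w * (be e (x - fst w) * kap e (snd w))))" for x
  define E' where "E' x = indicator (ball 0 R') x * (u e (x, 0) - conv T0 (be e) x)" for x
  have E': "(E' x)^2 \<le> (E x)^2" for x
  proof (cases "x \<in> ball 0 R'")
   case True
   have "norm x + (k + 1) * e < R" using True ke by simp
   from trace_identity[OF e(1) this] have "u e (x, 0) - conv T0 (be e) x = E x" by (simp only: E_def)
   with True show ?thesis by (simp add: E'_def)
  qed (simp add: E'_def)
  have near: "\<bar>conv q' (be e) x - q' x\<bar> \<le> th" if x: "x \<in> ball 0 R'" for x
  proof -
   have b: "L1 (\<lambda>x'. q' x' * be e (x - x'))" by (rule conv_integrable[OF iq bsm_be])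
   have ib: "L1 (\<lambda>x'. be e (x - x'))" "(LINT x'|lborel. be e (x - x')) = 1"
   proof -
    show "L1 (\<lambda>x'. be e (x - x'))" by (intro integrableI_bounded) (simp_all add: be_nonneg e nn_integral_be_shift[OF e(1)])
    show "(LINT x'|lborel. be e (x - x')) = 1" by (subst integral_eq_nn_integral) (auto simp: be_nonneg e nn_integral_be_shift[OF e(1)])
   qed
   have "conv q' (be e) x - q' x = (LINT x'|lborel. q' x' * be e (x - x') - q' x * be e (x - x'))" using b ib by (simp add: conv_def)
   hence "\<bar>conv q' (be e) x - q' x\<bar> = \<bar>LINT x'|lborel. q' x' * be e (x - x') - q' x * be e (x - x')\<bar>" by simp
   also have "\<dots> \<le> (LINT x'|lborel. \<bar>q' x' * be e (x - x') - q' x * be e (x - x')\<bar>)" by (rule integral_abs_bound)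
   also have "\<dots> \<le> (LINT x'|lborel. th * be e (x - x'))"
   proof (rule integral_mono)
    show "\<bar>q' x' * be e (x - x') - q' x * be e (x - x')\<bar> \<le> th * be e (x - x')" for x'
    proof (cases "norm (x - x') > e * real DIM('b)")
     case True
     thus ?thesis using be_zero[OF e(1) True] by simp
    next
     case False
     have 1: "e * real DIM('b) \<le> (k + 1) * e" using e(1) by (simp add: k_def ka_def algebra_simps)
     hence "norm x' < R" "norm x < R" "dist x' x < d" using False x ke R' norm_triangle_sub[of x' x] by (auto simp: dist_norm norm_minus_commute)
     hence "\<bar>q' x' - q' x\<bar> \<le> th" using d(2)[of x x'] by (simp add: q'_def dist_real_def)
     from mult_right_mono[OF this be_nonneg[OF e(1), of "x - x'"]] show ?thesis by (simp add: abs_mult be_nonneg[OF e(1)] flip: left_diff_distrib)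
    qed
   qed (use b ib in auto)
   finally show ?thesis using ib by simp
  qed
  let ?A = "\<lambda>x. ennreal ((E' x)^2)" and ?B = "\<lambda>x. ennreal ((conv r (be e) x)^2)"
  let ?C = "\<lambda>x::'b. ennreal (th^2) * indicator (ball 0 R') x" and ?D = "\<lambda>x. ennreal ((r x)^2)"
  have pt: "indicator (ball 0 R') x * ennreal ((u e (x, 0) - T0 x)^2) \<le> 4 * (?A x + (?B x + (?C x + ?D x)))" for x
  proof (cases "x \<in> ball 0 R'")
   case True
   have "u e (x, 0) - conv T0 (be e) x = E' x" using True by (simp add: E'_def)
   moreover have "conv T0 (be e) x = conv r (be e) x + conv q' (be e) x"
   proof -
    have "conv r (be e) x + conv q' (be e) x = (LINT w|lborel. r w * be e (x - w) + q' w * be e (x - w))"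
     unfolding conv_def by (rule Bochner_Integration.integral_add[symmetric]; rule conv_integrable[OF _ bsm_be]; fact)
    thus ?thesis by (simp add: r_def conv_def left_diff_distrib)
   qed
   ultimately have eq: "u e (x, 0) - T0 x = E' x + conv r (be e) x + (conv q' (be e) x - q' x) - r x" by (simp add: r_def)
   have "(conv q' (be e) x - q' x)^2 \<le> th^2" using near[OF True] th(1) by (metis abs_le_square_iff abs_of_pos)
   moreover have "(a + b + c - d)^2 \<le> 4 * a^2 + 4 * b^2 + 4 * c^2 + 4 * d^2" for a b c d :: real
   proof -
    have "4 * a^2 + 4 * b^2 + 4 * c^2 + 4 * d^2 - (a + b + c - d)^2
     = (a - b)^2 + (a - c)^2 + (a + d)^2 + (b - c)^2 + (b + d)^2 + (c + d)^2"
     by (simp add: power2_eq_square algebra_simps)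
    thus ?thesis by (smt (verit) zero_le_power2)
   qed
   ultimately have "(u e (x, 0) - T0 x)^2 \<le> 4 * ((E' x)^2 + ((conv r (be e) x)^2 + (th^2 + (r x)^2)))" unfolding eq by (smt (verit))
   from ennreal_leI[OF this] True show ?thesis by (simp add: ennreal_mult)
  qed simp
  have Em: "E' \<in> BM"
  proof -
   have "(\<lambda>x::'b. u e (x, 0)) \<in> BM" by (intro borel_measurable_continuous_onI continuous_on_compose2[OF bsm_continuous[OF bsm_uvy(1)]] continuous_intros) auto
   moreover have "conv T0 (be e) \<in> BM" by (rule bsm_measurable[OF bsm_conv[OF int(3) bsm_be]])
   ultimately show ?thesis unfolding E'_def by (intro borel_measurable_times borel_measurable_diff borel_measurable_indicator) auto
  qed
  have cm: "conv r (be e) \<in> BM" by (rule bsm_measurable[OF bsm_conv[OF ir bsm_be]])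
  have rm: "r \<in> BM" using borel_measurable_integrable[OF ir] by simp
  have "?C \<in> BM" by (intro borel_measurable_times_ennreal borel_measurable_indicator) auto
  note [measurable] = this Em cm rm
  have "(NBINT x. indicator (ball 0 R') x * ennreal ((u e (x, 0) - T0 x)^2)) \<le> (NBINT x. 4 * (?A x + (?B x + (?C x + ?D x))))" by (intro nn_integral_mono pt)
  also have "\<dots> = 4 * ((NBINT x. ?A x) + ((NBINT x. ?B x) + (ennreal (th^2) * ennreal vol + (NBINT x. ?D x))))"
   by (subst nn_integral_cmult, measurable, (subst nn_integral_add, measurable)+, simp add: nn_integral_cmult_indicator emv)
  also have "\<dots> \<le> 4 * (ennreal (4 * e) * ennreal Gs + (ennreal (et / 32) + (ennreal (th^2) * ennreal vol + ennreal (et / 32))))"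
  proof (intro add_mono mult_left_mono order_refl r2)
   have "(NBINT x. ?A x) \<le> (NBINT x. ennreal ((E x)^2))" by (intro nn_integral_mono ennreal_leI E')
   also have "\<dots> \<le> ennreal (4 * e) * ennreal Gs" using trace_error_L2[OF e(1)] unfolding Gs E_def .
   finally show "(NBINT x. ?A x) \<le> ennreal (4 * e) * ennreal Gs" .
   show "(NBINT x. ?B x) \<le> ennreal (et / 32)" using conv_L2[OF ir bsm_be be_nonneg nn_integral_be] e r2 by (meson order_trans)
  qed auto
  also have "\<dots> = ennreal (4 * (4 * e * Gs + (et / 32 + (th^2 * vol + et / 32))))"
  proof -
   have "4 * (ennreal a + (ennreal b + (ennreal c + ennreal b))) = ennreal (4 * (a + (b + (c + b))))"
    if "0 \<le> a" "0 \<le> b" "0 \<le> c" for a b c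
    using that ennreal_mult[of 4 "a + (b + (c + b))"] by (simp flip: ennreal_plus)
   moreover have "ennreal (4 * e) * ennreal Gs = ennreal (4 * e * Gs)" "ennreal (th^2) * ennreal vol = ennreal (th^2 * vol)"
    using e(1) Gs(2) vol by (intro ennreal_mult[symmetric]; simp)+
   ultimately show ?thesis using e(1) Gs(2) vol et by simp
  qed
  also have "\<dots> \<le> ennreal et"
  proof (rule ennreal_leI)
   have "4 * (a + (h / 32 + (b + h / 32))) \<le> h" if "a \<le> h / 16" "b \<le> h / 16" "0 < h" for a b h :: real using that by argo
   from this[OF Ge th(2) et] show "4 * (4 * e * Gs + (et / 32 + (th^2 * vol + et / 32))) \<le> et" .
  qed
  finally show "(NBINT x. indicator (ball 0 R') x * ennreal ((u e (x, 0) - T0 x)^2)) \<le> ennreal et" .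
 qed
qed

lemma u_small:
 assumes AE: "AE z in lborel. norm z < rh0 \<longrightarrow> \<bar>u0 z\<bar> \<le> norm z ^ n"
  and e: "e > 0" "k * e \<le> norm x" and x: "2 * norm x < rh0"
 shows "\<bar>u e (x, 0)\<bar> \<le> (2 * norm x) ^ n"
proof -
 have ib: "L1 (\<lambda>w. rho e ((x, 0) - w))" "(LINT w|lborel. rho e ((x, 0) - w)) = 1"
 proof -
  have "(NBINT w. ennreal (rho e ((x, 0) - w))) = 1"
   using nn_integral_lborel_shift(2)[of "\<lambda>z. ennreal (rho e z)" "(x, 0)"] nn_integral_rho[OF e(1), where 'b = 'b] by simp
  moreover define h where "h w = rho e ((x, 0) - w)" for w
  moreover have "h w \<ge> 0" for w unfolding h_def by (rule rho_nonneg[OF e(1)])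
  moreover have [measurable]: "h \<in> BM" unfolding h_def by measurable
  ultimately show "L1 (\<lambda>w. rho e ((x, 0) - w))" "(LINT w|lborel. rho e ((x, 0) - w)) = 1"
   unfolding h_def[symmetric] by (auto intro!: integrableI_nonneg simp: integral_eq_nn_integral)
 qed
 have "\<bar>u e (x, 0)\<bar> \<le> (LINT w|lborel. \<bar>u0 w * rho e ((x, 0) - w)\<bar>)" unfolding u_def conv_def by (rule integral_abs_bound)
 also have "\<dots> \<le> (LINT w|lborel. (2 * norm x) ^ n * rho e ((x, 0) - w))"
 proof (rule integral_mono_AE)
  show "L1 (\<lambda>w. \<bar>u0 w * rho e ((x, 0) - w)\<bar>)" by (intro integrable_abs conv_integrable int bsm_rho)
  show "L1 (\<lambda>w. (2 * norm x) ^ n * rho e ((x, 0) - w))" using ib by simp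
  show "AE w in lborel. \<bar>u0 w * rho e ((x, 0) - w)\<bar> \<le> (2 * norm x) ^ n * rho e ((x, 0) - w)" using AE
  proof eventually_elim
   case (elim w)
   show ?case
   proof (cases "norm ((x, 0) - w) > k * e")
    case True
    hence "rho e ((x, 0) - w) = 0" using e(1) by (intro rho_zero) (auto simp: k_def)
    thus ?thesis by simp
   next
    case False
    have "norm w \<le> norm (x, 0::real) + norm ((x, 0) - w)" by (metis norm_minus_commute norm_triangle_sub)
    hence w: "norm w \<le> 2 * norm x" using False e(2) by (simp add: norm_Pair)
    hence "\<bar>u0 w\<bar> \<le> norm w ^ n" using elim x by simp
    also have "\<dots> \<le> (2 * norm x) ^ n" using w by (intro power_mono) auto
    finally show ?thesis using rho_nonneg[OF e(1), of "(x, 0) - w"] by (simp add: abs_mult mult_right_mono)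
   qed
  qed
 qed
 also have "\<dots> = (2 * norm x) ^ n" using ib by simp
 finally show ?thesis .
qed

text \<open>L2 convergence gives almost everywhere convergence along a subsequence. It is indexed by
  the cutoff radius, whose square is the mollification scale.\<close>

lemma trace_subseq:
 "\<exists>s. filterlim s (at_right 0) sequentially \<and>
   (AE x in lborel. norm x < R / 2 \<longrightarrow> (\<lambda>j. u ((s j)^2) (x, 0)) \<longlonglongrightarrow> T0 x)"
proof -
 define g where "g e x = indicator (ball 0 (R / 2)) x * (u e (x, 0) - T0 x)^2" for e x
 have gm [measurable]: "g e \<in> BM" for e
 proof -
  have "(\<lambda>x::'b. u e (x, 0)) \<in> BM" by (intro borel_measurable_continuous_onI continuous_on_compose2[OF bsm_continuous[OF bsm_uvy(1)]] continuous_intros) auto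
  thus ?thesis unfolding g_def by (intro borel_measurable_times borel_measurable_indicator) auto
 qed
 have "\<exists>d>0. d \<le> 1 / Suc n \<and> (NBINT x. ennreal (g (d^2) x)) \<le> ennreal (1 / Suc n)" for n
 proof -
  obtain e0 where e0: "e0 > 0" "\<And>e. 0 < e \<Longrightarrow> e < e0 \<Longrightarrow>
    (NBINT x. indicator (ball 0 (R / 2)) x * ennreal ((u e (x, 0) - T0 x)^2)) \<le> ennreal (1 / Suc n)"
   using trace_L2[of "R / 2" "1 / Suc n"] R by auto
  define d where "d = min (1 / Suc n) (e0 / 2)"
  have d: "0 < d" "d \<le> 1 / Suc n" "d < e0" "d \<le> 1" using e0(1) by (auto simp: d_def min_le_iff_disj)
  hence "d * d \<le> d" by (intro mult_left_le) auto
  hence "d^2 < e0" using d(3) by (simp add: power2_eq_square)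
  hence "(NBINT x. ennreal (g (d^2) x)) \<le> ennreal (1 / Suc n)" using e0(2)[of "d^2"] d(1) by (simp add: g_def ennreal_mult ennreal_indicator)
  with d show ?thesis by blast
 qed
 then obtain d where d: "\<And>n. d n > 0" "\<And>n. d n \<le> 1 / Suc n"
  "\<And>n. (NBINT x. ennreal (g ((d n)^2) x)) \<le> ennreal (1 / Suc n)" by metis
 have g0: "g e x \<ge> 0" for e x by (simp add: g_def)
 have ig: "L1 (g ((d n)^2))" for n by (rule integrableI_bounded) (use order_le_less_trans[OF d(3)[of n]] in \<open>auto simp: g0\<close>)
 have inv: "(\<lambda>n. 1 / real (Suc n)) \<longlonglongrightarrow> 0" by real_asymp
 have lim: "(\<lambda>n. LBINT x. norm (g ((d n)^2) x)) \<longlonglongrightarrow> 0"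
 proof (rule tendsto_sandwich[OF _ _ tendsto_const inv])
  have "(LBINT x. g ((d n)^2) x) \<le> 1 / Suc n" for n using d(3)[of n] nn_integral_eq_integral[OF ig[of n]] by (simp add: g0 ennreal_le_iff)
  thus "\<forall>\<^sub>F n in sequentially. (LBINT x. norm (g ((d n)^2) x)) \<le> 1 / real (Suc n)" by (simp add: g0)
 qed (simp add: Bochner_Integration.integral_nonneg)
 obtain r where r: "strict_mono r" "AE x in lborel. (\<lambda>n. g ((d (r n))^2) x) \<longlonglongrightarrow> 0" using tendsto_L1_AE_subseq[OF ig lim] by blast
 have "d \<longlonglongrightarrow> 0" by (rule tendsto_sandwich[OF _ _ tendsto_const inv]) (use d in \<open>auto intro!: always_eventually less_imp_le\<close>)
 hence "(\<lambda>n. d (r n)) \<longlonglongrightarrow> 0" using LIMSEQ_subseq_LIMSEQ[OF _ r(1)] by (simp add: o_def)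
 hence "filterlim (\<lambda>n. d (r n)) (at_right 0) sequentially" by (simp add: filterlim_at d(1) order_less_imp_not_eq2)
 moreover have "AE x in lborel. norm x < R / 2 \<longrightarrow> (\<lambda>j. u ((d (r j))^2) (x, 0)) \<longlonglongrightarrow> T0 x" using r(2)
 proof eventually_elim
  case (elim x)
  show ?case
  proof
   assume "norm x < R / 2"
   hence "(\<lambda>n. sqrt ((u ((d (r n))^2) (x, 0) - T0 x)^2)) \<longlonglongrightarrow> sqrt 0" using elim by (intro tendsto_real_sqrt) (simp add: g_def)
   hence "(\<lambda>n. u ((d (r n))^2) (x, 0) - T0 x) \<longlonglongrightarrow> 0" by (simp add: tendsto_rabs_zero_iff)
   thus "(\<lambda>j. u ((d (r j))^2) (x, 0)) \<longlonglongrightarrow> T0 x" by (simp add: LIM_zero_iff)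
  qed
 qed
 ultimately show ?thesis by blast
qed

text \<open>The vanishing order of the trace is read off from the mollified functions: their bound
  at (x, 0) passes to the limit along the subsequence. The factor 2 appears because the average is
  over points of norm at most |x| + k e \<le> 2 |x|.\<close>

lemma T0_small:
 "\<exists>r>0. AE x in lborel. norm x < r \<longrightarrow> \<bar>T0 x\<bar> \<le> (2 * norm x) ^ n"
proof -
 obtain rh0 where rh0: "rh0 > 0" and AE: "AE z in lborel. norm z < rh0 \<longrightarrow> \<bar>u0 z\<bar> \<le> norm z ^ n" using vanish[of n] by blast
 obtain s where s: "filterlim s (at_right 0) sequentially"
  and lim: "AE x in lborel. norm x < R / 2 \<longrightarrow> (\<lambda>j. u ((s j)^2) (x, 0)) \<longlonglongrightarrow> T0 x"
  using trace_subseq by blast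
 define r where "r = min (rh0 / 2) (R / 2)"
 have r: "r > 0" "2 * r \<le> rh0" "r \<le> R / 2" using rh0 R by (auto simp: r_def)
 have s0: "s \<longlonglongrightarrow> 0" and pos: "\<forall>\<^sub>F j in sequentially. s j > 0" using s unfolding filterlim_at by (auto elim: eventually_mono)
 have "(\<lambda>j. k * (s j)^2) \<longlonglongrightarrow> k * 0^2" by (intro tendsto_intros s0)
 hence ks: "\<forall>\<^sub>F j in sequentially. k * (s j)^2 < norm x" if "x \<noteq> 0" for x :: 'b by (rule order_tendstoD(2)) (use that in simp)
 have "AE x in lborel. x \<noteq> (0::'b)" by (rule AE_lborel_singleton)
 with lim have "AE x in lborel. norm x < r \<longrightarrow> \<bar>T0 x\<bar> \<le> (2 * norm x) ^ n"
 proof eventually_elim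
  case (elim x)
  show ?case
  proof
   assume x: "norm x < r"
   have "(\<lambda>j. u ((s j)^2) (x, 0)) \<longlonglongrightarrow> T0 x" using elim x r by auto
   hence "(\<lambda>j. \<bar>u ((s j)^2) (x, 0)\<bar>) \<longlonglongrightarrow> \<bar>T0 x\<bar>" by (rule tendsto_rabs)
   thus "\<bar>T0 x\<bar> \<le> (2 * norm x) ^ n"
   proof (rule tendsto_upperbound)
    show "\<forall>\<^sub>F j in sequentially. \<bar>u ((s j)^2) (x, 0)\<bar> \<le> (2 * norm x) ^ n"
     using pos ks[OF elim(2)] by eventually_elim (rule u_small[OF AE], use x r in auto)
   qed simp
  qed
 qed
 thus ?thesis using r(1) by blast
qed

end

section \<open>A weighted Green identity\<close>

lemma C2_zero_outside:
 assumes "C2 f g H" "\<And>x. norm x > r \<Longrightarrow> f x = 0" "norm x > r"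
 shows "f x = 0" "g x = 0" "H x h = 0" "tr H x = 0"
proof -
 have o: "open (- cball (0::'a) r)" by auto
 have 0: "f y = 0" if "y \<in> - cball 0 r" for y using that assms(2) by auto
 have x: "x \<in> - cball 0 r" using assms(3) by auto
 show "f x = 0" using assms by auto
 show "g x = 0" "H x h = 0" for h using C2_locally_zero[OF assms(1) o x 0] by auto
 thus "tr H x = 0" by (simp add: tr_def)
qed

text \<open>Divergence theorem for xi w \<nabla>w - (w^2 / 2) \<nabla>xi. The products \<nabla>xi
  \<bullet> \<nabla>w cancel, so the weighted Dirichlet integral is expressed by w and its
  Laplacian.\<close>

lemma green_weighted:
 fixes xi w :: "'a::euclidean_space \<Rightarrow> real"
 assumes X: "C2 xi gxi Hxi" "\<And>x. norm x > r \<Longrightarrow> xi x = 0" and W: "C2 w g H"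
 shows "(LBINT x. xi x * (g x \<bullet> g x)) = (LBINT x. (w x)^2 / 2 * tr Hxi x - xi x * (w x * tr H x))"
proof -
 note A = C2D[OF X(1)] and B = C2D[OF W] and Z = C2_zero_outside[OF X]
 define D where "D x h = (xi x * w x) *\<^sub>R H x h + (xi x * (g x \<bullet> h) + (gxi x \<bullet> h) * w x) *\<^sub>R g x
   - ((w x)^2 / 2) *\<^sub>R Hxi x h - (w x * (g x \<bullet> h)) *\<^sub>R gxi x" for x h
 have "(LBINT x. (\<Sum>i\<in>Basis. D x i \<bullet> i)) = 0"
 proof (rule integral_divergence_eq_0[where Q = "\<lambda>x. (xi x * w x) *\<^sub>R g x - ((w x)^2 / 2) *\<^sub>R gxi x" and r = "r + 1"])
  show "((\<lambda>x. (xi x * w x) *\<^sub>R g x - ((w x)^2 / 2) *\<^sub>R gxi x) has_derivative D x) (at x)" for x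
   unfolding D_def by (rule A B derivative_eq_intros refl)+ (auto simp: algebra_simps intro: A B)
  show "continuous_on UNIV (\<lambda>x. D x i)" for i unfolding D_def by (intro continuous_intros A B) auto
 qed (use Z in auto)
 moreover have "(\<Sum>i\<in>Basis. D x i \<bullet> i) = xi x * (g x \<bullet> g x) - ((w x)^2 / 2 * tr Hxi x - xi x * (w x * tr H x))" for x
 proof -
  have 1: "(\<Sum>i\<in>Basis. (g x \<bullet> i) * (g x \<bullet> i)) = g x \<bullet> g x" by (simp add: euclidean_inner[symmetric])
  have 2: "(\<Sum>i\<in>Basis. (gxi x \<bullet> i) * (g x \<bullet> i)) = gxi x \<bullet> g x" by (simp add: euclidean_inner[symmetric])
  have 3: "(\<Sum>i\<in>Basis. (g x \<bullet> i) * (gxi x \<bullet> i)) = gxi x \<bullet> g x" by (subst inner_commute[of "gxi x"]) (simp add: euclidean_inner[symmetric])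
  have "D x i \<bullet> i = (xi x * w x) * (H x i \<bullet> i) + xi x * ((g x \<bullet> i) * (g x \<bullet> i)) + w x * ((gxi x \<bullet> i) * (g x \<bullet> i))
    - ((w x)^2 / 2) * (Hxi x i \<bullet> i) - w x * ((g x \<bullet> i) * (gxi x \<bullet> i))" for i
   by (simp add: D_def inner_diff_left inner_add_left algebra_simps)
  hence "(\<Sum>i\<in>Basis. D x i \<bullet> i) = (xi x * w x) * tr H x + xi x * (g x \<bullet> g x) + w x * (gxi x \<bullet> g x)
    - ((w x)^2 / 2) * tr Hxi x - w x * (gxi x \<bullet> g x)"
   unfolding tr_def by (simp add: sum.distrib sum_subtractf sum_distrib_left[symmetric] sum_divide_distrib[symmetric] 1 2 3)
  thus ?thesis by (simp add: algebra_simps)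
 qed
 moreover have "L1 (\<lambda>x. xi x * (g x \<bullet> g x))"
  by (rule integrable_continuous_vanishing[of _ "r + 1"]) (use Z in \<open>auto intro!: continuous_intros A B\<close>)
 moreover have "L1 (\<lambda>x. (w x)^2 / 2 * tr Hxi x - xi x * (w x * tr H x))"
  by (rule integrable_continuous_vanishing[of _ "r + 1"]) (use Z in \<open>auto intro!: continuous_intros A B\<close>)
 ultimately show ?thesis by simp
qed

section \<open>Cutoff functions\<close>

text \<open>A profile composed with |z|^2 / a^2 is smooth at the origin as well, and its derivatives
  scale explicitly in a.\<close>

definition chi :: "(real \<Rightarrow> real) \<Rightarrow> real \<Rightarrow> 'a::euclidean_space \<Rightarrow> real" where
 "chi X a z = X ((z \<bullet> z) / a^2)"
definition gchi :: "(real \<Rightarrow> real) \<Rightarrow> real \<Rightarrow> 'a::euclidean_space \<Rightarrow> 'a" where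
 "gchi X a z = (2 * (pd 1 X ((z \<bullet> z) / a^2) / a^2)) *\<^sub>R z"
definition Hchi :: "(real \<Rightarrow> real) \<Rightarrow> real \<Rightarrow> 'a::euclidean_space \<Rightarrow> 'a \<Rightarrow> 'a" where
 "Hchi X a z h = (2 * (pd 1 X ((z \<bullet> z) / a^2) / a^2)) *\<^sub>R h + (4 * (pd 1 (pd 1 X) ((z \<bullet> z) / a^2) / a ^ 4) * (z \<bullet> h)) *\<^sub>R z"

lemma bsm_real_deriv: "bsm X \<Longrightarrow> (X has_real_derivative pd 1 X s) (at s)"
 using bsm_slice[of X 1 0 s] by simp

lemma bsm_pd1: "bsm X \<Longrightarrow> bsm (pd (1::real) X)" by (rule bsm_pd) auto

lemma deriv_scaled:
 assumes "bsm X" shows "((\<lambda>s. X (s / c) / b) has_real_derivative pd 1 X (s / c) / (c * b)) (at s)"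
proof (cases "c = 0")
 case False
 have "((\<lambda>s. X (s / c)) has_real_derivative pd 1 X (s / c) * (1 / c)) (at s)"
  by (rule DERIV_chain2[OF bsm_real_deriv[OF assms]]) (use False in \<open>auto intro!: derivative_eq_intros\<close>)
 from DERIV_cdivide[OF this, of b] show ?thesis by simp
qed simp

lemma C2_chi:
 assumes "bsm X" shows "C2 (chi X a) (gchi X a) (Hchi X a :: 'a::euclidean_space \<Rightarrow> 'a \<Rightarrow> 'a)"
 unfolding chi_def[abs_def] gchi_def[abs_def] Hchi_def[abs_def]
proof (rule C2_radial)
 show "((\<lambda>s. X (s / a^2)) has_real_derivative pd 1 X (s / a^2) / a^2) (at s)" for s using deriv_scaled[OF assms, of "a^2" 1] by simp
 show "((\<lambda>s. pd 1 X (s / a^2) / a^2) has_real_derivative pd 1 (pd 1 X) (s / a^2) / a ^ 4) (at s)" for s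
  using deriv_scaled[OF bsm_pd1[OF assms], of "a^2" "a^2"] by (simp add: power4_eq_xxxx power2_eq_square mult.assoc)
 show "continuous_on UNIV (\<lambda>s. pd 1 (pd 1 X) (s / a^2) / a ^ 4)" unfolding divide_inverse
  by (intro continuous_intros continuous_on_compose2[OF bsm_continuous[OF bsm_pd1[OF bsm_pd1[OF assms]], of UNIV]]) auto
qed

lemma tr_Hchi: "tr (Hchi X a) (z::'a::euclidean_space) = 2 * real DIM('a) * (pd 1 X ((z \<bullet> z) / a^2) / a^2)
  + 4 * (pd 1 (pd 1 X) ((z \<bullet> z) / a^2) / a ^ 4) * (z \<bullet> z)"
 unfolding Hchi_def[abs_def] by (rule tr_radial)

text \<open>Profiles in the variable |z|^2 / a^2: the inner cutoff \<open>Xi\<close> rises for |z|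
  between a and sqrt 2 a, the outer cutoff \<open>Xo\<close> falls for |z| between a / sqrt 2 and
  a.\<close>

definition Xi :: "real \<Rightarrow> real" where "Xi s = stp (s - 1)"
definition Xo :: "real \<Rightarrow> real" where "Xo s = stp (2 - 2 * s)"

lemma bsm_Xi: "bsm Xi" and bsm_Xo: "bsm Xo"
 using bsm_scale[OF stp(1), of 1 "- 1"] bsm_scale[OF stp(1), of "- 2" 2] by (simp_all add: Xi_def[abs_def] Xo_def[abs_def])

lemma Xi: "s \<le> 1 \<Longrightarrow> Xi s = 0" "s \<ge> 2 \<Longrightarrow> Xi s = 1" "0 \<le> Xi s" "Xi s \<le> 1"
 by (auto simp: Xi_def stp)

lemma Xo: "s \<ge> 1 \<Longrightarrow> Xo s = 0" "s \<le> 1 / 2 \<Longrightarrow> Xo s = 1" "0 \<le> Xo s" "Xo s \<le> 1"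
 by (auto simp: Xo_def stp)

lemma pd1_zero_open:
 fixes X :: "real \<Rightarrow> real"
 assumes "bsm X" "open S" "\<And>s. s \<in> S \<Longrightarrow> X s = c" "s \<in> S" shows "pd 1 X s = 0"
proof -
 have "(X has_real_derivative 0) (at s)" by (rule has_field_derivative_transform_within_open[of "\<lambda>_. c" _ _ S]) (use assms in auto)
 thus ?thesis using bsm_real_deriv[OF assms(1)] DERIV_unique by blast
qed

lemma pd_X_zero:
 "s > 2 \<or> s < 1 \<Longrightarrow> pd 1 Xi s = 0" "s > 2 \<or> s < 1 \<Longrightarrow> pd 1 (pd 1 Xi) s = 0"
 "s > 1 \<or> s < 1 / 2 \<Longrightarrow> pd 1 Xo s = 0" "s > 1 \<or> s < 1 / 2 \<Longrightarrow> pd 1 (pd 1 Xo) s = 0"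
proof -
 have i: "pd 1 Xi s = 0" if "s > 2 \<or> s < 1" for s using that pd1_zero_open[OF bsm_Xi, of "{2<..}" 1 s] pd1_zero_open[OF bsm_Xi, of "{..<1}" 0 s] by (auto simp: Xi)
 have o: "pd 1 Xo s = 0" if "s > 1 \<or> s < 1 / 2" for s
  using that pd1_zero_open[OF bsm_Xo, of "{1<..}" 0 s] pd1_zero_open[OF bsm_Xo, of "{..<1/2}" 1 s] by (auto simp: Xo)
 show "s > 2 \<or> s < 1 \<Longrightarrow> pd 1 Xi s = 0" by (rule i)
 show "s > 1 \<or> s < 1 / 2 \<Longrightarrow> pd 1 Xo s = 0" by (rule o)
 show "s > 2 \<or> s < 1 \<Longrightarrow> pd 1 (pd 1 Xi) s = 0"
  using pd1_zero_open[OF bsm_pd1[OF bsm_Xi], of "{2<..}" 0 s] pd1_zero_open[OF bsm_pd1[OF bsm_Xi], of "{..<1}" 0 s] by (auto simp: i)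
 show "s > 1 \<or> s < 1 / 2 \<Longrightarrow> pd 1 (pd 1 Xo) s = 0"
  using pd1_zero_open[OF bsm_pd1[OF bsm_Xo], of "{1<..}" 0 s] pd1_zero_open[OF bsm_pd1[OF bsm_Xo], of "{..<1/2}" 0 s] by (auto simp: o)
qed

lemma sq_div:
 fixes z :: "'a::real_inner"
 assumes "a > 0"
 shows "norm z < c * a \<Longrightarrow> c \<ge> 0 \<Longrightarrow> (z \<bullet> z) / a^2 < c^2" "norm z > c * a \<Longrightarrow> c \<ge> 0 \<Longrightarrow> (z \<bullet> z) / a^2 > c^2"
  "norm z \<le> c * a \<Longrightarrow> (z \<bullet> z) / a^2 \<le> c^2" "norm z \<ge> c * a \<Longrightarrow> c \<ge> 0 \<Longrightarrow> (z \<bullet> z) / a^2 \<ge> c^2"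
proof -
 have e: "z \<bullet> z = (norm z)^2" "(c * a)^2 = c^2 * a^2" by (simp_all add: power2_norm_eq_inner power_mult_distrib)
 have a2: "a^2 > 0" using assms by simp
 show "norm z < c * a \<Longrightarrow> c \<ge> 0 \<Longrightarrow> (z \<bullet> z) / a^2 < c^2"
  using power_strict_mono[of "norm z" "c * a" 2] a2 unfolding e by (simp add: divide_less_eq)
 show "norm z > c * a \<Longrightarrow> c \<ge> 0 \<Longrightarrow> (z \<bullet> z) / a^2 > c^2"
  using power_strict_mono[of "c * a" "norm z" 2] a2 assms unfolding e by (simp add: less_divide_eq)
 show "norm z \<le> c * a \<Longrightarrow> (z \<bullet> z) / a^2 \<le> c^2" using power_mono[of "norm z" "c * a" 2] a2 unfolding e by (simp add: divide_le_eq)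
 show "norm z \<ge> c * a \<Longrightarrow> c \<ge> 0 \<Longrightarrow> (z \<bullet> z) / a^2 \<ge> c^2"
  using power_mono[of "c * a" "norm z" 2] a2 assms unfolding e by (simp add: le_divide_eq)
qed

lemma tr_Hchi_bound:
 fixes X :: "real \<Rightarrow> real"
 assumes X: "bsm X" and 0: "\<And>s. s > 2 \<Longrightarrow> pd 1 (pd 1 X) s = 0"
 shows "\<exists>K\<ge>0. \<forall>a>0. \<forall>z::'a::euclidean_space. \<bar>tr (Hchi X a) z\<bar> \<le> K / a^2"
proof -
 obtain B1 where B1: "\<And>s. \<bar>pd 1 X s\<bar> \<le> B1" by (rule bsm_bounded[OF bsm_pd1[OF X]]) blast
 obtain B2 where B2: "\<And>s. \<bar>pd 1 (pd 1 X) s\<bar> \<le> B2" by (rule bsm_bounded[OF bsm_pd1[OF bsm_pd1[OF X]]]) blast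
 have B: "B1 \<ge> 0" "B2 \<ge> 0" using B1[of 0] B2[of 0] by linarith+
 let ?K = "2 * real DIM('a) * B1 + 4 * (B2 * 2)"
 show ?thesis
 proof (intro exI[of _ ?K] conjI allI impI)
  show "?K \<ge> 0" using B by simp
  fix a :: real and z :: 'a assume a: "a > 0"
  define s where "s = (z \<bullet> z) / a^2"
  have s: "s \<ge> 0" by (simp add: s_def)
  have "tr (Hchi X a) z = (2 * real DIM('a) * pd 1 X s + 4 * (pd 1 (pd 1 X) s * s)) / a^2"
   unfolding tr_Hchi s_def using a by (simp add: field_simps power4_eq_xxxx power2_eq_square)
  moreover have "\<bar>pd 1 (pd 1 X) s * s\<bar> \<le> B2 * 2"
  proof (cases "s > 2")
   case False
   thus ?thesis unfolding abs_mult using s B B2[of s] by (intro mult_mono) auto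
  qed (simp add: 0 B)
  moreover have "\<bar>2 * real DIM('a) * pd 1 X s\<bar> \<le> 2 * real DIM('a) * B1" unfolding abs_mult using B1[of s] by (intro mult_mono) auto
  ultimately show "\<bar>tr (Hchi X a) z\<bar> \<le> ?K / a^2" unfolding abs_divide by (auto intro!: divide_right_mono)
 qed
qed

text \<open>The integrand is the square of the commutator of \<Delta> with the cutoff. Its gradient
  term is eliminated by a Caccioppoli argument based on \<open>green_weighted\<close>, so the error
  is bounded by w and \<Delta>w, the quantities that are known for the mollified functions; a \<le>
  1 lets the single power a^(-4) cover all terms.\<close>

lemma cutoff_error:
 fixes X :: "real \<Rightarrow> real"
 assumes X: "bsm X" and z1: "\<And>s. s > 2 \<Longrightarrow> pd 1 X s = 0" and z2: "\<And>s. s > 2 \<Longrightarrow> pd 1 (pd 1 X) s = 0"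
 shows "\<exists>C\<ge>0. \<forall>a (w :: 'a::euclidean_space \<Rightarrow> real) g H. 0 < a \<longrightarrow> a \<le> 1 \<longrightarrow> C2 w g H \<longrightarrow>
   (LBINT z. (2 * (gchi X a z \<bullet> g z) + w z * tr (Hchi X a) z)^2)
    \<le> C / a ^ 4 * (LBINT z. indicator (cball 0 (2 * a)) z * ((w z)^2 + (tr H z)^2))"
proof -
 obtain B where B: "\<And>s. \<bar>pd 1 X s\<bar> \<le> B" by (rule bsm_bounded[OF bsm_pd1[OF X]]) blast
 obtain K where K: "K \<ge> 0" "\<And>a (z::'a). a > 0 \<Longrightarrow> \<bar>tr (Hchi X a) z\<bar> \<le> K / a^2" using tr_Hchi_bound[OF X z2] by blast
 obtain L where L: "L \<ge> 0" "\<And>a (z::'a). a > 0 \<Longrightarrow> \<bar>tr (Hchi Xo a) z\<bar> \<le> L / a^2"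
  using tr_Hchi_bound[OF bsm_Xo] by (auto simp: pd_X_zero)
 define C where "C = 32 * B^2 * (L + 1) + 2 * K^2"
 show ?thesis
 proof (intro exI[of _ C] conjI allI impI)
  show "C \<ge> 0" using L(1) by (simp add: C_def)
  fix a :: real and w :: "'a \<Rightarrow> real" and g H
  assume a: "0 < a" "a \<le> 1" and W: "C2 w g H"
  let ?S = "\<lambda>z::'a. indicator (cball 0 (2 * a)) z :: real"
  let ?P = "\<lambda>z. 2 * (gchi X a z \<bullet> g z) + w z * tr (Hchi X a) z"
  \<comment> \<open>The outer cutoff at radius 2 a equals 1 where |z|^2 \<le> 2 a^2, a set that
    contains all points at which the cutoff \<open>chi X a\<close> has a nonzero derivative.\<close>
  define q where "q = (chi Xo (2 * a) :: 'a \<Rightarrow> real)"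
  define T where "T = (tr (Hchi Xo (2 * a)) :: 'a \<Rightarrow> real)"
  define N where "N z = ?S z * ((w z)^2 + (tr H z)^2)" for z
  note Cq = C2_chi[OF bsm_Xo, of "2 * a", where 'a = 'a, folded q_def]
  note A = C2D[OF W] and Q = C2D[OF Cq, folded T_def] and CX = C2D[OF C2_chi[OF X, of a]]
  have far: "(z \<bullet> z) / a^2 > 2" if "norm z > 2 * a" for z :: 'a using sq_div(2)[OF a(1), of 2 z] that by simp
  have q: "0 \<le> q z" "q z \<le> ?S z" "(z \<bullet> z) / a^2 \<le> 2 \<Longrightarrow> q z = 1" for z
   using sq_div(2)[of "2 * a" 1 z] a by (auto simp: q_def chi_def Xo indicator_def field_simps)
  have qz: "q z = 0" if "norm z > 2 * a" for z using q(1,2)[of z] that by simp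
  note Zq = C2_zero_outside[OF Cq qz, folded T_def]
  have T: "\<bar>T z\<bar> \<le> L / a^2 * ?S z" for z
  proof (cases "norm z > 2 * a")
   case False
   have "L / (2 * a)^2 \<le> L / a^2" using L(1) a by (intro divide_left_mono power_mono) auto
   thus ?thesis using L(2)[of "2 * a" z] a False by (simp add: T_def)
  qed (simp add: Zq)
  have gq: "gchi X a z \<bullet> gchi X a z \<le> 8 * B^2 / a^2 * q z" for z :: 'a
  proof (cases "(z \<bullet> z) / a^2 > 2")
   case False
   have "gchi X a z \<bullet> gchi X a z = 4 * ((pd 1 X ((z \<bullet> z) / a^2))^2 * ((z \<bullet> z) / a^2)) / a^2" by (simp add: gchi_def power2_eq_square)
   also have "\<dots> \<le> 4 * (B^2 * 2) / a^2" using False B[of "(z \<bullet> z) / a^2"]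
    by (intro divide_right_mono mult_left_mono mult_mono) (auto simp: abs_le_square_iff[symmetric])
   finally show ?thesis using q(3)[of z] False by simp
  qed (use q(1)[of z] in \<open>simp add: gchi_def z1\<close>)
  have LB: "(tr (Hchi X a) z)^2 \<le> K^2 / a ^ 4 * ?S z" for z :: 'a
  proof (cases "norm z > 2 * a")
   case False
   have "\<bar>tr (Hchi X a) z\<bar>^2 \<le> (K / a^2)^2" by (rule power_mono[OF K(2)[OF a(1)]]) simp
   thus ?thesis using False by (simp add: power_divide)
  qed (use far in \<open>simp add: tr_Hchi z1 z2\<close>)
  have iS: "L1 (\<lambda>z. ?S z * h z)" if "continuous_on UNIV h" for h :: "'a \<Rightarrow> real"
  proof -
   have "L1 (\<lambda>z. ?S z *\<^sub>R h z)" by (rule borel_integrable_compact) (auto intro: continuous_on_subset[OF that])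
   thus ?thesis by simp
  qed
  have iN: "L1 N" and iw: "L1 (\<lambda>z. ?S z * (w z)^2)" unfolding N_def[abs_def] by (intro iS continuous_intros A)+
  have iq: "L1 (\<lambda>z. q z * (g z \<bullet> g z))"
   by (rule integrable_continuous_vanishing[of _ "2 * a + 1"]) (use qz a in \<open>auto intro!: continuous_intros A Q\<close>)
  have "(LBINT z. (?P z)^2) \<le> (LBINT z. 64 * B^2 / a^2 * (q z * (g z \<bullet> g z)) + 2 * K^2 / a ^ 4 * N z)"
  proof (rule integral_mono)
   have "?P z = 0" if "norm z > 2 * a" for z using far[OF that] by (simp add: gchi_def tr_Hchi z1 z2)
   thus "L1 (\<lambda>z. (?P z)^2)" using a by (intro integrable_continuous_vanishing[of _ "2 * a + 1"]) (auto intro!: continuous_intros A CX)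
   show "L1 (\<lambda>z. 64 * B^2 / a^2 * (q z * (g z \<bullet> g z)) + 2 * K^2 / a ^ 4 * N z)" using iq iN by simp
   fix z
   have "(gchi X a z \<bullet> g z)^2 \<le> (gchi X a z \<bullet> gchi X a z) * (g z \<bullet> g z)" by (rule Cauchy_Schwarz_ineq)
   also have "\<dots> \<le> 8 * B^2 / a^2 * q z * (g z \<bullet> g z)" by (intro mult_right_mono gq) simp
   finally have 1: "(gchi X a z \<bullet> g z)^2 \<le> 8 * B^2 / a^2 * q z * (g z \<bullet> g z)" .
   have "(w z * tr (Hchi X a) z)^2 \<le> (w z)^2 * (K^2 / a ^ 4 * ?S z)" unfolding power_mult_distrib by (intro mult_left_mono LB) simp
   also have "\<dots> \<le> K^2 / a ^ 4 * N z" by (simp add: N_def indicator_def algebra_simps)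
   finally have 2: "(w z * tr (Hchi X a) z)^2 \<le> K^2 / a ^ 4 * N z" .
   have "(2 * x + y)^2 \<le> 8 * x^2 + 2 * y^2" for x y :: real using zero_le_power2[of "2 * x - y"] by (simp add: power2_eq_square algebra_simps)
   from this[of "gchi X a z \<bullet> g z" "w z * tr (Hchi X a) z"]
   show "(?P z)^2 \<le> 64 * B^2 / a^2 * (q z * (g z \<bullet> g z)) + 2 * K^2 / a ^ 4 * N z" using 1 2 by (simp add: mult.assoc)
  qed
  also have "\<dots> = 64 * B^2 / a^2 * (LBINT z. q z * (g z \<bullet> g z)) + 2 * K^2 / a ^ 4 * integral\<^sup>L lborel N" using iq iN by simp
  finally have S: "(LBINT z. (?P z)^2) \<le> \<dots>" .
  have "(LBINT z. q z * (g z \<bullet> g z)) = (LBINT z. (w z)^2 / 2 * T z - q z * (w z * tr H z))" unfolding T_def by (rule green_weighted[OF Cq qz W])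
  also have "\<dots> \<le> (LBINT z. (L + 1) / 2 / a^2 * N z)"
  proof (rule integral_mono)
   show "L1 (\<lambda>z. (w z)^2 / 2 * T z - q z * (w z * tr H z))" by (rule integrable_continuous_vanishing[of _ "2 * a + 1"])
      (use Zq a in \<open>auto intro!: continuous_intros A Q\<close>)
   show "L1 (\<lambda>z. (L + 1) / 2 / a^2 * N z)" using iN by simp
   fix z
   have 1: "(w z)^2 / 2 * T z \<le> (w z)^2 / 2 * (L / a^2 * ?S z)" using T[of z] by (intro mult_left_mono) auto
   have 2: "(w z)^2 / 2 * (L / a^2 * ?S z) \<le> L / 2 / a^2 * N z" using L(1) by (simp add: N_def indicator_def divide_simps algebra_simps)
   have "\<bar>q z\<bar> * \<bar>w z * tr H z\<bar> \<le> ?S z * (((w z)^2 + (tr H z)^2) / 2)"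
    using q[of z] sum_squares_bound[of "\<bar>w z\<bar>" "\<bar>tr H z\<bar>"] by (intro mult_mono) (auto simp: abs_mult)
   also have "\<dots> = N z / 2" by (simp add: N_def)
   also have "\<dots> \<le> 1 / a^2 * N z / 2" using mult_right_mono[of 1 "1 / a^2" "N z"] a power_le_one[of a 2] by (simp add: N_def)
   finally have 3: "- (q z * (w z * tr H z)) \<le> 1 / a^2 * N z / 2" using abs_ge_minus_self[of "q z * (w z * tr H z)"] by (simp only: abs_mult)
   have "(L + 1) / 2 / a^2 * N z = L / 2 / a^2 * N z + 1 / a^2 * N z / 2" by (simp add: add_divide_distrib distrib_right)
   thus "(w z)^2 / 2 * T z - q z * (w z * tr H z) \<le> (L + 1) / 2 / a^2 * N z" using 1 2 3 by linarith
  qed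
  finally have "64 * B^2 / a^2 * (LBINT z. q z * (g z \<bullet> g z)) \<le> 64 * B^2 / a^2 * ((L + 1) / 2 / a^2 * integral\<^sup>L lborel N)"
   by (intro mult_left_mono) simp_all
  with S have "(LBINT z. (?P z)^2) \<le> 64 * B^2 / a^2 * ((L + 1) / 2 / a^2 * integral\<^sup>L lborel N) + 2 * K^2 / a ^ 4 * integral\<^sup>L lborel N" by linarith
  also have "\<dots> = C / a ^ 4 * integral\<^sup>L lborel N" using a by (simp add: C_def field_simps power4_eq_xxxx power2_eq_square)
  finally show "(LBINT z. (?P z)^2) \<le> C / a ^ 4 * (LBINT z. ?S z * ((w z)^2 + (tr H z)^2))" unfolding N_def[abs_def] .
 qed
qed

section \<open>The two-sided cutoff and its commutator with the Laplacian\<close>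

definition ch :: "real \<Rightarrow> real \<Rightarrow> 'a::euclidean_space \<Rightarrow> real" where
 "ch dl rh z = chi Xi dl z * chi Xo rh z"
definition gch :: "real \<Rightarrow> real \<Rightarrow> 'a::euclidean_space \<Rightarrow> 'a" where
 "gch dl rh z = chi Xi dl z *\<^sub>R gchi Xo rh z + chi Xo rh z *\<^sub>R gchi Xi dl z"
definition Hch :: "real \<Rightarrow> real \<Rightarrow> 'a::euclidean_space \<Rightarrow> 'a \<Rightarrow> 'a" where
 "Hch dl rh z h = chi Xi dl z *\<^sub>R Hchi Xo rh z h + (gchi Xi dl z \<bullet> h) *\<^sub>R gchi Xo rh z
   + chi Xo rh z *\<^sub>R Hchi Xi dl z h + (gchi Xo rh z \<bullet> h) *\<^sub>R gchi Xi dl z"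

lemma C2_ch: "C2 (ch dl rh) (gch dl rh) (Hch dl rh :: 'a::euclidean_space \<Rightarrow> 'a \<Rightarrow> 'a)"
 unfolding ch_def[abs_def] gch_def[abs_def] Hch_def[abs_def] by (rule C2_mult[OF C2_chi[OF bsm_Xi] C2_chi[OF bsm_Xo]])

lemma tr_Hch: "tr (Hch dl rh) z = chi Xi dl z * tr (Hchi Xo rh) z + 2 * (gchi Xi dl z \<bullet> gchi Xo rh z) + chi Xo rh z * tr (Hchi Xi dl) z"
 unfolding Hch_def[abs_def] by (rule tr_mult)

lemma chi_Xi:
 assumes "a > 0"
 shows "norm z \<le> a \<Longrightarrow> chi Xi a z = 0" "norm z \<ge> 2 * a \<Longrightarrow> chi Xi a z = 1"
  "norm z < a \<or> norm z \<ge> 2 * a \<Longrightarrow> gchi Xi a z = 0 \<and> tr (Hchi Xi a) z = 0"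
 using sq_div(1,3)[OF assms, of z 1] sq_div(4)[OF assms, of 2 z] by (auto simp: chi_def gchi_def tr_Hchi Xi pd_X_zero)

lemma chi_Xo:
 assumes "a > 0"
 shows "norm z \<ge> a \<Longrightarrow> chi Xo a z = 0" "norm z \<le> a / 2 \<Longrightarrow> chi Xo a z = 1"
  "norm z > a \<or> norm z \<le> a / 2 \<Longrightarrow> gchi Xo a z = 0 \<and> tr (Hchi Xo a) z = 0"
proof -
 have "x < 1 / 2" if "x \<le> (1 / 2)^2" for x :: real using that by (simp add: power_divide)
 from this[OF sq_div(3)[OF assms, of z "1 / 2"]] have "(z \<bullet> z) / a^2 < 1 / 2" if "norm z \<le> a / 2" using that by simp
 thus "norm z \<ge> a \<Longrightarrow> chi Xo a z = 0" "norm z \<le> a / 2 \<Longrightarrow> chi Xo a z = 1"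
  "norm z > a \<or> norm z \<le> a / 2 \<Longrightarrow> gchi Xo a z = 0 \<and> tr (Hchi Xo a) z = 0"
  using sq_div(2,4)[OF assms, of 1 z] by (auto simp: chi_def gchi_def tr_Hchi Xo pd_X_zero)
qed

lemma ch_props:
 assumes "0 < dl" "4 * dl < rh"
 shows "0 \<le> ch dl rh z" "ch dl rh z \<le> 1"
  "norm z \<le> dl \<Longrightarrow> ch dl rh z = 0" "norm z \<ge> rh \<Longrightarrow> ch dl rh z = 0"
  "2 * dl \<le> norm z \<Longrightarrow> norm z \<le> rh / 2 \<Longrightarrow> ch dl rh z = 1"
proof -
 show "0 \<le> ch dl rh z" "ch dl rh z \<le> 1" unfolding ch_def chi_def by (auto intro!: mult_nonneg_nonneg mult_le_one Xi Xo)
qed (use assms in \<open>simp_all add: ch_def chi_Xi chi_Xo\<close>)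

text \<open>The inner transition ends before |z| = 2 \<open>dl\<close>, which is smaller than
  \<open>rh / 2\<close>, where the outer one begins; so at each point at most one factor of the
  product is differentiated.\<close>

lemma ch_zones:
 assumes d: "0 < dl" "4 * dl < rh"
 shows "norm z < rh / 2 \<Longrightarrow> gch dl rh z = gchi Xi dl z \<and> tr (Hch dl rh) z = tr (Hchi Xi dl) z"
  "norm z > 2 * dl \<Longrightarrow> gch dl rh z = gchi Xo rh z \<and> tr (Hch dl rh) z = tr (Hchi Xo rh) z"
 using d by (simp_all add: gch_def tr_Hch chi_Xi chi_Xo)

lemma ch_outside:
 fixes z :: "'a::euclidean_space"
 assumes d: "0 < dl" "4 * dl < rh" and z: "norm z < dl \<or> norm z > rh"
 shows "ch dl rh z = 0" "gch dl rh z = 0" "tr (Hch dl rh) z = 0"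
 using d z ch_zones[OF d, of z] by (auto simp: ch_props chi_Xi chi_Xo)

lemma integrable_powr_vanishing:
 fixes f :: "'a::euclidean_space \<Rightarrow> real"
 assumes "dl > 0" "continuous_on UNIV f" "\<And>z. norm z < dl \<Longrightarrow> f z = 0" "\<And>z. norm z > rh \<Longrightarrow> f z = 0"
 shows "L1 (\<lambda>z. norm z powr p * f z)"
 by (rule integrable_continuous_vanishing[of _ "rh + 1"], rule continuous_on_glue[OF _ assms(1)])
  (use assms in \<open>auto intro!: continuous_intros continuous_on_subset[OF assms(2)]\<close>)

lemma powr_antimono:
 fixes p :: real assumes "0 < x" "x \<le> y" "p \<le> 0" shows "y powr p \<le> x powr p"
 using powr_mono2'[of p x y] assms by simp

text \<open>\<open>l\<close> stands for the Laplacian of \<open>w\<close>, and the ball of radius 2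
  a is where the commutator at radius a is controlled.\<close>

definition NN :: "real \<Rightarrow> ('a::euclidean_space \<Rightarrow> real) \<Rightarrow> ('a \<Rightarrow> real) \<Rightarrow> real" where
 "NN a w l = (LBINT z. indicator (cball 0 (2 * a)) z * ((w z)^2 + (l z)^2))"

lemma NN_nonneg: "NN a w l \<ge> 0"
 unfolding NN_def by (rule Bochner_Integration.integral_nonneg) simp

text \<open>The commutator terms live in |z| \<ge> \<open>dl\<close> for the inner zone and in |z|
  \<ge> \<open>rh / 2\<close> for the outer zone, and a nonpositive power of |z| is at most its
  value at the inner radius of its zone. This leaves the unweighted commutators, for which there is
  \<open>cutoff_error\<close>.\<close>

lemma weighted_cutoff:
 "\<exists>C\<ge>0. \<forall>dl rh p (w :: 'a::euclidean_space \<Rightarrow> real) g H. 0 < dl \<longrightarrow> 4 * dl < rh \<longrightarrow> rh \<le> 1 \<longrightarrow> p \<le> 0 \<longrightarrow> C2 w g H \<longrightarrow>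
  (LBINT z. norm z powr p * (ch dl rh z * tr H z + 2 * (gch dl rh z \<bullet> g z) + w z * tr (Hch dl rh) z)^2)
   \<le> 2 * (LBINT z. norm z powr p * (ch dl rh z * tr H z)^2)
    + C * (dl powr p / dl ^ 4 * NN dl w (tr H) + (rh / 2) powr p / rh ^ 4 * NN rh w (tr H))"
proof -
 obtain Ci where Ci: "Ci \<ge> 0" "\<And>a (w :: 'a \<Rightarrow> real) g H. 0 < a \<Longrightarrow> a \<le> 1 \<Longrightarrow> C2 w g H \<Longrightarrow>
   (LBINT z. (2 * (gchi Xi a z \<bullet> g z) + w z * tr (Hchi Xi a) z)^2) \<le> Ci / a ^ 4 * NN a w (tr H)"
  using cutoff_error[OF bsm_Xi, where 'a = 'a] unfolding NN_def by (auto simp: pd_X_zero)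
 obtain Co where Co: "Co \<ge> 0" "\<And>a (w :: 'a \<Rightarrow> real) g H. 0 < a \<Longrightarrow> a \<le> 1 \<Longrightarrow> C2 w g H \<Longrightarrow>
   (LBINT z. (2 * (gchi Xo a z \<bullet> g z) + w z * tr (Hchi Xo a) z)^2) \<le> Co / a ^ 4 * NN a w (tr H)"
  using cutoff_error[OF bsm_Xo, where 'a = 'a] unfolding NN_def by (auto simp: pd_X_zero)
 define C where "C = 2 * max Ci Co"
 show ?thesis
 proof (intro exI[of _ C] conjI allI impI)
  show "C \<ge> 0" using Ci by (simp add: C_def)
  fix dl rh p :: real and w :: "'a \<Rightarrow> real" and g H
  assume d: "0 < dl" "4 * dl < rh" "rh \<le> 1" and p: "p \<le> 0" and W: "C2 w g H"
  have rh: "rh > 0" "dl \<le> 1" using d by auto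
  note A = C2D[OF W]
  let ?Q = "\<lambda>z. ch dl rh z * tr H z + 2 * (gch dl rh z \<bullet> g z) + w z * tr (Hch dl rh) z"
  let ?P = "\<lambda>z. 2 * (gch dl rh z \<bullet> g z) + w z * tr (Hch dl rh) z"
  let ?Pi = "\<lambda>z. 2 * (gchi Xi dl z \<bullet> g z) + w z * tr (Hchi Xi dl) z"
  let ?Po = "\<lambda>z. 2 * (gchi Xo rh z \<bullet> g z) + w z * tr (Hchi Xo rh) z"
  have pt: "norm z powr p * (?P z)^2 \<le> dl powr p * (?Pi z)^2 + (rh / 2) powr p * (?Po z)^2" for z
  proof (cases "norm z < rh / 2")
   case True
   hence P: "?P z = ?Pi z" using ch_zones(1)[OF d(1,2), of z] by simp
   have "norm z powr p * (?Pi z)^2 \<le> dl powr p * (?Pi z)^2"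
   proof (cases "norm z < dl")
    case True
    thus ?thesis using chi_Xi(3)[OF d(1), of z] by simp
   next
    case False
    thus ?thesis using d p by (intro mult_right_mono powr_antimono) auto
   qed
   moreover have "0 \<le> (rh / 2) powr p * (?Po z)^2" by simp
   ultimately show ?thesis unfolding P by linarith
  next
   case False
   hence P: "?P z = ?Po z" using ch_zones(2)[OF d(1,2), of z] d by simp
   have "norm z powr p * (?Po z)^2 \<le> (rh / 2) powr p * (?Po z)^2" using False rh p by (intro mult_right_mono powr_antimono) auto
   moreover have "0 \<le> dl powr p * (?Pi z)^2" by simp
   ultimately show ?thesis unfolding P by linarith
  qed
  have zi: "?Pi z = 0" if "norm z > 2 * dl" for z using chi_Xi(3)[OF d(1), of z] that by simp
  have zo: "?Po z = 0" if "norm z > rh" for z using chi_Xo(3)[OF rh(1), of z] that by simp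
  have ii: "L1 (\<lambda>z. (?Pi z)^2)" by (rule integrable_continuous_vanishing[of _ "2 * dl + 1"])
     (use zi d in \<open>auto intro!: continuous_intros A C2D(6,7)[OF C2_chi[OF bsm_Xi]]\<close>)
  have io: "L1 (\<lambda>z. (?Po z)^2)" by (rule integrable_continuous_vanishing[of _ "rh + 1"])
     (use zo d in \<open>auto intro!: continuous_intros A C2D(6,7)[OF C2_chi[OF bsm_Xo]]\<close>)
  note E = C2D[OF C2_ch[of dl rh, where 'a = 'a]]
  note iw = integrable_powr_vanishing[of dl _ rh, OF d(1)]
  have i1: "L1 (\<lambda>z. norm z powr p * (ch dl rh z * tr H z)^2)" by (rule iw) (auto simp: ch_outside[OF d(1,2)] intro!: continuous_intros E A)
  have i2: "L1 (\<lambda>z. norm z powr p * (?P z)^2)" by (rule iw) (auto simp: ch_outside[OF d(1,2)] intro!: continuous_intros E A)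
  have i3: "L1 (\<lambda>z. norm z powr p * (?Q z)^2)" by (rule iw) (auto simp: ch_outside[OF d(1,2)] intro!: continuous_intros E A)
  have "(LBINT z. norm z powr p * (?Q z)^2)
   \<le> (LBINT z. 2 * (norm z powr p * (ch dl rh z * tr H z)^2) + 2 * (norm z powr p * (?P z)^2))"
  proof (rule integral_mono[OF i3])
   show "L1 (\<lambda>z. 2 * (norm z powr p * (ch dl rh z * tr H z)^2) + 2 * (norm z powr p * (?P z)^2))"
    using i1 i2 by (intro Bochner_Integration.integrable_add integrable_mult_right)
   fix z
   have "(x + y)^2 \<le> 2 * x^2 + 2 * y^2" for x y :: real using zero_le_power2[of "x - y"] by (simp add: power2_eq_square algebra_simps)
   from mult_left_mono[OF this[of "ch dl rh z * tr H z" "?P z"], of "norm z powr p"]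
   show "norm z powr p * (?Q z)^2
     \<le> 2 * (norm z powr p * (ch dl rh z * tr H z)^2) + 2 * (norm z powr p * (?P z)^2)"
    by (simp add: add.assoc distrib_left mult.left_commute[of 2])
  qed
  also have "\<dots> = 2 * (LBINT z. norm z powr p * (ch dl rh z * tr H z)^2) + 2 * (LBINT z. norm z powr p * (?P z)^2)" using i1 i2 by simp
  finally have S1: "(LBINT z. norm z powr p * (?Q z)^2)
   \<le> 2 * (LBINT z. norm z powr p * (ch dl rh z * tr H z)^2) + 2 * (LBINT z. norm z powr p * (?P z)^2)" .
  have "(LBINT z. norm z powr p * (?P z)^2) \<le> (LBINT z. dl powr p * (?Pi z)^2 + (rh / 2) powr p * (?Po z)^2)"
   by (rule integral_mono[OF i2 _ pt]) (use ii io in \<open>intro Bochner_Integration.integrable_add integrable_mult_right\<close>)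
  also have "\<dots> = dl powr p * (LBINT z. (?Pi z)^2) + (rh / 2) powr p * (LBINT z. (?Po z)^2)" using ii io by simp
  also have "\<dots> \<le> dl powr p * (Ci / dl ^ 4 * NN dl w (tr H)) + (rh / 2) powr p * (Co / rh ^ 4 * NN rh w (tr H))"
   using Ci(2)[OF d(1) rh(2) W] Co(2)[OF rh(1) d(3) W] by (intro add_mono mult_left_mono) auto
  also have "\<dots> \<le> max Ci Co * (dl powr p / dl ^ 4 * NN dl w (tr H) + (rh / 2) powr p / rh ^ 4 * NN rh w (tr H))"
  proof -
   have "Ci * (dl powr p / dl ^ 4 * NN dl w (tr H)) \<le> max Ci Co * (dl powr p / dl ^ 4 * NN dl w (tr H))"
    using NN_nonneg[of dl w "tr H"] d by (intro mult_right_mono) auto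
   moreover have "Co * ((rh / 2) powr p / rh ^ 4 * NN rh w (tr H)) \<le> max Ci Co * ((rh / 2) powr p / rh ^ 4 * NN rh w (tr H))"
    using NN_nonneg[of rh w "tr H"] rh by (intro mult_right_mono) auto
   ultimately show ?thesis by (simp add: algebra_simps)
  qed
  finally show "(LBINT z. norm z powr p * (?Q z)^2)
   \<le> 2 * (LBINT z. norm z powr p * (ch dl rh z * tr H z)^2)
    + C * (dl powr p / dl ^ 4 * NN dl w (tr H) + (rh / 2) powr p / rh ^ 4 * NN rh w (tr H))"
   using S1 unfolding C_def by linarith
 qed
qed

lemma gchi_bound:
 fixes X :: "real \<Rightarrow> real"
 assumes X: "bsm X" and 0: "\<And>s. s > 2 \<Longrightarrow> pd 1 X s = 0"
 shows "\<exists>K\<ge>0. \<forall>a (z::'a::euclidean_space). gchi X a z \<bullet> gchi X a z \<le> K / a^2"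
proof -
 obtain M where M: "\<And>s. \<bar>pd 1 X s\<bar> \<le> M" by (rule bsm_bounded[OF bsm_pd1[OF X]]) blast
 have "gchi X a z \<bullet> gchi X a z \<le> 4 * (M^2 * 2) / a^2" for a and z :: 'a
 proof -
  let ?s = "(z \<bullet> z) / a^2"
  have "(pd 1 X ?s)^2 * ?s \<le> M^2 * 2"
  proof (cases "?s > 2")
   case False
   have "(pd 1 X ?s)^2 \<le> M^2" using M[of ?s] abs_le_square_iff[of "pd 1 X ?s" M] by linarith
   thus ?thesis using False by (intro mult_mono) auto
  qed (simp add: 0)
  from divide_right_mono[OF mult_left_mono[OF this, of 4], of "a^2"] show ?thesis by (simp add: gchi_def power2_eq_square)
 qed
 thus ?thesis by (intro exI[of _ "4 * (M^2 * 2)"]) simp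
qed

text \<open>The same comparison of zones for the term that appears when the cutoff is commuted with
  a first derivative.\<close>

lemma gch_weighted:
 "\<exists>K\<ge>0. \<forall>dl rh p (w :: 'a::euclidean_space \<Rightarrow> real) l. 0 < dl \<longrightarrow> 4 * dl < rh \<longrightarrow> p \<le> 0 \<longrightarrow> continuous_on UNIV w \<longrightarrow> continuous_on UNIV l \<longrightarrow>
  (LBINT z. norm z powr p * ((w z)^2 * (gch dl rh z \<bullet> gch dl rh z)))
   \<le> K * (dl powr p / dl^2 * NN dl w l + (rh / 2) powr p / rh^2 * NN rh w l)"
proof -
 obtain K1 where K1: "K1 \<ge> 0" "\<And>a (z::'a). gchi Xi a z \<bullet> gchi Xi a z \<le> K1 / a^2" using gchi_bound[OF bsm_Xi, where 'a = 'a] by (auto simp: pd_X_zero)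
 obtain K2 where K2: "K2 \<ge> 0" "\<And>a (z::'a). gchi Xo a z \<bullet> gchi Xo a z \<le> K2 / a^2" using gchi_bound[OF bsm_Xo, where 'a = 'a] by (auto simp: pd_X_zero)
 define K where "K = K1 + K2"
 have K: "K \<ge> 0" using K1 K2 by (simp add: K_def)
 have "K1 / a^2 \<le> K / a^2" "K2 / a^2 \<le> K / a^2" for a :: real using K1 K2 by (auto simp: K_def intro: divide_right_mono)
 note gK = order_trans[OF K1(2) this(1)] order_trans[OF K2(2) this(2)]
 show ?thesis
 proof (intro exI[of _ K] conjI allI impI K)
  fix dl rh p :: real and w l :: "'a \<Rightarrow> real"
  assume d: "0 < dl" "4 * dl < rh" and p: "p \<le> 0" and w: "continuous_on UNIV w" and l: "continuous_on UNIV l"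
  let ?g = "\<lambda>z::'a. gch dl rh z \<bullet> gch dl rh z"
  let ?D = "\<lambda>a z. indicator (cball 0 (2 * a)) z * ((w z)^2 + (l z)^2)"
  let ?a = "dl powr p / dl^2" and ?c = "(rh / 2) powr p / rh^2"
  have key: "norm z powr p * ?g z \<le> K * (?a * indicator (cball 0 (2 * dl)) z + ?c * indicator (cball 0 (2 * rh)) z)" for z
  proof -
   have m: "norm z powr p * G \<le> K * (s powr p / t^2)" if "0 < s" "s \<le> norm z" "G \<le> K / t^2" "0 \<le> G" for s t G
    using mult_mono[OF powr_antimono[OF that(1,2) p] that(3)] that(4) by (simp add: mult.commute)
   have *: "K * ?a \<ge> 0" "K * ?c \<ge> 0" using K by simp_all
   consider "norm z < dl \<or> norm z > rh" | "dl \<le> norm z" "norm z < rh / 2" | "rh / 2 \<le> norm z" "norm z \<le> rh" by linarith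
   thus ?thesis
   proof cases
    case 1
    thus ?thesis using ch_outside(2)[OF d 1] K by simp
   next
    case 2
    hence g: "gch dl rh z = gchi Xi dl z" using ch_zones(1)[OF d, of z] by simp
    show ?thesis
    proof (cases "norm z \<le> 2 * dl")
     case True
     thus ?thesis using m[OF d(1) 2(1) gK(1)[of dl z]] 2 d * unfolding g by (simp add: distrib_left)
    qed (use chi_Xi(3)[OF d(1), of z] g K in simp)
   next
    case 3
    hence g: "gch dl rh z = gchi Xo rh z" using ch_zones(2)[OF d, of z] d by simp
    have "norm z powr p * ?g z \<le> K * ?c" unfolding g by (rule m[OF _ 3(1) gK(2)]) (use d in auto)
    thus ?thesis using 3 d * by (cases "norm z \<le> 2 * dl") (simp_all add: distrib_left)
   qed
  qed
  have pt: "norm z powr p * ((w z)^2 * ?g z) \<le> K * (?a * ?D dl z + ?c * ?D rh z)" for z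
  proof -
   have "norm z powr p * ((w z)^2 * ?g z) = (norm z powr p * ?g z) * (w z)^2" by (simp add: mult_ac)
   also have "\<dots> \<le> (K * (?a * indicator (cball 0 (2 * dl)) z + ?c * indicator (cball 0 (2 * rh)) z)) * ((w z)^2 + (l z)^2)"
    by (rule mult_mono[OF key]) (use K in auto)
   also have "\<dots> = K * (?a * ?D dl z + ?c * ?D rh z)" by (simp only: distrib_right distrib_left mult.assoc)
   finally show ?thesis .
  qed
  have iD: "L1 (?D a)" for a
  proof -
   have "continuous_on UNIV (\<lambda>z. (w z)^2 + (l z)^2)" by (intro continuous_intros w l)
   hence "continuous_on (cball 0 (2 * a)) (\<lambda>z. (w z)^2 + (l z)^2)" by (rule continuous_on_subset) simp
   from borel_integrable_compact[OF compact_cball this] show ?thesis by simp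
  qed
  have iL: "L1 (\<lambda>z. norm z powr p * ((w z)^2 * ?g z))" by (rule integrable_powr_vanishing[OF d(1), of _ rh])
     (auto simp: ch_outside[OF d] intro!: continuous_intros w C2D(6)[OF C2_ch])
  have "(LBINT z. norm z powr p * ((w z)^2 * ?g z)) \<le> (LBINT z. K * (?a * ?D dl z + ?c * ?D rh z))"
   by (rule integral_mono[OF iL _ pt]) (intro integrable_mult_right Bochner_Integration.integrable_add iD)
  also have "\<dots> = K * (?a * NN dl w l + ?c * NN rh w l)" unfolding NN_def using iD[of dl] iD[of rh] by (simp del: divide_inverse)
  finally show "(LBINT z. norm z powr p * ((w z)^2 * ?g z)) \<le> K * (?a * NN dl w l + ?c * NN rh w l)" .
 qed
qed

section \<open>The Carleman estimate for the system\<close>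

text \<open>The common bound A collects the source \<Delta>y, the inner cutoff error and the outer
  cutoff error. The trace carries the weight 1 - b and the source the weight 4 - b: this gap of
  three powers allows absorption.\<close>

definition system_bounded :: "real \<Rightarrow> real \<Rightarrow> real \<Rightarrow> real \<Rightarrow> ('b::euclidean_space \<times> real \<Rightarrow> real) \<Rightarrow> ('b \<times> real \<Rightarrow> real) \<Rightarrow> bool" where
 "system_bounded C dl rh b u y \<longleftrightarrow> (let A = C * ((LBINT z. norm z powr (4 - b) * (ch dl rh z * lap y z)^2)
     + (dl powr (3 - b) / dl ^ 4 * (NN dl u (lap u) + NN dl y (lap y))
     + (rh / 2) powr (3 - b) / rh ^ 4 * (NN rh u (lap u) + NN rh y (lap y))))
   in (LBINT x. norm x powr (1 - b) * (ch dl rh (x, 0::real) * u (x, 0))^2) \<le> A \<and>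
     (LBINT z. norm z powr (- b) * (ch dl rh z * u z)^2) \<le> A)"

text \<open>The gradient bound of \<open>carleman\<close> for the cut-off y with exponent b controls
  \<Delta>u = \<partial>y/\<partial>t; \<open>carleman_trace\<close> and \<open>carleman\<close> for
  the cut-off u with exponent b + 1 then give the two estimates.\<close>

lemma carleman_system:
 "\<exists>C\<ge>0. \<forall>dl rh b (u :: 'b::euclidean_space \<times> real \<Rightarrow> real) y. 0 < dl \<longrightarrow> 4 * dl < rh \<longrightarrow> rh \<le> 1 \<longrightarrow>
   b \<ge> real DIM('b \<times> real) \<longrightarrow> b \<ge> 4 \<longrightarrow> bsm u \<longrightarrow> bsm y \<longrightarrow> (\<forall>z. norm z < rh \<longrightarrow> lap u z = pd (0, 1) y z) \<longrightarrow>
   system_bounded C dl rh b u y"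
proof -
 obtain C where C: "C \<ge> 0" "\<And>dl rh p (w :: 'b \<times> real \<Rightarrow> real) g H. 0 < dl \<Longrightarrow> 4 * dl < rh \<Longrightarrow> rh \<le> 1 \<Longrightarrow> p \<le> 0 \<Longrightarrow> C2 w g H \<Longrightarrow>
  (LBINT z. norm z powr p * (ch dl rh z * tr H z + 2 * (gch dl rh z \<bullet> g z) + w z * tr (Hch dl rh) z)^2)
   \<le> 2 * (LBINT z. norm z powr p * (ch dl rh z * tr H z)^2)
    + C * (dl powr p / dl ^ 4 * NN dl w (tr H) + (rh / 2) powr p / rh ^ 4 * NN rh w (tr H))"
  using weighted_cutoff[where 'a = "'b \<times> real"] by blast
 obtain K where K: "K \<ge> 0" "\<And>dl rh p (w :: 'b \<times> real \<Rightarrow> real) l. 0 < dl \<Longrightarrow> 4 * dl < rh \<Longrightarrow> p \<le> 0 \<Longrightarrow> continuous_on UNIV w \<Longrightarrow> continuous_on UNIV l \<Longrightarrow>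
  (LBINT z. norm z powr p * ((w z)^2 * (gch dl rh z \<bullet> gch dl rh z)))
   \<le> K * (dl powr p / dl^2 * NN dl w l + (rh / 2) powr p / rh^2 * NN rh w l)"
  using gch_weighted[where 'a = "'b \<times> real"] by blast
 \<comment> \<open>The factor 9 is the constant of \<open>carleman_trace\<close>. For the bracket,
   \<open>Ps\<close> is at most 24 Ph plus 12 C + 2 K times the cutoff errors of y and enters twice;
   the last C belongs to the commutator with u.\<close>
 define C' where "C' = 9 * (48 + 24 * C + 4 * K + C)"
 show ?thesis
 proof (intro exI[of _ C'] conjI allI impI)
  show "C' \<ge> 0" using C(1) K(1) by (simp add: C'_def)
  fix dl rh b :: real and u y :: "'b \<times> real \<Rightarrow> real"
  assume d: "0 < dl" "4 * dl < rh" "rh \<le> 1" and b: "b \<ge> real DIM('b \<times> real)" "b \<ge> 4"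
   and u: "bsm u" and y: "bsm y" and eq: "\<forall>z. norm z < rh \<longrightarrow> lap u z = pd (0, 1) y z"
  have rh: "rh > 0" "dl \<le> 1" using d by auto
  note cu = C2_mult[OF C2_ch[of dl rh] bsm_C2[OF u]] and cy = C2_mult[OF C2_ch[of dl rh] bsm_C2[OF y]]
  have dim: "DIM('b \<times> real) \<ge> 2" using DIM_positive[where 'a = 'b] by (simp add: Suc_le_eq)
  have z0: "ch dl rh z * w = 0" if "norm z < dl" for z :: "'b \<times> real" and w using ch_props(3)[OF d(1,2), of z] that by simp
  have z1: "ch dl rh z * w = 0" if "norm z \<ge> 1" for z :: "'b \<times> real" and w using ch_props(4)[OF d(1,2), of z] that d by simp
  have tru: "tr (hess u) = lap u" and trY: "tr (hess y) = lap y" by (rule ext, rule tr_hess)+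
  define Ph where "Ph = (LBINT z. norm z powr (4 - b) * (ch dl rh z * lap y z)^2)"
  define Ps where "Ps = (LBINT z. norm z powr (3 - b) * (ch dl rh z * lap u z)^2)"
  define q where "q z = norm z powr (3 - b) * ((y z)^2 * (gch dl rh z \<bullet> gch dl rh z))" for z
  define gy where "gy z = ch dl rh z *\<^sub>R grad y z + y z *\<^sub>R gch dl rh z" for z
  define P where "P = dl powr (3 - b) / dl ^ 4"
  define Q where "Q = (rh / 2) powr (3 - b) / rh ^ 4"
  let ?nu = "NN dl u (lap u)" and ?ny = "NN dl y (lap y)" and ?mu = "NN rh u (lap u)" and ?my = "NN rh y (lap y)"
  have nn: "0 \<le> ?nu" "0 \<le> ?ny" "0 \<le> ?mu" "0 \<le> ?my" by (rule NN_nonneg)+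
  have Ph0: "Ph \<ge> 0" unfolding Ph_def by (rule Bochner_Integration.integral_nonneg) simp
  have PQ: "dl powr (4 - b) / dl ^ 4 \<le> P" "(rh / 2) powr (4 - b) / rh ^ 4 \<le> Q" "dl powr (3 - b) / dl^2 \<le> P" "(rh / 2) powr (3 - b) / rh^2 \<le> Q" "0 \<le> P" "0 \<le> Q"
  proof -
   show "dl powr (4 - b) / dl ^ 4 \<le> P" "(rh / 2) powr (4 - b) / rh ^ 4 \<le> Q" unfolding P_def Q_def using d rh by (intro divide_right_mono powr_mono'; simp)+
   show "dl powr (3 - b) / dl^2 \<le> P" "(rh / 2) powr (3 - b) / rh^2 \<le> Q" unfolding P_def Q_def using d rh by (intro divide_left_mono power_decreasing; simp)+
   show "0 \<le> P" "0 \<le> Q" unfolding P_def Q_def by simp_all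
  qed
  have Iy: "(LBINT z. norm z powr (4 - b) * (ch dl rh z * lap y z + 2 * (gch dl rh z \<bullet> grad y z) + y z * tr (Hch dl rh) z)^2)
   \<le> 2 * Ph + C * (P * ?ny + Q * ?my)"
  proof -
   have "C * (dl powr (4 - b) / dl ^ 4 * ?ny + (rh / 2) powr (4 - b) / rh ^ 4 * ?my) \<le> C * (P * ?ny + Q * ?my)"
    by (intro mult_left_mono add_mono mult_right_mono PQ nn C(1))
   thus ?thesis using C(2)[OF d, of "4 - b" y "grad y" "hess y"] b bsm_C2[OF y] unfolding trY Ph_def by simp
  qed
  have gy: "(LBINT z. norm z powr (3 - b) * (gy z \<bullet> gy z)) \<le> 6 * (2 * Ph + C * (P * ?ny + Q * ?my))" unfolding gy_def
   by (rule order_trans[OF carleman(2)[OF cy d(1) z0 z1 dim b]], assumption, assumption)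
    (unfold tr_mult trY, rule mult_left_mono[OF Iy], simp)
  have qq: "(LBINT z. q z) \<le> K * (P * ?ny + Q * ?my)"
  proof -
   have "K * (dl powr (3 - b) / dl^2 * ?ny + (rh / 2) powr (3 - b) / rh^2 * ?my) \<le> K * (P * ?ny + Q * ?my)"
    by (intro mult_left_mono add_mono mult_right_mono PQ nn K(1))
   thus ?thesis using K(2)[OF d(1,2), of "3 - b" y "lap y"] b bsm_continuous[OF y, of UNIV] bsm_continuous[OF bsm_lap[OF y], of UNIV] unfolding q_def by simp
  qed
  note E = C2D[OF C2_ch[of dl rh, where 'a = "'b \<times> real"]] and Y = C2D[OF bsm_C2[OF y]] and U = C2D[OF bsm_C2[OF u]]
  note iw = integrable_powr_vanishing[of dl _ rh, OF d(1)]
  have iq: "L1 q" unfolding q_def by (rule iw) (auto simp: ch_outside[OF d(1,2)] intro!: continuous_intros E Y)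
  have ig: "L1 (\<lambda>z. norm z powr (3 - b) * (gy z \<bullet> gy z))" unfolding gy_def by (rule iw) (auto simp: ch_outside[OF d(1,2)] intro!: continuous_intros E Y)
  have Ps: "Ps \<le> 12 * (2 * Ph + C * (P * ?ny + Q * ?my)) + 2 * (K * (P * ?ny + Q * ?my))"
  proof -
   have "Ps \<le> (LBINT z. 2 * (norm z powr (3 - b) * (gy z \<bullet> gy z)) + 2 * q z)" unfolding Ps_def
   proof (rule integral_mono)
    show "L1 (\<lambda>z. norm z powr (3 - b) * (ch dl rh z * lap u z)^2)"
     by (rule iw) (auto simp: ch_outside[OF d(1,2)] intro!: continuous_intros E bsm_continuous[OF bsm_lap[OF u]])
    show "L1 (\<lambda>z. 2 * (norm z powr (3 - b) * (gy z \<bullet> gy z)) + 2 * q z)" using ig iq by simp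
    fix z :: "'b \<times> real"
    \<comment> \<open>Product rule: ch \<partial>y/\<partial>t is the t component of
      \<open>gy\<close>, the gradient of ch y, minus y \<partial>ch/\<partial>t, which lives in the
      transition zones.\<close>
    have "(ch dl rh z * lap u z)^2 \<le> 2 * (gy z \<bullet> gy z) + 2 * ((y z)^2 * (gch dl rh z \<bullet> gch dl rh z))"
    proof -
     have n1: "(a \<bullet> (0, 1))^2 \<le> a \<bullet> a" for a :: "'b \<times> real"
     proof -
      have "a \<bullet> a = fst a \<bullet> fst a + (snd a)^2" "a \<bullet> (0, 1) = snd a" by (simp_all add: inner_prod_def power2_eq_square)
      thus ?thesis by simp
     qed
     have "ch dl rh z * lap u z = ch dl rh z * pd (0, 1) y z" using eq[rule_format, of z] ch_props(4)[OF d(1,2), of z] by (cases "norm z < rh") simp_all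
     also have "\<dots> = gy z \<bullet> (0, 1) - y z * (gch dl rh z \<bullet> (0, 1))" using grad_inner_Basis[OF Basis_01, of y z] by (simp add: gy_def inner_add_left)
     finally have e: "ch dl rh z * lap u z = gy z \<bullet> (0, 1) - y z * (gch dl rh z \<bullet> (0, 1))" .
     have s: "(a - c)^2 \<le> 2 * a^2 + 2 * c^2" for a c :: real using zero_le_power2[of "a + c"] by (simp add: power2_eq_square algebra_simps)
     have t: "(y z * (gch dl rh z \<bullet> (0, 1)))^2 \<le> (y z)^2 * (gch dl rh z \<bullet> gch dl rh z)" unfolding power_mult_distrib by (intro mult_left_mono n1) simp
     show ?thesis unfolding e using s[of "gy z \<bullet> (0, 1)" "y z * (gch dl rh z \<bullet> (0, 1))"] t n1[of "gy z"] by linarith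
    qed
    from mult_left_mono[OF this, of "norm z powr (3 - b)"]
    show "norm z powr (3 - b) * (ch dl rh z * lap u z)^2 \<le> 2 * (norm z powr (3 - b) * (gy z \<bullet> gy z)) + 2 * q z"
     unfolding q_def by (simp add: distrib_left mult.left_commute[of 2])
   qed
   also have "\<dots> = 2 * (LBINT z. norm z powr (3 - b) * (gy z \<bullet> gy z)) + 2 * (LBINT z. q z)" using ig iq by simp
   finally show ?thesis using gy qq by linarith
  qed
  define A where "A = Ph + (P * (?nu + ?ny) + Q * (?mu + ?my))"
  \<comment> \<open>The exponent b + 1 is taken for u because 4 - (b + 1) = 3 - b is the weight in
    which \<nabla>y, hence \<Delta>u, has been controlled.\<close>
  have Iu: "9 * (LBINT z. norm z powr (4 - (b + 1)) * (tr (\<lambda>x h. ch dl rh x *\<^sub>R hess u x h + (gch dl rh x \<bullet> h) *\<^sub>R grad u x + u x *\<^sub>R Hch dl rh x h + (grad u x \<bullet> h) *\<^sub>R gch dl rh x) z)^2)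
    \<le> C' * A" (is "9 * ?I \<le> _")
  proof -
   have e: "4 - (b + 1) = 3 - b" by simp
   have "?I \<le> 2 * Ps + C * (P * ?nu + Q * ?mu)" using C(2)[OF d, of "3 - b" u "grad u" "hess u"] b bsm_C2[OF u] unfolding tr_mult tru Ps_def P_def Q_def e by simp
   also have "\<dots> \<le> 48 * Ph + 24 * (C * (P * ?ny + Q * ?my)) + 4 * (K * (P * ?ny + Q * ?my)) + C * (P * ?nu + Q * ?mu)"
   proof -
    have "2 * p + z \<le> 48 * f + 24 * c + 4 * k + z" if "p \<le> 12 * (2 * f + c) + 2 * k" for p f c k z :: real using that by argo
    from this[OF Ps] show ?thesis .
   qed
   also have "\<dots> \<le> 48 * A + 24 * (C * A) + 4 * (K * A) + C * A"
   proof -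
    have 1: "P * ?nu + Q * ?mu \<le> A" "P * ?ny + Q * ?my \<le> A" "Ph \<le> A"
     unfolding A_def using Ph0 PQ(5,6) nn by (simp_all add: distrib_left add_increasing add_increasing2)
    show ?thesis using mult_left_mono[OF 1(1) C(1)] mult_left_mono[OF 1(2) C(1)] mult_left_mono[OF 1(2) K(1)] 1(3) by linarith
   qed
   also have "\<dots> = C' / 9 * A" by (simp add: C'_def algebra_simps)
   finally show ?thesis by simp
  qed
  have b1: "b + 1 \<ge> real DIM('b \<times> real)" "b + 1 \<ge> 4" using b by auto
  have I0: "?I \<ge> 0" by (rule Bochner_Integration.integral_nonneg) simp
  have R1: "(LBINT x. norm x powr (1 - b) * (ch dl rh (x, 0::real) * u (x, 0))^2) \<le> C' * A"
  proof -
   have e: "2 - (b + 1) = 1 - b" by simp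
   have "(LBINT x. norm x powr (2 - (b + 1)) * (ch dl rh (x, 0::real) * u (x, 0))^2) \<le> 9 * ?I" by (rule carleman_trace[OF cu d(1) z0 z1 dim b1])
   thus ?thesis using Iu unfolding e by linarith
  qed
  have R2: "(LBINT z. norm z powr (- b) * (ch dl rh z * u z)^2) \<le> C' * A"
  proof -
   let ?L = "(LBINT z. norm z powr (- b) * (ch dl rh z * u z)^2)"
   have e: "1 - (b + 1) = - b" by simp
   have c: "(b + 1 - 2)^2 * ?L \<le> 4 * ?I" unfolding e[symmetric] by (rule carleman(1)[OF cu d(1) z0 z1 dim b1])
   have L0: "?L \<ge> 0" by (rule Bochner_Integration.integral_nonneg) simp
   have "4 \<le> (b + 1 - 2)^2" using power_mono[of 2 "b + 1 - 2" 2] b by simp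
   from mult_right_mono[OF this L0] have "?L \<le> ?I" using c by linarith
   thus ?thesis using Iu I0 by linarith
  qed
  show "system_bounded C' dl rh b u y" unfolding system_bounded_def unfolding Let_def using R1 R2 unfolding A_def Ph_def P_def Q_def by blast
 qed
qed

section \<open>Size of the mollified functions in the two cutoff zones\<close>

lemma NN_nn_integral:
 fixes w l :: "'a::euclidean_space \<Rightarrow> real"
 assumes w: "continuous_on UNIV w" and l: "continuous_on UNIV l"
 shows "ennreal (NN a w l) = (NBINT z. indicator (cball 0 (2 * a)) z * ennreal ((w z)^2))
   + (NBINT z. indicator (cball 0 (2 * a)) z * ennreal ((l z)^2))"
proof -
 have c: "continuous_on UNIV (\<lambda>z. (w z)^2 + (l z)^2)" by (intro continuous_intros w l)
 hence "continuous_on (cball 0 (2 * a)) (\<lambda>z. (w z)^2 + (l z)^2)" by (rule continuous_on_subset) simp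
 from borel_integrable_compact[OF compact_cball this]
 have i: "L1 (\<lambda>z. indicator (cball 0 (2 * a)) z * ((w z)^2 + (l z)^2))" by simp
 have [measurable]: "w \<in> BM" "l \<in> BM" using w l by (simp_all add: borel_measurable_continuous_onI)
 have "ennreal (NN a w l) = (NBINT z. ennreal (indicator (cball 0 (2 * a)) z * ((w z)^2 + (l z)^2)))"
  unfolding NN_def by (rule nn_integral_eq_integral[OF i, symmetric]) simp
 also have "\<dots> = (NBINT z. indicator (cball 0 (2 * a)) z * ennreal ((w z)^2) + indicator (cball 0 (2 * a)) z * ennreal ((l z)^2))"
  by (rule nn_integral_cong) (simp add: indicator_def ennreal_plus)
 also have "\<dots> = (NBINT z. indicator (cball 0 (2 * a)) z * ennreal ((w z)^2))
   + (NBINT z. indicator (cball 0 (2 * a)) z * ennreal ((l z)^2))"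
  by (rule nn_integral_add; intro borel_measurable_times_ennreal borel_measurable_indicator) simp_all
 finally show ?thesis .
qed

context core begin

lemma cont: "continuous_on UNIV (u e)" "continuous_on UNIV (v e)" "continuous_on UNIV (y e)"
 "continuous_on UNIV (lap (u e))" "continuous_on UNIV (lap (y e))"
 by (intro bsm_continuous bsm_uvy bsm_lap)+

lemma cont_measurable [measurable]: "u e \<in> BM" "v e \<in> BM" "y e \<in> BM"
 "lap (u e) \<in> BM" "lap (y e) \<in> BM"
 using cont by (simp_all add: borel_measurable_continuous_onI)

abbreviation mass where
 "mass a e \<equiv> NN a (u e) (lap (u e)) + NN a (y e) (lap (y e))"

lemma NN_sum:
 assumes e: "e > 0" and a: "2 * a + k * e < R"
 shows "ennreal (mass a e)
  = (NBINT z. indicator (cball 0 (2 * a)) z * ennreal ((u e z)^2))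
  + (NBINT z. indicator (cball 0 (2 * a)) z * ennreal ((v e z)^2))
  + ((NBINT z. indicator (cball 0 (2 * a)) z * ennreal ((y e z)^2))
  + (NBINT z. indicator (cball 0 (2 * a)) z * ennreal ((F e z)^2)))"
proof -
 have "norm z + k * e < R" if "z \<in> cball 0 (2 * a)" for z :: "'b \<times> real" using that a by simp
 hence 1: "indicator (cball 0 (2 * a)) z * ennreal ((lap (u e) z)^2) = indicator (cball 0 (2 * a)) z * ennreal ((v e z)^2)"
  "indicator (cball 0 (2 * a)) z * ennreal ((lap (y e) z)^2) = indicator (cball 0 (2 * a)) z * ennreal ((F e z)^2)" for z
  by (cases "z \<in> cball 0 (2 * a)"; simp add: lap_u[OF e] lap_y[OF e])+
 show ?thesis using NN_nn_integral[OF cont(1,4)] NN_nn_integral[OF cont(3,5)] by (simp add: ennreal_plus NN_nonneg 1)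
qed

lemma f_sq: "ennreal ((f x)^2) \<le> ennreal (Hb^2 * (T0 x)^2)"
proof (rule ennreal_leI)
 have "\<bar>f x\<bar>^2 \<le> (Hb * \<bar>T0 x\<bar>)^2" by (rule power_mono[OF f_le]) simp
 thus "(f x)^2 \<le> Hb^2 * (T0 x)^2" by (simp add: power_mult_distrib)
qed

text \<open>By the L2 bounds, M depends neither on the mollification scale nor on \<open>rh\<close>,
  so the outer cutoff error stays bounded while the scale tends to 0.\<close>

lemma outer_bound:
 "\<exists>M\<ge>0. \<forall>e rh. 0 < e \<longrightarrow> 0 < rh \<longrightarrow> rh \<le> R / 4 \<longrightarrow> k * e \<le> R / 4 \<longrightarrow>
   mass rh e \<le> M"
proof -
 define M where "M = (LBINT z. (u0 z)^2) + 2 * (LBINT z. (v0 z)^2) + 2 * Hb^2 * (LBINT x. (T0 x)^2)"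
 have M: "M \<ge> 0" unfolding M_def by (intro add_nonneg_nonneg mult_nonneg_nonneg Bochner_Integration.integral_nonneg) auto
 have "mass rh e \<le> M" if e: "0 < e" and rh: "0 < rh" "rh \<le> R / 4" and ke: "k * e \<le> R / 4" for e rh
 proof -
  have a: "2 * rh + k * e < R" using rh ke R by linarith
  have 1: "(NBINT z. indicator (cball 0 (2 * rh)) z * ennreal ((w z)^2)) \<le> (NBINT z. ennreal ((w z)^2))" for w :: "'b \<times> real \<Rightarrow> real"
   by (rule nn_integral_mono) (simp add: indicator_def)
  have 2: "(NBINT z. indicator (cball 0 (2 * rh)) z * ennreal ((y e z)^2)) \<le> (NBINT z. indicator {z. \<bar>snd z\<bar> \<le> 1} z * ennreal ((y e z)^2))"
  proof (rule nn_integral_mono, rule mult_right_mono)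
   fix z :: "'b \<times> real"
   show "(indicator (cball 0 (2 * rh)) z :: ennreal) \<le> indicator {z. \<bar>snd z\<bar> \<le> 1} z"
    using norm_snd_le[of "snd z" "fst z"] rh R by (auto simp: indicator_def)
  qed simp
  have 3: "(NBINT z. indicator (cball 0 (2 * rh)) z * ennreal ((F e z)^2)) \<le> (NBINT x. ennreal (2 * 1) * 1 * ennreal ((f x)^2))"
  proof (rule F_L2[OF e, where Om = "\<lambda>_. 1"])
   show "indicator (cball 0 (2 * rh)) z \<le> indicator {- 1..1} (snd z) * (1::ennreal)" for z :: "'b \<times> real"
    using norm_snd_le[of "snd z" "fst z"] rh R by (auto simp: indicator_def)
   show "(NBINT x. 1 * ennreal (be e (x - x'))) \<le> 1" for x' :: 'b using nn_integral_be_shift(1)[OF e, of x'] by simp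
  qed (simp_all add: borel_measurable_indicator)
  also have "\<dots> \<le> (NBINT x. ennreal (2 * Hb^2 * (T0 x)^2))"
  proof (rule nn_integral_mono)
   fix x :: 'b
   have "ennreal (2 * 1) * 1 * ennreal ((f x)^2) \<le> ennreal 2 * ennreal (Hb^2 * (T0 x)^2)" using mult_left_mono[OF f_sq[of x], of 2] by simp
   thus "ennreal (2 * 1) * 1 * ennreal ((f x)^2) \<le> ennreal (2 * Hb^2 * (T0 x)^2)" by (simp add: ennreal_mult mult.assoc)
  qed
  finally have 3: "(NBINT z. indicator (cball 0 (2 * rh)) z * ennreal ((F e z)^2)) \<le> (NBINT x. ennreal (2 * Hb^2 * (T0 x)^2))" .
  have I: "(NBINT z. ennreal ((u0 z)^2)) = ennreal (LBINT z. (u0 z)^2)"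
   "(NBINT z. ennreal ((v0 z)^2)) = ennreal (LBINT z. (v0 z)^2)"
   "(NBINT x. ennreal (2 * Hb^2 * (T0 x)^2)) = ennreal (2 * Hb^2 * (LBINT x. (T0 x)^2))"
   using sq by (simp_all add: nn_integral_eq_integral)
  have "ennreal (mass rh e)
   \<le> ennreal (LBINT z. (u0 z)^2) + ennreal (LBINT z. (v0 z)^2)
    + (ennreal (LBINT z. (v0 z)^2) + ennreal (2 * Hb^2 * (LBINT x. (T0 x)^2)))"
   unfolding NN_sum[OF e a] I[symmetric] by (intro add_mono order_trans[OF 1 u_L2] order_trans[OF 1 v_L2] order_trans[OF 2 y_L2] 3 e)
  also have "\<dots> = ennreal M" unfolding M_def by (subst ennreal_plus[symmetric], simp_all)+
  finally show ?thesis using M by (simp add: ennreal_le_iff)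
 qed
 thus ?thesis using M by blast
qed

lemma F_bound:
 assumes T0: "AE x in lborel. norm x \<le> r \<longrightarrow> \<bar>T0 x\<bar> \<le> c" and c: "c \<ge> 0"
  and e: "e > 0" and z: "norm z + k * e \<le> r"
 shows "\<bar>F e z\<bar> \<le> Hb * c"
proof -
 let ?b = "\<lambda>x. be e (x - fst z)"
 have sym: "be e (fst z - x) = ?b x" for x using be_even[of e "fst z - x"] by simp
 have ib: "L1 ?b" "(LBINT x. ?b x) = 1" by (auto intro!: integrableI_bounded simp: integral_eq_nn_integral be_nonneg e nn_integral_be_shift[OF e])
 have "(\<lambda>x. Tht e (fst z - x, snd z)) \<in> borel_measurable lborel" by measurable
 moreover obtain M where "\<And>z. \<bar>Tht e (z::'b \<times> real)\<bar> \<le> M" by (rule bsm_bounded[OF bsm_Tht]) blast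
 ultimately have i: "L1 (\<lambda>x. (-2) * (f x * Tht e (fst z - x, snd z)))" by (intro integrable_mult_right integrable_mult_bounded[OF int(4)])
 have "\<bar>F e z\<bar> \<le> (LBINT x. \<bar>(-2) * (f x * Tht e (fst z - x, snd z))\<bar>)"
  using integral_abs_bound[of lborel "\<lambda>x. (-2) * (f x * Tht e (fst z - x, snd z))"] by (simp add: F_def)
 also have "\<dots> \<le> (LBINT x. Hb * c * ?b x)"
 proof (rule integral_mono_AE)
  show "AE x in lborel. \<bar>(-2) * (f x * Tht e (fst z - x, snd z))\<bar> \<le> Hb * c * ?b x" using T0
  proof eventually_elim
   case (elim x)
   have "\<bar>(-2) * (f x * Tht e (fst z - x, snd z))\<bar> \<le> \<bar>f x\<bar> * ?b x"
    using mult_left_mono[OF Tht_bound[OF e, of "(fst z - x, snd z)"] abs_ge_zero[of "f x"]] by (simp add: abs_mult sym)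
   also have "\<dots> \<le> Hb * c * ?b x"
   proof (cases "norm x \<le> r")
    case True
    have "\<bar>f x\<bar> \<le> Hb * c" using f_le[of x] mult_left_mono[of "\<bar>T0 x\<bar>" c Hb] elim True Hb by auto
    thus ?thesis by (intro mult_right_mono be_nonneg e)
   next
    case False
    have "norm (x - fst z) > k * e" using False z norm_triangle_ineq2[of x "fst z"] norm_fst_le[of "fst z" "snd z"] by simp
    moreover have "e * real DIM('b) \<le> k * e" using e by (simp add: k_def ka_def distrib_right mult.commute)
    ultimately have "?b x = 0" by (intro be_zero e) linarith
    thus ?thesis by simp
   qed
   finally show ?case .
  qed
 qed (use i ib in auto)
 also have "\<dots> = Hb * c" using ib by simp
 finally show ?thesis .
qed

text \<open>At cutoff radius \<open>dl\<close> and scale \<open>dl^2\<close> the kernels cost a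
  factor \<open>dl\<close> to the power -2 p, which vanishing of order 2 p + m outweighs. For
  \<open>F\<close>, which is an average of f, the vanishing order of the trace is used
  instead.\<close>

lemma inner_bound:
 "\<exists>C\<ge>0. \<exists>dl0>0. \<forall>dl. 0 < dl \<longrightarrow> dl < dl0 \<longrightarrow>
   mass dl (dl^2) \<le> C * dl ^ m"
proof -
 define p where "p = DIM('b) + 3"
 obtain M where M: "M \<ge> 0" "\<And>e (z::'b \<times> real). 0 < e \<Longrightarrow> e \<le> 1 \<Longrightarrow> norm z + k * e < R \<Longrightarrow>
   \<bar>u e z\<bar> \<le> M * (1 / e) ^ p * La (norm z + k * e) \<and>
   \<bar>v e z\<bar> \<le> M * (1 / e) ^ p * La (norm z + k * e) \<and>
   \<bar>y e z\<bar> \<le> M * (1 / e) ^ p * La (norm z + k * e)"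
  unfolding p_def using inner_bounds by blast
 obtain s0 C0 where s0: "s0 > 0" "C0 \<ge> 0" "\<And>s. 0 < s \<Longrightarrow> s < s0 \<Longrightarrow> 0 \<le> La s \<and> La s \<le> C0 * s ^ (2 * p + m)"
  using La_bound[of "2 * p + m"] by blast
 obtain r where r: "r > 0" "AE x in lborel. norm x < r \<longrightarrow> \<bar>T0 x\<bar> \<le> (2 * norm x) ^ m" using T0_small[of m] by blast
 define D where "D = M * C0 * 3 ^ (2 * p + m) + Hb * 6 ^ m"
 have D: "D \<ge> 0" "M * C0 * 3 ^ (2 * p + m) \<le> D" "Hb * 6 ^ m \<le> D" using M(1) s0(2) Hb by (simp_all add: D_def)
 define W where "W = measure lborel (cball (0 :: 'b \<times> real) 2)"
 define C where "C = 4 * (D^2 * W)"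
 have C: "C \<ge> 0" by (simp add: C_def W_def)
 \<comment> \<open>The bound 1 / k gives k dl^2 \<le> dl, so all averages stay in radius 3 dl, which
   the three thirds keep inside the domains of the estimates; 1 / 2 makes powers of dl at most 1 and
   the ball of radius 2 dl part of the fixed ball of volume W.\<close>
 define dl0 where "dl0 = min (min (1 / 2) (1 / k)) (min (s0 / 3) (min (r / 3) (R / 3)))"
 have k0: "k > 0" using k by linarith
 have dl0: "dl0 > 0" using k0 s0 r R by (simp add: dl0_def)
 have "mass dl (dl^2) \<le> C * dl ^ m" if dl: "0 < dl" "dl < dl0" for dl
 proof -
  have d: "dl < 1 / 2" "dl < 1 / k" "3 * dl < s0" "3 * dl < r" "3 * dl < R" using dl by (auto simp: dl0_def)
  have kd: "k * dl^2 \<le> dl"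
  proof -
   have "k * dl \<le> 1" using d(2) k0 by (simp add: field_simps)
   from mult_right_mono[OF this, of dl] show ?thesis using dl by (simp add: power2_eq_square mult.assoc)
  qed
  have e: "dl^2 > 0" "dl^2 \<le> 1" using dl d(1) by (auto simp: power_le_one)
  have a: "2 * dl + k * dl^2 < R" using kd d by linarith
  have pw: "M * (1 / dl^2) ^ p * La (norm z + k * dl^2) \<le> D * dl ^ m" if z: "norm z \<le> 2 * dl" for z :: "'b \<times> real"
  proof -
   let ?s = "norm z + k * dl^2"
   have s: "0 < ?s" "?s \<le> 3 * dl" using z kd k0 e by (auto intro: add_nonneg_pos)
   have "La ?s \<le> C0 * ?s ^ (2 * p + m)" using s0(3)[of ?s] s d(3) by simp
   also have "\<dots> \<le> C0 * (3 * dl) ^ (2 * p + m)" using s s0(2) by (intro mult_left_mono power_mono) auto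
   finally have "La ?s \<le> C0 * (3 * dl) ^ (2 * p + m)" .
   hence "M * (1 / dl^2) ^ p * La ?s \<le> M * (1 / dl^2) ^ p * (C0 * (3 * dl) ^ (2 * p + m))" using M(1) by (intro mult_left_mono) auto
   moreover have "(dl ^ p)^2 = (dl^2) ^ p" by (simp add: mult.commute flip: power_mult)
   hence "M * (1 / dl^2) ^ p * (C0 * (3 * dl) ^ (2 * p + m)) = M * C0 * 3 ^ (2 * p + m) * dl ^ m" using dl(1)
    by (simp add: power_mult_distrib power_add power_mult power_divide field_simps)
   moreover have "M * C0 * 3 ^ (2 * p + m) * dl ^ m \<le> D * dl ^ m" using D(2) dl(1) by (intro mult_right_mono) auto
   ultimately show ?thesis by linarith
  qed
  have ptu: "\<bar>u (dl^2) z\<bar> \<le> D * dl ^ m" "\<bar>v (dl^2) z\<bar> \<le> D * dl ^ m" "\<bar>y (dl^2) z\<bar> \<le> D * dl ^ m" if z: "norm z \<le> 2 * dl" for z :: "'b \<times> real"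
  proof -
   have "norm z + k * dl^2 < R" using z a by linarith
   from M(2)[OF e this] pw[OF z] show "\<bar>u (dl^2) z\<bar> \<le> D * dl ^ m" "\<bar>v (dl^2) z\<bar> \<le> D * dl ^ m" "\<bar>y (dl^2) z\<bar> \<le> D * dl ^ m"
    by linarith+
  qed
  have dm: "(dl ^ m)^2 \<le> dl ^ m" using dl(1) d(1) by (simp add: power2_eq_square mult_left_le power_le_one)
  have ptF: "\<bar>F (dl^2) z\<bar> \<le> D * dl ^ m" if z: "norm z \<le> 2 * dl" for z :: "'b \<times> real"
  proof -
   have "AE x in lborel. norm x \<le> 3 * dl \<longrightarrow> \<bar>T0 x\<bar> \<le> (6 * dl) ^ m" using r(2)
   proof eventually_elim
    case (elim x)
    thus ?case using d(4) power_mono[of "2 * norm x" "6 * dl" m] by force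
   qed
   hence "\<bar>F (dl^2) z\<bar> \<le> Hb * (6 * dl) ^ m" by (rule F_bound) (use e z kd dl in auto)
   also have "\<dots> \<le> D * dl ^ m" unfolding power_mult_distrib mult.assoc[symmetric] using D(3) dl(1) by (intro mult_right_mono) auto
   finally show ?thesis .
  qed
  have vol: "emeasure lborel (cball (0 :: 'b \<times> real) 2) = ennreal W"
   unfolding W_def using emeasure_eq_ennreal_measure[of lborel] emeasure_bounded_finite[of "cball _ 2"] by (metis bounded_cball less_irrefl infinity_ennreal_def)
  have 1: "(NBINT z. indicator (cball 0 (2 * dl)) z * ennreal ((w z)^2)) \<le> ennreal (D^2 * W * dl ^ m)"
   if w: "\<And>z. norm z \<le> 2 * dl \<Longrightarrow> \<bar>w z\<bar> \<le> D * dl ^ m" for w :: "'b \<times> real \<Rightarrow> real"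
  proof -
   have "(NBINT z. indicator (cball 0 (2 * dl)) z * ennreal ((w z)^2)) \<le> (NBINT z. ennreal (D^2 * dl ^ m) * indicator (cball (0 :: 'b \<times> real) 2) z)"
   proof (rule nn_integral_mono)
    fix z :: "'b \<times> real"
    show "indicator (cball 0 (2 * dl)) z * ennreal ((w z)^2) \<le> ennreal (D^2 * dl ^ m) * indicator (cball 0 2) z"
    proof (cases "norm z \<le> 2 * dl")
     case True
     have "\<bar>w z\<bar>^2 \<le> (D * dl ^ m)^2" by (rule power_mono[OF w[OF True]]) simp
     also have "\<dots> \<le> D^2 * dl ^ m" unfolding power_mult_distrib by (rule mult_left_mono[OF dm]) simp
     finally show ?thesis using True d(1) by (simp add: ennreal_leI)
    qed simp
   qed
   also have "\<dots> = ennreal (D^2 * dl ^ m) * ennreal W" by (simp add: nn_integral_cmult_indicator vol)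
   also have "\<dots> = ennreal (D^2 * W * dl ^ m)" using dl(1) by (simp add: W_def mult_ac flip: ennreal_mult)
   finally show ?thesis .
  qed
  let ?X = "D^2 * W * dl ^ m"
  have nn: "?X \<ge> 0" using dl(1) by (simp add: W_def)
  have "ennreal (mass dl (dl^2))
   \<le> ennreal ?X + ennreal ?X + (ennreal ?X + ennreal ?X)"
   unfolding NN_sum[OF e(1) a] by (intro add_mono 1 ptu ptF)
  also have "\<dots> = ennreal (C * dl ^ m)"
  proof -
   have "ennreal x + ennreal x + (ennreal x + ennreal x) = ennreal (4 * x)" if "x \<ge> 0" for x using that by (simp flip: ennreal_plus)
   from this[OF nn] show ?thesis by (simp add: C_def mult.assoc)
  qed
  finally show ?thesis using C dl(1) by (subst (asm) ennreal_le_iff) simp_all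
 qed
 thus ?thesis using C dl0 by blast
qed

end

section \<open>Absorption of the trace term and passage to the limit\<close>

context core begin

text \<open>Valued in \<open>ennreal\<close>: finiteness, which the absorption requires, is a
  separate fact about the vanishing order of the trace.\<close>

definition I where "I p a = (NBINT x. ennreal (indicator (cball 0 a) x * norm x powr p * (T0 x)^2))"

text \<open>Averaging at scale dl^2 changes the weight by a factor less than 2 once dl is small in
  terms of b. With the slab thickness 2 rh and the bound Hb this gives the constant 4 rh
  Hb^2.\<close>

lemma Phi_bound:
 assumes b: "b \<ge> 4" and rh: "0 < rh" "rh \<le> R / 4"
 shows "\<forall>\<^sub>F dl in at_right 0. ennreal (LBINT z. norm z powr (4 - b) * (ch dl rh z * lap (y (dl^2)) z)^2)
   \<le> ennreal (4 * rh * Hb^2) * I (4 - b) (2 * rh)"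
proof -
 have k0: "k > 0" using k by linarith
 have "((\<lambda>dl::real. (1 - k * dl) powr (4 - b)) \<longlongrightarrow> (1 - k * 0) powr (4 - b)) (at_right 0)" by (intro tendsto_intros) auto
 hence 1: "\<forall>\<^sub>F dl in at_right 0. (1 - k * dl) powr (4 - b) < 2" by (rule order_tendstoD(2)) simp
 have 2: "\<forall>\<^sub>F dl in at_right (0::real). dl < min (1 / 2) (min (1 / (2 * k)) (rh / 4))" by (rule order_tendstoD(2)[OF tendsto_ident_at]) (use k0 rh in auto)
 have 3: "\<forall>\<^sub>F dl in at_right (0::real). dl > 0" by (rule eventually_at_right_less)
 show ?thesis using 1 2 3
 proof eventually_elim
  case (elim dl)
  hence d: "dl < 1 / 2" "dl < 1 / (2 * k)" "4 * dl < rh" "dl > 0" by auto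
  have kd1: "k * dl < 1 / 2" using d(2) k0 by (simp add: field_simps)
  have kd: "k * dl^2 \<le> dl / 2" using mult_right_mono[of "k * dl" "1 / 2" dl] kd1 d by (simp add: power2_eq_square mult.assoc)
  have e: "dl^2 > 0" using d by simp
  let ?p = "4 - b"
  have p: "?p \<le> 0" using b by simp
  \<comment> \<open>On the support of the cutoff |z| is at least dl and at least |x|; as the
    exponent is nonpositive, the weight is bounded by a function of x alone.\<close>
  define Om where "Om x = indicator (cball 0 rh) x * ennreal (max (norm x) dl powr ?p)" for x :: 'b
  define B where "B x = 2 * (indicator (cball 0 (2 * rh)) x * ennreal (max (norm x) dl powr ?p))" for x :: 'b
  define om where "om z = indicator (- ball 0 dl \<inter> cball 0 rh) z * ennreal (norm z powr ?p)" for z :: "'b \<times> real"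
  have i: "L1 (\<lambda>z. norm z powr ?p * (ch dl rh z * lap (y (dl^2)) z)^2)" by (rule integrable_powr_vanishing[OF d(4), of _ rh])
     (auto simp: ch_outside[OF d(4,3)] intro!: continuous_intros cont C2D(5)[OF C2_ch])
  have "ennreal (LBINT z. norm z powr ?p * (ch dl rh z * lap (y (dl^2)) z)^2)
   = (NBINT z. ennreal (norm z powr ?p * (ch dl rh z * lap (y (dl^2)) z)^2))"
   by (rule nn_integral_eq_integral[OF i, symmetric]) simp
  also have "\<dots> \<le> (NBINT z. om z * ennreal ((F (dl^2) z)^2))"
  proof (rule nn_integral_mono)
   fix z :: "'b \<times> real"
   show "ennreal (norm z powr ?p * (ch dl rh z * lap (y (dl^2)) z)^2) \<le> om z * ennreal ((F (dl^2) z)^2)"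
   proof (cases "dl \<le> norm z \<and> norm z \<le> rh")
    case True
    have l: "lap (y (dl^2)) z = F (dl^2) z" by (rule lap_y[OF e]) (use True kd d rh R in linarith)
    have "(ch dl rh z)^2 \<le> 1" using ch_props(1,2)[OF d(4,3), of z] by (simp add: power_le_one)
    hence "(ch dl rh z * F (dl^2) z)^2 \<le> (F (dl^2) z)^2" unfolding power_mult_distrib by (simp add: mult_left_le_one_le)
    hence "ennreal (norm z powr ?p * (ch dl rh z * F (dl^2) z)^2) \<le> ennreal (norm z powr ?p * (F (dl^2) z)^2)" by (intro ennreal_leI mult_left_mono) auto
    thus ?thesis using True unfolding l om_def by (simp add: ennreal_mult)
   next
    case False
    hence "ch dl rh z = 0" using ch_props(3,4)[OF d(4,3), of z] by auto
    thus ?thesis by simp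
   qed
  qed
  also have "\<dots> \<le> (NBINT x. ennreal (2 * rh) * B x * ennreal ((f x)^2))"
  proof (rule F_L2[OF e, where Om = Om])
   show "rh \<ge> 0" using rh by simp
   show "om \<in> BM" unfolding om_def by (intro borel_measurable_times_ennreal borel_measurable_indicator) auto
   show "Om \<in> BM" unfolding Om_def by (intro borel_measurable_times_ennreal borel_measurable_indicator) auto
   show "B \<in> BM" unfolding B_def by (intro borel_measurable_times_ennreal borel_measurable_indicator) auto
   fix z :: "'b \<times> real"
   show "om z \<le> indicator {- rh..rh} (snd z) * Om (fst z)"
   proof (cases "dl \<le> norm z \<and> norm z \<le> rh")
    case True
    have n: "norm (fst z) \<le> norm z" "norm (snd z) \<le> norm z" using norm_snd_le[of "snd z" "fst z"] norm_fst_le[of "fst z" "snd z"] by auto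
    have "ennreal (norm z powr ?p) \<le> ennreal (max (norm (fst z)) dl powr ?p)" by (intro ennreal_leI powr_antimono p) (use n True d in auto)
    moreover have "snd z \<in> {- rh..rh}" "norm (fst z) \<le> rh" using n True by auto
    ultimately show ?thesis using True by (simp add: om_def Om_def)
   qed (auto simp: om_def)
  next
   fix x' :: 'b
   show "(NBINT x. Om x * ennreal (be (dl^2) (x - x'))) \<le> B x'"
   proof -
    have "(NBINT x. Om x * ennreal (be (dl^2) (x - x'))) \<le> (NBINT x. B x' * ennreal (be (dl^2) (x - x')))"
    proof (rule nn_integral_mono)
     fix x
     show "Om x * ennreal (be (dl^2) (x - x')) \<le> B x' * ennreal (be (dl^2) (x - x'))"
     proof (cases "norm (x - x') > k * dl^2")
      case True
      have "dl^2 * real DIM('b) \<le> k * dl^2" by (simp add: k_def ka_def distrib_right mult.commute)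
      hence "be (dl^2) (x - x') = 0" using True by (intro be_zero[OF e]) linarith
      thus ?thesis by simp
     next
      case False
      have n: "norm x' \<le> norm x + k * dl^2" using False norm_triangle_ineq2[of x' x] by (simp add: norm_minus_commute)
      show ?thesis
      proof (cases "norm x \<le> rh")
       case True
       let ?m = "max (norm x') dl"
       have kdl: "k * dl^2 \<le> k * dl * ?m" using k0 d by (simp add: power2_eq_square mult.assoc mult_left_mono)
       have "?m \<le> max (norm x) dl + k * dl^2"
       proof -
        have "0 \<le> k * dl^2" using k0 by simp
        thus ?thesis using n by linarith
       qed
       \<comment> \<open>The averaging kernel moves x by at most k dl^2, which is at most the
         fraction k dl of max |x'| dl.\<close>
       hence "(1 - k * dl) * ?m \<le> max (norm x) dl" using kdl unfolding left_diff_distrib mult_1_left by linarith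
       hence "max (norm x) dl powr ?p \<le> ((1 - k * dl) * ?m) powr ?p" by (intro powr_antimono p) (use kd1 d in auto)
       also have "\<dots> = (1 - k * dl) powr ?p * ?m powr ?p" by (rule powr_mult)
       also have "\<dots> \<le> 2 * ?m powr ?p" using elim by (intro mult_right_mono) auto
       finally have "ennreal (max (norm x) dl powr ?p) \<le> ennreal (2 * ?m powr ?p)" by (rule ennreal_leI)
       hence "Om x \<le> B x'" using True n kd d by (simp add: Om_def B_def ennreal_mult)
       thus ?thesis by (rule mult_right_mono) simp
      qed (simp add: Om_def)
     qed
    qed
    also have "\<dots> = B x' * (NBINT x. ennreal (be (dl^2) (x - x')))" by (rule nn_integral_cmult) simp
    also have "\<dots> = B x'" using nn_integral_be_shift(1)[OF e, of x'] by simp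
    finally show ?thesis .
   qed
  qed
  also have "\<dots> \<le> (NBINT x. ennreal (4 * rh * Hb^2) * ennreal (indicator (cball 0 (2 * rh)) x * norm x powr ?p * (T0 x)^2))"
  proof (rule nn_integral_mono_AE)
   have "AE x in lborel. x \<noteq> (0::'b)" by (rule AE_lborel_singleton)
   thus "AE x in lborel. ennreal (2 * rh) * B x * ennreal ((f x)^2) \<le> ennreal (4 * rh * Hb^2) * ennreal (indicator (cball 0 (2 * rh)) x * norm x powr ?p * (T0 x)^2)"
   proof eventually_elim
    case (elim x)
    show ?case
    proof (cases "norm x \<le> 2 * rh")
     case True
     have "max (norm x) dl powr ?p \<le> norm x powr ?p" using elim by (intro powr_antimono p) auto
     hence "ennreal (2 * rh) * (2 * ennreal (max (norm x) dl powr ?p)) * ennreal ((f x)^2) \<le> ennreal (2 * rh) * (2 * ennreal (norm x powr ?p)) * ennreal (Hb^2 * (T0 x)^2)"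
      by (intro mult_mono f_sq ennreal_leI) (use rh in auto)
     also have "\<dots> = ennreal (2 * rh) * (ennreal 2 * ennreal (norm x powr ?p)) * ennreal (Hb^2 * (T0 x)^2)" by simp
     also have "\<dots> = ennreal (2 * rh * (2 * norm x powr ?p) * (Hb^2 * (T0 x)^2))"
      using rh by (simp only: ennreal_mult'[symmetric] ennreal_mult''[symmetric] powr_ge_zero zero_le_power2 mult_nonneg_nonneg)
     also have "\<dots> = ennreal (4 * rh * Hb^2) * ennreal (norm x powr ?p * (T0 x)^2)" using rh by (subst ennreal_mult''[symmetric]) (auto simp: mult_ac)
     finally show ?thesis using True by (simp add: B_def)
    qed (simp add: B_def)
   qed
  qed
  also have "\<dots> = ennreal (4 * rh * Hb^2) * I ?p (2 * rh)"
   unfolding I_def by (rule nn_integral_cmult) (intro borel_measurable_times measurable_compose[OF _ measurable_ennreal] borel_measurable_indicator; simp)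
  finally show ?case .
 qed
qed

lemma I_measurable: "(\<lambda>x. indicator (cball 0 a) x * norm x powr p * (T0 x)^2) \<in> BM"
 by (intro borel_measurable_times borel_measurable_indicator) auto

text \<open>Near 0 the vanishing order of the trace beats the negative power; away from 0 the power
  is bounded and the trace is square integrable.\<close>

lemma I_finite:
 assumes p: "p \<le> 0" and a: "a \<le> 1"
 shows "I p a < \<infinity>"
proof -
 \<comment> \<open>With n \<ge> -p the product of |x|^p and |x|^n is at most 1 on the unit ball, and
   a second factor |x|^n is at most 1 as well.\<close>
 define n where "n = nat \<lceil>- p\<rceil>"
 have n: "real n \<ge> - p" unfolding n_def using p by linarith
 obtain r where r: "r > 0" "AE x in lborel. norm x < r \<longrightarrow> \<bar>T0 x\<bar> \<le> (2 * norm x) ^ n" using T0_small[of n] by blast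
 let ?g = "\<lambda>x::'b. (2 ^ n)^2 * indicator (cball 0 1) x + r powr p * (T0 x)^2"
 have ig: "L1 ?g" using sq(4) by (intro Bochner_Integration.integrable_add integrable_mult_right integrable_real_indicator emeasure_bounded_finite) auto
 have "I p a \<le> (NBINT x. ennreal (?g x))" unfolding I_def
 proof (rule nn_integral_mono_AE)
  show "AE x in lborel. ennreal (indicator (cball 0 a) x * norm x powr p * (T0 x)^2) \<le> ennreal (?g x)" using r(2)
  proof eventually_elim
   case (elim x)
   show ?case
   proof (rule ennreal_leI)
    show "indicator (cball 0 a) x * norm x powr p * (T0 x)^2 \<le> ?g x"
    proof (cases "norm x \<le> a \<and> x \<noteq> 0")
     case True
     hence x: "norm x \<le> 1" "norm x > 0" using a by auto
     have ind: "indicator (cball 0 a) x = (1::real)" "indicator (cball 0 1) x = (1::real)" using True x by auto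
     show ?thesis
     proof (cases "norm x < r")
      case True
      have "\<bar>T0 x\<bar>^2 \<le> ((2 * norm x) ^ n)^2" using elim True by (intro power_mono) auto
      also have "\<dots> = (2 ^ n)^2 * (norm x ^ n)^2" by (simp add: power_mult_distrib)
      finally have t: "(T0 x)^2 \<le> (2 ^ n)^2 * (norm x ^ n)^2" by simp
      have q: "norm x powr p * (norm x ^ n)^2 \<le> 1"
      proof -
       have "norm x powr p * (norm x ^ n) = norm x powr (p + real n)" using x by (simp add: powr_add powr_realpow)
       moreover have "norm x powr (p + real n) \<le> 1" using x n by (intro powr_le1) auto
       moreover have "norm x ^ n \<le> 1" using x by (simp add: power_le_one)
       ultimately have "norm x powr p * norm x ^ n * norm x ^ n \<le> 1" using x by (smt (verit) mult_le_one zero_le_power)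
       thus ?thesis by (simp add: power2_eq_square mult.assoc)
      qed
      have "norm x powr p * (T0 x)^2 \<le> norm x powr p * ((2 ^ n)^2 * (norm x ^ n)^2)" by (rule mult_left_mono[OF t]) simp
      also have "\<dots> = (2 ^ n)^2 * (norm x powr p * (norm x ^ n)^2)" by (simp add: mult_ac)
      also have "\<dots> \<le> (2 ^ n)^2 * 1" by (rule mult_left_mono[OF q]) simp
      finally have "norm x powr p * (T0 x)^2 \<le> (2 ^ n)^2" by simp
      moreover have "0 \<le> r powr p * (T0 x)^2" by simp
      ultimately show ?thesis unfolding ind by linarith
     next
      case False
      have "norm x powr p * (T0 x)^2 \<le> r powr p * (T0 x)^2" using False r(1) p by (intro mult_right_mono powr_antimono) auto
      moreover have "0 \<le> (2 ^ n :: real)^2" by simp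
      ultimately show ?thesis unfolding ind by linarith
     qed
    qed auto
   qed
  qed
 qed
 also have "\<dots> < \<infinity>" using ig by (subst nn_integral_eq_integral) auto
 finally show ?thesis .
qed

text \<open>Fatou's lemma along the sequence on which the mollified trace converges almost
  everywhere. At a fixed x \<noteq> 0 with |x| \<le> rh / 2 the cutoff is eventually 1.\<close>

lemma trace_limit:
 assumes rh: "0 < rh" "rh \<le> R / 4"
  and bound: "\<forall>\<^sub>F dl in at_right 0. (LBINT x. norm x powr p * (ch dl rh (x, 0::real) * u (dl^2) (x, 0))^2) \<le> A"
 shows "I p (rh / 2) \<le> ennreal A"
proof -
 obtain s where s: "filterlim s (at_right 0) sequentially"
  and lim: "AE x in lborel. norm x < R / 2 \<longrightarrow> (\<lambda>j. u ((s j)^2) (x, 0)) \<longlonglongrightarrow> T0 x"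
  using trace_subseq by blast
 define h where "h dl x = norm x powr p * (ch dl rh (x, 0::real) * u (dl^2) (x, 0))^2" for dl and x :: 'b
 have cc: "continuous_on UNIV (\<lambda>x::'b. (ch dl rh (x, 0::real) * u (dl^2) (x, 0))^2)" for dl
  by (intro continuous_intros continuous_on_compose2[OF cont(1)] continuous_on_compose2[OF C2D(5)[OF C2_ch], of UNIV]) auto
 have hm [measurable]: "h dl \<in> BM" for dl unfolding h_def by (intro borel_measurable_times borel_measurable_continuous_onI[OF cc]) simp
 have "\<forall>\<^sub>F dl in at_right (0::real). dl > 0" "\<forall>\<^sub>F dl in at_right (0::real). dl < rh / 4"
  by (rule eventually_at_right_less order_tendstoD(2)[OF tendsto_ident_at]; use rh in simp)+
 hence "\<forall>\<^sub>F dl in at_right 0. (NBINT x. ennreal (h dl x)) \<le> ennreal A" using bound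
 proof eventually_elim
  case (elim dl)
  hence d: "0 < dl" "4 * dl < rh" by auto
  have "L1 (h dl)" unfolding h_def by (rule integrable_powr_vanishing[OF d(1), of _ rh, OF cc])
     (simp_all add: ch_outside(1)[OF d] norm_Pair)
  hence "(NBINT x. ennreal (h dl x)) = ennreal (LBINT x. h dl x)" by (rule nn_integral_eq_integral) (simp add: h_def)
  thus ?case using elim(3) by (simp add: h_def ennreal_leI)
 qed
 note le = eventually_compose_filterlim[OF this s]
 have "AE x in lborel. x \<noteq> (0::'b)" by (rule AE_lborel_singleton)
 with lim have "AE x in lborel. ennreal (indicator (cball 0 (rh / 2)) x * norm x powr p * (T0 x)^2)
   \<le> liminf (\<lambda>j. ennreal (h (s j) x))"
 proof eventually_elim
  case (elim x)
  show ?case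
  proof (cases "norm x \<le> rh / 2")
   case True
   have "\<forall>\<^sub>F dl in at_right (0::real). dl > 0" "\<forall>\<^sub>F dl in at_right (0::real). dl < min (rh / 4) (norm x / 2)"
    by (rule eventually_at_right_less order_tendstoD(2)[OF tendsto_ident_at]; use rh elim(2) in simp)+
   hence "\<forall>\<^sub>F dl in at_right 0. norm x powr p * (u (dl^2) (x, 0))^2 = h dl x"
   proof eventually_elim
    case (elim dl)
    thus ?case using ch_props(5)[of dl rh "(x, 0::real)"] True by (simp add: h_def norm_Pair)
   qed
   note eq = eventually_compose_filterlim[OF this s]
   have "(\<lambda>j. norm x powr p * (u ((s j)^2) (x, 0))^2) \<longlonglongrightarrow> norm x powr p * (T0 x)^2" using elim(1) True rh R by (intro tendsto_intros) auto
   hence "(\<lambda>j. ennreal (h (s j) x)) \<longlonglongrightarrow> ennreal (norm x powr p * (T0 x)^2)" by (intro tendsto_ennrealI Lim_transform_eventually[OF _ eq])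
   from lim_imp_Liminf[OF _ this] show ?thesis using True by simp
  qed simp
 qed
 hence "I p (rh / 2) \<le> (NBINT x. liminf (\<lambda>j. ennreal (h (s j) x)))" unfolding I_def by (rule nn_integral_mono_AE)
 also have "\<dots> \<le> liminf (\<lambda>j. (NBINT x. ennreal (h (s j) x)))" by (rule nn_integral_liminf) simp
 also have "\<dots> \<le> ennreal A" by (rule order_trans[OF Liminf_le_Limsup Limsup_bounded[OF le]]) simp
 finally show ?thesis .
qed

end

context core begin

text \<open>For fixed b the inner error carries a fixed negative power of dl, and
  \<open>inner_bound\<close> supplies a positive power as high as desired.\<close>

lemma inner_limit:
 assumes s: "s > 0"
 shows "\<forall>\<^sub>F dl in at_right 0. dl powr (3 - b) / dl ^ 4 * (mass dl (dl^2)) \<le> s"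
proof -
 \<comment> \<open>Chosen so that the total exponent 3 - b - 4 + m of dl is at least 1.\<close>
 define m where "m = nat \<lceil>b\<rceil> + 2"
 have m: "real m \<ge> b + 2" unfolding m_def by linarith
 obtain C dl0 where C: "C \<ge> 0" "dl0 > 0" "\<And>dl. 0 < dl \<Longrightarrow> dl < dl0 \<Longrightarrow>
   mass dl (dl^2) \<le> C * dl ^ m"
  using inner_bound[of m] by blast
 have 2: "\<forall>\<^sub>F dl in at_right (0::real). dl < min (min 1 dl0) (s / (C + 1))" by (rule order_tendstoD(2)[OF tendsto_ident_at]) (use C s in auto)
 have 3: "\<forall>\<^sub>F dl in at_right (0::real). dl > 0" by (rule eventually_at_right_less)
 show ?thesis using 2 3
 proof eventually_elim
  case (elim dl)
  let ?N = "mass dl (dl^2)"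
  have "?N \<le> C * dl ^ m" by (rule C(3)) (use elim in auto)
  hence "dl powr (3 - b) / dl ^ 4 * ?N \<le> dl powr (3 - b) / dl ^ 4 * (C * dl ^ m)" using elim by (intro mult_left_mono) auto
  also have "dl powr (3 - b) / dl ^ 4 * (C * dl ^ m) = C * dl powr (3 - b - 4 + real m)"
   using elim powr_realpow[of dl m] powr_realpow[of dl 4] powr_add[of dl "3 - b - 4" "real m"] powr_diff[of dl "3 - b" 4] by (simp only:) simp
  also have "\<dots> \<le> C * dl powr 1" using elim C(1) m by (intro mult_left_mono powr_mono') auto
  also have "\<dots> \<le> (C + 1) * dl" using elim by (simp add: distrib_right)
  also have "\<dots> \<le> s" using elim C(1) by (simp add: less_divide_eq mult.commute)
  finally show ?case .
 qed
qed

text \<open>For |x| \<le> rh / 2 the three extra powers of |x| are turned into (rh / 2)^3; for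
  larger |x| the weight is at most its value at rh / 2, and the plain L2 norm remains.\<close>

lemma I_split:
 assumes b: "b \<ge> 4" and rh: "rh > 0"
 shows "I (4 - b) (2 * rh) \<le> ennreal ((rh / 2) ^ 3) * I (1 - b) (rh / 2) + ennreal ((rh / 2) powr (4 - b) * (LBINT x. (T0 x)^2))"
proof -
 let ?g = "\<lambda>p a x. indicator (cball 0 a) x * norm x powr p * (T0 x)^2"
 have i: "L1 (\<lambda>x. (rh / 2) powr (4 - b) * (T0 x)^2)" using sq(4) by simp
 have "I (4 - b) (2 * rh) \<le> (NBINT x. ennreal ((rh / 2) ^ 3) * ennreal (?g (1 - b) (rh / 2) x) + ennreal ((rh / 2) powr (4 - b) * (T0 x)^2))" unfolding I_def
 proof (rule nn_integral_mono)
  fix x :: 'b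
  have "?g (4 - b) (2 * rh) x \<le> (rh / 2) ^ 3 * ?g (1 - b) (rh / 2) x + (rh / 2) powr (4 - b) * (T0 x)^2"
  proof (cases "x = 0")
   case False
   show ?thesis
   proof (cases "norm x \<le> rh / 2")
    case True
    have "norm x powr (4 - b) = norm x ^ 3 * norm x powr (1 - b)" using False powr_add[of "norm x" 3 "1 - b"] by (simp add: powr_numeral)
    also have "\<dots> \<le> (rh / 2) ^ 3 * norm x powr (1 - b)" using True by (intro mult_right_mono power_mono) auto
    finally have "norm x powr (4 - b) * (T0 x)^2 \<le> (rh / 2) ^ 3 * norm x powr (1 - b) * (T0 x)^2" by (rule mult_right_mono) simp
    moreover have "0 \<le> (rh / 2) powr (4 - b) * (T0 x)^2" by simp
    moreover have "indicator (cball 0 (2 * rh)) x = (1::real)" "indicator (cball 0 (rh / 2)) x = (1::real)" using True rh by auto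
    ultimately show ?thesis by (simp only: mult_1_left mult.assoc)
   next
    case False
    have "norm x powr (4 - b) * (T0 x)^2 \<le> (rh / 2) powr (4 - b) * (T0 x)^2" using False b rh by (intro mult_right_mono powr_antimono) auto
    moreover have "0 \<le> (rh / 2) powr (4 - b) * (T0 x)^2" by simp
    ultimately show ?thesis using False by (cases "norm x \<le> 2 * rh") auto
   qed
  qed simp
  hence "ennreal (?g (4 - b) (2 * rh) x) \<le> ennreal ((rh / 2) ^ 3 * ?g (1 - b) (rh / 2) x + (rh / 2) powr (4 - b) * (T0 x)^2)" by (rule ennreal_leI)
  also have "\<dots> = ennreal ((rh / 2) ^ 3) * ennreal (?g (1 - b) (rh / 2) x) + ennreal ((rh / 2) powr (4 - b) * (T0 x)^2)"
   using rh by (subst ennreal_plus) (simp_all add: ennreal_mult)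
  finally show "ennreal (?g (4 - b) (2 * rh) x) \<le> ennreal ((rh / 2) ^ 3) * ennreal (?g (1 - b) (rh / 2) x) + ennreal ((rh / 2) powr (4 - b) * (T0 x)^2)" .
 qed
 also have "\<dots> = ennreal ((rh / 2) ^ 3) * I (1 - b) (rh / 2) + (NBINT x. ennreal ((rh / 2) powr (4 - b) * (T0 x)^2))"
  unfolding I_def using I_measurable[of "rh / 2" "1 - b"] by (subst nn_integral_add) (simp_all add: nn_integral_cmult)
 also have "(NBINT x. ennreal ((rh / 2) powr (4 - b) * (T0 x)^2)) = ennreal ((rh / 2) powr (4 - b) * (LBINT x. (T0 x)^2))"
  by (subst nn_integral_eq_integral[OF i]) simp_all
 finally show ?thesis .
qed

text \<open>The trace term is bounded by a small multiple of itself: \<open>carleman_system\<close>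
  bounds it by the source, \<open>Phi_bound\<close> bounds the source by the trace with weight 4 -
  b, and \<open>I_split\<close> returns to weight 1 - b. All errors are multiples of (rh / 2)^(-b),
  and neither rh nor D depends on b, so that b may tend to infinity afterwards.\<close>

lemma system_bound:
 "\<exists>rh D b0. 0 < rh \<and> rh \<le> R / 4 \<and> D \<ge> 0 \<and> (\<forall>b\<ge>b0. \<forall>\<^sub>F dl in at_right 0.
   (LBINT z. norm z powr (- b) * (ch dl rh z * u (dl^2) z)^2) \<le> D * (rh / 2) powr (- b))"
proof -
 obtain C where C: "C \<ge> 0" "\<And>dl rh b (u :: 'b \<times> real \<Rightarrow> real) y. 0 < dl \<Longrightarrow> 4 * dl < rh \<Longrightarrow> rh \<le> 1 \<Longrightarrow>
   b \<ge> real DIM('b \<times> real) \<Longrightarrow> b \<ge> 4 \<Longrightarrow> bsm u \<Longrightarrow> bsm y \<Longrightarrow> (\<forall>z. norm z < rh \<longrightarrow> lap u z = pd (0, 1) y z) \<Longrightarrow>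
   system_bounded C dl rh b u y"
  using carleman_system[where 'b = 'b] by blast
 obtain M where M: "M \<ge> 0" "\<And>e rh. 0 < e \<Longrightarrow> 0 < rh \<Longrightarrow> rh \<le> R / 4 \<Longrightarrow> k * e \<le> R / 4 \<Longrightarrow>
   mass rh e \<le> M"
  using outer_bound by blast
 define c where "c = C * Hb^2"
 have c: "c \<ge> 0" using C(1) by (simp add: c_def)
 \<comment> \<open>Chosen so that 4 c rh \<le> 1 / 2, independently of b; this is the factor in
   front of the trace term to be absorbed.\<close>
 define rh where "rh = min (R / 4) (1 / (8 * c + 1))"
 have rh: "0 < rh" "rh \<le> R / 4" using R c by (simp_all add: rh_def)
 have small: "4 * (c * rh) * (rh / 2) ^ 3 \<le> 1 / 2"
 proof -
  have "4 * (c * rh) \<le> 4 * (c * (1 / (8 * c + 1)))" using c by (intro mult_left_mono) (auto simp: rh_def)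
  also have "\<dots> \<le> 1 / 2" using c by (simp add: field_simps)
  finally have 1: "4 * (c * rh) \<le> 1 / 2" .
  have "(rh / 2) ^ 3 \<le> 1" using rh R by (intro power_le_one) auto
  with 1 have "4 * (c * rh) * (rh / 2) ^ 3 \<le> 1 / 2 * 1" using rh by (intro mult_mono) auto
  thus ?thesis by simp
 qed
 define ta where "ta = (LBINT x. (T0 x)^2)"
 have ta: "ta \<ge> 0" unfolding ta_def by (rule Bochner_Integration.integral_nonneg) simp
 define q where "q = (rh / 2) ^ 3 / rh ^ 4"
 have q: "q \<ge> 0" using rh by (simp add: q_def)
 \<comment> \<open>In units of (rh / 2)^(-b): the inequality Z \<le> Z / 2 + rest leaves twice the
   rest, which is \<open>D1\<close>; inserting this into the common bound A gives
   \<open>D\<close>.\<close>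
 define D1 where "D1 = 2 * (4 * (c * rh) * ((rh / 2) ^ 4 * ta) + C * (1 + q * M))"
 define D where "D = 4 * (c * rh) * ((rh / 2) ^ 3 * D1 + (rh / 2) ^ 4 * ta) + C * (1 + q * M)"
 have D1: "D1 \<ge> 0" unfolding D1_def using c rh ta C(1) q M(1) by simp
 have D: "D \<ge> 0" unfolding D_def using c rh ta C(1) q M(1) D1 by simp
 define b0 where "b0 = max 4 (real DIM('b \<times> real))"
 have "\<forall>\<^sub>F dl in at_right 0. (LBINT z. norm z powr (- b) * (ch dl rh z * u (dl^2) z)^2) \<le> D * (rh / 2) powr (- b)"
  if b: "b \<ge> b0" for b
 proof -
  have b': "b \<ge> real DIM('b \<times> real)" "b \<ge> 4" using b by (simp_all add: b0_def)
  define s where "s = (rh / 2) powr (- b)"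
  have s: "s > 0" using rh by (simp add: s_def)
  have s3: "(rh / 2) powr (3 - b) = (rh / 2) ^ 3 * s" "(rh / 2) powr (4 - b) = (rh / 2) ^ 4 * s"
   using rh powr_add[of "rh / 2" 3 "- b"] powr_add[of "rh / 2" 4 "- b"] by (simp_all add: s_def powr_numeral)
  have fin: "I (4 - b) (2 * rh) < \<infinity>" "I (1 - b) (rh / 2) < \<infinity>" using b' rh R by (intro I_finite; linarith)+
  define Y where "Y = enn2real (I (4 - b) (2 * rh))"
  define Z where "Z = enn2real (I (1 - b) (rh / 2))"
  have Y: "I (4 - b) (2 * rh) = ennreal Y" "Y \<ge> 0" and Z: "I (1 - b) (rh / 2) = ennreal Z" "Z \<ge> 0" unfolding Y_def Z_def using fin by (simp_all add: less_top)
  define A where "A = 4 * (c * rh) * Y + C * (1 + q * M) * s"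
  have A: "A \<ge> 0" unfolding A_def using c rh Y(2) C(1) q M(1) s by simp
  have k0: "k > 0" using k by linarith
  have e1: "\<forall>\<^sub>F dl in at_right (0::real). dl < min (rh / 4) (min 1 (R / (4 * k)))" by (rule order_tendstoD(2)[OF tendsto_ident_at]) (use rh R k0 in auto)
  have e2: "\<forall>\<^sub>F dl in at_right (0::real). dl > 0" by (rule eventually_at_right_less)
  have ev: "\<forall>\<^sub>F dl in at_right 0. (LBINT x. norm x powr (1 - b) * (ch dl rh (x, 0::real) * u (dl^2) (x, 0))^2) \<le> A
    \<and> (LBINT z. norm z powr (- b) * (ch dl rh z * u (dl^2) z)^2) \<le> A"
   using e1 e2 inner_limit[OF s, of b] Phi_bound[OF b'(2) rh]
  proof eventually_elim
   case (elim dl)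
   have d: "0 < dl" "4 * dl < rh" "rh \<le> 1" "dl \<le> 1" using elim rh R by auto
   have kd: "k * dl^2 \<le> R / 4"
   proof -
    have "dl^2 \<le> dl" using d by (simp add: power2_eq_square mult_left_le)
    hence "k * dl^2 \<le> k * dl" using k0 by (intro mult_left_mono) auto
    also have "\<dots> \<le> R / 4" using elim k0 by (simp add: field_simps)
    finally show ?thesis .
   qed
   have e: "dl^2 > 0" using d by simp
   let ?ndl = "mass dl (dl^2)"
   let ?nrh = "mass rh (dl^2)"
   let ?Ph = "LBINT z. norm z powr (4 - b) * (ch dl rh z * lap (y (dl^2)) z)^2"
   have eq: "\<forall>z. norm z < rh \<longrightarrow> lap (u (dl^2)) z = pd (0, 1) (y (dl^2)) z"
   proof (intro allI impI)
    fix z :: "'b \<times> real" assume "norm z < rh"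
    hence "norm z + k * dl^2 < R" using kd rh R by linarith
    from lap_u[OF e this] show "lap (u (dl^2)) z = pd (0, 1) (y (dl^2)) z" by (simp add: pd_y[OF e])
   qed
   have P: "?Ph \<le> 4 * rh * Hb^2 * Y" using elim(4) Y(2) rh unfolding Y(1) by (subst (asm) ennreal_mult''[symmetric]) (auto simp: ennreal_le_iff)
   have O: "(rh / 2) powr (3 - b) / rh ^ 4 * ?nrh \<le> q * s * M"
   proof -
    have "(rh / 2) powr (3 - b) / rh ^ 4 = q * s" by (simp add: s3 q_def)
    thus ?thesis using mult_left_mono[OF M(2)[OF e rh kd], of "q * s"] q s by simp
   qed
   have T: "C * (?Ph + (dl powr (3 - b) / dl ^ 4 * ?ndl + (rh / 2) powr (3 - b) / rh ^ 4 * ?nrh)) \<le> A"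
   proof -
    have "C * (?Ph + (dl powr (3 - b) / dl ^ 4 * ?ndl + (rh / 2) powr (3 - b) / rh ^ 4 * ?nrh)) \<le> C * (4 * rh * Hb^2 * Y + (s + q * s * M))"
     by (intro mult_left_mono add_mono P O elim(3) C(1))
    also have "\<dots> = A" by (simp add: A_def c_def algebra_simps)
    finally show ?thesis .
   qed
   show ?case using C(2)[OF d(1-3) b' bsm_uvy(1) bsm_uvy(3) eq] T unfolding system_bounded_def Let_def by (blast intro: order_trans)
  qed
  have "I (1 - b) (rh / 2) \<le> ennreal A" by (rule trace_limit[OF rh eventually_mono[OF ev]]) auto
  hence ZA: "Z \<le> A" unfolding Z(1) using A by (subst (asm) ennreal_le_iff) auto
  have YZ: "Y \<le> (rh / 2) ^ 3 * Z + (rh / 2) ^ 4 * s * ta"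
  proof -
   have "ennreal Y \<le> ennreal ((rh / 2) ^ 3) * ennreal Z + ennreal ((rh / 2) ^ 4 * s * ta)" using I_split[OF b'(2) rh(1)] unfolding Y(1) Z(1) s3 ta_def .
   also have "\<dots> = ennreal ((rh / 2) ^ 3 * Z + (rh / 2) ^ 4 * s * ta)" using rh Z(2) s ta by (subst ennreal_plus) (simp_all add: ennreal_mult'')
   finally show ?thesis using rh Z(2) s ta by (subst (asm) ennreal_le_iff) auto
  qed
  have cY: "4 * (c * rh) * Y \<le> 4 * (c * rh) * ((rh / 2) ^ 3 * Z + (rh / 2) ^ 4 * s * ta)" using YZ c rh by (intro mult_left_mono) auto
  \<comment> \<open>The absorption step: Z is a real number by \<open>I_finite\<close>, so half of
    it may be subtracted on both sides.\<close>
  have Zs: "Z \<le> D1 * s"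
  proof -
   have "4 * (c * rh) * (rh / 2) ^ 3 * Z \<le> 1 / 2 * Z" by (rule mult_right_mono[OF small Z(2)])
   moreover have "D1 * s = 2 * (4 * (c * rh) * ((rh / 2) ^ 4 * s * ta) + C * (1 + q * M) * s)" unfolding D1_def by (simp only: distrib_left distrib_right mult_ac)
   moreover have "4 * (c * rh) * ((rh / 2) ^ 3 * Z + (rh / 2) ^ 4 * s * ta) = 4 * (c * rh) * (rh / 2) ^ 3 * Z + 4 * (c * rh) * ((rh / 2) ^ 4 * s * ta)"
    by (simp only: distrib_left mult.assoc)
   moreover have "Z \<le> d" if "a \<le> 1 / 2 * Z" "d = 2 * (X + W)" "r = a + X" "Z \<le> p + W" "p \<le> r"
    for a d X W r p :: real using that by argo
   ultimately show ?thesis using ZA cY unfolding A_def by blast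
  qed
  have "A \<le> D * s"
  proof -
   have "4 * (c * rh) * ((rh / 2) ^ 3 * Z + (rh / 2) ^ 4 * s * ta) \<le> 4 * (c * rh) * ((rh / 2) ^ 3 * (D1 * s) + (rh / 2) ^ 4 * s * ta)"
    using Zs c rh by (intro mult_left_mono add_right_mono) auto
   moreover have "D * s = 4 * (c * rh) * ((rh / 2) ^ 3 * (D1 * s) + (rh / 2) ^ 4 * s * ta) + C * (1 + q * M) * s"
    unfolding D_def by (simp only: distrib_left distrib_right mult_ac)
   moreover have "p + W \<le> d" if "r \<le> t" "d = t + W" "p \<le> r" for r t d W p :: real using that by argo
   ultimately show ?thesis using cY unfolding A_def by blast
  qed
  thus ?thesis using ev unfolding s_def[symmetric] by (auto elim!: eventually_mono)
 qed
 thus ?thesis using rh D by blast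
qed

end

section \<open>Vanishing of the reflected solution near the origin\<close>

lemma conv_adjoint:
 fixes g qs K :: "'a::euclidean_space \<Rightarrow> real"
 assumes g: "L1 g" and qs: "L1 qs" and K: "bsm K"
 shows "(LBINT z. conv g K z * qs z) = (LINT w|lborel. g w * (LBINT z. qs z * K (z - w)))"
proof -
 obtain M where M: "\<And>z. \<bar>K z\<bar> \<le> M" by (rule bsm_bounded[OF K]) blast
 have [measurable]: "g \<in> BM" "qs \<in> BM" "K \<in> BM" using g qs bsm_measurable[OF K] by auto
 define h where "h z w = qs z * (g w * K (z - w))" for z w
 have i0: "integrable (lborel \<Otimes>\<^sub>M lborel) (\<lambda>(z, w). M * (\<bar>qs z\<bar> * \<bar>g w\<bar>))"
 proof (rule lborel_pair.Fubini_integrable)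
  show "(\<lambda>(z, w). M * (\<bar>qs z\<bar> * \<bar>g w\<bar>)) \<in> borel_measurable (lborel \<Otimes>\<^sub>M lborel)" by measurable
  show "L1 (\<lambda>z. LINT w|lborel. norm (case (z, w) of (z, w) \<Rightarrow> M * (\<bar>qs z\<bar> * \<bar>g w\<bar>)))" using qs by (simp add: abs_mult)
  show "AE z in lborel. L1 (\<lambda>w. case (z, w) of (z, w) \<Rightarrow> M * (\<bar>qs z\<bar> * \<bar>g w\<bar>))" using g by simp
 qed
 have i: "integrable (lborel \<Otimes>\<^sub>M lborel) (case_prod h)"
 proof (rule Bochner_Integration.integrable_bound[OF i0])
  show "case_prod h \<in> borel_measurable (lborel \<Otimes>\<^sub>M lborel)" unfolding h_def by measurable
  have "norm (h z w) \<le> norm (M * (\<bar>qs z\<bar> * \<bar>g w\<bar>))" for z w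
  proof -
   have "\<bar>qs z\<bar> * \<bar>g w\<bar> * \<bar>K (z - w)\<bar> \<le> \<bar>qs z\<bar> * \<bar>g w\<bar> * M" by (intro mult_left_mono M) auto
   thus ?thesis using M[of 0] by (simp add: h_def abs_mult mult_ac)
  qed
  thus "AE p in lborel \<Otimes>\<^sub>M lborel. norm (case_prod h p) \<le> norm (case p of (z, w) \<Rightarrow> M * (\<bar>qs z\<bar> * \<bar>g w\<bar>))" by auto
 qed
 have "(LBINT z. conv g K z * qs z) = (LINT z|lborel. LINT w|lborel. h z w)" by (intro Bochner_Integration.integral_cong refl) (simp add: conv_def h_def mult.commute)
 also have "\<dots> = (LINT w|lborel. LINT z|lborel. h z w)" by (rule lborel_pair.Fubini_integral[OF i, symmetric])
 also have "\<dots> = (LINT w|lborel. g w * (LBINT z. qs z * K (z - w)))" unfolding integral_mult_right_zero[symmetric]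
  by (intro Bochner_Integration.integral_cong refl) (simp add: h_def mult_ac)
 finally show ?thesis .
qed

lemma rho_shift:
 fixes w :: "'b::euclidean_space \<times> real"
 assumes e: "e > 0"
 shows "L1 (\<lambda>z. rho e (z - w))" "(LBINT z. rho e (z - w)) = 1"
proof -
 have "(NBINT z. ennreal (rho e (z - w))) = 1" using nn_integral_lborel_shift(1)[of "\<lambda>z. ennreal (rho e z)" w] nn_integral_rho[OF e, where 'b = 'b] by simp
 moreover define h where "h z = rho e (z - w)" for z
 moreover have "h z \<ge> 0" for z unfolding h_def by (rule rho_nonneg[OF e])
 moreover have [measurable]: "h \<in> BM" unfolding h_def by measurable
 ultimately show "L1 (\<lambda>z. rho e (z - w))" "(LBINT z. rho e (z - w)) = 1"
  unfolding h_def[symmetric] by (auto intro!: integrableI_nonneg simp: integral_eq_nn_integral)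
qed

text \<open>The mollifier is moved onto the test function, which is Lipschitz, so the error is of
  order e.\<close>

lemma mollify_weak:
 fixes g qs :: "'b::euclidean_space \<times> real \<Rightarrow> real"
 assumes g: "L1 g" and qs: "L1 qs" "bsm qs"
 shows "((\<lambda>e. LBINT z. conv g (rho e) z * qs z) \<longlongrightarrow> (LBINT z. g z * qs z)) (at_right 0)"
proof -
 obtain L where L: "L \<ge> 0" "\<And>x h. \<bar>qs (x + h) - qs x\<bar> \<le> L * norm h" by (rule bsm_lipschitz[OF qs(2)]) blast
 obtain B where B: "\<And>x. \<bar>qs x\<bar> \<le> B" by (rule bsm_bounded[OF qs(2)]) blast
 define N where "N = (LBINT z. \<bar>g z\<bar>)"
 define c where "c = L * ka TYPE('b) * N"
 have [measurable]: "g \<in> BM" "qs \<in> BM" using g qs by auto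
 have bound: "\<bar>(LBINT z. conv g (rho e) z * qs z) - (LBINT z. g z * qs z)\<bar> \<le> c * e" if e: "e > 0" for e
 proof -
  define P where "P w = (LBINT z. qs z * rho e (z - w))" for w
  have ip: "L1 (\<lambda>z. qs z * rho e (z - w))" for w
  proof -
   obtain M where M: "\<And>z. \<bar>rho e (z :: 'b \<times> real)\<bar> \<le> M" by (rule bsm_bounded[OF bsm_rho]) blast
   show ?thesis by (rule integrable_mult_bounded[OF qs(1) _ M]) measurable
  qed
  have P: "\<bar>P w - qs w\<bar> \<le> L * (ka TYPE('b) * e)" for w
  proof -
   have "P w - qs w = (LBINT z. qs z * rho e (z - w)) - (LBINT z. qs w * rho e (z - w))" unfolding P_def using rho_shift[OF e, of w] by simp
   also have "\<dots> = (LBINT z. (qs z - qs w) * rho e (z - w))" using ip[of w] rho_shift(1)[OF e, of w] by (simp add: left_diff_distrib)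
   finally have eq: "P w - qs w = (LBINT z. (qs z - qs w) * rho e (z - w))" .
   have i: "L1 (\<lambda>z. (qs z - qs w) * rho e (z - w))" using ip[of w] rho_shift(1)[OF e, of w] by (simp add: left_diff_distrib)
   have "\<bar>P w - qs w\<bar> \<le> (LBINT z. \<bar>(qs z - qs w) * rho e (z - w)\<bar>)" unfolding eq by (rule integral_abs_bound)
   also have "\<dots> \<le> (LBINT z. L * (ka TYPE('b) * e) * rho e (z - w))"
   proof (rule integral_mono)
    show "L1 (\<lambda>z. \<bar>(qs z - qs w) * rho e (z - w)\<bar>)" by (rule integrable_abs[OF i])
    show "L1 (\<lambda>z. L * (ka TYPE('b) * e) * rho e (z - w))" using rho_shift(1)[OF e, of w] by simp
    fix z
    show "\<bar>(qs z - qs w) * rho e (z - w)\<bar> \<le> L * (ka TYPE('b) * e) * rho e (z - w)"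
    proof (cases "norm (z - w) > ka TYPE('b) * e")
     case True
     thus ?thesis using rho_zero[OF e True] by simp
    next
     case False
     have "\<bar>qs z - qs w\<bar> \<le> L * norm (z - w)" using L(2)[of w "z - w"] by simp
     also have "\<dots> \<le> L * (ka TYPE('b) * e)" using False L(1) by (intro mult_left_mono) auto
     finally show ?thesis unfolding abs_mult using rho_nonneg[OF e, of "z - w"] by (simp add: mult_right_mono)
    qed
   qed
   also have "\<dots> = L * (ka TYPE('b) * e)" using rho_shift[OF e, of w] by simp
   finally show ?thesis .
  qed
  have Pm [measurable]: "P \<in> BM" unfolding P_def by measurable
  have iP: "L1 (\<lambda>w. g w * P w)"
  proof (rule integrable_mult_bounded[OF g, of _ "B + L * (ka TYPE('b) * e)"])
   show "\<bar>P w\<bar> \<le> B + L * (ka TYPE('b) * e)" for w using P[of w] B[of w] by linarith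
  qed simp
  have iqs: "L1 (\<lambda>w. g w * qs w)" by (rule integrable_mult_bounded[OF g _ B]) simp
  have "(LBINT z. conv g (rho e) z * qs z) - (LBINT z. g z * qs z) = (LINT w|lborel. g w * (P w - qs w))"
   unfolding conv_adjoint[OF g qs(1) bsm_rho] P_def[symmetric] using iP iqs by (simp add: right_diff_distrib)
  hence "\<bar>(LBINT z. conv g (rho e) z * qs z) - (LBINT z. g z * qs z)\<bar> \<le> (LINT w|lborel. \<bar>g w * (P w - qs w)\<bar>)"
   using integral_abs_bound[of lborel "\<lambda>w. g w * (P w - qs w)"] by simp
  also have "\<dots> \<le> (LINT w|lborel. \<bar>g w\<bar> * (L * (ka TYPE('b) * e)))"
  proof (rule integral_mono)
   show "L1 (\<lambda>w. \<bar>g w * (P w - qs w)\<bar>)" using iP iqs by (intro integrable_abs) (simp add: right_diff_distrib)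
   show "L1 (\<lambda>w. \<bar>g w\<bar> * (L * (ka TYPE('b) * e)))" using g by simp
   show "\<bar>g w * (P w - qs w)\<bar> \<le> \<bar>g w\<bar> * (L * (ka TYPE('b) * e))" for w unfolding abs_mult by (intro mult_left_mono P) simp
  qed
  also have "\<dots> = c * e" by (simp add: c_def N_def)
  finally show ?thesis .
 qed
 have "((\<lambda>e. c * e) \<longlongrightarrow> c * 0) (at_right 0)" by (intro tendsto_intros)
 hence z: "((\<lambda>e. c * e) \<longlongrightarrow> 0) (at_right 0)" by simp
 have "((\<lambda>e. (LBINT z. conv g (rho e) z * qs z) - (LBINT z. g z * qs z)) \<longlongrightarrow> 0) (at_right 0)"
  by (rule Lim_null_comparison[OF _ z]) (use bound in \<open>auto simp: eventually_at_filter\<close>)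
 thus ?thesis by (simp add: LIM_zero_iff)
qed

lemma tst_integrable: "tst Om qs \<Longrightarrow> L1 qs"
proof -
 assume "tst Om qs"
 then obtain K where K: "bsm qs" "compact K" "\<And>z. z \<notin> K \<Longrightarrow> qs z = 0" by (auto simp: tst_def)
 then obtain r where r: "\<And>z. z \<in> K \<Longrightarrow> norm z \<le> r" using compact_imp_bounded bounded_iff by metis
 have "qs z = 0" if "norm z \<ge> r + 1" for z using r[of z] K(3)[of z] that by force
 thus "L1 qs" using integrable_continuous_vanishing[OF bsm_continuous[OF K(1)]] by blast
qed

context core begin

text \<open>On |z| < rh / 4 the weight is at least (rh / 4)^(-b); against the bound D (rh / 2)^(-b)
  this leaves D (1 / 2)^b. The estimate concerns mollified functions, so it is tested against
  functions supported in an annulus and passed to the limit weakly, before b grows.\<close>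

theorem u0_zero: "\<exists>r>0. r \<le> R \<and> (AE z in lborel. norm z < r \<longrightarrow> u0 z = 0)"
proof -
 obtain rh D b0 where rh: "0 < rh" "rh \<le> R / 4" and D: "D \<ge> 0" and bd: "\<And>b. b \<ge> b0 \<Longrightarrow> \<forall>\<^sub>F dl in at_right 0.
   (LBINT z. norm z powr (- b) * (ch dl rh z * u (dl^2) z)^2) \<le> D * (rh / 2) powr (- b)"
  using system_bound by blast
 \<comment> \<open>In this annulus the cutoff is identically 1 once 2 dl < et, so the integral
   against the test function does not see the inner cutoff.\<close>
 define S where "S et = ball (0::'b \<times> real) (rh / 4) - cball 0 et" for et
 have "AE z in lborel. z \<in> S et \<longrightarrow> u0 z = 0" if et: "et > 0" for et
 proof (rule fundamental_lemma[OF int(1)])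
  show "open (S et)" unfolding S_def by (intro open_Diff) auto
  fix qs assume t: "tst (S et) qs"
  hence qs: "bsm qs" "\<And>z. z \<notin> S et \<Longrightarrow> qs z = 0" by (auto simp: tst_def)
  note iqs = tst_integrable[OF t]
  have qs0: "qs z = 0" if "rh \<le> norm z" for z using qs(2)[of z] that rh unfolding S_def by force
  have iqs2: "L1 (\<lambda>z. (qs z)^2)" by (rule integrable_continuous_vanishing[of _ rh]; (intro continuous_intros bsm_continuous qs(1))?) (simp add: qs0)
  define N where "N = (LBINT z. (qs z)^2)"
  let ?A = "\<bar>LBINT z. u0 z * qs z\<bar>"
  have lim0: "((\<lambda>e. LBINT z. u e z * qs z) \<longlongrightarrow> (LBINT z. u0 z * qs z)) (at_right 0)" unfolding u_def by (rule mollify_weak[OF int(1) iqs qs(1)])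
  have sq0: "filterlim (\<lambda>dl::real. dl^2) (at_right 0) (at_right 0)" unfolding filterlim_at by (auto intro!: tendsto_eq_intros simp: eventually_at_filter)
  have lim: "((\<lambda>dl. \<bar>LBINT z. u (dl^2) z * qs z\<bar>) \<longlongrightarrow> ?A) (at_right 0)" using tendsto_rabs[OF filterlim_compose[OF lim0 sq0]] by simp
  \<comment> \<open>s is the free parameter in |x y| \<le> s x^2 / 2 + y^2 / (2 s), which separates
    the mollified function from the test function.\<close>
  have main: "?A \<le> s / 2 * (D * (1 / 2) powr b) + N / (2 * s)" if b: "b \<ge> b0" "b \<ge> 0" and s: "s > 0" for b s
  proof (rule tendsto_upperbound[OF lim])
   have e1: "\<forall>\<^sub>F dl in at_right (0::real). dl < min (rh / 4) (et / 2)" by (rule order_tendstoD(2)[OF tendsto_ident_at]) (use rh et in auto)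
   have e2: "\<forall>\<^sub>F dl in at_right (0::real). dl > 0" by (rule eventually_at_right_less)
   show "\<forall>\<^sub>F dl in at_right 0. \<bar>LBINT z. u (dl^2) z * qs z\<bar> \<le> s / 2 * (D * (1 / 2) powr b) + N / (2 * s)" using e1 e2 bd[OF b(1)]
   proof eventually_elim
    case (elim dl)
    hence d: "0 < dl" "4 * dl < rh" "2 * dl < et" by auto
    let ?U = "u (dl^2)"
    let ?w = "\<lambda>z. norm z powr (- b) * (ch dl rh z * ?U z)^2"
    have iw: "L1 ?w" by (rule integrable_powr_vanishing[OF d(1), of _ rh])
       (auto simp: ch_outside[OF d(1,2)] intro!: continuous_intros cont C2D(5)[OF C2_ch])
    have i: "L1 (\<lambda>z. ?U z * qs z)" by (rule integrable_continuous_vanishing[of _ rh]; (intro continuous_intros bsm_continuous cont qs(1))?) (simp add: qs0)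
    have "\<bar>LBINT z. ?U z * qs z\<bar> \<le> (LBINT z. \<bar>?U z * qs z\<bar>)" by (rule integral_abs_bound)
    also have "\<dots> \<le> (LBINT z. s / 2 * ((rh / 4) powr b * ?w z) + (qs z)^2 / (2 * s))"
    proof (rule integral_mono)
     show "L1 (\<lambda>z. \<bar>?U z * qs z\<bar>)" by (rule integrable_abs[OF i])
     show "L1 (\<lambda>z. s / 2 * ((rh / 4) powr b * ?w z) + (qs z)^2 / (2 * s))"
      using iw iqs2 by (intro Bochner_Integration.integrable_add integrable_mult_right integrable_divide) auto
     fix z :: "'b \<times> real"
     show "\<bar>?U z * qs z\<bar> \<le> s / 2 * ((rh / 4) powr b * ?w z) + (qs z)^2 / (2 * s)"
     proof (cases "z \<in> S et")
      case True
      hence z: "norm z > et" "norm z < rh / 4" by (auto simp: S_def)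
      have c: "ch dl rh z = 1" using ch_props(5)[OF d(1,2), of z] z d by simp
      have am: "\<bar>x * y\<bar> \<le> s / 2 * x^2 + y^2 / (2 * s)" for x y :: real
      proof -
       have "0 \<le> (s * \<bar>x\<bar> - \<bar>y\<bar>)^2" by simp
       hence "2 * s * (\<bar>x\<bar> * \<bar>y\<bar>) \<le> s^2 * x^2 + y^2" by (simp add: power2_diff power_mult_distrib)
       thus ?thesis using s by (simp add: field_simps power2_eq_square abs_mult)
      qed
      have "(?U z)^2 \<le> (rh / 4) powr b * ?w z"
      proof -
       have "(rh / 4) powr (- b) \<le> norm z powr (- b)" using z et b by (intro powr_antimono) auto
       hence "(rh / 4) powr b * (rh / 4) powr (- b) \<le> (rh / 4) powr b * norm z powr (- b)" by (intro mult_left_mono) auto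
       moreover have "(rh / 4) powr b * (rh / 4) powr (- b) = 1" using rh by (simp add: powr_minus)
       ultimately have "1 * (?U z)^2 \<le> (rh / 4) powr b * norm z powr (- b) * (?U z)^2" by (intro mult_right_mono) auto
       thus ?thesis by (simp add: c mult.assoc)
      qed
      hence "s / 2 * (?U z)^2 \<le> s / 2 * ((rh / 4) powr b * ?w z)" using s by (intro mult_left_mono) auto
      thus ?thesis using am[of "?U z" "qs z"] by linarith
     next
      case False
      thus ?thesis using qs(2) s by simp
     qed
    qed
    also have "\<dots> = s / 2 * ((rh / 4) powr b * (LBINT z. ?w z)) + N / (2 * s)" unfolding N_def using iw iqs2 by simp
    also have "\<dots> \<le> s / 2 * ((rh / 4) powr b * (D * (rh / 2) powr (- b))) + N / (2 * s)" using elim s by (intro add_right_mono mult_left_mono) auto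
    also have "(rh / 4) powr b * (D * (rh / 2) powr (- b)) = D * (1 / 2) powr b"
    proof -
     have "(rh / 4) powr b = (rh / 2) powr b * (1 / 2) powr b" using powr_mult[of "rh / 2" "1 / 2" b] by simp
     moreover have "(rh / 2) powr b * (rh / 2) powr (- b) = 1" using rh by (simp add: powr_minus)
     ultimately show ?thesis by simp
    qed
    finally show ?case .
   qed
  qed simp
  \<comment> \<open>For fixed s the term with (1 / 2)^b disappears as b grows; afterwards s itself
    tends to infinity.\<close>
  have "?A \<le> N / (2 * s)" if s: "s > 0" for s
  proof -
   have "((\<lambda>b::real. (1 / 2) powr b) \<longlongrightarrow> 0) at_top" by real_asymp
   hence "((\<lambda>b::real. s / 2 * (D * (1 / 2) powr b) + N / (2 * s)) \<longlongrightarrow> s / 2 * (D * 0) + N / (2 * s)) at_top" by (intro tendsto_intros)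
   hence "?A \<le> s / 2 * (D * 0) + N / (2 * s)"
   proof (rule tendsto_lowerbound)
    show "\<forall>\<^sub>F b in at_top. ?A \<le> s / 2 * (D * (1 / 2) powr b) + N / (2 * s)"
     using eventually_ge_at_top[of "max b0 0"] by eventually_elim (rule main[OF _ _ s], auto)
   qed simp
   thus ?thesis by simp
  qed
  moreover have "((\<lambda>s::real. N / (2 * s)) \<longlongrightarrow> 0) at_top" by real_asymp
  ultimately have "?A \<le> 0" by (intro tendsto_lowerbound[of "\<lambda>s. N / (2 * s)" 0 at_top ?A]) (auto intro: eventually_mono[OF eventually_gt_at_top[of 0]])
  thus "(LBINT z. u0 z * qs z) = 0" by simp
 qed
 hence "AE z in lborel. \<forall>n. z \<in> S (1 / Suc n) \<longrightarrow> u0 z = 0" unfolding AE_all_countable by simp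
 moreover have "AE z in lborel. z \<noteq> (0::'b \<times> real)" by (rule AE_lborel_singleton)
 ultimately have "AE z in lborel. norm z < rh / 4 \<longrightarrow> u0 z = 0"
 proof eventually_elim
  case (elim z)
  show ?case
  proof
   assume z: "norm z < rh / 4"
   obtain n where "1 / Suc n < norm z" using nat_approx_posE[of "norm z"] elim by auto
   hence "z \<in> S (1 / Suc n)" using z by (simp add: S_def)
   thus "u0 z = 0" using elim by blast
  qed
 qed
 thus ?thesis using rh R by (intro exI[of _ "rh / 4"]) auto
qed

end

section \<open>Unique continuation for weakly harmonic functions\<close>

text \<open>The Laplacian of the cut-off function lives in r / 2 \<le> |z| \<le> r, so comparing its
  weight with that on |z| < r / 4 gains the factor (1 / 2)^(b - 1), and b tends to infinity. The
  zero set around 0 plays the part of the inner cutoff, whatever its radius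
  \<open>et\<close>.\<close>

lemma harmonic_zero_spread:
 fixes w :: "'a::euclidean_space \<Rightarrow> real"
 assumes dim: "DIM('a) \<ge> 2" and w: "bsm w" and r: "0 < r" "r \<le> 1" and et: "et > 0"
  and har: "\<And>z. norm z < r \<Longrightarrow> lap w z = 0" and zero: "\<And>z. norm z < et \<Longrightarrow> w z = 0"
 shows "AE z in lborel. norm z < r / 4 \<longrightarrow> w z = 0"
proof -
 let ?W = "\<lambda>z. chi Xo r z * w z"
 define P where "P z = 2 * (gchi Xo r z \<bullet> grad w z) + w z * tr (Hchi Xo r) z" for z
 note c = C2_mult[OF C2_chi[OF bsm_Xo, of r] bsm_C2[OF w]]
 note X = C2D[OF C2_chi[OF bsm_Xo, where a = r and 'a = 'a]] and B = C2D[OF bsm_C2[OF w]]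
 have W0: "?W z = 0" if "norm z < et" for z using zero[OF that] by simp
 note chi0 = chi_Xo(1)[OF r(1)] and chi1 = chi_Xo(2)[OF r(1)]
 have W1: "?W z = 0" if "norm z \<ge> 1" for z using chi0[of z] that r by simp
 have P0: "P z = 0" if "norm z < r / 2 \<or> norm z > r" for z using chi_Xo(3)[OF r(1), of z] that by (auto simp: P_def)
 have tr: "tr (\<lambda>x h. chi Xo r x *\<^sub>R hess w x h + (gchi Xo r x \<bullet> h) *\<^sub>R grad w x + w x *\<^sub>R Hchi Xo r x h + (grad w x \<bullet> h) *\<^sub>R gchi Xo r x) z = P z" for z
  unfolding tr_mult tr_hess P_def using chi0[of z] har[of z] by (cases "norm z < r") auto
 have cP: "continuous_on UNIV P" unfolding P_def by (intro continuous_intros X B bsm_continuous[OF w])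
 have iP: "L1 (\<lambda>z. (P z)^2)" by (rule integrable_continuous_vanishing[of _ "r + 1"]) (use P0 r in \<open>auto intro!: continuous_intros cP\<close>)
 define K where "K = (LBINT z. (P z)^2)"
 define J where "J = (LBINT z. indicator (ball 0 (r / 4)) z * (w z)^2)"
 have iJ: "L1 (\<lambda>z. indicator (ball 0 (r / 4)) z * (w z)^2)"
 proof -
  have i: "L1 (\<lambda>z. (?W z)^2)" by (rule integrable_continuous_vanishing[of _ 1]) (use W1 in \<open>auto intro!: continuous_intros X bsm_continuous[OF w]\<close>)
  have "L1 (\<lambda>z. indicator (ball 0 (r / 4)) z *\<^sub>R (?W z)^2)" by (rule integrable_mult_indicator[OF _ i]) simp
  moreover have "indicator (ball 0 (r / 4)) z *\<^sub>R (?W z)^2 = indicator (ball 0 (r / 4)) z * (w z)^2" for z using chi1[of z] r by (cases "norm z < r / 4") auto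
  ultimately show ?thesis by (simp only:)
 qed
 have J: "J \<le> (1 / 2) powr (b - 1) * ((r / 2) ^ 3 * K)" if b: "b \<ge> real DIM('a)" "b \<ge> 4" for b
 proof -
  let ?L = "LBINT z. norm z powr (1 - b) * (?W z)^2" and ?I = "LBINT z. norm z powr (4 - b) * (P z)^2"
  have c1: "(b - 2)^2 * ?L \<le> 4 * ?I" unfolding tr[symmetric] by (rule carleman(1)[OF c et W0 W1 dim b])
  have iI: "L1 (\<lambda>z. norm z powr (4 - b) * (P z)^2)"
   by (rule integrable_powr_vanishing[of "r / 2" _ r]) (use P0 r in \<open>auto intro!: continuous_intros cP\<close>)
  have iL: "L1 (\<lambda>z. norm z powr (1 - b) * (?W z)^2)"
   by (rule integrable_powr_vanishing[OF et, of _ 1]) (use W0 W1 in \<open>auto intro!: continuous_intros X bsm_continuous[OF w]\<close>)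
  have "?I \<le> (LBINT z. (r / 2) powr (4 - b) * (P z)^2)"
  proof (rule integral_mono[OF iI])
   show "norm z powr (4 - b) * (P z)^2 \<le> (r / 2) powr (4 - b) * (P z)^2" for z
   proof (cases "norm z < r / 2")
    case False
    thus ?thesis using r b by (intro mult_right_mono powr_antimono) auto
   qed (simp add: P0)
  qed (use iP in simp)
  hence I: "?I \<le> (r / 2) powr (4 - b) * K" by (simp add: K_def)
  have "4 \<le> (b - 2)^2" using power_mono[of 2 "b - 2" 2] b by simp
  moreover have "?L \<ge> 0" by (rule Bochner_Integration.integral_nonneg) simp
  ultimately have "4 * ?L \<le> (b - 2)^2 * ?L" by (rule mult_right_mono)
  hence L: "?L \<le> (r / 2) powr (4 - b) * K" using c1 I by linarith
  have "(LBINT z. (r / 4) powr (1 - b) * (indicator (ball 0 (r / 4)) z * (w z)^2)) \<le> ?L"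
  proof (rule integral_mono[OF _ iL])
   show "L1 (\<lambda>z. (r / 4) powr (1 - b) * (indicator (ball 0 (r / 4)) z * (w z)^2))" using iJ by simp
   show "(r / 4) powr (1 - b) * (indicator (ball 0 (r / 4)) z * (w z)^2) \<le> norm z powr (1 - b) * (?W z)^2" for z
   proof (cases "norm z < r / 4 \<and> z \<noteq> 0")
    case True
    hence "(r / 4) powr (1 - b) * (w z)^2 \<le> norm z powr (1 - b) * (w z)^2" using b by (intro mult_right_mono powr_antimono) auto
    thus ?thesis using True chi1[of z] r by simp
   next
    case False
    thus ?thesis using zero[of 0] et by auto
   qed
  qed
  hence "(r / 4) powr (1 - b) * J \<le> (r / 2) powr (4 - b) * K" using L by (simp add: J_def)
  hence "(r / 4) powr (b - 1) * ((r / 4) powr (1 - b) * J) \<le> (r / 4) powr (b - 1) * ((r / 2) powr (4 - b) * K)" by (rule mult_left_mono) simp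
  moreover have "(r / 4) powr (b - 1) * (r / 4) powr (1 - b) = 1" using r by (simp flip: powr_add)
  moreover have "(r / 4) powr (b - 1) * (r / 2) powr (4 - b) = (1 / 2) powr (b - 1) * (r / 2) ^ 3"
  proof -
   have "(r / 4) powr (b - 1) = (r / 2) powr (b - 1) * (1 / 2) powr (b - 1)" using powr_mult[of "r / 2" "1 / 2" "b - 1"] by simp
   moreover have "(r / 2) powr (b - 1) * (r / 2) powr (4 - b) = (r / 2) ^ 3" using r by (simp add: powr_numeral flip: powr_add)
   ultimately show ?thesis by (simp add: mult_ac)
  qed
  ultimately show ?thesis by (metis mult.assoc mult_1_left)
 qed
 have "J \<le> 0"
 proof (rule tendsto_lowerbound)
  have "((\<lambda>b::real. (1 / 2) powr (b - 1)) \<longlongrightarrow> 0) at_top" by real_asymp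
  thus "((\<lambda>b::real. (1 / 2) powr (b - 1) * ((r / 2) ^ 3 * K)) \<longlongrightarrow> 0) at_top" by (rule tendsto_mult_left_zero)
  show "\<forall>\<^sub>F b in at_top. J \<le> (1 / 2) powr (b - 1) * ((r / 2) ^ 3 * K)"
   using eventually_ge_at_top[of "max 4 (real DIM('a))"] by eventually_elim (rule J, auto)
 qed simp
 moreover have "J \<ge> 0" unfolding J_def by (rule Bochner_Integration.integral_nonneg) simp
 ultimately have "J = 0" by simp
 hence "AE z in lborel. indicator (ball 0 (r / 4)) z * (w z)^2 = 0" unfolding J_def by (subst (asm) integral_nonneg_eq_0_iff_AE[OF iJ]) auto
 thus ?thesis by eventually_elim auto
qed

lemma tst_rho_ball:
 fixes z :: "'b::euclidean_space \<times> real"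
 assumes "e > 0" "norm (z - p) + ka TYPE('b) * e < r" shows "tst (ball p r) (\<lambda>w. rho e (z - w))"
 unfolding tst_def
proof (intro conjI exI)
 show "bsm (\<lambda>w. rho e (z - w))" by (intro bsm_neg bsm_rho)
 show "compact (cball z (ka TYPE('b) * e))" by simp
 show "cball z (ka TYPE('b) * e) \<subseteq> ball p r"
 proof
  fix w assume w: "w \<in> cball z (ka TYPE('b) * e)"
  have "dist p w \<le> dist p z + dist z w" by (rule dist_triangle)
  thus "w \<in> ball p r" using w assms by (simp add: dist_norm norm_minus_commute)
 qed
 show "\<forall>w. w \<notin> cball z (ka TYPE('b) * e) \<longrightarrow> rho e (z - w) = 0" by (intro allI impI rho_zero[OF assms(1)]) (simp add: dist_norm)
qed

text \<open>With k e below r / 2 and et / 2, the mollification is smooth, harmonic in |z - p| < r /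
  2 and zero in |z - p| < et / 2. \<open>harmonic_zero_spread\<close> makes it zero in |z - p| < r /
  8, a radius independent of e and et, and e tends to 0 weakly.\<close>

lemma ucp_step:
 fixes g :: "'b::euclidean_space \<times> real \<Rightarrow> real"
 assumes g: "L1 g" and r: "0 < r" "r \<le> 1" and et: "et > 0"
  and har: "\<And>ph. tst (ball p r) ph \<Longrightarrow> (LBINT z. g z * lap ph z) = 0"
  and zero: "AE z in lborel. z \<in> ball p et \<longrightarrow> g z = 0"
 shows "AE z in lborel. z \<in> ball p (r / 8) \<longrightarrow> g z = 0"
proof (rule fundamental_lemma[OF g])
 let ?k = "ka TYPE('b)"
 have k0: "?k > 0" by (simp add: ka_def add_nonneg_pos)
 have dim: "DIM('b \<times> real) \<ge> 2" using DIM_positive[where 'a = 'b] by (simp add: Suc_le_eq)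
 fix qs :: "'b \<times> real \<Rightarrow> real" assume t: "tst (ball p (r / 8)) qs"
 hence qs: "bsm qs" "\<And>z. z \<notin> ball p (r / 8) \<Longrightarrow> qs z = 0" unfolding tst_def by blast+
 have z: "(LBINT z. conv g (rho e) z * qs z) = 0" if e: "0 < e" "e < min (r / 2) (et / 2) / ?k" for e
 proof -
  have ke: "?k * e < r / 2" "?k * e < et / 2" using e(2) k0 by (auto simp: less_divide_eq mult.commute)
  define w where "w z = conv g (rho e) (1 *\<^sub>R z + p)" for z
  have bw: "bsm w" unfolding w_def by (intro bsm_scale bsm_conv g bsm_rho)
  have "AE z in lborel. norm z < r / 2 / 4 \<longrightarrow> w z = 0"
  proof (rule harmonic_zero_spread[OF dim bw])
   show "0 < et / 2" "0 < r / 2" "r / 2 \<le> 1" using et r by auto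
   fix z :: "'b \<times> real"
   show "lap w z = 0" if "norm z < r / 2"
   proof -
    have t: "tst (ball p r) (\<lambda>w. rho e ((z + p) - w))" using that ke by (intro tst_rho_ball e) simp
    have "lap w z = (LINT w|lborel. g w * lap (\<lambda>w. rho e ((z + p) - w)) w)" unfolding w_def[abs_def] lap_affine[OF bsm_conv[OF g bsm_rho]]
     by (simp add: lap_conv[OF g bsm_rho] conv_def lap_neg[OF bsm_rho])
    thus ?thesis using har[OF t] by simp
   qed
   show "w z = 0" if "norm z < et / 2"
   proof -
    have "AE x in lborel. g x * rho e ((z + p) - x) = 0" using zero
    proof eventually_elim
     case (elim x)
     show ?case
     proof (cases "x \<in> ball p et")
      case True
      thus ?thesis using elim by simp
     next
      case False
      have "dist p x \<le> dist p (z + p) + dist (z + p) x" by (rule dist_triangle)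
      hence "norm ((z + p) - x) > ?k * e" using False that ke by (simp add: dist_norm)
      thus ?thesis using rho_zero[OF e(1), of "(z + p) - x"] by simp
     qed
    qed
    hence "(LBINT x. g x * rho e ((z + p) - x)) = 0" by (rule integral_eq_zero_AE)
    thus ?thesis by (simp add: w_def conv_def)
   qed
  qed
  hence w0: "AE z in lborel. z \<in> ball 0 (r / 8) \<longrightarrow> conv g (rho e) (z + p) = 0" by (simp add: w_def)
  have wz: "AE z in lborel. conv g (rho e) (z + p) * qs (z + p) = 0" using w0
  proof eventually_elim
   case (elim z)
   thus ?case using qs(2)[of "z + p"] by (cases "norm z < r / 8") (auto simp: dist_norm)
  qed
  have "(LBINT z. conv g (rho e) z * qs z) = (LBINT z. conv g (rho e) (p + z) * qs (p + z))" by (subst lborel_distr_plus[of p, symmetric], rule integral_distr)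
    (auto intro!: bsm_measurable bsm_mult qs(1) bsm_conv g bsm_rho)
  also have "\<dots> = 0" using wz by (intro integral_eq_zero_AE) (simp add: add.commute)
  finally show ?thesis .
 qed
 have "((\<lambda>e. LBINT z. conv g (rho e) z * qs z) \<longlongrightarrow> 0) (at_right 0)"
 proof (rule tendsto_eventually)
  have e1: "\<forall>\<^sub>F e in at_right (0::real). e < min (r / 2) (et / 2) / ?k" by (rule order_tendstoD(2)[OF tendsto_ident_at]) (use r et k0 in auto)
  have e2: "\<forall>\<^sub>F e in at_right (0::real). e > 0" by (rule eventually_at_right_less)
  show "\<forall>\<^sub>F e in at_right 0. (LBINT z. conv g (rho e) z * qs z) = 0" using e1 e2 by eventually_elim (rule z)
 qed
 moreover note mollify_weak[OF g tst_integrable[OF t] qs(1)]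
 ultimately show "(LBINT z. g z * qs z) = 0" using tendsto_unique[OF trivial_limit_at_right_real] by blast
qed simp

lemma tst_mono: "tst S ph \<Longrightarrow> S \<subseteq> T \<Longrightarrow> tst T ph"
 unfolding tst_def by blast

text \<open>The set of points with a neighbourhood on which g vanishes almost everywhere is
  relatively open and, because the radius reached by \<open>ucp_step\<close> does not depend on the
  size of that neighbourhood, relatively closed.\<close>

theorem weakly_harmonic_unique_continuation:
 fixes g :: "'b::euclidean_space \<times> real \<Rightarrow> real"
 assumes g: "L1 g" and Om: "open Om" "connected Om"
  and har: "\<And>ph. tst Om ph \<Longrightarrow> (LBINT z. g z * lap ph z) = 0"
  and p: "p \<in> Om" "et > 0" and zero: "AE z in lborel. z \<in> ball p et \<longrightarrow> g z = 0"
 shows "AE z in lborel. z \<in> Om \<longrightarrow> g z = 0"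
proof -
 define Z where "Z = {q \<in> Om. \<exists>s>0. AE z in lborel. z \<in> ball q s \<longrightarrow> g z = 0}"
 \<comment> \<open>The ball of radius r / 2 about q lies in \<open>Om\<close>, so
   \<open>ucp_step\<close> clears the ball of radius r / 16 about q, which contains the ball of
   radius r / 32 about q'.\<close>
 have step: "q' \<in> Z" if q: "q \<in> Z" and q': "q' \<in> Om" and r: "0 < r" "r \<le> 1" "ball q' r \<subseteq> Om" and d: "dist q q' < r / 32" for q q' r
 proof -
  obtain s where s: "s > 0" "AE z in lborel. z \<in> ball q s \<longrightarrow> g z = 0" using q by (auto simp: Z_def)
  have sub: "ball q (r / 2) \<subseteq> Om"
  proof -
   have "ball q (r / 2) \<subseteq> ball q' r"
   proof
    fix x assume x: "x \<in> ball q (r / 2)"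
    have "dist q' x \<le> dist q' q + dist q x" by (rule dist_triangle)
    thus "x \<in> ball q' r" using x d r(1) by (simp add: dist_commute[of q' q])
   qed
   thus ?thesis using r by blast
  qed
  have "AE z in lborel. z \<in> ball q (r / 2 / 8) \<longrightarrow> g z = 0" by (rule ucp_step[OF g _ _ s(1) har[OF tst_mono[OF _ sub]] s(2)]) (use r in auto)
  moreover have "ball q' (r / 32) \<subseteq> ball q (r / 2 / 8)"
  proof
   fix x assume x: "x \<in> ball q' (r / 32)"
   have "dist q x \<le> dist q q' + dist q' x" by (rule dist_triangle)
   thus "x \<in> ball q (r / 2 / 8)" using x d by simp
  qed
  ultimately have "AE z in lborel. z \<in> ball q' (r / 32) \<longrightarrow> g z = 0" by (auto elim!: eventually_mono)
  thus ?thesis using q' r by (auto simp: Z_def intro!: exI[of _ "r / 32"])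
 qed
 have rad: "\<exists>r>0. r \<le> 1 \<and> ball q r \<subseteq> Om" if q: "q \<in> Om" for q
 proof -
  obtain r where "r > 0" "ball q r \<subseteq> Om" by (rule openE[OF Om(1) q])
  thus ?thesis by (intro exI[of _ "min r 1"]) auto
 qed
 have oZ: "openin (top_of_set Om) Z" unfolding openin_contains_ball
 proof (intro conjI ballI)
  show "Z \<subseteq> Om" by (auto simp: Z_def)
  fix q assume "q \<in> Z"
  then obtain s where s: "s > 0" "AE z in lborel. z \<in> ball q s \<longrightarrow> g z = 0" by (auto simp: Z_def)
  have "ball q s \<inter> Om \<subseteq> Z"
  proof
   fix x assume x: "x \<in> ball q s \<inter> Om"
   then obtain s' where s': "s' > 0" "ball x s' \<subseteq> ball q s" using openE[OF open_ball, of x q s] by blast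
   have "AE z in lborel. z \<in> ball x s' \<longrightarrow> g z = 0" using s(2) by eventually_elim (use s' in blast)
   thus "x \<in> Z" using x s' by (auto simp: Z_def)
  qed
  thus "\<exists>e>0. ball q e \<inter> Om \<subseteq> Z" using s by blast
 qed
 have cZ: "closedin (top_of_set Om) Z" unfolding closedin_limpt
 proof (intro conjI allI impI)
  show "Z \<subseteq> Om" by (auto simp: Z_def)
  fix q assume q: "q islimpt Z \<and> q \<in> Om"
  then obtain r where r: "r > 0" "r \<le> 1" "ball q r \<subseteq> Om" using rad by blast
  obtain x where "x \<in> Z" "dist x q < r / 32" using q r unfolding islimpt_approachable by (metis divide_pos_pos zero_less_numeral)
  thus "q \<in> Z" using step[of x q r] q r by blast
 qed
 have "Z \<noteq> {}" using p zero unfolding Z_def by blast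
 hence Z: "Z = Om" using Om(2) oZ cZ unfolding connected_clopen by blast
 define s where "s q = (SOME s. s > 0 \<and> (AE z in lborel. z \<in> ball q s \<longrightarrow> g z = 0))" for q
 have s: "s q > 0" "AE z in lborel. z \<in> ball q (s q) \<longrightarrow> g z = 0" if "q \<in> Om" for q
 proof -
  have "q \<in> Z" using that Z by blast
  hence "\<exists>s. s > 0 \<and> (AE z in lborel. z \<in> ball q s \<longrightarrow> g z = 0)" unfolding Z_def by blast
  from someI_ex[OF this] show "s q > 0" "AE z in lborel. z \<in> ball q (s q) \<longrightarrow> g z = 0" unfolding s_def by blast+
 qed
 \<comment> \<open>Lindelof reduces the cover to countably many balls, over which null sets may be
   united.\<close>
 obtain F where F: "F \<subseteq> (\<lambda>q. ball q (s q)) ` Om" "countable F" "\<Union>F = \<Union>((\<lambda>q. ball q (s q)) ` Om)"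
  by (rule Lindelof[of "(\<lambda>q. ball q (s q)) ` Om"]) auto
 have "AE z in lborel. \<forall>S\<in>F. z \<in> S \<longrightarrow> g z = 0" unfolding AE_ball_countable[OF F(2)] using F(1) s(2) by blast
 thus ?thesis
 proof eventually_elim
  case (elim z)
  show ?case
  proof
   assume z: "z \<in> Om"
   hence "z \<in> ball z (s z)" using s(1) by simp
   hence "z \<in> \<Union>F" unfolding F(3) using z by blast
   thus "g z = 0" using elim by blast
  qed
 qed
qed

section \<open>Reduction of the weak formulation\<close>

text \<open>Borel representatives, extended by 0: they move statements about \<open>lebesgue_on S\<close> to \<open>lborel\<close>.\<close>

definition brep :: "'a::euclidean_space set \<Rightarrow> ('a \<Rightarrow> real) \<Rightarrow> ('a \<Rightarrow> real) \<Rightarrow> bool" where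
 "brep S f f' \<longleftrightarrow> f' \<in> BM \<and> (\<forall>z. z \<notin> S \<longrightarrow> f' z = 0)
   \<and> f \<in> borel_measurable (lebesgue_on S) \<and> (AE z in lborel. z \<in> S \<longrightarrow> f z = f' z)"

lemma AE_lebesgue_on_iff:
 "S \<in> sets borel \<Longrightarrow> (AE z in lebesgue_on S. P z) \<longleftrightarrow> (AE z in lborel. z \<in> S \<longrightarrow> P z)"
 by (subst AE_restrict_space_iff) (auto simp: AE_completion_iff)

lemma brep_ex:
 fixes f :: "'a::euclidean_space \<Rightarrow> real"
 assumes S: "S \<in> sets borel" and f: "f \<in> borel_measurable (lebesgue_on S)"
 shows "\<exists>f'. brep S f f'"
proof -
 have "S \<in> sets lebesgue" using S by simp
 from borel_measurable_if_I[OF f this] completion_ex_borel_measurable_real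
 obtain f1 where f1: "f1 \<in> borel_measurable lborel" "AE x in lborel. (if x \<in> S then f x else 0) = f1 x" by blast
 have [measurable]: "f1 \<in> BM" using f1(1) by simp
 have "brep S f (\<lambda>z. indicator S z * f1 z)" unfolding brep_def
 proof (intro conjI)
  show "(\<lambda>z. indicator S z * f1 z) \<in> BM" by (intro borel_measurable_times borel_measurable_indicator S) simp
  show "AE z in lborel. z \<in> S \<longrightarrow> f z = indicator S z * f1 z" using f1(2) by eventually_elim auto
 qed (use f in auto)
 thus ?thesis by blast
qed

lemma brep_integral:
 fixes f :: "'a::euclidean_space \<Rightarrow> real"
 assumes S: "S \<in> sets borel" and f: "brep S f f'"
 shows "(LINT z|lebesgue_on S. f z) = (LBINT z. f' z)"
  and "integrable (lebesgue_on S) f \<longleftrightarrow> L1 f'"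
proof -
 have S': "S \<inter> space lebesgue \<in> sets lebesgue" using S by simp
 have m: "(\<lambda>x. indicator S x *\<^sub>R f x) \<in> borel_measurable lebesgue" using f borel_measurable_restrict_space_iff[OF S'] unfolding brep_def by blast
 have f'm: "f' \<in> borel_measurable lborel" using f by (simp add: brep_def)
 hence m': "f' \<in> borel_measurable lebesgue" by (rule measurable_completion)
 have "AE z in lborel. indicator S z *\<^sub>R f z = f' z" using f unfolding brep_def by (auto simp: indicator_def elim!: eventually_mono)
 hence ae: "AE z in lebesgue. indicator S z *\<^sub>R f z = f' z" by (rule AE_completion)
 show "(LINT z|lebesgue_on S. f z) = (LBINT z. f' z)" unfolding integral_restrict_space[OF S'] integral_cong_AE[OF m m' ae] by (rule integral_completion[OF f'm])
 show "integrable (lebesgue_on S) f \<longleftrightarrow> L1 f'"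
  unfolding integrable_restrict_space[OF S'] integrable_cong_AE[OF m m' ae] by (rule integrable_completion[OF f'm])
qed

lemma brep_mult_borel:
 fixes k :: "'a::euclidean_space \<Rightarrow> real"
 assumes f: "brep S f f'" and k: "k \<in> BM"
 shows "brep S (\<lambda>z. f z * k z) (\<lambda>z. f' z * k z)"
proof -
 have "k \<in> borel_measurable lebesgue" using k by (intro measurable_completion) simp
 hence "k \<in> borel_measurable (lebesgue_on S)" by (rule measurable_restrict_space1)
 thus ?thesis using f k unfolding brep_def by (auto elim!: eventually_mono)
qed

lemma brep_mult: "brep S f f' \<Longrightarrow> brep S g g' \<Longrightarrow> brep S (\<lambda>z. f z * g z) (\<lambda>z. f' z * g' z)"
 unfolding brep_def by (auto elim: eventually_elim2)

lemma brep_diff: "brep S f f' \<Longrightarrow> brep S g g' \<Longrightarrow> brep S (\<lambda>z. f z - g z) (\<lambda>z. f' z - g' z)"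
 unfolding brep_def by (auto elim: eventually_elim2)

lemma brep_add: "brep S f f' \<Longrightarrow> brep S g g' \<Longrightarrow> brep S (\<lambda>z. f z + g z) (\<lambda>z. f' z + g' z)"
 unfolding brep_def by (auto elim: eventually_elim2)

lemma brep_square: "brep S f f' \<Longrightarrow> brep S (\<lambda>z. (f z)^2) (\<lambda>z. (f' z)^2)"
 unfolding power2_eq_square by (rule brep_mult)

lemma brep_sum: "finite I \<Longrightarrow> (\<And>i. i \<in> I \<Longrightarrow> brep S (f i) (f' i)) \<Longrightarrow> brep S (\<lambda>z. \<Sum>i\<in>I. f i z) (\<lambda>z. \<Sum>i\<in>I. f' i z)"
proof (induction rule: finite_induct)
 case empty
 thus ?case by (simp add: brep_def)
next
 case (insert i I)
 thus ?case using brep_add[of S "f i" "f' i"] by simp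
qed

lemma brep_borel:
 fixes k :: "'a::euclidean_space \<Rightarrow> real"
 assumes S: "S \<in> sets borel" and k: "k \<in> BM"
 shows "brep S k (\<lambda>z. indicator S z * k z)"
proof -
 have "k \<in> borel_measurable lebesgue" using k by (intro measurable_completion) simp
 hence "k \<in> borel_measurable (lebesgue_on S)" by (rule measurable_restrict_space1)
 thus ?thesis using S k unfolding brep_def by auto
qed

lemma L2_rep:
 assumes S: "S \<in> sets borel" and u: "u \<in> L2 (lebesgue_on S)"
 shows "\<exists>u'. brep S u u' \<and> L1 (\<lambda>z. (u' z)^2)"
proof -
 obtain u' where u': "brep S u u'" using brep_ex[OF S] u by (auto simp: L2_def)
 have "integrable (lebesgue_on S) (\<lambda>z. (u z)^2)" using u by (simp add: L2_def)
 thus ?thesis using u' brep_integral(2)[OF S brep_square[OF u']] by blast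
qed

lemma L2_component:
 fixes g :: "'a::euclidean_space \<Rightarrow> 'a"
 assumes g: "g \<in> L2 M" and i: "i \<in> Basis" shows "(\<lambda>z. g z \<bullet> i) \<in> L2 M"
 unfolding L2_def
proof safe
 have gm: "g \<in> borel_measurable M" "integrable M (\<lambda>x. (norm (g x))^2)" using g by (auto simp: L2_def)
 thus m: "(\<lambda>z. g z \<bullet> i) \<in> borel_measurable M" by simp
 show "integrable M (\<lambda>x. (norm (g x \<bullet> i))^2)"
 proof (rule Bochner_Integration.integrable_bound[OF gm(2)])
  show "AE x in M. norm ((norm (g x \<bullet> i))^2) \<le> norm ((norm (g x))^2)" by (intro AE_I2) (simp add: abs_le_square_iff[symmetric] Basis_le_norm[OF i])
 qed (use m in simp)
qed

lemma weak_rep: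
 assumes Om: "open Om" and u: "brep Om u u'" and g: "brep Om (\<lambda>z. g z \<bullet> i) g'" and i: "i \<in> Basis"
  and w: "is_weak_gradient Om u g" and ph: "tst Om ph"
 shows "(LBINT z. u' z * pd i ph z) = - (LBINT z. g' z * ph z)"
proof -
 have S: "Om \<in> sets borel" using Om by simp
 have b: "bsm ph" using ph by (simp add: tst_def)
 have "(LINT z|lebesgue_on Om. u z * pd i ph z) = - (LINT z|lebesgue_on Om. (g z \<bullet> i) * ph z)"
  using w tst_imp_test_functions[OF ph] i unfolding is_weak_gradient_def pd_def by blast
 thus ?thesis using brep_integral(1)[OF S brep_mult_borel[OF u bsm_measurable[OF bsm_pd[OF b i]]]]
   brep_integral(1)[OF S brep_mult_borel[OF g bsm_measurable[OF b]]] by simp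
qed

lemma brep_integrable:
 fixes g' :: "'a::euclidean_space \<Rightarrow> real"
 assumes g: "brep S g g'" and sq: "L1 (\<lambda>z. (g' z)^2)" and S: "S \<subseteq> ball 0 R"
 shows "L1 g'"
 by (rule integrable_of_square[OF _ sq, of R]) (use g S in \<open>auto simp: brep_def\<close>)

text \<open>The fundamental lemma applied to each component of the difference; boundedness of the
  domain turns square integrable components into integrable ones.\<close>

lemma weak_gradient_unique:
 fixes g h :: "'a::euclidean_space \<Rightarrow> 'a"
 assumes Om: "open Om" "Om \<subseteq> ball 0 R" and u: "u \<in> L2 (lebesgue_on Om)"
  and g: "g \<in> L2 (lebesgue_on Om)" "is_weak_gradient Om u g"
  and h: "h \<in> L2 (lebesgue_on Om)" "is_weak_gradient Om u h"
 shows "AE z in lborel. z \<in> Om \<longrightarrow> g z = h z"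
proof -
 have S: "Om \<in> sets borel" using Om by simp
 have "AE z in lborel. z \<in> Om \<longrightarrow> g z \<bullet> i = h z \<bullet> i" if i: "i \<in> Basis" for i
 proof -
  obtain u' where u': "brep Om u u'" using L2_rep[OF S u] by blast
  obtain g' where g': "brep Om (\<lambda>z. g z \<bullet> i) g'" "L1 (\<lambda>z. (g' z)^2)" using L2_rep[OF S L2_component[OF g(1) i]] by blast
  obtain h' where h': "brep Om (\<lambda>z. h z \<bullet> i) h'" "L1 (\<lambda>z. (h' z)^2)" using L2_rep[OF S L2_component[OF h(1) i]] by blast
  note ig = brep_integrable[OF g' Om(2)] and ih = brep_integrable[OF h' Om(2)]
  have "AE z in lborel. z \<in> Om \<longrightarrow> g' z - h' z = 0"
  proof (rule fundamental_lemma[OF _ _ Om(1)])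
   show "L1 (\<lambda>z. g' z - h' z)" using ig ih by simp
   fix ph :: "'a \<Rightarrow> real" assume t: "tst Om ph"
   hence b: "bsm ph" by (simp add: tst_def)
   obtain M where M: "\<And>z. \<bar>ph z\<bar> \<le> M" by (rule bsm_bounded[OF b]) blast
   have "L1 (\<lambda>z. g' z * ph z)" "L1 (\<lambda>z. h' z * ph z)" by (rule integrable_mult_bounded[OF _ _ M]; use ig ih bsm_measurable[OF b] in simp)+
   thus "(LBINT z. (g' z - h' z) * ph z) = 0" using weak_rep[OF Om(1) u' g'(1) i g(2) t] weak_rep[OF Om(1) u' h'(1) i h(2) t] by (simp add: left_diff_distrib)
  qed
  moreover have "AE z in lborel. z \<in> Om \<longrightarrow> g z \<bullet> i = g' z" "AE z in lborel. z \<in> Om \<longrightarrow> h z \<bullet> i = h' z"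
   using g'(1) h'(1) by (auto simp: brep_def)
  ultimately show ?thesis by eventually_elim auto
 qed
 hence "AE z in lborel. \<forall>i\<in>Basis. z \<in> Om \<longrightarrow> g z \<bullet> i = h z \<bullet> i"
  unfolding AE_ball_countable[OF countable_finite[OF finite_Basis]] by blast
 thus ?thesis by eventually_elim (auto intro: euclidean_eqI)
qed

text \<open>\<open>weak_gradient\<close> is a Hilbert choice; exhibiting one weak gradient
  determines it up to a null set.\<close>

lemma weak_gradient_AE:
 assumes Om: "open Om" "Om \<subseteq> ball 0 R" and u: "u \<in> L2 (lebesgue_on Om)"
  and g: "g \<in> L2 (lebesgue_on Om)" "is_weak_gradient Om u g"
 shows "weak_gradient Om u \<in> L2 (lebesgue_on Om)" "is_weak_gradient Om u (weak_gradient Om u)"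
  "AE z in lborel. z \<in> Om \<longrightarrow> weak_gradient Om u z = g z"
proof -
 have "weak_gradient Om u \<in> L2 (lebesgue_on Om) \<and> is_weak_gradient Om u (weak_gradient Om u)"
  unfolding weak_gradient_def by (rule someI[of _ g]) (use g in blast)
 thus "weak_gradient Om u \<in> L2 (lebesgue_on Om)" "is_weak_gradient Om u (weak_gradient Om u)" by blast+
 thus "AE z in lborel. z \<in> Om \<longrightarrow> weak_gradient Om u z = g z" by (rule weak_gradient_unique[OF Om u _ _ g])
qed

text \<open>The first-order facts about arbitrary \<open>test_functions\<close>, a class given by
  \<open>smooth\<close> and not by \<open>bsm\<close>; they are called for wherever a function is
  shown to have a weak gradient.\<close>

lemma test_function_C1:
 assumes "qs \<in> test_functions Om"
 shows "(qs has_derivative frechet_derivative qs (at x)) (at x)"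
  "i \<in> Basis \<Longrightarrow> continuous_on UNIV (pd i qs)" "continuous_on UNIV qs"
  "\<exists>K. compact K \<and> K \<subseteq> Om \<and> (\<forall>z. z \<notin> K \<longrightarrow> qs z = 0 \<and> (\<forall>i. pd i qs z = 0))"
proof -
 have s: "C_on (Suc 0) UNIV qs" using assms unfolding test_functions_def smooth_def by blast
 thus d: "(qs has_derivative frechet_derivative qs (at x)) (at x)" for x by (auto simp: differentiable_on_def frechet_derivative_works)
 show "i \<in> Basis \<Longrightarrow> continuous_on UNIV (pd i qs)" using s by (simp add: pd_def)
 show "continuous_on UNIV qs" using d by (meson continuous_at_imp_continuous_on has_derivative_continuous)
 let ?K = "closure {z. qs z \<noteq> 0}"
 have z: "qs z = 0" if "z \<notin> ?K" for z using that closure_subset[of "{z. qs z \<noteq> 0}"] by blast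
 have p: "pd i qs z = 0" if "z \<notin> ?K" for i z
 proof -
  have "frechet_derivative qs (at z) = (\<lambda>_. 0)" by (rule has_derivative_zero_of_locally_zero[OF d, of "- ?K"])
    (simp_all only: open_Compl closed_closure Compl_iff that z not_False_eq_True)
  thus ?thesis unfolding pd_def by (rule fun_cong)
 qed
 have K: "compact ?K" "?K \<subseteq> Om" using assms unfolding test_functions_def mem_Collect_eq by blast+
 show "\<exists>K. compact K \<and> K \<subseteq> Om \<and> (\<forall>z. z \<notin> K \<longrightarrow> qs z = 0 \<and> (\<forall>i. pd i qs z = 0))"
  by (intro exI[of _ ?K] conjI allI impI K z p)
qed

lemma C1_weak_gradient:
 fixes f :: "'a::euclidean_space \<Rightarrow> real"
 assumes Om: "open Om" and der: "\<And>z. (f has_derivative (\<lambda>h. g z \<bullet> h)) (at z)" and g: "continuous_on UNIV g"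
 shows "is_weak_gradient Om f g"
 unfolding is_weak_gradient_def
proof (intro ballI)
 fix qs and i :: 'a assume qs: "qs \<in> test_functions Om" and i: "i \<in> Basis"
 note T = test_function_C1[OF qs]
 obtain K where K: "compact K" "K \<subseteq> Om" "\<And>z. z \<notin> K \<Longrightarrow> qs z = 0" "\<And>z i. z \<notin> K \<Longrightarrow> pd i qs z = 0" using T(4) by blast
 obtain r where r: "\<And>z. z \<in> K \<Longrightarrow> norm z \<le> r" using compact_imp_bounded[OF K(1)] bounded_iff by metis
 have cf: "continuous_on UNIV f" using der by (meson continuous_at_imp_continuous_on has_derivative_continuous)
 have S: "Om \<in> sets borel" using Om by simp
 have out: "z \<notin> K" if "norm z \<ge> r + 1" for z using r[of z] that by force
 have lb: "(LINT z|lebesgue_on Om. F z) = (LBINT z. F z)" "L1 F"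
  if F: "continuous_on UNIV F" "\<And>z. z \<notin> K \<Longrightarrow> F z = 0" for F :: "'a \<Rightarrow> real"
 proof -
  have "F \<in> BM" using F(1) by (simp add: borel_measurable_continuous_onI)
  from brep_integral(1)[OF S brep_borel[OF S this]]
  have "(LINT z|lebesgue_on Om. F z) = (LBINT z. indicator Om z * F z)" .
  also have "\<dots> = (LBINT z. F z)" by (intro Bochner_Integration.integral_cong refl) (use F(2) K(2) in \<open>auto simp: indicator_def\<close>)
  finally show "(LINT z|lebesgue_on Om. F z) = (LBINT z. F z)" .
  show "L1 F" by (rule integrable_continuous_vanishing[OF F(1), of "r + 1"]) (use F(2) out in blast)
 qed
 have T2: "continuous_on UNIV (\<lambda>z. frechet_derivative qs (at z) i)" using T(2)[OF i] by (simp add: pd_def[abs_def])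
 have D: "((\<lambda>z. f z * qs z) has_derivative (\<lambda>h. f z * frechet_derivative qs (at z) h + (g z \<bullet> h) * qs z)) (at z)" for z
  by (rule has_derivative_mult[OF der T(1)])
 have 0: "(LBINT z. f z * frechet_derivative qs (at z) i + (g z \<bullet> i) * qs z) = 0"
 proof (rule integral_directional_derivative_eq_0[OF D])
  show "continuous_on UNIV (\<lambda>z. f z * frechet_derivative qs (at z) i + (g z \<bullet> i) * qs z)" by (intro continuous_intros cf g T(3) T2)
  show "f z * qs z = 0" if "norm z \<ge> r + 1" for z using K(3)[OF out[OF that]] by simp
 qed
 have c: "continuous_on UNIV (\<lambda>z. f z * frechet_derivative qs (at z) i)" "continuous_on UNIV (\<lambda>z. (g z \<bullet> i) * qs z)"
  by (intro continuous_intros cf g T(3) T2)+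
 have z: "f z * frechet_derivative qs (at z) i = 0" "(g z \<bullet> i) * qs z = 0" if "z \<notin> K" for z
  by (simp_all only: K(3)[OF that] K(4)[OF that, of i, unfolded pd_def] mult_zero_right)
 show "(LINT z|lebesgue_on Om. f z * frechet_derivative qs (at z) i) = - (LINT z|lebesgue_on Om. (g z \<bullet> i) * qs z)"
proof -
  have "(LINT z|lebesgue_on Om. f z * frechet_derivative qs (at z) i) = (LBINT z. f z * frechet_derivative qs (at z) i)" by (rule lb(1)[OF c(1)]) (rule z(1))
  moreover have "(LINT z|lebesgue_on Om. (g z \<bullet> i) * qs z) = (LBINT z. (g z \<bullet> i) * qs z)" by (rule lb(1)[OF c(2)]) (rule z(2))
  moreover have "L1 (\<lambda>z. f z * frechet_derivative qs (at z) i)" by (rule lb(2)[OF c(1)]) (rule z(1))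
  moreover have "L1 (\<lambda>z. (g z \<bullet> i) * qs z)" by (rule lb(2)[OF c(2)]) (rule z(2))
  ultimately show ?thesis using 0 by simp
 qed
qed

lemma L2_continuous:
 fixes f :: "'a::euclidean_space \<Rightarrow> 'c::euclidean_space"
 assumes S: "S \<in> sets borel" "S \<subseteq> ball 0 R" and f: "continuous_on UNIV f"
 shows "f \<in> L2 (lebesgue_on S)"
 unfolding L2_def
proof safe
 have fm: "f \<in> BM" using f by (rule borel_measurable_continuous_onI)
 hence "f \<in> borel_measurable lebesgue" by (intro measurable_completion) simp
 thus "f \<in> borel_measurable (lebesgue_on S)" by (rule measurable_restrict_space1)
 have c: "continuous_on UNIV (\<lambda>x. (norm (f x))^2)" by (intro continuous_intros f)
 hence k: "(\<lambda>x. (norm (f x))^2) \<in> BM" by (rule borel_measurable_continuous_onI)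
 have "compact ((\<lambda>x. (norm (f x))^2) ` cball 0 R)" by (rule compact_continuous_image[OF continuous_on_subset[OF c]]) auto
 from compact_imp_bounded[OF this] obtain B where "\<forall>y \<in> (\<lambda>x. (norm (f x))^2) ` cball 0 R. norm y \<le> B" unfolding bounded_iff by blast
 hence B: "(norm (f x))^2 \<le> B" if "x \<in> cball 0 R" for x using that by fastforce
 have i: "L1 (\<lambda>x::'a. B * indicator (cball 0 R) x)" by (intro integrable_mult_right integrable_real_indicator emeasure_bounded_finite) auto
 have "L1 (\<lambda>x. indicator S x * (norm (f x))^2)"
 proof (rule Bochner_Integration.integrable_bound[OF i])
  show "(\<lambda>x. indicator S x * (norm (f x))^2) \<in> borel_measurable lborel" using S k by (auto intro!: borel_measurable_times borel_measurable_indicator)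
  show "AE x in lborel. norm (indicator S x * (norm (f x))^2) \<le> norm (B * indicator (cball 0 R) x)"
  proof (rule AE_I2)
   fix x :: 'a
   show "norm (indicator S x * (norm (f x))^2) \<le> norm (B * indicator (cball 0 R) x)"
   proof (cases "x \<in> S")
    case True
    hence "x \<in> cball 0 R" using S by auto
    with B[OF this] True show ?thesis by simp
   qed simp
  qed
 qed
 thus "integrable (lebesgue_on S) (\<lambda>x. (norm (f x))^2)" using brep_integral(2)[OF S(1) brep_borel[OF S(1) k]] by simp
qed

lemma H1_weak_gradient:
 assumes "u \<in> H1 Om"
 shows "u \<in> L2 (lebesgue_on Om)" "weak_gradient Om u \<in> L2 (lebesgue_on Om)" "is_weak_gradient Om u (weak_gradient Om u)"
proof -
 have "\<exists>g. g \<in> L2 (lebesgue_on Om) \<and> is_weak_gradient Om u g" using assms by (auto simp: H1_def)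
 from someI_ex[OF this] show "weak_gradient Om u \<in> L2 (lebesgue_on Om)" "is_weak_gradient Om u (weak_gradient Om u)" unfolding weak_gradient_def by blast+
 show "u \<in> L2 (lebesgue_on Om)" using assms by (simp add: H1_def)
qed

lemma C1_H1:
 assumes Om: "open Om" "Om \<subseteq> ball 0 R" and der: "\<And>z. (f has_derivative (\<lambda>h. g z \<bullet> h)) (at z)" and g: "continuous_on UNIV g"
 shows "f \<in> H1 Om" "AE z in lborel. z \<in> Om \<longrightarrow> weak_gradient Om f z = g z"
proof -
 have S: "Om \<in> sets borel" using Om by simp
 have cf: "continuous_on UNIV f" using der by (meson continuous_at_imp_continuous_on has_derivative_continuous)
 note f2 = L2_continuous[OF S Om(2) cf] and g2 = L2_continuous[OF S Om(2) g] and w = C1_weak_gradient[OF Om(1) der g]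
 show "f \<in> H1 Om" using f2 g2 w by (auto simp: H1_def)
 show "AE z in lborel. z \<in> Om \<longrightarrow> weak_gradient Om f z = g z" by (rule weak_gradient_AE(3)[OF Om f2 g2 w])
qed

lemma L2_test_integrable:
 fixes u k :: "'a::euclidean_space \<Rightarrow> real"
 assumes S: "S \<in> sets borel" "S \<subseteq> ball 0 R" and u: "u \<in> L2 (lebesgue_on S)"
  and k: "continuous_on UNIV k" "compact K" "\<And>z. z \<notin> K \<Longrightarrow> k z = 0"
 shows "integrable (lebesgue_on S) (\<lambda>z. u z * k z)"
proof -
 obtain u' where u': "brep S u u'" "L1 (\<lambda>z. (u' z)^2)" using L2_rep[OF S(1) u] by blast
 have km: "k \<in> BM" using k(1) by (rule borel_measurable_continuous_onI)
 have "bounded (k ` K)" by (rule compact_imp_bounded[OF compact_continuous_image[OF continuous_on_subset[OF k(1)] k(2)]]) simp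
 then obtain B where B: "\<And>z. z \<in> K \<Longrightarrow> \<bar>k z\<bar> \<le> B" by (auto simp: bounded_iff)
 have "\<bar>k z\<bar> \<le> max B 0" for z using B[of z] k(3)[of z] by (cases "z \<in> K") auto
 from integrable_mult_bounded[OF brep_integrable[OF u' S(2)] _ this] km
 have "L1 (\<lambda>z. u' z * k z)" by simp
 thus ?thesis using brep_integral(2)[OF S(1) brep_mult_borel[OF u'(1) km]] by simp
qed

lemma L2_diff:
 assumes "f \<in> L2 M" "g \<in> L2 M" shows "(\<lambda>z. f z - g z) \<in> L2 M"
 unfolding L2_def
proof safe
 have m: "f \<in> borel_measurable M" "g \<in> borel_measurable M" and i: "integrable M (\<lambda>z. (norm (f z))^2)" "integrable M (\<lambda>z. (norm (g z))^2)"
  using assms by (auto simp: L2_def)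
 show m': "(\<lambda>z. f z - g z) \<in> borel_measurable M" using m by simp
 have i2: "integrable M (\<lambda>z. 2 * (norm (f z))^2 + 2 * (norm (g z))^2)" using i by simp
 show "integrable M (\<lambda>z. (norm (f z - g z))^2)"
 proof (rule Bochner_Integration.integrable_bound[OF i2])
  have "(norm (f z - g z))^2 \<le> 2 * (norm (f z))^2 + 2 * (norm (g z))^2" for z
  proof -
   have "(norm (f z - g z))^2 \<le> (norm (f z) + norm (g z))^2" by (rule power_mono[OF norm_triangle_ineq4]) simp
   also have "\<dots> \<le> 2 * (norm (f z))^2 + 2 * (norm (g z))^2" using zero_le_power2[of "norm (f z) - norm (g z)"] by (simp add: power2_eq_square algebra_simps)
   finally show ?thesis .
  qed
  thus "AE z in M. norm ((norm (f z - g z))^2) \<le> norm (2 * (norm (f z))^2 + 2 * (norm (g z))^2)" by (intro AE_I2) simp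
 qed (use m' in measurable)
qed

lemma is_weak_gradient_diff:
 fixes u v :: "'a::euclidean_space \<Rightarrow> real"
 assumes Om: "open Om" "Om \<subseteq> ball 0 R"
  and u: "u \<in> L2 (lebesgue_on Om)" "g \<in> L2 (lebesgue_on Om)" "is_weak_gradient Om u g"
  and v: "v \<in> L2 (lebesgue_on Om)" "h \<in> L2 (lebesgue_on Om)" "is_weak_gradient Om v h"
 shows "is_weak_gradient Om (\<lambda>z. u z - v z) (\<lambda>z. g z - h z)"
 unfolding is_weak_gradient_def
proof (intro ballI)
 fix qs and i :: 'a assume qs: "qs \<in> test_functions Om" and i: "i \<in> Basis"
 have S: "Om \<in> sets borel" using Om by simp
 note T = test_function_C1[OF qs]
 obtain K where K: "compact K" "K \<subseteq> Om" "\<And>z. z \<notin> K \<Longrightarrow> qs z = 0" "\<And>z i. z \<notin> K \<Longrightarrow> pd i qs z = 0" using T(4) by blast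
 have I: "integrable (lebesgue_on Om) (\<lambda>z. w z * pd i qs z)" "integrable (lebesgue_on Om) (\<lambda>z. w z * qs z)"
  if w: "w \<in> L2 (lebesgue_on Om)" for w
 proof -
  show "integrable (lebesgue_on Om) (\<lambda>z. w z * pd i qs z)" by (rule L2_test_integrable[OF S Om(2) w T(2)[OF i] K(1)]) (rule K(4))
  show "integrable (lebesgue_on Om) (\<lambda>z. w z * qs z)" by (rule L2_test_integrable[OF S Om(2) w T(3) K(1)]) (rule K(3))
 qed
 have e: "(LINT z|lebesgue_on Om. u z * pd i qs z) = - (LINT z|lebesgue_on Om. (g z \<bullet> i) * qs z)"
  "(LINT z|lebesgue_on Om. v z * pd i qs z) = - (LINT z|lebesgue_on Om. (h z \<bullet> i) * qs z)"
  using u(3) v(3) qs i unfolding is_weak_gradient_def pd_def by blast+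
 have pd_def': "pd i qs z = frechet_derivative qs (at z) i" for z by (simp add: pd_def)
 show "(LINT z|lebesgue_on Om. (u z - v z) * frechet_derivative qs (at z) i) = - (LINT z|lebesgue_on Om. ((g z - h z) \<bullet> i) * qs z)"
  unfolding pd_def'[symmetric] inner_diff_left left_diff_distrib
  by (subst (1 2) Bochner_Integration.integral_diff) (use e in \<open>auto intro!: I u v L2_component i\<close>)
qed

text \<open>The definition of a trace measures distance by the chosen gradient of a difference,
  which has to be split into a difference of chosen gradients.\<close>

lemma H1_diff_weak_gradient:
 assumes Om: "open Om" "Om \<subseteq> ball 0 R" and u: "u \<in> H1 Om" and v: "v \<in> H1 Om"
 shows "weak_gradient Om (\<lambda>z. u z - v z) \<in> L2 (lebesgue_on Om)" "(\<lambda>z. u z - v z) \<in> L2 (lebesgue_on Om)"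
  "AE z in lborel. z \<in> Om \<longrightarrow> weak_gradient Om (\<lambda>z. u z - v z) z = weak_gradient Om u z - weak_gradient Om v z"
proof -
 note U = H1_weak_gradient[OF u] and V = H1_weak_gradient[OF v]
 show d: "(\<lambda>z. u z - v z) \<in> L2 (lebesgue_on Om)" by (rule L2_diff[OF U(1) V(1)])
 note W = weak_gradient_AE[OF Om d L2_diff[OF U(2) V(2)] is_weak_gradient_diff[OF Om U V]]
 show "weak_gradient Om (\<lambda>z. u z - v z) \<in> L2 (lebesgue_on Om)" by (rule W(1))
 show "AE z in lborel. z \<in> Om \<longrightarrow> weak_gradient Om (\<lambda>z. u z - v z) z = weak_gradient Om u z - weak_gradient Om v z" by (rule W(3))
qed

text \<open>Traces of test functions are exhibited by constant sequences, and even for the zero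
  function the chosen weak gradient is known only almost everywhere.\<close>

lemma H1_norm_0:
 assumes Om: "open Om" "Om \<subseteq> ball 0 R" shows "H1_norm Om (\<lambda>z. 0) = 0"
proof -
 have S: "Om \<in> sets borel" using Om by simp
 have "AE z in lborel. z \<in> Om \<longrightarrow> weak_gradient Om (\<lambda>z. 0) z = 0" by (rule C1_H1(2)[OF Om, of "\<lambda>_. 0" "\<lambda>_. 0"]) auto
 hence "AE z in lebesgue_on Om. weak_gradient Om (\<lambda>z. 0) z = 0" by (simp add: AE_lebesgue_on_iff[OF S])
 hence "(LINT z|lebesgue_on Om. (norm (weak_gradient Om (\<lambda>z. 0) z))^2) = 0" by (intro integral_eq_zero_AE) (auto elim!: eventually_mono)
 thus ?thesis by (simp add: H1_norm_def)
qed

section \<open>Admissible test functions on the half ball\<close>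

lemma half_ball_facts:
 "open (half_ball R :: ((real^'n) \<times> real) set)" "(half_ball R :: ((real^'n) \<times> real) set) \<subseteq> ball 0 R"
 "(half_ball R :: ((real^'n) \<times> real) set) \<in> sets borel" "connected (half_ball R :: ((real^'n) \<times> real) set)"
proof -
 have e: "half_ball R = ball 0 R \<inter> {z :: (real^'n) \<times> real. (0, 1) \<bullet> z > 0}" by (auto simp: half_ball_def inner_prod_def)
 show "open (half_ball R :: ((real^'n) \<times> real) set)" unfolding e by (intro open_Int open_ball open_halfspace_gt)
 thus "(half_ball R :: ((real^'n) \<times> real) set) \<in> sets borel" by simp
 show "(half_ball R :: ((real^'n) \<times> real) set) \<subseteq> ball 0 R" unfolding e by blast
 show "connected (half_ball R :: ((real^'n) \<times> real) set)" unfolding e by (intro convex_connected convex_Int convex_ball convex_halfspace_gt)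
qed

text \<open>Test functions of the full ball may be inserted into the weak formulation: a constant
  sequence shows that they vanish on the half sphere and that their flat trace is their restriction
  to t = 0.\<close>

lemma tst_zero_trace:
 fixes ph :: "(real^'n) \<times> real \<Rightarrow> real"
 assumes R: "R > 0" and ph: "tst (ball 0 R) ph"
 shows "ph \<in> H1 (half_ball R)" "zero_trace_on_half_sphere R ph" "has_flat_trace R ph (\<lambda>x. ph (x, 0))"
  "AE z in lborel. z \<in> half_ball R \<longrightarrow> weak_gradient (half_ball R) ph z = grad ph z"
proof -
 have b: "bsm ph" using ph by (simp add: tst_def)
 have z: "ph y = 0" if "norm y \<ge> R" for y
 proof -
  obtain K where "K \<subseteq> ball 0 R" "\<And>z. z \<notin> K \<Longrightarrow> ph z = 0" using ph unfolding tst_def by blast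
  thus ?thesis using that by (metis mem_ball_0 not_less subsetD)
 qed
 note C = C1_H1[OF half_ball_facts(1,2) bsm_grad[OF b] C2D(6)[OF bsm_C2[OF b]]]
 show "ph \<in> H1 (half_ball R)" "AE z in lborel. z \<in> half_ball R \<longrightarrow> weak_gradient (half_ball R) ph z = grad ph z" by (rule C)+
 have sm: "smooth ph" by (rule bsm_imp_smooth[OF b])
 have n0: "(\<lambda>k::nat. H1_norm (half_ball R) (\<lambda>z::(real^'n) \<times> real. ph z - ph z)) \<longlonglongrightarrow> 0"
  by (simp add: H1_norm_0[OF half_ball_facts(1,2)])
 let ?M = "half_sphere_measure R :: ((real^'n) \<times> real) measure"
 \<comment> \<open>Radial projection maps the half ball into the sphere of radius R, where
   \<open>ph\<close> vanishes; the half ball does not contain the origin, so the projection is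
   defined on all of it.\<close>
 have AE0: "AE y in ?M. ph y = 0"
 proof (rule AE_I)
  let ?N = "{y. ph y \<noteq> 0}"
  have N: "?N \<in> sets borel" using bsm_measurable[OF b] by measurable
  show "{y \<in> space ?M. ph y \<noteq> 0} \<subseteq> ?N" by blast
  show "?N \<in> sets ?M" using N by (simp add: half_sphere_measure_def)
  have m: "(\<lambda>z. (R / norm z) *\<^sub>R z) \<in> measurable (lebesgue_on (half_ball R)) borel"
   by (rule measurable_restrict_space1, rule measurable_completion) simp
  have "(\<lambda>z. (R / norm z) *\<^sub>R z) -` ?N \<inter> space (lebesgue_on (half_ball R)) = {}"
  proof -
   have "ph ((R / norm z) *\<^sub>R z) = 0" if "z \<in> half_ball R" for z :: "(real^'n) \<times> real"
   proof -
    have "z \<noteq> 0" using that by (auto simp: half_ball_def)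
    hence "norm ((R / norm z) *\<^sub>R z) = R" using R by simp
    thus ?thesis by (intro z) simp
   qed
   thus ?thesis by auto
  qed
  hence "emeasure (distr (lebesgue_on (half_ball R)) borel (\<lambda>z. (R / norm z) *\<^sub>R z)) ?N = 0" by (subst emeasure_distr[OF m N]) simp
  thus "emeasure ?M ?N = 0" by (simp add: half_sphere_measure_def)
 qed
 hence "(LINT y|?M. (ph y - 0)^2) = 0" by (intro integral_eq_zero_AE) (auto elim!: eventually_mono)
 thus "zero_trace_on_half_sphere R ph" unfolding zero_trace_on_half_sphere_def has_trace_def using sm n0 by (intro conjI exI[of _ "\<lambda>_. ph"]) (auto simp: L2_def)
 have "(\<lambda>x. ph (x, 0)) \<in> L2 (lebesgue_on (ball 0 R))"
  by (rule L2_continuous[of _ R]) (auto intro!: continuous_on_compose2[OF bsm_continuous[OF b, of UNIV]] continuous_intros)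
 thus "has_flat_trace R ph (\<lambda>x. ph (x, 0))" unfolding has_flat_trace_def has_trace_def using sm n0 by (intro conjI exI[of _ "\<lambda>_. ph"]) auto
qed

lemma tst_pd_zero:
 assumes "bsm ph" "compact K" "\<And>z. z \<notin> K \<Longrightarrow> ph z = 0" "z \<notin> K" shows "pd i ph z = 0"
proof -
 have o: "open (- K)" using compact_imp_closed[OF assms(2)] by (rule open_Compl)
 have "(\<lambda>h. \<Sum>i\<in>Basis. (h \<bullet> i) * pd i ph z) = (\<lambda>_. 0)"
  by (rule has_derivative_zero_of_locally_zero[OF bsm_has_derivative[OF assms(1)] o]) (simp_all add: assms)
 thus ?thesis using pd_eq[OF bsm_has_derivative[OF assms(1)], of i z] by metis
qed

section \<open>Green's identity for even test functions\<close>

lemma pd_even_zero: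
 fixes ph :: "'b::euclidean_space \<times> real \<Rightarrow> real"
 assumes b: "bsm ph" and e: "\<And>z. ph (rfl z) = ph z"
 shows "pd (0, 1) ph (x, 0) = 0"
proof -
 let ?D = "pd (0, 1) ph (x, 0)"
 have "((\<lambda>t. (x, t)) has_derivative (\<lambda>h. (0, h))) (at (0::real))" by (auto intro!: derivative_eq_intros)
 from has_derivative_compose[OF this bsm_grad[OF b]]
 have "((\<lambda>t. ph (x, t)) has_derivative (\<lambda>h. grad ph (x, 0) \<bullet> (0, h))) (at 0)" .
 moreover have "grad ph (x, 0) \<bullet> (0, h) = ?D * h" for h
  using grad_inner_Basis[OF Basis_01, of ph "(x, 0)"] inner_scaleR_right[of "grad ph (x, 0)" h "(0, 1)"] by (simp add: mult.commute)
 ultimately have 1: "((\<lambda>t. ph (x, t)) has_real_derivative ?D) (at 0)" by (simp add: has_field_derivative_def)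
 have "((\<lambda>t. ph (x, - t)) has_real_derivative ?D * (- 1)) (at 0)"
  by (rule DERIV_chain2[where f = "\<lambda>t. ph (x, t)" and g = uminus]) (use 1 in \<open>auto intro!: derivative_eq_intros\<close>)
 moreover have "ph (x, - t) = ph (x, t)" for t using e[of "(x, t)"] by (simp add: rfl_def)
 ultimately have 2: "((\<lambda>t. ph (x, t)) has_real_derivative - ?D) (at 0)" by simp
 show ?thesis using DERIV_unique[OF 1 2] by simp
qed

text \<open>Weak gradients are tested with functions supported in the open half ball, so the test
  function is cut off near t = 0. For an even test function the error of this cutoff tends to 0
  because its t derivative vanishes on t = 0.\<close>

lemma even_green:
 fixes u' :: "'b::euclidean_space \<times> real \<Rightarrow> real" and G :: "'b \<times> real \<Rightarrow> 'b \<times> real \<Rightarrow> real"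
 assumes H: "H = {z. norm z < R \<and> snd z > 0}"
  and u: "L1 u'" "\<And>z. z \<notin> H \<Longrightarrow> u' z = 0"
  and G: "\<And>i. i \<in> Basis \<Longrightarrow> L1 (G i)" "\<And>i z. i \<in> Basis \<Longrightarrow> z \<notin> H \<Longrightarrow> G i z = 0"
  and weak: "\<And>i ph. i \<in> Basis \<Longrightarrow> tst H ph \<Longrightarrow> (LBINT z. u' z * pd i ph z) = - (LBINT z. G i z * ph z)"
  and ph: "tst (ball 0 R) ph" and e: "\<And>z. ph (rfl z) = ph z"
 shows "(\<Sum>i\<in>Basis. LBINT z. G i z * pd i ph z) = - (LBINT z. u' z * lap ph z)"
proof -
 obtain K where K: "bsm ph" "compact K" "K \<subseteq> ball 0 R" "\<And>z. z \<notin> K \<Longrightarrow> ph z = 0" using ph unfolding tst_def by blast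
 note b = K(1)
 define ep where "ep n = 1 / real (Suc n)" for n
 have ep: "ep n > 0" for n by (simp add: ep_def)
 define s where "s n z = (0::'b, 1 / ep n) \<bullet> z + - 1" for n z
 have s: "s n z = snd z / ep n - 1" for n z by (simp add: s_def inner_prod_def)
 \<comment> \<open>\<open>et n\<close> is 0 for t \<le> ep n and 1 for t \<ge> 2 ep n;
   \<open>si n\<close> below is its t derivative.\<close>
 define et where "et n z = stp (s n z)" for n z
 define si where "si n z = pd 1 stp (s n z) / ep n" for n z
 have bet: "bsm (et n)" for n unfolding et_def s_def by (rule bsm_stp_inner)
 let ?e = "(0::'b, 1::real)" and ?q = "\<lambda>n i z. et n z * pd i ph z"
 have pdet: "pd i (et n) z = si n z * snd i" for i n z
 proof -
  have ds: "(s n has_derivative (\<lambda>h. snd h / ep n)) (at z)" unfolding s[abs_def] using ep[of n] by (auto intro!: derivative_eq_intros)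
  have "(et n has_derivative (\<lambda>h. pd 1 stp (s n z) * (snd h / ep n))) (at z)" unfolding et_def[abs_def]
   by (rule has_derivative_compose[OF ds, of stp]) (use bsm_real_deriv[OF stp(1)] in \<open>simp add: has_field_derivative_def\<close>)
  from pd_eq[OF this, of i] show ?thesis by (simp add: si_def)
 qed
 have tst: "tst H (?q n i)" if i: "i \<in> Basis" for i n unfolding tst_def
 proof (intro conjI exI)
  show "bsm (?q n i)" by (intro bsm_mult bet bsm_pd b i)
  show "compact (K \<inter> {z. ep n \<le> snd z})" by (intro compact_Int_closed K closed_Collect_le continuous_intros)
  show "K \<inter> {z. ep n \<le> snd z} \<subseteq> H" using K(3) ep[of n] unfolding H by fastforce
  show "\<forall>z. z \<notin> K \<inter> {z. ep n \<le> snd z} \<longrightarrow> et n z * pd i ph z = 0"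
  proof (intro allI impI)
   fix z assume z: "z \<notin> K \<inter> {z. ep n \<le> snd z}"
   show "et n z * pd i ph z = 0"
   proof (cases "z \<in> K")
    case True
    hence "s n z \<le> 0" using z ep[of n] by (simp add: s)
    thus ?thesis by (simp add: et_def stp)
   next
    case False
    thus ?thesis using tst_pd_zero[OF K(1,2,4)] by simp
   qed
  qed
 qed
 have bd: "\<exists>B\<ge>0. \<forall>z. \<bar>f z\<bar> \<le> B" if f: "bsm f" for f :: "'b \<times> real \<Rightarrow> real" using bsm_bounded[OF f] by metis
 have et1: "\<bar>et n z\<bar> \<le> 1" for n z by (simp add: et_def stp)
 have ev: "\<forall>\<^sub>F n in sequentially. et n z = 1 \<and> si n z = 0" if z: "z \<in> H" for z
 proof -
  have t: "snd z > 0" using z by (simp add: H)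
  obtain N where N: "1 / real (Suc N) < snd z / 3" using nat_approx_posE[of "snd z / 3"] t by auto
  show ?thesis
  proof (rule eventually_sequentiallyI[of N])
   fix n assume n: "N \<le> n"
   have "ep n \<le> 1 / real (Suc N)" unfolding ep_def by (rule divide_left_mono) (use n in auto)
   hence "3 * ep n < snd z" using N by linarith
   hence "snd z / ep n > 3" using ep[of n] by (simp add: less_divide_eq)
   hence "s n z > 1" by (simp add: s)
   thus "et n z = 1 \<and> si n z = 0" using pd1_zero_open[OF stp(1), of "{1<..}" 1 "s n z"] by (simp add: et_def si_def stp(3))
  qed
 qed
 have lim: "(\<lambda>n. LBINT z. g z * p n z) \<longlonglongrightarrow> (LBINT z. g z * q z)"
  if g: "L1 g" "\<And>z. z \<notin> H \<Longrightarrow> g z = 0" and m: "\<And>n. p n \<in> BM" "q \<in> BM"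
   and B: "\<And>n z. \<bar>p n z\<bar> \<le> B" and eq: "\<And>n z. et n z = 1 \<Longrightarrow> si n z = 0 \<Longrightarrow> p n z = q z"
  for g q :: "'b \<times> real \<Rightarrow> real" and p B
 proof (rule integral_dominated_convergence[where w = "\<lambda>z. \<bar>g z\<bar> * B"])
  show "AE z in lborel. (\<lambda>n. g z * p n z) \<longlonglongrightarrow> g z * q z"
  proof (rule AE_I2)
   fix z
   show "(\<lambda>n. g z * p n z) \<longlonglongrightarrow> g z * q z"
   proof (cases "z \<in> H")
    case True
    from ev[OF True] have "\<forall>\<^sub>F n in sequentially. g z * p n z = g z * q z" by eventually_elim (simp add: eq)
    thus ?thesis by (rule tendsto_eventually)
   qed (simp add: g)
  qed
  show "AE z in lborel. norm (g z * p n z) \<le> \<bar>g z\<bar> * B" for n using B by (intro AE_I2) (simp add: abs_mult mult_left_mono)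
 qed (use g m in auto)
 have L1: "(\<lambda>n. LBINT z. G i z * (et n z * pd i ph z)) \<longlonglongrightarrow> (LBINT z. G i z * pd i ph z)" if i: "i \<in> Basis" for i
 proof -
  obtain B where B: "B \<ge> 0" "\<And>z. \<bar>pd i ph z\<bar> \<le> B" using bd[OF bsm_pd[OF b i]] by blast
  show ?thesis
  proof (rule lim[OF G(1)[OF i] G(2)[OF i]])
   show "\<bar>et n z * pd i ph z\<bar> \<le> 1 * B" for n z unfolding abs_mult by (intro mult_mono et1 B) auto
  qed (intro bsm_measurable bsm_mult bet bsm_pd b i | simp)+
 qed
 obtain M where M: "M \<ge> 0" "\<And>x h. \<bar>pd ?e ph (x + h) - pd ?e ph x\<bar> \<le> M * norm h" by (rule bsm_lipschitz[OF bsm_pd[OF b Basis_01]]) blast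
 \<comment> \<open>The t derivative is Lipschitz and vanishes at t = 0, hence is O(|t|).\<close>
 have Mt: "\<bar>pd ?e ph z\<bar> \<le> M * \<bar>snd z\<bar>" for z using M(2)[of "(fst z, 0)" "(0, snd z)"] pd_even_zero[OF b e, of "fst z"] by simp
 obtain S where S: "S \<ge> 0" "\<And>t. \<bar>pd 1 stp t\<bar> \<le> S" using bsm_bounded[OF bsm_pd1[OF stp(1)]] by metis
 obtain BL where BL: "BL \<ge> 0" "\<And>z. \<bar>lap ph z\<bar> \<le> BL" using bd[OF bsm_lap[OF b]] by blast
 \<comment> \<open>In the layer |t| \<le> 2 ep n the factor \<open>si n\<close> is O(1 / ep n) and
   the t derivative is O(ep n), so the product is bounded uniformly in n; at each point of H it is
   eventually 0, and dominated convergence applies.\<close>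
 have sib: "\<bar>si n z * pd ?e ph z\<bar> \<le> 2 * S * M" for n z
 proof (cases "s n z > 1 \<or> s n z < 0")
  case True
  hence "pd 1 stp (s n z) = 0" using pd1_zero_open[OF stp(1), of "{1<..}" 1 "s n z"] pd1_zero_open[OF stp(1), of "{..<0}" 0 "s n z"] by (auto simp: stp)
  thus ?thesis using S M by (simp add: si_def)
 next
  case False
  hence t: "\<bar>snd z\<bar> \<le> 2 * ep n" using ep[of n] by (simp add: s field_simps)
  have "\<bar>si n z * pd ?e ph z\<bar> \<le> (S / ep n) * (M * (2 * ep n))" unfolding abs_mult
  proof (rule mult_mono)
   show "\<bar>si n z\<bar> \<le> S / ep n" using S(2)[of "s n z"] ep[of n] by (simp add: si_def divide_right_mono)
   show "\<bar>pd ?e ph z\<bar> \<le> M * (2 * ep n)" using Mt[of z] mult_left_mono[OF t M(1)] by linarith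
  qed (use S ep[of n] in auto)
  also have "\<dots> = 2 * S * M" using ep[of n] by simp
  finally show ?thesis .
 qed
 define P where "P n z = et n z * lap ph z + si n z * pd ?e ph z" for n z
 have bP: "\<And>n. P n \<in> BM"
 proof -
  fix n
  have e: "si n z = pd ?e (et n) z" for z by (simp add: pdet)
  have "bsm (P n)" unfolding P_def[abs_def] e by (intro bsm_add bsm_mult bet bsm_lap b bsm_pd Basis_01)
  thus "P n \<in> BM" by (rule bsm_measurable)
 qed
 have P2: "\<bar>P n z\<bar> \<le> BL + 2 * S * M" for n z
 proof -
  have "\<bar>et n z * lap ph z\<bar> \<le> 1 * BL" unfolding abs_mult by (intro mult_mono et1 BL) auto
  thus ?thesis unfolding P_def using sib[of n z] by linarith
 qed
 have L2: "(\<lambda>n. LBINT z. u' z * P n z) \<longlonglongrightarrow> (LBINT z. u' z * lap ph z)"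
  by (rule lim[OF u bP bsm_measurable[OF bsm_lap[OF b]] P2]) (simp_all add: P_def)
 have eq: "(\<Sum>i\<in>Basis. LBINT z. G i z * (et n z * pd i ph z)) = - (LBINT z. u' z * P n z)" for n
 proof -
  have pdm: "pd i (?q n i) z = et n z * pd i (pd i ph) z + si n z * (snd i * pd i ph z)" if i: "i \<in> Basis" for i z
  proof -
   have "((?q n i) has_derivative (\<lambda>h. et n z * (grad (pd i ph) z \<bullet> h) + (grad (et n) z \<bullet> h) * pd i ph z)) (at z)"
    by (rule has_derivative_mult[OF bsm_grad[OF bet] bsm_grad[OF bsm_pd[OF b i]]])
   from pd_eq[OF this, of i] show ?thesis by (simp add: grad_inner_Basis[OF i] pdet)
  qed
  have ii: "L1 (\<lambda>z. u' z * pd i (?q n i) z)" if i: "i \<in> Basis" for i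
  proof -
   have bb: "bsm (pd i (?q n i))" by (intro bsm_pd bsm_mult bet b i)
   obtain C where C: "\<And>z. \<bar>pd i (?q n i) z\<bar> \<le> C" using bd[OF bb] by blast
   show ?thesis by (rule integrable_mult_bounded[OF u(1) _ C]) (use bsm_measurable[OF bb] in simp)
  qed
  have "(\<Sum>i\<in>Basis. LBINT z. G i z * (et n z * pd i ph z)) = (\<Sum>i\<in>Basis. - (LBINT z. u' z * pd i (?q n i) z))"
   by (intro sum.cong refl) (simp add: weak[OF _ tst])
  also have "\<dots> = - (LBINT z. (\<Sum>i\<in>Basis. u' z * pd i (?q n i) z))" using ii by (simp add: sum_negf)
  also have "\<dots> = - (LBINT z. u' z * P n z)"
  proof (intro arg_cong[where f = uminus] Bochner_Integration.integral_cong refl)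
   fix z
   have "(\<Sum>i\<in>Basis. snd i * pd i ph z) = grad ph z \<bullet> ?e" unfolding grad_inner by (simp add: inner_prod_def)
   also have "\<dots> = pd ?e ph z" by (rule grad_inner_Basis[OF Basis_01])
   finally have q: "(\<Sum>i\<in>Basis. snd i * pd i ph z) = pd ?e ph z" .
   have "(\<Sum>i\<in>Basis. u' z * pd i (?q n i) z) = u' z * (\<Sum>i\<in>Basis. et n z * pd i (pd i ph) z + si n z * (snd i * pd i ph z))"
    unfolding sum_distrib_left by (intro sum.cong refl) (simp add: pdm)
   also have "(\<Sum>i\<in>Basis. et n z * pd i (pd i ph) z + si n z * (snd i * pd i ph z)) = P n z"
    unfolding P_def sum.distrib sum_distrib_left[symmetric] q by (simp add: lap_def)
   finally show "(\<Sum>i\<in>Basis. u' z * pd i (?q n i) z) = u' z * P n z" .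
  qed
  finally show ?thesis .
 qed
 have "(\<lambda>n. - (LBINT z. u' z * P n z)) \<longlonglongrightarrow> (\<Sum>i\<in>Basis. LBINT z. G i z * pd i ph z)"
  unfolding eq[symmetric] by (intro tendsto_sum L1)
 moreover have "(\<lambda>n. - (LBINT z. u' z * P n z)) \<longlonglongrightarrow> - (LBINT z. u' z * lap ph z)" by (rule tendsto_minus[OF L2])
 ultimately show ?thesis by (rule LIMSEQ_unique)
qed

section \<open>The trace on the flat boundary\<close>

lemma L2_mult_integrable:
 fixes a qs :: "'a \<Rightarrow> real"
 assumes "a \<in> L2 M" "qs \<in> L2 M" shows "integrable M (\<lambda>z. a z * qs z)"
proof -
 have m: "a \<in> borel_measurable M" "qs \<in> borel_measurable M" and i: "integrable M (\<lambda>z. (a z)^2)" "integrable M (\<lambda>z. (qs z)^2)"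
  using assms by (auto simp: L2_def)
 have i2: "integrable M (\<lambda>z. (a z)^2 + (qs z)^2)" using i by simp
 show ?thesis
 proof (rule Bochner_Integration.integrable_bound[OF i2])
  have "\<bar>a z * qs z\<bar> \<le> (a z)^2 + (qs z)^2" for z
   using sum_squares_bound[of "\<bar>a z\<bar>" "\<bar>qs z\<bar>"] mult_nonneg_nonneg[of "\<bar>a z\<bar>" "\<bar>qs z\<bar>", OF abs_ge_zero abs_ge_zero]
   unfolding power2_abs abs_mult mult.assoc by linarith
  thus "AE z in M. norm (a z * qs z) \<le> norm ((a z)^2 + (qs z)^2)" by (intro AE_I2) simp
 qed (use m in simp)
qed

text \<open>Strong L2 convergence implies weak convergence, here by the weighted
  arithmetic-geometric mean inequality; its weight (N + 1) / r keeps the share of the fixed function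
  below r / 2.\<close>

lemma L2_weak_limit:
 fixes a :: "nat \<Rightarrow> 'a \<Rightarrow> real"
 assumes a: "\<And>k. a k \<in> L2 M" and qs: "qs \<in> L2 M" and lim: "(\<lambda>k. LINT z|M. (a k z)^2) \<longlonglongrightarrow> 0"
 shows "(\<lambda>k. LINT z|M. a k z * qs z) \<longlonglongrightarrow> 0"
proof (rule LIMSEQ_I)
 fix r :: real assume r: "0 < r"
 define N where "N = (LINT z|M. (qs z)^2)"
 have N: "N \<ge> 0" unfolding N_def by (rule Bochner_Integration.integral_nonneg) simp
 have ia: "integrable M (\<lambda>z. (a k z)^2)" for k using a[of k] by (simp add: L2_def)
 have iqs: "integrable M (\<lambda>z. (qs z)^2)" using qs by (simp add: L2_def)
 define s where "s = (N + 1) / r"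
 have s: "s > 0" using N r by (simp add: s_def add_nonneg_pos)
 have bound: "\<bar>LINT z|M. a k z * qs z\<bar> \<le> s / 2 * (LINT z|M. (a k z)^2) + r / 2" for k
 proof -
  have am: "\<bar>x * y\<bar> \<le> s / 2 * x^2 + y^2 / (2 * s)" for x y :: real
  proof -
   have "0 \<le> (s * \<bar>x\<bar> - \<bar>y\<bar>)^2" by simp
   hence "2 * s * (\<bar>x\<bar> * \<bar>y\<bar>) \<le> s^2 * x^2 + y^2" by (simp add: power2_diff power_mult_distrib)
   thus ?thesis using s by (simp add: field_simps power2_eq_square abs_mult)
  qed
  have "\<bar>LINT z|M. a k z * qs z\<bar> \<le> (LINT z|M. \<bar>a k z * qs z\<bar>)" by (rule integral_abs_bound)
  also have "\<dots> \<le> (LINT z|M. s / 2 * (a k z)^2 + (qs z)^2 / (2 * s))"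
  proof (rule integral_mono)
   show "integrable M (\<lambda>z. \<bar>a k z * qs z\<bar>)" by (rule integrable_abs[OF L2_mult_integrable[OF a qs]])
   show "integrable M (\<lambda>z. s / 2 * (a k z)^2 + (qs z)^2 / (2 * s))" using ia iqs by simp
  qed (rule am)
  also have "\<dots> = s / 2 * (LINT z|M. (a k z)^2) + N / (2 * s)" unfolding N_def using ia iqs by simp
  also have "N / (2 * s) \<le> r / 2" unfolding s_def using N r by (simp add: field_simps)
  finally show ?thesis by simp
 qed
 have "(\<lambda>k. s / 2 * (LINT z|M. (a k z)^2)) \<longlonglongrightarrow> s / 2 * 0" by (intro tendsto_intros lim)
 hence "\<forall>\<^sub>F k in sequentially. s / 2 * (LINT z|M. (a k z)^2) < r / 2" by (rule order_tendstoD(2)) (use r in simp)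
 then obtain k0 where "\<And>k. k \<ge> k0 \<Longrightarrow> s / 2 * (LINT z|M. (a k z)^2) < r / 2" unfolding eventually_sequentially by blast
 thus "\<exists>no. \<forall>k\<ge>no. norm ((LINT z|M. a k z * qs z) - 0) < r"
  by (intro exI[of _ k0] allI impI) (use bound in \<open>fastforce intro: le_less_trans\<close>)
qed

lemma smooth_C1:
 fixes f :: "'a::euclidean_space \<Rightarrow> real"
 assumes "smooth f"
 shows "(f has_derivative (\<lambda>h. grad f z \<bullet> h)) (at z)" "continuous_on UNIV (grad f)"
proof -
 have s: "C_on (Suc 0) UNIV f" using assms unfolding smooth_def by blast
 have d: "(f has_derivative frechet_derivative f (at z)) (at z)" for z using s by (auto simp: differentiable_on_def frechet_derivative_works)
 have c: "continuous_on UNIV (pd i f)" if "i \<in> Basis" for i using s that by (simp add: pd_def)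
 show "continuous_on UNIV (grad f)" unfolding grad_def[abs_def] by (intro continuous_intros c)
 have "frechet_derivative f (at z) = (\<lambda>h. grad f z \<bullet> h)"
 proof
  fix h
  interpret linear "frechet_derivative f (at z)" using d has_derivative_linear by blast
  have "frechet_derivative f (at z) h = frechet_derivative f (at z) (\<Sum>i\<in>Basis. (h \<bullet> i) *\<^sub>R i)" by (simp add: euclidean_representation)
  also have "\<dots> = grad f z \<bullet> h" unfolding grad_inner sum scale by (simp add: pd_def)
  finally show "frechet_derivative f (at z) h = grad f z \<bullet> h" .
 qed
 thus "(f has_derivative (\<lambda>h. grad f z \<bullet> h)) (at z)" using d[of z] by simp
qed

text \<open>For the smooth functions in the definition of the trace the identity is the divergence
  theorem on the upper half space. The boundary term passes to the limit by L2 convergence on the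
  flat part, the other terms by convergence in H1.\<close>

lemma flat_trace_identity:
 fixes U :: "(real^'n) \<times> real \<Rightarrow> real"
 assumes U: "U \<in> H1 (half_ball R)" and T: "has_flat_trace R U T" and qs: "tst (ball 0 R) qs"
 shows "(LINT x|lebesgue_on (ball 0 R). T x * qs (x, 0))
   = - (LINT z|lebesgue_on (half_ball R). (weak_gradient (half_ball R) U z \<bullet> (0, 1)) * qs z + U z * pd (0, 1) qs z)"
proof -
 let ?H = "half_ball R :: ((real^'n) \<times> real) set" and ?B = "ball 0 R :: (real^'n) set"
 let ?MH = "lebesgue_on ?H" and ?MB = "lebesgue_on ?B" and ?e = "(0 :: real^'n, 1::real)"
 note hb = half_ball_facts[of R, where 'n = 'n]
 obtain ph where ph: "\<And>k. smooth (ph k)" "(\<lambda>k. H1_norm ?H (\<lambda>z. ph k z - U z)) \<longlonglongrightarrow> 0"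
   "(\<lambda>k. LINT y|?MB. (ph k (y, 0) - T y)^2) \<longlonglongrightarrow> 0" and T2: "T \<in> L2 ?MB"
  using T unfolding has_flat_trace_def has_trace_def by blast
 have b: "bsm qs" using qs by (simp add: tst_def)
 obtain K where K: "compact K" "K \<subseteq> ball 0 R" "\<And>z. z \<notin> K \<Longrightarrow> qs z = 0" using qs unfolding tst_def by blast
 note S = smooth_C1[OF ph(1)]
 let ?g = "\<lambda>k z. grad (ph k) z \<bullet> ?e" and ?G = "\<lambda>z. weak_gradient ?H U z \<bullet> ?e"
 have cph: "continuous_on UNIV (ph k)" for k using S(1) by (meson continuous_at_imp_continuous_on has_derivative_continuous)
 have cqs: "continuous_on UNIV qs" "continuous_on UNIV (pd ?e qs)" by (intro bsm_continuous b bsm_pd Basis_01)+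
 define w where "w k z = ph k z - U z" for k z
 define W where "W k = weak_gradient ?H (\<lambda>z. ph k z - U z)" for k
 note C1 = C1_H1[OF hb(1,2) S]
 note D = H1_diff_weak_gradient[OF hb(1,2) C1(1) U]
 have w2: "w k \<in> L2 ?MH" for k unfolding w_def by (rule D(2))
 have W2: "W k \<in> L2 ?MH" for k unfolding W_def by (rule D(1))
 have We2: "(\<lambda>z. W k z \<bullet> ?e) \<in> L2 ?MH" for k by (rule L2_component[OF W2 Basis_01])
 have WAE: "AE z in ?MH. W k z \<bullet> ?e = ?g k z - ?G z" for k
 proof -
  have "AE z in lborel. z \<in> ?H \<longrightarrow> W k z \<bullet> ?e = ?g k z - ?G z" using D(3)[of k] C1(2)[of k] by eventually_elim (simp add: W_def inner_diff_left)
  thus ?thesis by (simp add: AE_lebesgue_on_iff[OF hb(3)])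
 qed
 have nn: "0 \<le> (LINT z|?MH. (w k z)^2)" "0 \<le> (LINT z|?MH. (norm (W k z))^2)" for k by (rule Bochner_Integration.integral_nonneg, simp)+
 have "(\<lambda>k. (H1_norm ?H (\<lambda>z. ph k z - U z))^2) \<longlonglongrightarrow> 0^2" by (intro tendsto_intros ph(2))
 hence lim: "(\<lambda>k. (LINT z|?MH. (w k z)^2) + (LINT z|?MH. (norm (W k z))^2)) \<longlonglongrightarrow> 0" using nn unfolding H1_norm_def w_def W_def by simp
 have lw: "(\<lambda>k. LINT z|?MH. (w k z)^2) \<longlonglongrightarrow> 0" by (rule tendsto_sandwich[OF _ _ tendsto_const lim]) (use nn in auto)
 have lW: "(\<lambda>k. LINT z|?MH. (W k z \<bullet> ?e)^2) \<longlonglongrightarrow> 0"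
 proof (rule tendsto_sandwich[OF _ _ tendsto_const lim])
  show "\<forall>\<^sub>F k in sequentially. 0 \<le> (LINT z|?MH. (W k z \<bullet> ?e)^2)" by (intro always_eventually allI Bochner_Integration.integral_nonneg) simp
  have "(LINT z|?MH. (W k z \<bullet> ?e)^2) \<le> (LINT z|?MH. (norm (W k z))^2)" for k
  proof (rule integral_mono)
   show "integrable ?MH (\<lambda>z. (W k z \<bullet> ?e)^2)" using We2[of k] by (simp add: L2_def)
   show "integrable ?MH (\<lambda>z. (norm (W k z))^2)" using W2[of k] by (simp add: L2_def)
   show "(W k z \<bullet> ?e)^2 \<le> (norm (W k z))^2" for z using Basis_le_norm[OF Basis_01, of "W k z"] by (simp add: abs_le_square_iff[symmetric])
  qed
  thus "\<forall>\<^sub>F k in sequentially. (LINT z|?MH. (W k z \<bullet> ?e)^2) \<le> (LINT z|?MH. (w k z)^2) + (LINT z|?MH. (norm (W k z))^2)"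
   by (intro always_eventually allI add_increasing[OF nn(1)])
 qed
 have qs2: "qs \<in> L2 ?MH" "pd ?e qs \<in> L2 ?MH" by (rule L2_continuous[OF hb(3,2)], rule cqs)+
 have sB: "?B \<in> sets borel" by simp
 have c0: "continuous_on UNIV (\<lambda>x. f (x, 0))" if "continuous_on UNIV f" for f :: "(real^'n) \<times> real \<Rightarrow> real"
  by (rule continuous_on_compose2[OF that]) (auto intro!: continuous_intros)
 have qs0: "(\<lambda>x. qs (x, 0)) \<in> L2 ?MB" by (rule L2_continuous[OF sB subset_refl c0[OF cqs(1)]])
 have ph0: "(\<lambda>x. ph k (x, 0)) \<in> L2 ?MB" for k by (rule L2_continuous[OF sB subset_refl c0[OF cph]])
 have ph2: "ph k \<in> L2 ?MH" "(\<lambda>z. ?g k z) \<in> L2 ?MH" for k by (rule L2_continuous[OF hb(3,2)], intro continuous_intros cph S)+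
 note U2 = H1_weak_gradient[OF U]
 note Ue = L2_component[OF U2(2) Basis_01]
 have l1: "(\<lambda>k. LINT x|?MB. (ph k (x, 0) - T x) * qs (x, 0)) \<longlonglongrightarrow> 0" by (rule L2_weak_limit[OF L2_diff[OF ph0 T2] qs0 ph(3)])
 have l2: "(\<lambda>k. LINT z|?MH. (W k z \<bullet> ?e) * qs z) \<longlonglongrightarrow> 0" by (rule L2_weak_limit[OF We2 qs2(1) lW])
 have l3: "(\<lambda>k. LINT z|?MH. w k z * pd ?e qs z) \<longlonglongrightarrow> 0" by (rule L2_weak_limit[OF w2 qs2(2) lw])
 have smooth_id: "(LINT x|?MB. ph k (x, 0) * qs (x, 0)) + (LINT z|?MH. ?g k z * qs z) + (LINT z|?MH. ph k z * pd ?e qs z) = 0" for k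
 proof -
  let ?F = "\<lambda>z. ph k z * qs z"
  have FD: "(?F has_derivative (\<lambda>h. ph k z * (grad qs z \<bullet> h) + (grad (ph k) z \<bullet> h) * qs z)) (at z)" for z
   by (rule has_derivative_mult[OF S(1) bsm_grad[OF b]])
  have out: "qs z = 0" "grad qs z \<bullet> ?e = 0" if "norm z \<ge> R" for z
  proof -
   have "z \<notin> K" using K(2) that by (metis mem_ball_0 not_less subsetD)
   thus "qs z = 0" "grad qs z \<bullet> ?e = 0" using K(3) tst_pd_zero[OF b K(1,3), of z ?e] by (simp_all add: grad_inner_Basis[OF Basis_01])
  qed
  have c1: "continuous_on UNIV (\<lambda>z. ph k z * (grad qs z \<bullet> ?e))" "continuous_on UNIV (\<lambda>z. ?g k z * qs z)"
   by (intro continuous_intros cph S cqs C2D(6)[OF bsm_C2[OF b]])+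
  have 1: "(LBINT z. indicator upper z * (ph k z * (grad qs z \<bullet> ?e) + ?g k z * qs z)) = - (LBINT x. ph k (x, 0) * qs (x, 0))"
   by (rule half_space_divergence[OF FD, of R]) (use out c1 in \<open>auto intro!: continuous_on_add\<close>)
  have mb: "(\<lambda>z. f z) \<in> BM" if "continuous_on UNIV f" for f :: "(real^'n) \<times> real \<Rightarrow> real"
   using that by (rule borel_measurable_continuous_onI)
  have i: "integrable ?MH (\<lambda>z. ph k z * (grad qs z \<bullet> ?e))" "integrable ?MH (\<lambda>z. ?g k z * qs z)"
   using L2_mult_integrable[OF ph2(1) qs2(2)] L2_mult_integrable[OF ph2(2) qs2(1)] by (simp_all add: grad_inner_Basis[OF Basis_01])
  have "(LINT z|?MH. ph k z * (grad qs z \<bullet> ?e) + ?g k z * qs z)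
    = (LBINT z. indicator ?H z * (ph k z * (grad qs z \<bullet> ?e) + ?g k z * qs z))"
   by (rule brep_integral(1)[OF hb(3) brep_borel[OF hb(3) mb]]) (intro continuous_on_add c1)
  also have "\<dots> = (LBINT z. indicator upper z * (ph k z * (grad qs z \<bullet> ?e) + ?g k z * qs z))"
  proof (intro Bochner_Integration.integral_cong refl)
   fix z :: "(real^'n) \<times> real"
   show "indicator ?H z * (ph k z * (grad qs z \<bullet> ?e) + ?g k z * qs z) = indicator upper z * (ph k z * (grad qs z \<bullet> ?e) + ?g k z * qs z)"
    using out[of z] by (cases "norm z < R") (simp_all add: half_ball_def indicator_def)
  qed
  finally have 2: "(LINT z|?MH. ph k z * (grad qs z \<bullet> ?e)) + (LINT z|?MH. ?g k z * qs z) = - (LBINT x. ph k (x, 0) * qs (x, 0))" using i 1 by simp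
  have "(LINT x|?MB. ph k (x, 0) * qs (x, 0)) = (LBINT x. indicator ?B x * (ph k (x, 0) * qs (x, 0)))"
  proof (rule brep_integral(1)[OF sB brep_borel[OF sB]])
   show "(\<lambda>x. ph k (x, 0) * qs (x, 0)) \<in> BM" by (rule borel_measurable_continuous_onI) (intro continuous_on_mult c0 cph cqs)
  qed
  also have "\<dots> = (LBINT x. ph k (x, 0) * qs (x, 0))"
   by (intro Bochner_Integration.integral_cong refl) (use out(1) in \<open>auto simp: indicator_def norm_Pair\<close>)
  finally show ?thesis using 2 by (simp add: grad_inner_Basis[OF Basis_01])
 qed
 define c where "c = (LINT x|?MB. T x * qs (x, 0)) + (LINT z|?MH. ?G z * qs z) + (LINT z|?MH. U z * pd ?e qs z)"
 have e1: "(LINT x|?MB. (ph k (x, 0) - T x) * qs (x, 0)) = (LINT x|?MB. ph k (x, 0) * qs (x, 0)) - (LINT x|?MB. T x * qs (x, 0))" for k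
  unfolding left_diff_distrib by (rule Bochner_Integration.integral_diff[OF L2_mult_integrable[OF ph0 qs0] L2_mult_integrable[OF T2 qs0]])
 have e2: "(LINT z|?MH. (W k z \<bullet> ?e) * qs z) = (LINT z|?MH. ?g k z * qs z) - (LINT z|?MH. ?G z * qs z)" for k
 proof -
  note ii = L2_mult_integrable[OF ph2(2) qs2(1), of k] L2_mult_integrable[OF Ue qs2(1)] L2_mult_integrable[OF We2 qs2(1), of k]
  have "(LINT z|?MH. (W k z \<bullet> ?e) * qs z) = (LINT z|?MH. ?g k z * qs z - ?G z * qs z)"
  proof (rule integral_cong_AE)
   show "AE z in ?MH. (W k z \<bullet> ?e) * qs z = ?g k z * qs z - ?G z * qs z" using WAE[of k] by eventually_elim (simp add: left_diff_distrib)
  qed (use ii in \<open>auto intro!: borel_measurable_diff\<close>)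
  also have "\<dots> = (LINT z|?MH. ?g k z * qs z) - (LINT z|?MH. ?G z * qs z)" by (rule Bochner_Integration.integral_diff[OF ii(1,2)])
  finally show ?thesis .
 qed
 have e3: "(LINT z|?MH. w k z * pd ?e qs z) = (LINT z|?MH. ph k z * pd ?e qs z) - (LINT z|?MH. U z * pd ?e qs z)" for k
  unfolding w_def left_diff_distrib by (rule Bochner_Integration.integral_diff[OF L2_mult_integrable[OF ph2(1) qs2(2)] L2_mult_integrable[OF U2(1) qs2(2)]])
 have "(\<lambda>k. (LINT x|?MB. (ph k (x, 0) - T x) * qs (x, 0)) + (LINT z|?MH. (W k z \<bullet> ?e) * qs z) + (LINT z|?MH. w k z * pd ?e qs z)) \<longlonglongrightarrow> 0 + 0 + 0"
  by (intro tendsto_add l1 l2 l3)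
 moreover have "(LINT x|?MB. (ph k (x, 0) - T x) * qs (x, 0)) + (LINT z|?MH. (W k z \<bullet> ?e) * qs z) + (LINT z|?MH. w k z * pd ?e qs z) = - c" for k
  unfolding e1 e2 e3 c_def using smooth_id[of k] by linarith
 ultimately have "(\<lambda>k::nat. - c) \<longlonglongrightarrow> 0" by simp
 hence "c = 0" by (simp add: LIMSEQ_const_iff)
 thus ?thesis unfolding c_def by (subst Bochner_Integration.integral_add[OF L2_mult_integrable[OF Ue qs2(1)] L2_mult_integrable[OF U2(1) qs2(2)]]) linarith
qed

text \<open>The smooth functions that define the trace, restricted to t = 0, are the continuous
  approximations.\<close>

lemma flat_trace_approx:
 fixes U :: "(real^'n) \<times> real \<Rightarrow> real"
 assumes T: "has_flat_trace R U T" and T': "brep (ball 0 R) T T'" and e: "e > 0"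
 shows "\<exists>q. continuous_on UNIV q \<and> (NBINT x. ennreal (indicator (ball 0 R) x * (T' x - q x)^2)) \<le> ennreal e"
proof -
 let ?B = "ball 0 R :: (real^'n) set"
 have sB: "?B \<in> sets borel" by simp
 obtain ph :: "nat \<Rightarrow> (real^'n) \<times> real \<Rightarrow> real" where ph: "\<And>k. smooth (ph k)" "(\<lambda>k. LINT y|lebesgue_on ?B. (ph k (y, 0) - T y)^2) \<longlonglongrightarrow> 0" and T2: "T \<in> L2 (lebesgue_on ?B)"
  using T unfolding has_flat_trace_def has_trace_def by blast
 have "\<forall>\<^sub>F k in sequentially. (LINT y|lebesgue_on ?B. (ph k (y, 0) - T y)^2) < e" by (rule order_tendstoD(2)[OF ph(2) e])
 then obtain k where k: "(LINT y|lebesgue_on ?B. (ph k (y, 0) - T y)^2) < e" unfolding eventually_sequentially by blast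
 define q where "q x = ph k (x, 0)" for x
 have "continuous_on UNIV (ph k)" using smooth_C1(1)[OF ph(1)] by (meson continuous_at_imp_continuous_on has_derivative_continuous)
 hence q: "continuous_on UNIV q" unfolding q_def by (rule continuous_on_compose2) (auto intro!: continuous_intros)
 have qm: "q \<in> BM" using q by (rule borel_measurable_continuous_onI)
 let ?g = "\<lambda>x. (indicator ?B x * q x - T' x)^2"
 have br: "brep ?B (\<lambda>x. (q x - T x)^2) ?g" by (intro brep_square brep_diff brep_borel sB qm T')
 have "(\<lambda>x. q x - T x) \<in> L2 (lebesgue_on ?B)" by (rule L2_diff[OF L2_continuous[OF sB subset_refl q] T2])
 hence "integrable (lebesgue_on ?B) (\<lambda>x. (q x - T x)^2)" by (simp add: L2_def)
 hence i: "L1 ?g" using brep_integral(2)[OF sB br] by simp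
 have "(NBINT x. ennreal (indicator ?B x * (T' x - q x)^2)) = (NBINT x. ennreal (?g x))"
  using T' by (intro nn_integral_cong) (auto simp: brep_def indicator_def power2_commute)
 also have "\<dots> = ennreal (LBINT x. ?g x)" by (rule nn_integral_eq_integral[OF i]) simp
 also have "(LBINT x. ?g x) = (LINT y|lebesgue_on ?B. (ph k (y, 0) - T y)^2)" using brep_integral(1)[OF sB br] by (simp add: q_def)
 also have "ennreal \<dots> \<le> ennreal e" using k by (intro ennreal_leI) simp
 finally show ?thesis using q by blast
qed

section \<open>From the half ball to the reflected problem\<close>

lemma AE_rfl:
 fixes P :: "'b::euclidean_space \<times> real \<Rightarrow> bool"
 assumes "AE z in lborel. P z" shows "AE z in lborel. P (rfl z)"
proof -
 have "AE z in distr lborel borel rfl. P z" using assms unfolding lborel_distr_rfl .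
 from AE_distrD[OF _ this] show ?thesis by simp
qed

lemma compose_rfl:
 fixes ph :: "'b::euclidean_space \<times> real \<Rightarrow> real"
 assumes b: "bsm ph"
 shows "bsm (\<lambda>w. ph (rfl w))" "lap (\<lambda>w. ph (rfl w)) = (\<lambda>w. lap ph (rfl w))"
proof -
 have e: "(\<lambda>w. ph (rfl w)) = (\<lambda>w. (\<lambda>x. ph (0 - x)) (0 - rfl w))" by simp
 show "bsm (\<lambda>w. ph (rfl w))" unfolding e by (rule bsm_rfl[OF bsm_neg[OF b]])
 show "lap (\<lambda>w. ph (rfl w)) = (\<lambda>w. lap ph (rfl w))" unfolding e lap_rfl[OF bsm_neg[OF b]] lap_neg[OF b] by simp
qed

lemma tst_pd: "tst Om ph \<Longrightarrow> i \<in> Basis \<Longrightarrow> tst Om (pd i ph)"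
 unfolding tst_def by (meson bsm_pd tst_pd_zero)

lemma tst_zero: "tst Om ph \<Longrightarrow> z \<notin> Om \<Longrightarrow> ph z = 0"
 unfolding tst_def by blast

lemma tst_bsm: "tst Om ph \<Longrightarrow> bsm ph"
 by (simp add: tst_def)

lemma tst_lap_zero: "tst Om ph \<Longrightarrow> z \<notin> Om \<Longrightarrow> lap ph z = 0"
 unfolding lap_def by (intro sum.neutral ballI tst_zero[of Om] tst_pd)

lemma tst_even:
 assumes "tst (ball 0 R) ph" shows "tst (ball 0 R) (\<lambda>z. ph z + ph (rfl z))"
proof -
 obtain K where K: "bsm ph" "compact K" "K \<subseteq> ball 0 R" "\<And>z. z \<notin> K \<Longrightarrow> ph z = 0" using assms unfolding tst_def by blast
 show ?thesis unfolding tst_def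
 proof (intro conjI exI)
  show "bsm (\<lambda>z. ph z + ph (rfl z))" by (intro bsm_add K(1) compose_rfl)
  show "compact (K \<union> rfl ` K)" by (intro compact_Un K(2) compact_continuous_image linear_continuous_on linear_conv_bounded_linear[THEN iffD1] linear_rfl)
  have "rfl z \<in> ball 0 R" if "z \<in> K" for z using subsetD[OF K(3) that] by simp
  thus "K \<union> rfl ` K \<subseteq> ball 0 R" using K(3) by blast
  show "\<forall>z. z \<notin> K \<union> rfl ` K \<longrightarrow> ph z + ph (rfl z) = 0"
  proof (intro allI impI)
   fix z assume z: "z \<notin> K \<union> rfl ` K"
   hence "rfl z \<notin> K" by (metis UnI2 image_eqI rfl_simps(2))
   thus "ph z + ph (rfl z) = 0" using z K(4) by simp
  qed
 qed
qed

text \<open>The weak formulation for Borel representatives extended by 0, with \<open>GU i\<close>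
  and \<open>GV i\<close> the components of the weak gradients. The equations are tested in the full
  ball, across t = 0, while \<open>weakU\<close> and \<open>weakV\<close> are tested inside
  H.\<close>

locale half_ball_solution =
 fixes R :: real and h T :: "'b::euclidean_space \<Rightarrow> real" and U V :: "'b \<times> real \<Rightarrow> real"
  and GU GV :: "'b \<times> real \<Rightarrow> 'b \<times> real \<Rightarrow> real" and H :: "('b \<times> real) set"
 assumes H: "H = {z. norm z < R \<and> snd z > 0}" and R: "R > 0" and h: "continuous_on (ball 0 R) h"
  and T: "T \<in> BM" "\<And>x. norm x \<ge> R \<Longrightarrow> T x = 0" "L1 (\<lambda>x. (T x)^2)"
  and U: "U \<in> BM" "\<And>z. z \<notin> H \<Longrightarrow> U z = 0" "L1 (\<lambda>z. (U z)^2)"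
  and V: "V \<in> BM" "\<And>z. z \<notin> H \<Longrightarrow> V z = 0" "L1 (\<lambda>z. (V z)^2)"
  and GU: "\<And>i. i \<in> Basis \<Longrightarrow> GU i \<in> BM" "\<And>i z. i \<in> Basis \<Longrightarrow> z \<notin> H \<Longrightarrow> GU i z = 0"
   "\<And>i. i \<in> Basis \<Longrightarrow> L1 (\<lambda>z. (GU i z)^2)"
  and GV: "\<And>i. i \<in> Basis \<Longrightarrow> GV i \<in> BM" "\<And>i z. i \<in> Basis \<Longrightarrow> z \<notin> H \<Longrightarrow> GV i z = 0"
   "\<And>i. i \<in> Basis \<Longrightarrow> L1 (\<lambda>z. (GV i z)^2)"
  and weakU: "\<And>i ph. i \<in> Basis \<Longrightarrow> tst H ph \<Longrightarrow> (LBINT z. U z * pd i ph z) = - (LBINT z. GU i z * ph z)"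
  and weakV: "\<And>i ph. i \<in> Basis \<Longrightarrow> tst H ph \<Longrightarrow> (LBINT z. V z * pd i ph z) = - (LBINT z. GV i z * ph z)"
  and eqU: "\<And>ph. tst (ball 0 R) ph \<Longrightarrow> (\<Sum>i\<in>Basis. LBINT z. GU i z * pd i ph z) = - (LBINT z. V z * ph z)"
  and eqV: "\<And>ph. tst (ball 0 R) ph \<Longrightarrow> (\<Sum>i\<in>Basis. LBINT z. GV i z * pd i ph z) = (LBINT x. h x * T x * ph (x, 0))"
  and tr: "\<And>qs. tst (ball 0 R) qs \<Longrightarrow> (LBINT x. T x * qs (x, 0)) = - (LBINT z. GU (0, 1) z * qs z + U z * pd (0, 1) qs z)"
  and approx: "\<And>e. e > 0 \<Longrightarrow> \<exists>q. continuous_on UNIV q \<and> (NBINT x. ennreal (indicator (ball 0 R) x * (T x - q x)^2)) \<le> ennreal e"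
  and vanish: "\<And>n::nat. \<exists>rh>0. AE z in lborel. norm z < rh \<longrightarrow> \<bar>U z\<bar> \<le> norm z ^ n"
begin

lemma subH: "H \<subseteq> ball 0 R" and openH: "open H" and connH: "connected H"
proof -
 have e: "H = ball 0 R \<inter> {z. (0, 1) \<bullet> z > 0}" unfolding H by (auto simp: inner_prod_def)
 show "open H" unfolding e by (intro open_Int open_ball open_halfspace_gt)
 show "H \<subseteq> ball 0 R" unfolding e by blast
 show "connected H" unfolding e by (intro convex_connected convex_Int convex_ball convex_halfspace_gt)
qed

lemma ints: "L1 U" "L1 V" "i \<in> Basis \<Longrightarrow> L1 (GU i)" "i \<in> Basis \<Longrightarrow> L1 (GV i)"
proof -
 have o: "z \<notin> H" if "norm z \<ge> R" for z using that by (simp add: H)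
 show "L1 U" by (rule integrable_of_square[OF U(1,3) U(2)[OF o]])
 show "L1 V" by (rule integrable_of_square[OF V(1,3) V(2)[OF o]])
 show "i \<in> Basis \<Longrightarrow> L1 (GU i)" by (rule integrable_of_square[OF GU(1,3) GU(2)[OF _ o]])
 show "i \<in> Basis \<Longrightarrow> L1 (GV i)" by (rule integrable_of_square[OF GV(1,3) GV(2)[OF _ o]])
qed

text \<open>By \<open>even_green\<close> the gradient pairing becomes an integral against the
  Laplacian of the test function, without boundary contribution, so the flux of V remains as the
  term with h.\<close>

lemma even_eq:
 assumes ph: "tst (ball 0 R) ph" and e: "\<And>z. ph (rfl z) = ph z"
 shows "(LBINT z. U z * lap ph z) = (LBINT z. V z * ph z)"
  "(LBINT z. V z * lap ph z) = - (LBINT x. h x * T x * ph (x, 0))"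
 using even_green[OF H ints(1) U(2) ints(3) GU(2) weakU ph e] eqU[OF ph]
  even_green[OF H ints(2) V(2) ints(4) GV(2) weakV ph e] eqV[OF ph] by linarith+

lemma tst_integrable_mult: "L1 g \<Longrightarrow> tst Om ph \<Longrightarrow> L1 (\<lambda>z. g z * ph z)"
 "L1 g \<Longrightarrow> tst Om ph \<Longrightarrow> L1 (\<lambda>z. g z * lap ph z)" for g :: "'b \<times> real \<Rightarrow> real"
proof -
 have *: "L1 (\<lambda>z. g z * k z)" if g: "L1 g" and k: "bsm k" for k
 proof -
  obtain M where M: "\<And>z. \<bar>k z\<bar> \<le> M" by (rule bsm_bounded[OF k]) blast
  show ?thesis by (rule integrable_mult_bounded[OF g _ M]) (use bsm_measurable[OF k] in simp)
 qed
 show "L1 g \<Longrightarrow> tst Om ph \<Longrightarrow> L1 (\<lambda>z. g z * ph z)" by (rule *[OF _ tst_bsm])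
 show "L1 g \<Longrightarrow> tst Om ph \<Longrightarrow> L1 (\<lambda>z. g z * lap ph z)" by (rule *[OF _ bsm_lap[OF tst_bsm]])
qed

lemma interior_eq:
 assumes ph: "tst H ph"
 shows "(LBINT z. U z * lap ph z) = (LBINT z. V z * ph z)" "(LBINT z. V z * lap ph z) = 0"
proof -
 have ph': "tst (ball 0 R) ph" by (rule tst_mono[OF ph subH])
 have I: "L1 (\<lambda>z. g z * pd i (pd i ph) z)" if "L1 g" "i \<in> Basis" for g :: "'b \<times> real \<Rightarrow> real" and i
  by (rule tst_integrable_mult(1)[OF that(1) tst_pd[OF tst_pd[OF ph that(2)] that(2)]])
 have "(LBINT z. U z * lap ph z) = (\<Sum>i\<in>Basis. LBINT z. U z * pd i (pd i ph) z)"
  unfolding lap_def sum_distrib_left by (rule Bochner_Integration.integral_sum) (rule I[OF ints(1)])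
 also have "\<dots> = - (\<Sum>i\<in>Basis. LBINT z. GU i z * pd i ph z)" unfolding sum_negf[symmetric] by (intro sum.cong refl weakU tst_pd[OF ph])
 finally show "(LBINT z. U z * lap ph z) = (LBINT z. V z * ph z)" using eqU[OF ph'] by simp
 have "(LBINT z. V z * lap ph z) = (\<Sum>i\<in>Basis. LBINT z. V z * pd i (pd i ph) z)"
  unfolding lap_def sum_distrib_left by (rule Bochner_Integration.integral_sum) (rule I[OF ints(2)])
 also have "\<dots> = - (\<Sum>i\<in>Basis. LBINT z. GV i z * pd i ph z)" unfolding sum_negf[symmetric] by (intro sum.cong refl weakV tst_pd[OF ph])
 also have "\<dots> = 0"
 proof -
  have "ph (x, 0) = 0" for x by (rule tst_zero[OF ph]) (simp add: H)
  thus ?thesis using eqV[OF ph'] by simp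
 qed
 finally show "(LBINT z. V z * lap ph z) = 0" .
qed

text \<open>Strictly smaller than R, so that h is bounded on the closed ball, and at most 1, as
  \<open>core\<close> requires.\<close>

definition R1 where "R1 = min R 1 / 2"

lemma R1: "0 < R1" "R1 \<le> 1" "R1 < R" using R by (auto simp: R1_def min_def)

text \<open>For g vanishing off H at most one of the two summands is nonzero, so this is the even
  reflection of g, cut off to the smaller ball.\<close>

definition ev where "ev g z = indicator (ball 0 R1) z * (g z + g (rfl z))" for g :: "'b \<times> real \<Rightarrow> real"
definition T0 where "T0 x = indicator (ball 0 R1) x * T x"
text \<open>Extending h by 0 from its open ball makes the product a Borel function on the whole
  space.\<close>

definition f where "f x = (indicator (ball 0 R) x * h x) * T0 x"

lemma ev_measurable: "g \<in> BM \<Longrightarrow> ev g \<in> BM"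
 unfolding ev_def[abs_def] by (intro borel_measurable_times borel_measurable_add borel_measurable_indicator measurable_compose[OF rfl_measurable]) auto

lemma ev_square:
 assumes g: "g \<in> BM" "L1 (\<lambda>z. (g z)^2)"
 shows "L1 (\<lambda>z. (ev g z)^2)"
proof -
 have "(\<lambda>z. (g z)^2) \<in> BM" using g(1) by simp
 note r = integral_rfl(2)[OF this g(2)]
 have i: "L1 (\<lambda>z. 2 * (g z)^2 + 2 * (g (rfl z))^2)" using g(2) r by simp
 show ?thesis
 proof (rule Bochner_Integration.integrable_bound[OF i])
  show "(\<lambda>z. (ev g z)^2) \<in> borel_measurable lborel" using ev_measurable[OF g(1)] by simp
  have "(ev g z)^2 \<le> 2 * (g z)^2 + 2 * (g (rfl z))^2" for z
   using zero_le_power2[of "g z - g (rfl z)"] by (cases "z \<in> ball 0 R1") (simp_all add: ev_def power2_eq_square algebra_simps)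
  thus "AE z in lborel. norm ((ev g z)^2) \<le> norm (2 * (g z)^2 + 2 * (g (rfl z))^2)" by (intro AE_I2) simp
 qed
qed

lemma ev_integral:
 fixes k :: "'b \<times> real \<Rightarrow> real"
 assumes g: "L1 g" and k: "bsm k" "\<And>z. norm z \<ge> R1 \<Longrightarrow> k z = 0"
 shows "(LBINT z. ev g z * k z) = (LBINT z. g z * (k z + k (rfl z)))"
proof -
 have gm [measurable]: "g \<in> BM" and km [measurable]: "k \<in> BM" using g bsm_measurable[OF k(1)] by auto
 obtain M where M: "\<And>z. \<bar>k z\<bar> \<le> M" by (rule bsm_bounded[OF k(1)]) blast
 have i1: "L1 (\<lambda>z. g z * k z)" by (rule integrable_mult_bounded[OF g _ M]) simp
 have i2: "L1 (\<lambda>z. g z * k (rfl z))" by (rule integrable_mult_bounded[OF g _ M]) simp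
 have m: "(\<lambda>z. g z * k (rfl z)) \<in> BM" by measurable
 have i3: "L1 (\<lambda>z. g (rfl z) * k z)" using integral_rfl(2)[OF m i2] by simp
 have "(LBINT z. ev g z * k z) = (LBINT z. g z * k z + g (rfl z) * k z)"
  by (intro Bochner_Integration.integral_cong refl) (use k(2) in \<open>auto simp: ev_def indicator_def algebra_simps\<close>)
 also have "\<dots> = (LBINT z. g z * k z) + (LBINT z. g (rfl z) * k z)" by (rule Bochner_Integration.integral_add[OF i1 i3])
 also have "(LBINT z. g (rfl z) * k z) = (LBINT z. g z * k (rfl z))" using integral_rfl(1)[OF m] by simp
 also have "(LBINT z. g z * k z) + (LBINT z. g z * k (rfl z)) = (LBINT z. g z * (k z + k (rfl z)))" using i1 i2 by (simp add: distrib_left)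
 finally show ?thesis .
qed

text \<open>Pairing an even reflection with ph is pairing the original function with ph + ph \<circ>
  rfl, an even test function to which \<open>even_eq\<close> applies. At t = 0 the symmetrisation
  doubles the value of ph, which produces the factor 2 in \<open>eq2\<close>.\<close>

lemma core_holds: "\<exists>Hb. core R1 Hb f T0 (ev U) (ev V) (GU (0, 1))"
proof -
 have "compact (h ` cball 0 R1)" by (rule compact_continuous_image[OF continuous_on_subset[OF h]]) (use R1 in auto)
 from compact_imp_bounded[OF this] obtain B where "\<forall>y\<in>h ` cball 0 R1. norm y \<le> B" unfolding bounded_iff by blast
 hence B: "\<bar>h x\<bar> \<le> B" if "norm x \<le> R1" for x using that by simp
 define Hb where "Hb = max B 0"
 have sub: "ball 0 R1 \<subseteq> ball (0::'b \<times> real) R" using R1 by auto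
 have hm: "(\<lambda>x. indicator (ball 0 R) x * h x) \<in> BM" using borel_measurable_continuous_on_indicator[OF _ h] by simp
 have T0m: "T0 \<in> BM" unfolding T0_def[abs_def] using T(1) by (intro borel_measurable_times borel_measurable_indicator) auto
 have T0sq: "(T0 x)^2 = indicator (ball 0 R1) x *\<^sub>R (T x)^2" for x by (simp add: T0_def indicator_def)
 have "core R1 Hb f T0 (ev U) (ev V) (GU (0, 1))"
 proof unfold_locales
  show "0 < R1" "R1 \<le> 1" by (rule R1)+
  show "0 \<le> Hb" by (simp add: Hb_def)
  show "f \<in> BM" unfolding f_def[abs_def] using hm T0m by (rule borel_measurable_times)
  show "T0 \<in> BM" by (rule T0m)
  show "ev U \<in> BM" "ev V \<in> BM" by (rule ev_measurable[OF U(1)], rule ev_measurable[OF V(1)])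
  show "GU (0, 1) \<in> BM" by (rule GU(1)[OF Basis_01])
  show "ev U z = 0" "ev V z = 0" if "R1 \<le> norm z" for z using that by (simp_all add: ev_def)
  show "T0 x = 0" if "R1 \<le> norm x" for x using that by (simp add: T0_def)
  show "L1 (\<lambda>z. (ev U z)^2)" "L1 (\<lambda>z. (ev V z)^2)" by (rule ev_square[OF U(1,3)], rule ev_square[OF V(1,3)])
  show "L1 (\<lambda>z. (GU (0, 1) z)^2)" by (rule GU(3)[OF Basis_01])
  show "L1 (\<lambda>x. (T0 x)^2)" unfolding T0sq by (rule integrable_mult_indicator[OF _ T(3)]) simp
  show "\<bar>f x\<bar> \<le> Hb * \<bar>T0 x\<bar>" for x
  proof (cases "norm x < R1")
   case True
   have "\<bar>h x\<bar> * \<bar>T0 x\<bar> \<le> Hb * \<bar>T0 x\<bar>" using B[of x] True by (intro mult_right_mono) (auto simp: Hb_def)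
   thus ?thesis using True R1 by (simp add: f_def abs_mult)
  next
   case False
   thus ?thesis by (simp add: f_def T0_def)
  qed
  show "ev U (rfl z) = ev U z" "ev V (rfl z) = ev V z" for z by (simp_all add: ev_def indicator_def)
 next
  fix ph :: "'b \<times> real \<Rightarrow> real" assume t: "tst (ball 0 R1) ph"
  note tR = tst_mono[OF t sub] and b = tst_bsm[OF t]
  have z: "ph z = 0" "lap ph z = 0" if "norm z \<ge> R1" for z using tst_zero[OF t, of z] tst_lap_zero[OF t, of z] that by auto
  let ?s = "\<lambda>z. ph z + ph (rfl z)"
  have ls: "lap ?s = (\<lambda>z. lap ph z + lap ph (rfl z))" using lap_add[OF b compose_rfl(1)[OF b]] by (simp add: compose_rfl(2)[OF b])
  have es: "?s (rfl z) = ?s z" for z by simp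
  note E = even_eq[OF tst_even[OF tR] es]
  have L: "(LBINT z. ev g z * lap ph z) = (LBINT z. g z * lap ?s z)" "(LBINT z. ev g z * ph z) = (LBINT z. g z * ?s z)"
   if "L1 g" for g
   unfolding ls by (rule ev_integral[OF that bsm_lap[OF b] z(2)], assumption, rule ev_integral[OF that b z(1)], assumption)
  show "(LBINT z. ev U z * lap ph z) = (LBINT z. ev V z * ph z)" unfolding L(1)[OF ints(1)] L(2)[OF ints(2)] by (rule E(1))
  have "(LBINT z. ev V z * lap ph z) = - (LBINT x. h x * T x * ?s (x, 0))" unfolding L(1)[OF ints(2)] by (rule E(2))
  also have "(LBINT x. h x * T x * ?s (x, 0)) = (LBINT x. 2 * (f x * ph (x, 0)))"
  proof (intro Bochner_Integration.integral_cong refl)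
   fix x :: 'b
   show "h x * T x * ?s (x, 0) = 2 * (f x * ph (x, 0))" using z(1)[of "(x, 0)"] R1 by (cases "norm x < R1") (auto simp: f_def T0_def norm_Pair)
  qed
  finally show "(LBINT z. ev V z * lap ph z) = - 2 * (LBINT x. f x * ph (x, 0))" by simp
 next
  fix qs :: "'b \<times> real \<Rightarrow> real" assume t: "tst (ball 0 R1) qs"
  note tR = tst_mono[OF t sub]
  have z: "qs z = 0" "pd (0, 1) qs z = 0" if "norm z \<ge> R1" for z using tst_zero[OF t, of z] tst_zero[OF tst_pd[OF t Basis_01], of z] that by auto
  have "(LBINT x. T0 x * qs (x, 0)) = (LBINT x. T x * qs (x, 0))"
  proof (intro Bochner_Integration.integral_cong refl)
   fix x :: 'b
   show "T0 x * qs (x, 0) = T x * qs (x, 0)" using z(1)[of "(x, 0)"] by (cases "norm x < R1") (auto simp: T0_def norm_Pair)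
  qed
  also have "\<dots> = - (LBINT z. GU (0, 1) z * qs z + U z * pd (0, 1) qs z)" by (rule tr[OF tR])
  also have "(LBINT z. GU (0, 1) z * qs z + U z * pd (0, 1) qs z) = (LBINT z. indicator upper z * (GU (0, 1) z * qs z + ev U z * pd (0, 1) qs z))"
  proof (intro Bochner_Integration.integral_cong refl)
   fix z :: "'b \<times> real"
   show "GU (0, 1) z * qs z + U z * pd (0, 1) qs z = indicator upper z * (GU (0, 1) z * qs z + ev U z * pd (0, 1) qs z)"
   proof (cases "snd z > 0")
    case True
    hence "rfl z \<notin> H" by (simp add: H rfl_def)
    hence "ev U z = indicator (ball 0 R1) z * U z" using U(2) by (simp add: ev_def)
    thus ?thesis using True z(2)[of z] by (cases "norm z < R1") auto
   next
    case False
    hence "z \<notin> H" by (simp add: H)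
    thus ?thesis using U(2) GU(2)[OF Basis_01] False by simp
   qed
  qed
  finally show "(LBINT x. T0 x * qs (x, 0)) = - (LBINT z. indicator upper z * (GU (0, 1) z * qs z + ev U z * pd (0, 1) qs z))" .
 next
  fix e :: real assume "e > 0"
  then obtain q where q: "continuous_on UNIV q" "(NBINT x. ennreal (indicator (ball 0 R) x * (T x - q x)^2)) \<le> ennreal e" using approx by blast
  have "(NBINT x. ennreal (indicator (ball 0 R1) x * (T0 x - q x)^2)) \<le> (NBINT x. ennreal (indicator (ball 0 R) x * (T x - q x)^2))"
   by (intro nn_integral_mono ennreal_leI) (use R1 in \<open>auto simp: T0_def indicator_def\<close>)
  thus "\<exists>q. continuous_on UNIV q \<and> (NBINT x. ennreal (indicator (ball 0 R1) x * (T0 x - q x)^2)) \<le> ennreal e" using q by (meson order_trans)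
 next
  fix n :: nat
  obtain rh where rh: "rh > 0" "AE z in lborel. norm z < rh \<longrightarrow> \<bar>U z\<bar> \<le> norm z ^ n" using vanish by blast
  have "AE z in lborel. norm z < rh \<longrightarrow> \<bar>ev U z\<bar> \<le> norm z ^ n" using rh(2) AE_rfl[OF rh(2)]
  proof eventually_elim
   case (elim z)
   have "z \<notin> H \<or> rfl z \<notin> H" by (auto simp: H rfl_def)
   hence "U z = 0 \<or> U (rfl z) = 0" using U(2) by blast
   hence "norm z < rh \<longrightarrow> \<bar>U z + U (rfl z)\<bar> \<le> norm z ^ n" using elim by auto
   moreover have "\<bar>ev U z\<bar> \<le> \<bar>U z + U (rfl z)\<bar>" by (simp add: ev_def indicator_def)
   ultimately show ?case by linarith
  qed
  thus "\<exists>rh>0. AE z in lborel. norm z < rh \<longrightarrow> \<bar>ev U z\<bar> \<le> norm z ^ n" using rh(1) by blast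
 qed
 thus ?thesis by blast
qed

text \<open>\<open>core.u0_zero\<close> makes U vanish near 0, hence on a small ball inside H; there
  the first equation gives V = 0. The weakly harmonic V then vanishes on the connected set H, so
  that U becomes weakly harmonic and vanishes as well.\<close>

theorem solution_zero: "AE z in lborel. z \<in> H \<longrightarrow> U z = 0 \<and> V z = 0"
proof -
 obtain Hb where "core R1 Hb f T0 (ev U) (ev V) (GU (0, 1))" using core_holds by blast
 from core.u0_zero[OF this] obtain r where r: "r > 0" "r \<le> R1" "AE z in lborel. norm z < r \<longrightarrow> ev U z = 0" by blast
 \<comment> \<open>The ball of radius r / 4 about (0, r / 2) stays inside norm r and inside t >
   0.\<close>
 define p where "p = (0 :: 'b, r / 2)"
 have bp: "norm z < r \<and> snd z > 0" if "z \<in> ball p (r / 4)" for z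
 proof -
  have d: "norm (z - p) < r / 4" using that by (simp add: dist_norm norm_minus_commute)
  have "norm z \<le> norm p + norm (z - p)" using norm_triangle_ineq[of p "z - p"] by simp
  moreover have "norm p = r / 2" using r by (simp add: p_def norm_Pair)
  moreover have "\<bar>snd z - r / 2\<bar> \<le> norm (z - p)" using norm_snd_le[of "snd (z - p)" "fst (z - p)"] unfolding prod.collapse by (simp add: p_def)
  ultimately show ?thesis using d r by linarith
 qed
 have subp: "ball p (r / 4) \<subseteq> H" using bp r R1 unfolding H by fastforce
 have pH: "p \<in> H" using subp r by (auto intro: subsetD)
 have U0: "AE z in lborel. z \<in> ball p (r / 4) \<longrightarrow> U z = 0" using r(3)
 proof eventually_elim
  case (elim z)
  show ?case
  proof
   assume z: "z \<in> ball p (r / 4)"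
   have "rfl z \<notin> H" using bp[OF z] by (simp add: H rfl_def)
   thus "U z = 0" using elim bp[OF z] r U(2) by (simp add: ev_def)
  qed
 qed
 have V0: "AE z in lborel. z \<in> ball p (r / 4) \<longrightarrow> V z = 0"
 proof (rule fundamental_lemma[OF ints(2)])
  fix ph assume t: "tst (ball p (r / 4)) ph"
  have "(LBINT z. V z * ph z) = (LBINT z. U z * lap ph z)" by (rule interior_eq(1)[OF tst_mono[OF t subp], symmetric])
  also have "\<dots> = 0"
  proof (rule integral_eq_zero_AE)
   show "AE z in lborel. U z * lap ph z = 0" using U0
   proof eventually_elim
    case (elim z)
    thus ?case using tst_lap_zero[OF t, of z] by (cases "z \<in> ball p (r / 4)") simp_all
   qed
  qed
  finally show "(LBINT z. V z * ph z) = 0" .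
 qed simp
 have r4: "r / 4 > 0" using r by simp
 have VH: "AE z in lborel. z \<in> H \<longrightarrow> V z = 0" by (rule weakly_harmonic_unique_continuation[OF ints(2) openH connH interior_eq(2) pH r4 V0])
 have "(LBINT z. U z * lap ph z) = 0" if t: "tst H ph" for ph unfolding interior_eq(1)[OF t]
 proof (rule integral_eq_zero_AE)
  show "AE z in lborel. V z * ph z = 0" using VH by eventually_elim (use V(2) in auto)
 qed
 hence "AE z in lborel. z \<in> H \<longrightarrow> U z = 0" by (rule weakly_harmonic_unique_continuation[OF ints(1) openH connH _ pH r4 U0])
 with VH show ?thesis by eventually_elim blast
qed

end

section \<open>Unfolding the weak formulation\<close>

lemma L2_basis_rep:
 fixes g :: "'a::euclidean_space \<Rightarrow> 'a"
 assumes S: "S \<in> sets borel" and g: "g \<in> L2 (lebesgue_on S)"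
 shows "\<exists>G. \<forall>i\<in>Basis. brep S (\<lambda>z. g z \<bullet> i) (G i) \<and> L1 (\<lambda>z. (G i z)^2)"
 by (rule bchoice) (use L2_rep[OF S L2_component[OF g]] in blast)

text \<open>The infimum with \<open>ae_filter\<close> expresses the o-condition up to null sets.
  Taken with constant 1 it gives the bound almost everywhere in a punctured neighbourhood within
  \<open>S\<close>; off \<open>S\<close> the representative is 0.\<close>

lemma vanishing_rep:
 assumes o: "U \<in> o[inf (at 0 within S) (ae_filter lebesgue)](\<lambda>z. norm z ^ n)"
  and U': "brep S U U'"
 shows "\<exists>rh>0. AE z in lborel. norm z < rh \<longrightarrow> \<bar>U' z\<bar> \<le> norm z ^ n"
proof -
 have "\<forall>\<^sub>F z in inf (at 0 within S) (ae_filter lebesgue). norm (U z) \<le> 1 * norm (norm z ^ n)" by (rule landau_o.smallD[OF o]) simp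
 then obtain P Q where P: "eventually P (at 0 within S)" and Q: "eventually Q (ae_filter lebesgue)"
  and PQ: "\<And>z. P z \<Longrightarrow> Q z \<Longrightarrow> norm (U z) \<le> 1 * norm (norm z ^ n)" unfolding eventually_inf by blast
 obtain d where d: "d > 0" "\<And>z. z \<in> S \<Longrightarrow> z \<noteq> 0 \<Longrightarrow> dist z 0 < d \<Longrightarrow> P z" using P unfolding eventually_at by blast
 have "AE z in lborel. Q z" using Q by (simp add: AE_completion_iff)
 moreover have "AE z in lborel. z \<in> S \<longrightarrow> U z = U' z" using U' by (simp add: brep_def)
 moreover have "AE z in lborel. z \<noteq> 0" by (rule AE_lborel_singleton)
 ultimately have "AE z in lborel. norm z < d \<longrightarrow> \<bar>U' z\<bar> \<le> norm z ^ n"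
 proof eventually_elim
  case (elim z)
  show ?case
  proof (cases "z \<in> S")
   case True
   thus ?thesis using elim d(2)[of z] PQ[of z] by simp
  next
   case False
   thus ?thesis using U' by (simp add: brep_def)
  qed
 qed
 thus ?thesis using d(1) by blast
qed

text \<open>The chosen weak gradient of a test function agrees with the classical gradient almost
  everywhere, which suffices under the integral; the inner product is then expanded in the
  basis.\<close>

lemma gradient_pairing:
 fixes g k :: "'a::euclidean_space \<Rightarrow> 'a"
 assumes S: "S \<in> sets borel" "S \<subseteq> ball 0 R" and ph: "bsm ph"
  and g: "g \<in> L2 (lebesgue_on S)" and k: "k \<in> L2 (lebesgue_on S)" "AE z in lborel. z \<in> S \<longrightarrow> k z = grad ph z"
  and G: "\<forall>i\<in>Basis. brep S (\<lambda>z. g z \<bullet> i) (G i) \<and> L1 (\<lambda>z. (G i z)^2)"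
 shows "(LINT z|lebesgue_on S. g z \<bullet> k z) = (\<Sum>i\<in>Basis. LBINT z. G i z * pd i ph z)"
proof -
 have "brep S (\<lambda>z. \<Sum>i\<in>Basis. (g z \<bullet> i) * (k z \<bullet> i)) (\<lambda>z. \<Sum>i\<in>Basis. G i z * pd i ph z)"
 proof (rule brep_sum)
  fix i :: 'a assume i: "i \<in> Basis"
  have Gi: "brep S (\<lambda>z. g z \<bullet> i) (G i)" using G i by blast
  have km: "(\<lambda>z. k z \<bullet> i) \<in> borel_measurable (lebesgue_on S)" using L2_component[OF k(1) i] by (simp add: L2_def)
  have "brep S (\<lambda>z. (g z \<bullet> i) * pd i ph z) (\<lambda>z. G i z * pd i ph z)" by (rule brep_mult_borel[OF Gi bsm_measurable[OF bsm_pd[OF ph i]]])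
  moreover have "AE z in lborel. z \<in> S \<longrightarrow> k z \<bullet> i = pd i ph z" using k(2) by eventually_elim (simp add: grad_inner_Basis[OF i])
  ultimately show "brep S (\<lambda>z. (g z \<bullet> i) * (k z \<bullet> i)) (\<lambda>z. G i z * pd i ph z)"
   using Gi km unfolding brep_def by (auto elim: eventually_elim2)
 qed simp
 from brep_integral(1)[OF S(1) this]
 have "(LINT z|lebesgue_on S. g z \<bullet> k z) = (LBINT z. (\<Sum>i\<in>Basis. G i z * pd i ph z))" by (simp add: euclidean_inner[symmetric])
 also have "\<dots> = (\<Sum>i\<in>Basis. LBINT z. G i z * pd i ph z)"
 proof (rule Bochner_Integration.integral_sum)
  fix i :: 'a assume i: "i \<in> Basis"
  obtain M where M: "\<And>z. \<bar>pd i ph z\<bar> \<le> M" by (rule bsm_bounded[OF bsm_pd[OF ph i]]) blast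
  show "L1 (\<lambda>z. G i z * pd i ph z)" by (rule integrable_mult_bounded[OF brep_integrable[OF _ _ S(2)] _ M]) (use G i bsm_measurable[OF bsm_pd[OF ph i]] in auto)
 qed
 finally show ?thesis .
qed

theorem theorem1p2:
  fixes R :: real
    and h :: "real^'n \<Rightarrow> real"
    and U V :: "(real^'n) \<times> real \<Rightarrow> real"
  assumes "CARD('n) > 3"
    and "R > 0"
    and "C_on 1 (ball 0 R) h"
    and "weak_solution R h U V"
    and "\<forall>n::nat. U \<in> o[inf (at 0 within half_ball R) (ae_filter lebesgue)](\<lambda>z. norm z ^ n)"
  shows "AE z in lebesgue_on (half_ball R). U z = 0 \<and> V z = 0"
proof -
 let ?H = "half_ball R :: ((real^'n) \<times> real) set" and ?B = "ball 0 R :: (real^'n) set"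
 note hb = half_ball_facts[of R, where 'n = 'n]
 have sB: "?B \<in> sets borel" by simp
 have ws: "U \<in> H1 ?H" "V \<in> H1 ?H" using assms(4) by (simp_all add: weak_solution_def)
 obtain T where T: "has_flat_trace R U T"
  and eq: "\<And>ph. ph \<in> H1 ?H \<Longrightarrow> zero_trace_on_half_sphere R ph \<Longrightarrow>
    (LINT z|lebesgue_on ?H. weak_gradient ?H U z \<bullet> weak_gradient ?H ph z) = - (LINT z|lebesgue_on ?H. V z * ph z)"
   "\<And>ph t. ph \<in> H1 ?H \<Longrightarrow> zero_trace_on_half_sphere R ph \<Longrightarrow> has_flat_trace R ph t \<Longrightarrow>
    (LINT z|lebesgue_on ?H. weak_gradient ?H V z \<bullet> weak_gradient ?H ph z) = (LINT x|lebesgue_on ?B. h x * T x * t x)"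
  using assms(4) unfolding weak_solution_def by blast
 note u = H1_weak_gradient[OF ws(1)] and v = H1_weak_gradient[OF ws(2)]
 obtain U' where U': "brep ?H U U'" "L1 (\<lambda>z. (U' z)^2)" using L2_rep[OF hb(3) u(1)] by blast
 obtain V' where V': "brep ?H V V'" "L1 (\<lambda>z. (V' z)^2)" using L2_rep[OF hb(3) v(1)] by blast
 obtain GU where GU: "\<forall>i\<in>Basis. brep ?H (\<lambda>z. weak_gradient ?H U z \<bullet> i) (GU i) \<and> L1 (\<lambda>z. (GU i z)^2)"
  using L2_basis_rep[OF hb(3) u(2)] by blast
 obtain GV where GV: "\<forall>i\<in>Basis. brep ?H (\<lambda>z. weak_gradient ?H V z \<bullet> i) (GV i) \<and> L1 (\<lambda>z. (GV i z)^2)"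
  using L2_basis_rep[OF hb(3) v(2)] by blast
 have "T \<in> L2 (lebesgue_on ?B)" using T by (simp add: has_flat_trace_def has_trace_def)
 then obtain T' where T': "brep ?B T T'" "L1 (\<lambda>x. (T' x)^2)" using L2_rep[OF sB] by blast
 have hc: "continuous_on ?B h"
 proof -
  have "h differentiable_on ?B" using assms(3) by (simp only: One_nat_def C_on.simps)
  thus ?thesis by (rule differentiable_imp_continuous_on)
 qed
 interpret half_ball_solution R h T' U' V' GU GV ?H
 proof unfold_locales
  show "?H = {z. norm z < R \<and> snd z > 0}" by (simp add: half_ball_def)
  show "R > 0" by fact
  show "continuous_on ?B h" by (rule hc)
  show "T' \<in> BM" "\<And>x. norm x \<ge> R \<Longrightarrow> T' x = 0" using T'(1) by (auto simp: brep_def)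
  show "U' \<in> BM" "\<And>z. z \<notin> ?H \<Longrightarrow> U' z = 0" using U'(1) unfolding brep_def by blast+
  show "V' \<in> BM" "\<And>z. z \<notin> ?H \<Longrightarrow> V' z = 0" using V'(1) unfolding brep_def by blast+
  show "L1 (\<lambda>x. (T' x)^2)" "L1 (\<lambda>z. (U' z)^2)" "L1 (\<lambda>z. (V' z)^2)" by fact+
  show "\<And>i. i \<in> Basis \<Longrightarrow> GU i \<in> BM" "\<And>i z. i \<in> Basis \<Longrightarrow> z \<notin> ?H \<Longrightarrow> GU i z = 0"
   "\<And>i. i \<in> Basis \<Longrightarrow> L1 (\<lambda>z. (GU i z)^2)" using GU unfolding brep_def by blast+
  show "\<And>i. i \<in> Basis \<Longrightarrow> GV i \<in> BM" "\<And>i z. i \<in> Basis \<Longrightarrow> z \<notin> ?H \<Longrightarrow> GV i z = 0"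
   "\<And>i. i \<in> Basis \<Longrightarrow> L1 (\<lambda>z. (GV i z)^2)" using GV unfolding brep_def by blast+
  show "(LBINT z. U' z * pd i ph z) = - (LBINT z. GU i z * ph z)" if "i \<in> Basis" "tst ?H ph" for i ph
   by (rule weak_rep[OF hb(1) U'(1) _ that(1) u(3) that(2)]) (use GU that(1) in blast)
  show "(LBINT z. V' z * pd i ph z) = - (LBINT z. GV i z * ph z)" if "i \<in> Basis" "tst ?H ph" for i ph
   by (rule weak_rep[OF hb(1) V'(1) _ that(1) v(3) that(2)]) (use GV that(1) in blast)
 next
  fix ph :: "(real^'n) \<times> real \<Rightarrow> real" assume t: "tst (ball 0 R) ph"
  note b = tst_bsm[OF t] and Z = tst_zero_trace[OF assms(2) t]
  note w = H1_weak_gradient(2)[OF Z(1)]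
  show "(\<Sum>i\<in>Basis. LBINT z. GU i z * pd i ph z) = - (LBINT z. V' z * ph z)" using eq(1)[OF Z(1,2)] unfolding gradient_pairing[OF hb(3,2) b u(2) w Z(4) GU]
    brep_integral(1)[OF hb(3) brep_mult_borel[OF V'(1) bsm_measurable[OF b]]] .
  have hm: "(\<lambda>x. indicator ?B x *\<^sub>R h x) \<in> BM" by (rule borel_measurable_continuous_on_indicator[OF sB hc])
  \<comment> \<open>Continuity on the open ball makes h measurable there and its extension by 0
    Borel.\<close>
  have "brep ?B h (\<lambda>x. indicator ?B x * h x)" using hm continuous_imp_measurable_on_sets_lebesgue[OF hc] unfolding brep_def by auto
  from brep_mult[OF this T'(1)]
  have "brep ?B (\<lambda>x. h x * T x * ph (x, 0)) (\<lambda>x. indicator ?B x * h x * T' x * ph (x, 0))"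
  proof (rule brep_mult_borel)
   show "(\<lambda>x. ph (x, 0)) \<in> BM" by (intro borel_measurable_continuous_onI continuous_on_compose2[OF bsm_continuous[OF b, of UNIV]] continuous_intros) auto
  qed
  from brep_integral(1)[OF sB this]
  have "(LINT x|lebesgue_on ?B. h x * T x * ph (x, 0)) = (LBINT x. indicator ?B x * h x * T' x * ph (x, 0))" .
  also have "\<dots> = (LBINT x. h x * T' x * ph (x, 0))"
   by (intro Bochner_Integration.integral_cong refl) (use T'(1) in \<open>auto simp: brep_def indicator_def\<close>)
  finally show "(\<Sum>i\<in>Basis. LBINT z. GV i z * pd i ph z) = (LBINT x. h x * T' x * ph (x, 0))"
   using eq(2)[OF Z(1-3)] unfolding gradient_pairing[OF hb(3,2) b v(2) w Z(4) GV] by simp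
  have f0: "(\<lambda>x. ph (x, 0)) \<in> BM" by (intro borel_measurable_continuous_onI continuous_on_compose2[OF bsm_continuous[OF b, of UNIV]] continuous_intros) auto
  have G1: "brep ?H (\<lambda>z. weak_gradient ?H U z \<bullet> (0, 1)) (GU (0, 1))" using GU Basis_01 by blast
  show "(LBINT x. T' x * ph (x, 0)) = - (LBINT z. GU (0, 1) z * ph z + U' z * pd (0, 1) ph z)" using flat_trace_identity[OF ws(1) T t]
   unfolding brep_integral(1)[OF sB brep_mult_borel[OF T'(1) f0]]
    brep_integral(1)[OF hb(3) brep_add[OF brep_mult_borel[OF G1 bsm_measurable[OF b]] brep_mult_borel[OF U'(1) bsm_measurable[OF bsm_pd[OF b Basis_01]]]]] .
 next
  show "\<exists>q. continuous_on UNIV q \<and> (NBINT x. ennreal (indicator ?B x * (T' x - q x)^2)) \<le> ennreal e" if "e > 0" for e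
   by (rule flat_trace_approx[OF T T'(1) that])
  show "\<exists>rh>0. AE z in lborel. norm z < rh \<longrightarrow> \<bar>U' z\<bar> \<le> norm z ^ n" for n by (rule vanishing_rep[OF _ U'(1)]) (use assms(5) in blast)
 qed
 have "AE z in lborel. z \<in> ?H \<longrightarrow> U z = U' z" "AE z in lborel. z \<in> ?H \<longrightarrow> V z = V' z" using U'(1) V'(1) by (simp_all add: brep_def)
 hence "AE z in lborel. z \<in> ?H \<longrightarrow> U z = 0 \<and> V z = 0" using solution_zero by eventually_elim auto
 thus ?thesis unfolding AE_lebesgue_on_iff[OF hb(3)] .
qed

end
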